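(* Let $\mathcal{C}\to\Delta$ be a small $2$-category (in the Segal-style sense given in the context). Then there exists a small strict $2$-category $\mathsf{R}(\mathcal{C})$ together with an equivalence $\mathcal{C}\cong\Delta\mathsf{R}(\mathcal{C})$ over $\Delta$ (that is, a functor cartesian over $\Delta$ that is an equivalence of categories), where $\Delta\mathsf{R}(\mathcal{C})$ is the simplicial replacement of $\mathsf{R}(\mathcal{C})$. Moreover, $\mathsf{R}(\mathcal{C})$ is unique up to a strong equivalence.
   Context: **Fibrations.** A morphism $f:c'\to c$ in a category $\mathcal{C}$ is cartesian with respect to a functor $\pi:\mathcal{C}\to I$ if any $f':c''\to c$ with $\pi(f')=\pi(f)$ factors uniquely as $f'=f\circ f_0$ with $\pi(f_0)=\mathrm{id}$. $\pi$ is a fibration if for any $c\in\mathcal{C}$ any $f:i'\to\pi(c)$ in $I$ admits a cartesian lifting $c'\to c$, and compositions of cartesian maps are cartesian. A map $f:i'\to i$ then induces a transition functor $f^*:\mathcal{C}_i\to\mathcal{C}_{i'}$ between fibers. A functor over $I$ between fibrations over $I$ is cartesian if it sends cartesian maps to cartesian maps. **Segal-style $2$-categories.** $\Delta$ is the category of finite ordinals $[n]=\{0,\dots,n\}$, $n\ge 0$, and order-preserving maps. For $0\le l\le n$, $s:[l]\to[n]$ and $t:[n-l]\to[n]$ are the embeddings onto the initial, resp. terminal segment. A $2$-category is a fibration $\mathcal{C}\to\Delta$ such that the fiber $\mathcal{C}_{[0]}$ is discrete (all its morphisms are identities) and such that for all $0\le l\le n$ the functor $s^*\times t^*:\mathcal{C}_{[n]}\to\mathcal{C}_{[l]}\times_{\mathcal{C}_{[0]}}\mathcal{C}_{[n-l]}$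 is an equivalence (Segal condition). It is small if the category $\mathcal{C}$ is small. **Strict $2$-categories.** A strict $2$-category is a category enriched in the category of small categories (small categories of morphisms $\mathcal{C}(c,c')$, composition functors strictly associative and unital). It is small if its objects form a set. A $2$-functor $\gamma:\mathcal{C}\to\mathcal{C}'$ between strict $2$-categories is a pseudofunctor: it consists of objects $\gamma(c)$, functors $\gamma_{c,c'}:\mathcal{C}(c,c')\to\mathcal{C}'(\gamma(c),\gamma(c'))$, isomorphisms $\gamma_c:\mathrm{id}_{\gamma(c)}\cong\gamma_{c,c}(\mathrm{id}_c)$, and natural isomorphisms $\gamma_{c,c',c''}:\gamma_{c',c''}(f')\circ\gamma_{c,c'}(f)\cong\gamma_{c,c''}(f'\circ f)$, satisfying the usual unit and associativity coherence conditions. If $\gamma,\gamma'$ are $2$-functors with $\gamma(c)=\gamma'(c)$ for all objects $c$, a $2$-morphism $\alpha:\gamma\to\gamma'$ is a collection of natural transformations $\alpha_{c,c'}:\gamma_{c,c'}\to\gamma'_{c,c'}$ compatible with the composition isomorphisms $\gamma_{c,c',c''},\gamma'_{c,c',c''}$ and with the unit isomorphisms $\gamma_c,\gamma'_c$; it is invertible if all $\alpha_{c,c'}$ are. If $\gamma,\gamma'$ do not coincide on objects there are no $2$-morphisms between them. For small $\mathcal{C}$, $2$-functors and $2$-morphisms form a category $\mathrm{Fun}^2(\mathcal{C},\mathcal{C}')$. A $2$-functor $\gamma:\mathcal{C}\to\mathcal{C}'$ is a strong equivalence if there exist a $2$-functor $\gamma':\mathcal{C}'\to\mathcal{C}$ and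 invertible $2$-morphisms $\mathrm{id}\to\gamma'\circ\gamma$, $\gamma\circ\gamma'\to\mathrm{id}$. **Simplicial replacement.** An ordinal $[n]$ is regarded as a category (a poset), hence as a strict $2$-category with discrete categories of morphisms. The simplicial replacement $\Delta\mathcal{C}$ of a strict $2$-category $\mathcal{C}$ is the fibration $\Delta\mathcal{C}\to\Delta$ with fibers $(\Delta\mathcal{C})_{[n]}=\mathrm{Fun}^2([n],\mathcal{C})$ and transition functors given by precomposition with order-preserving maps $[n]\to[m]$. *)

theory Defs
  imports "HOL-Library.FuncSet"
begin

text \<open>
  Categories have carrier sets of objects and of arrows inside HOL types, hence all of them are
  small. All structure maps that are compared for equality (functors, natural transformations,
  2-functors, 2-morphisms) are extensional in the sense of HOL-Library.FuncSet, so that HOL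
  equality is equality on the carriers. Composites are written so that
  \<open>g \<cdot> f\<close> is \<open>g\<close> after \<open>f\<close>.
\<close>

section \<open>Categories, functors, equivalences\<close>

record ('o, 'a) cat =
  Obj :: "'o set"
  Arr :: "'a set"
  Dom :: "'a \<Rightarrow> 'o"
  Cod :: "'a \<Rightarrow> 'o"
  Ide :: "'o \<Rightarrow> 'a"
  Comp :: "'a \<Rightarrow> 'a \<Rightarrow> 'a"  (infixr "\<cdot>\<index>" 70)

definition hom :: "('o, 'a) cat \<Rightarrow> 'o \<Rightarrow> 'o \<Rightarrow> 'a set" where
  "hom C x y = {f \<in> Arr C. Dom C f = x \<and> Cod C f = y}"

locale category =
  fixes C :: "('o, 'a) cat"  (structure)
  assumes dom_obj: "f \<in> Arr C \<Longrightarrow> Dom C f \<in> Obj C"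
    and cod_obj: "f \<in> Arr C \<Longrightarrow> Cod C f \<in> Obj C"
    and ide_hom: "x \<in> Obj C \<Longrightarrow> Ide C x \<in> hom C x x"
    and comp_hom: "f \<in> hom C x y \<Longrightarrow> g \<in> hom C y z \<Longrightarrow> g \<cdot> f \<in> hom C x z"
    and ide_left: "f \<in> hom C x y \<Longrightarrow> Ide C y \<cdot> f = f"
    and ide_right: "f \<in> hom C x y \<Longrightarrow> f \<cdot> Ide C x = f"
    and comp_assoc: "f \<in> hom C w x \<Longrightarrow> g \<in> hom C x y \<Longrightarrow> h \<in> hom C y z
      \<Longrightarrow> h \<cdot> (g \<cdot> f) = (h \<cdot> g) \<cdot> f"

definition iso :: "('o, 'a) cat \<Rightarrow> 'a \<Rightarrow> bool" where
  "iso C f \<longleftrightarrow> f \<in> Arr C \<and>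
     (\<exists>g \<in> hom C (Cod C f) (Dom C f).
        g \<cdot>\<^bsub>C\<^esub> f = Ide C (Dom C f) \<and> f \<cdot>\<^bsub>C\<^esub> g = Ide C (Cod C f))"

definition discrete :: "('o, 'a) cat \<Rightarrow> bool" where
  "discrete C \<longleftrightarrow> category C \<and> (\<forall>f \<in> Arr C. f = Ide C (Dom C f))"

record ('o, 'a, 'p, 'b) fct =
  FObj :: "'o \<Rightarrow> 'p"
  FArr :: "'a \<Rightarrow> 'b"

locale cat_functor = A: category A + B: category B
  for A :: "('o, 'a) cat" and B :: "('p, 'b) cat" +
  fixes F :: "('o, 'a, 'p, 'b) fct"
  assumes obj_map: "FObj F \<in> Obj A \<rightarrow>\<^sub>E Obj B"
    and arr_ext: "FArr F \<in> extensional (Arr A)"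
    and arr_map: "f \<in> hom A x y \<Longrightarrow> FArr F f \<in> hom B (FObj F x) (FObj F y)"
    and map_ide: "x \<in> Obj A \<Longrightarrow> FArr F (Ide A x) = Ide B (FObj F x)"
    and map_comp: "f \<in> hom A x y \<Longrightarrow> g \<in> hom A y z
      \<Longrightarrow> FArr F (g \<cdot>\<^bsub>A\<^esub> f) = FArr F g \<cdot>\<^bsub>B\<^esub> FArr F f"

definition id_fct :: "('o, 'a) cat \<Rightarrow> ('o, 'a, 'o, 'a) fct" where
  "id_fct A = \<lparr>FObj = \<lambda>x\<in>Obj A. x, FArr = \<lambda>f\<in>Arr A. f\<rparr>"

definition comp_fct ::
  "('o, 'a) cat \<Rightarrow> ('p, 'b, 'q, 'c) fct \<Rightarrow> ('o, 'a, 'p, 'b) fct \<Rightarrow> ('o, 'a, 'q, 'c) fct" where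
  "comp_fct A G F =
     \<lparr>FObj = compose (Obj A) (FObj G) (FObj F), FArr = compose (Arr A) (FArr G) (FArr F)\<rparr>"

locale nat_trans = F: cat_functor A B F + G: cat_functor A B G
  for A :: "('o, 'a) cat" and B :: "('p, 'b) cat"
    and F :: "('o, 'a, 'p, 'b) fct" and G :: "('o, 'a, 'p, 'b) fct" +
  fixes \<tau> :: "'o \<Rightarrow> 'b"
  assumes component_ext: "\<tau> \<in> extensional (Obj A)"
    and component: "x \<in> Obj A \<Longrightarrow> \<tau> x \<in> hom B (FObj F x) (FObj G x)"
    and natural: "f \<in> hom A x y \<Longrightarrow> \<tau> y \<cdot>\<^bsub>B\<^esub> FArr F f = FArr G f \<cdot>\<^bsub>B\<^esub> \<tau> x"

definition nat_iso ::
  "('o, 'a) cat \<Rightarrow> ('p, 'b) cat \<Rightarrow> ('o, 'a, 'p, 'b) fct \<Rightarrow> ('o, 'a, 'p, 'b) fct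
    \<Rightarrow> ('o \<Rightarrow> 'b) \<Rightarrow> bool" where
  "nat_iso A B F G \<tau> \<longleftrightarrow> nat_trans A B F G \<tau> \<and> (\<forall>x \<in> Obj A. iso B (\<tau> x))"

definition equivalence ::
  "('o, 'a) cat \<Rightarrow> ('p, 'b) cat \<Rightarrow> ('o, 'a, 'p, 'b) fct \<Rightarrow> bool" where
  "equivalence A B F \<longleftrightarrow> cat_functor A B F \<and>
     (\<exists>G. cat_functor B A G \<and>
        (\<exists>\<eta>. nat_iso A A (id_fct A) (comp_fct A G F) \<eta>) \<and>
        (\<exists>\<epsilon>. nat_iso B B (comp_fct B F G) (id_fct B) \<epsilon>))"

definition prod_cat :: "('o, 'a) cat \<Rightarrow> ('p, 'b) cat \<Rightarrow> ('o \<times> 'p, 'a \<times> 'b) cat" where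
  "prod_cat A B =
     \<lparr>Obj = Obj A \<times> Obj B, Arr = Arr A \<times> Arr B,
      Dom = map_prod (Dom A) (Dom B), Cod = map_prod (Cod A) (Cod B),
      Ide = map_prod (Ide A) (Ide B),
      Comp = \<lambda>(g, g') (f, f'). (g \<cdot>\<^bsub>A\<^esub> f, g' \<cdot>\<^bsub>B\<^esub> f')\<rparr>"

definition prod_fct ::
  "('o, 'a) cat \<Rightarrow> ('o', 'a') cat \<Rightarrow> ('o, 'a, 'p, 'b) fct \<Rightarrow> ('o', 'a', 'p', 'b') fct
    \<Rightarrow> ('o \<times> 'o', 'a \<times> 'a', 'p \<times> 'p', 'b \<times> 'b') fct" where
  "prod_fct A A' F F' =
     \<lparr>FObj = restrict (map_prod (FObj F) (FObj F')) (Obj A \<times> Obj A'),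
      FArr = restrict (map_prod (FArr F) (FArr F')) (Arr A \<times> Arr A')\<rparr>"

definition pair_fct ::
  "('o, 'a) cat \<Rightarrow> ('o, 'a, 'p, 'b) fct \<Rightarrow> ('o, 'a, 'q, 'c) fct
    \<Rightarrow> ('o, 'a, 'p \<times> 'q, 'b \<times> 'c) fct" where
  "pair_fct A F G =
     \<lparr>FObj = \<lambda>x\<in>Obj A. (FObj F x, FObj G x), FArr = \<lambda>f\<in>Arr A. (FArr F f, FArr G f)\<rparr>"

definition fiber_product ::
  "('o, 'a) cat \<Rightarrow> ('p, 'b) cat \<Rightarrow> ('o, 'a, 'q, 'c) fct \<Rightarrow> ('p, 'b, 'q, 'c) fct
    \<Rightarrow> ('o \<times> 'p, 'a \<times> 'b) cat" where
  "fiber_product A B F G =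
     (prod_cat A B)
       \<lparr>Obj := {(x, y). x \<in> Obj A \<and> y \<in> Obj B \<and> FObj F x = FObj G y},
        Arr := {(f, g). f \<in> Arr A \<and> g \<in> Arr B \<and> FArr F f = FArr G g}\<rparr>"

section \<open>Fibrations\<close>

definition cartesian ::
  "('o, 'a) cat \<Rightarrow> ('i, 'j) cat \<Rightarrow> ('o, 'a, 'i, 'j) fct \<Rightarrow> 'a \<Rightarrow> bool" where
  "cartesian C I \<pi> f \<longleftrightarrow> f \<in> Arr C \<and>
     (\<forall>f' \<in> Arr C. Cod C f' = Cod C f \<and> FArr \<pi> f' = FArr \<pi> f \<longrightarrow>
        (\<exists>!f0. f0 \<in> hom C (Dom C f') (Dom C f) \<and>
               FArr \<pi> f0 = Ide I (FObj \<pi> (Dom C f)) \<and> f \<cdot>\<^bsub>C\<^esub> f0 = f'))"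

definition fibration ::
  "('o, 'a) cat \<Rightarrow> ('i, 'j) cat \<Rightarrow> ('o, 'a, 'i, 'j) fct \<Rightarrow> bool" where
  "fibration C I \<pi> \<longleftrightarrow> cat_functor C I \<pi> \<and>
     (\<forall>c \<in> Obj C. \<forall>f \<in> Arr I. Cod I f = FObj \<pi> c \<longrightarrow>
        (\<exists>f'. cartesian C I \<pi> f' \<and> Cod C f' = c \<and> FArr \<pi> f' = f)) \<and>
     (\<forall>f g. cartesian C I \<pi> f \<and> cartesian C I \<pi> g \<and> Cod C f = Dom C g \<longrightarrow>
        cartesian C I \<pi> (g \<cdot>\<^bsub>C\<^esub> f))"

definition fiber ::
  "('o, 'a) cat \<Rightarrow> ('i, 'j) cat \<Rightarrow> ('o, 'a, 'i, 'j) fct \<Rightarrow> 'i \<Rightarrow> ('o, 'a) cat" where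
  "fiber C I \<pi> i =
     C\<lparr>Obj := {c \<in> Obj C. FObj \<pi> c = i}, Arr := {f \<in> Arr C. FArr \<pi> f = Ide I i}\<rparr>"

text \<open>
  The transition functor depends on a choice of cartesian liftings; different choices give
  canonically isomorphic functors, so one choice is fixed globally.
\<close>

definition cart_lift ::
  "('o, 'a) cat \<Rightarrow> ('i, 'j) cat \<Rightarrow> ('o, 'a, 'i, 'j) fct \<Rightarrow> 'j \<Rightarrow> 'o \<Rightarrow> 'a" where
  "cart_lift C I \<pi> f c =
     (SOME f'. cartesian C I \<pi> f' \<and> Cod C f' = c \<and> FArr \<pi> f' = f)"

definition transition ::
  "('o, 'a) cat \<Rightarrow> ('i, 'j) cat \<Rightarrow> ('o, 'a, 'i, 'j) fct \<Rightarrow> 'j \<Rightarrow> ('o, 'a, 'o, 'a) fct" where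
  "transition C I \<pi> f =
     \<lparr>FObj = \<lambda>c\<in>Obj (fiber C I \<pi> (Cod I f)). Dom C (cart_lift C I \<pi> f c),
      FArr = \<lambda>g\<in>Arr (fiber C I \<pi> (Cod I f)).
        (THE h. h \<in> hom (fiber C I \<pi> (Dom I f))
                      (Dom C (cart_lift C I \<pi> f (Dom C g)))
                      (Dom C (cart_lift C I \<pi> f (Cod C g))) \<and>
                cart_lift C I \<pi> f (Cod C g) \<cdot>\<^bsub>C\<^esub> h =
                g \<cdot>\<^bsub>C\<^esub> cart_lift C I \<pi> f (Dom C g))\<rparr>"

definition cartesian_fct ::
  "('i, 'j) cat \<Rightarrow> ('o, 'a) cat \<Rightarrow> ('o, 'a, 'i, 'j) fct \<Rightarrow> ('p, 'b) cat \<Rightarrow> ('p, 'b, 'i, 'j) fct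
    \<Rightarrow> ('o, 'a, 'p, 'b) fct \<Rightarrow> bool" where
  "cartesian_fct I C \<pi> D \<rho> F \<longleftrightarrow>
     fibration C I \<pi> \<and> fibration D I \<rho> \<and> cat_functor C D F \<and> comp_fct C \<rho> F = \<pi> \<and>
     (\<forall>f. cartesian C I \<pi> f \<longrightarrow> cartesian D I \<rho> (FArr F f))"

definition equivalence_over ::
  "('i, 'j) cat \<Rightarrow> ('o, 'a) cat \<Rightarrow> ('o, 'a, 'i, 'j) fct \<Rightarrow> ('p, 'b) cat \<Rightarrow> ('p, 'b, 'i, 'j) fct
    \<Rightarrow> ('o, 'a, 'p, 'b) fct \<Rightarrow> bool" where
  "equivalence_over I C \<pi> D \<rho> F \<longleftrightarrow> cartesian_fct I C \<pi> D \<rho> F \<and> equivalence C D F"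

text \<open>
  The fibration with prescribed fibers and prescribed, strictly functorial, transition functors
  (Grothendieck construction): an arrow from \<open>(i, c)\<close> to \<open>(j, d)\<close> is an arrow \<open>f : i \<rightarrow> j\<close>
  together with an arrow \<open>a : c \<rightarrow> f\<^sup>*d\<close> in the fiber over \<open>i\<close>; it is stored as \<open>(f, a, d)\<close>,
  since \<open>f\<^sup>*d\<close> does not determine \<open>d\<close>.
\<close>

definition grothendieck ::
  "('i, 'j) cat \<Rightarrow> ('i \<Rightarrow> ('o, 'a) cat) \<Rightarrow> ('j \<Rightarrow> ('o, 'a, 'o, 'a) fct)
    \<Rightarrow> ('i \<times> 'o, 'j \<times> 'a \<times> 'o) cat" where
  "grothendieck I Fib Tr =
     \<lparr>Obj = {(i, c). i \<in> Obj I \<and> c \<in> Obj (Fib i)},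
      Arr = {(f, a, d). f \<in> Arr I \<and> a \<in> Arr (Fib (Dom I f)) \<and> d \<in> Obj (Fib (Cod I f)) \<and>
               Cod (Fib (Dom I f)) a = FObj (Tr f) d},
      Dom = \<lambda>(f, a, d). (Dom I f, Dom (Fib (Dom I f)) a),
      Cod = \<lambda>(f, a, d). (Cod I f, d),
      Ide = \<lambda>(i, c). (Ide I i, Ide (Fib i) c, c),
      Comp = \<lambda>(g, b, e) (f, a, d).
        (g \<cdot>\<^bsub>I\<^esub> f, FArr (Tr f) b \<cdot>\<^bsub>Fib (Dom I f)\<^esub> a, e)\<rparr>"

definition grothendieck_proj ::
  "('i, 'j) cat \<Rightarrow> ('i \<Rightarrow> ('o, 'a) cat) \<Rightarrow> ('j \<Rightarrow> ('o, 'a, 'o, 'a) fct)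
    \<Rightarrow> ('i \<times> 'o, 'j \<times> 'a \<times> 'o, 'i, 'j) fct" where
  "grothendieck_proj I Fib Tr =
     \<lparr>FObj = restrict fst (Obj (grothendieck I Fib Tr)),
      FArr = restrict fst (Arr (grothendieck I Fib Tr))\<rparr>"

section \<open>The category \<open>\<Delta>\<close> and Segal-style 2-categories\<close>

text \<open>The object \<open>[n]\<close> is \<open>n\<close>; an arrow \<open>[m] \<rightarrow> [n]\<close> is \<open>(m, f, n)\<close>.\<close>

type_synonym delta_arr = "nat \<times> (nat \<Rightarrow> nat) \<times> nat"

definition Delta :: "(nat, delta_arr) cat" where
  "Delta =
     \<lparr>Obj = UNIV,
      Arr = {(m, f, n). f \<in> {0..m} \<rightarrow>\<^sub>E {0..n} \<and> mono_on {0..m} f},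
      Dom = \<lambda>(m, f, n). m,
      Cod = \<lambda>(m, f, n). n,
      Ide = \<lambda>n. (n, \<lambda>i\<in>{0..n}. i, n),
      Comp = \<lambda>(l', g, n) (m, f, l). (m, compose {0..m} g f, n)\<rparr>"

definition init_seg :: "nat \<Rightarrow> nat \<Rightarrow> delta_arr" where
  "init_seg k n = (k, \<lambda>i\<in>{0..k}. i, n)"

definition term_seg :: "nat \<Rightarrow> nat \<Rightarrow> delta_arr" where
  "term_seg k n = (k, \<lambda>i\<in>{0..k}. n - k + i, n)"

definition segal_fct ::
  "('o, 'a) cat \<Rightarrow> ('o, 'a, nat, delta_arr) fct \<Rightarrow> nat \<Rightarrow> nat \<Rightarrow> ('o, 'a, 'o \<times> 'o, 'a \<times> 'a) fct" where
  "segal_fct C \<pi> n l =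
     pair_fct (fiber C Delta \<pi> n)
       (transition C Delta \<pi> (init_seg l n))
       (transition C Delta \<pi> (term_seg (n - l) n))"

text \<open>
  The fiber product is formed along the transition functors of the two inclusions
  \<open>[0] \<rightarrow> [l]\<close>, \<open>0 \<mapsto> l\<close>, and \<open>[0] \<rightarrow> [n - l]\<close>, \<open>0 \<mapsto> 0\<close>.
\<close>

definition segal_target ::
  "('o, 'a) cat \<Rightarrow> ('o, 'a, nat, delta_arr) fct \<Rightarrow> nat \<Rightarrow> nat \<Rightarrow> ('o \<times> 'o, 'a \<times> 'a) cat" where
  "segal_target C \<pi> n l =
     fiber_product (fiber C Delta \<pi> l) (fiber C Delta \<pi> (n - l))
       (transition C Delta \<pi> (term_seg 0 l))
       (transition C Delta \<pi> (init_seg 0 (n - l)))"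

definition segal_2_category :: "('o, 'a) cat \<Rightarrow> ('o, 'a, nat, delta_arr) fct \<Rightarrow> bool" where
  "segal_2_category C \<pi> \<longleftrightarrow>
     fibration C Delta \<pi> \<and>
     discrete (fiber C Delta \<pi> 0) \<and>
     (\<forall>n l. l \<le> n \<longrightarrow>
        equivalence (fiber C Delta \<pi> n) (segal_target C \<pi> n l) (segal_fct C \<pi> n l))"

section \<open>Strict 2-categories and 2-functors\<close>

record ('o, 'm, 't) two_cat =
  Obj2 :: "'o set"
  Hom2 :: "'o \<Rightarrow> 'o \<Rightarrow> ('m, 't) cat"
  Ide2 :: "'o \<Rightarrow> 'm"
  Comp2 :: "'o \<Rightarrow> 'o \<Rightarrow> 'o \<Rightarrow> ('m \<times> 'm, 't \<times> 't, 'm, 't) fct"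

abbreviation hcomp1 :: "('o, 'm, 't) two_cat \<Rightarrow> 'o \<Rightarrow> 'o \<Rightarrow> 'o \<Rightarrow> 'm \<Rightarrow> 'm \<Rightarrow> 'm" where
  "hcomp1 K x y z g f \<equiv> FObj (Comp2 K x y z) (g, f)"

abbreviation hcomp2 :: "('o, 'm, 't) two_cat \<Rightarrow> 'o \<Rightarrow> 'o \<Rightarrow> 'o \<Rightarrow> 't \<Rightarrow> 't \<Rightarrow> 't" where
  "hcomp2 K x y z b a \<equiv> FArr (Comp2 K x y z) (b, a)"

locale strict_2_category =
  fixes K :: "('o, 'm, 't) two_cat"
  assumes hom_category: "x \<in> Obj2 K \<Longrightarrow> y \<in> Obj2 K \<Longrightarrow> category (Hom2 K x y)"
    and ide2_obj: "x \<in> Obj2 K \<Longrightarrow> Ide2 K x \<in> Obj (Hom2 K x x)"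
    and comp2_functor: "x \<in> Obj2 K \<Longrightarrow> y \<in> Obj2 K \<Longrightarrow> z \<in> Obj2 K \<Longrightarrow>
      cat_functor (prod_cat (Hom2 K y z) (Hom2 K x y)) (Hom2 K x z) (Comp2 K x y z)"
    and unit_left1: "x \<in> Obj2 K \<Longrightarrow> y \<in> Obj2 K \<Longrightarrow> f \<in> Obj (Hom2 K x y) \<Longrightarrow>
      hcomp1 K x y y (Ide2 K y) f = f"
    and unit_right1: "x \<in> Obj2 K \<Longrightarrow> y \<in> Obj2 K \<Longrightarrow> f \<in> Obj (Hom2 K x y) \<Longrightarrow>
      hcomp1 K x x y f (Ide2 K x) = f"
    and assoc1: "w \<in> Obj2 K \<Longrightarrow> x \<in> Obj2 K \<Longrightarrow> y \<in> Obj2 K \<Longrightarrow> z \<in> Obj2 K \<Longrightarrow>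
      f \<in> Obj (Hom2 K w x) \<Longrightarrow> g \<in> Obj (Hom2 K x y) \<Longrightarrow> h \<in> Obj (Hom2 K y z) \<Longrightarrow>
      hcomp1 K w y z h (hcomp1 K w x y g f) = hcomp1 K w x z (hcomp1 K x y z h g) f"
    and unit_left2: "x \<in> Obj2 K \<Longrightarrow> y \<in> Obj2 K \<Longrightarrow> a \<in> Arr (Hom2 K x y) \<Longrightarrow>
      hcomp2 K x y y (Ide (Hom2 K y y) (Ide2 K y)) a = a"
    and unit_right2: "x \<in> Obj2 K \<Longrightarrow> y \<in> Obj2 K \<Longrightarrow> a \<in> Arr (Hom2 K x y) \<Longrightarrow>
      hcomp2 K x x y a (Ide (Hom2 K x x) (Ide2 K x)) = a"
    and assoc2: "w \<in> Obj2 K \<Longrightarrow> x \<in> Obj2 K \<Longrightarrow> y \<in> Obj2 K \<Longrightarrow> z \<in> Obj2 K \<Longrightarrow>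
      a \<in> Arr (Hom2 K w x) \<Longrightarrow> b \<in> Arr (Hom2 K x y) \<Longrightarrow> c \<in> Arr (Hom2 K y z) \<Longrightarrow>
      hcomp2 K w y z c (hcomp2 K w x y b a) = hcomp2 K w x z (hcomp2 K x y z c b) a"

record ('o, 'm, 't, 'p, 'n, 'u) two_fct =
  PObj :: "'o \<Rightarrow> 'p"
  PHom :: "'o \<times> 'o \<Rightarrow> ('m, 't, 'n, 'u) fct"
  PUnit :: "'o \<Rightarrow> 'u"
  PComp :: "'o \<times> 'o \<times> 'o \<Rightarrow> 'm \<times> 'm \<Rightarrow> 'u"

abbreviation PMap1 :: "('o, 'm, 't, 'p, 'n, 'u) two_fct \<Rightarrow> 'o \<Rightarrow> 'o \<Rightarrow> 'm \<Rightarrow> 'n" where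
  "PMap1 \<gamma> x y f \<equiv> FObj (PHom \<gamma> (x, y)) f"

abbreviation PMap2 :: "('o, 'm, 't, 'p, 'n, 'u) two_fct \<Rightarrow> 'o \<Rightarrow> 'o \<Rightarrow> 't \<Rightarrow> 'u" where
  "PMap2 \<gamma> x y a \<equiv> FArr (PHom \<gamma> (x, y)) a"

text \<open>The hom-category of the target between the images of two objects.\<close>

abbreviation PHomCat ::
  "('p, 'n, 'u) two_cat \<Rightarrow> ('o, 'm, 't, 'p, 'n, 'u) two_fct \<Rightarrow> 'o \<Rightarrow> 'o \<Rightarrow> ('n, 'u) cat" where
  "PHomCat L \<gamma> x y \<equiv> Hom2 L (PObj \<gamma> x) (PObj \<gamma> y)"

locale two_functor = K: strict_2_category K + L: strict_2_category L
  for K :: "('o, 'm, 't) two_cat" and L :: "('p, 'n, 'u) two_cat" +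
  fixes \<gamma> :: "('o, 'm, 't, 'p, 'n, 'u) two_fct"
  assumes pobj_map: "PObj \<gamma> \<in> Obj2 K \<rightarrow>\<^sub>E Obj2 L"
    and phom_ext: "PHom \<gamma> \<in> extensional (Obj2 K \<times> Obj2 K)"
    and phom_functor: "x \<in> Obj2 K \<Longrightarrow> y \<in> Obj2 K \<Longrightarrow>
      cat_functor (Hom2 K x y) (PHomCat L \<gamma> x y) (PHom \<gamma> (x, y))"
    and punit_ext: "PUnit \<gamma> \<in> extensional (Obj2 K)"
    and punit_hom: "x \<in> Obj2 K \<Longrightarrow>
      PUnit \<gamma> x \<in> hom (PHomCat L \<gamma> x x) (Ide2 L (PObj \<gamma> x)) (PMap1 \<gamma> x x (Ide2 K x))"
    and punit_iso: "x \<in> Obj2 K \<Longrightarrow> iso (PHomCat L \<gamma> x x) (PUnit \<gamma> x)"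
    and pcomp_ext: "PComp \<gamma> \<in> extensional (Obj2 K \<times> Obj2 K \<times> Obj2 K)"
    and pcomp_nat_iso: "x \<in> Obj2 K \<Longrightarrow> y \<in> Obj2 K \<Longrightarrow> z \<in> Obj2 K \<Longrightarrow>
      nat_iso (prod_cat (Hom2 K y z) (Hom2 K x y)) (PHomCat L \<gamma> x z)
        (comp_fct (prod_cat (Hom2 K y z) (Hom2 K x y))
           (Comp2 L (PObj \<gamma> x) (PObj \<gamma> y) (PObj \<gamma> z))
           (prod_fct (Hom2 K y z) (Hom2 K x y) (PHom \<gamma> (y, z)) (PHom \<gamma> (x, y))))
        (comp_fct (prod_cat (Hom2 K y z) (Hom2 K x y)) (PHom \<gamma> (x, z)) (Comp2 K x y z))
        (PComp \<gamma> (x, y, z))"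
    and pcoh_left: "x \<in> Obj2 K \<Longrightarrow> y \<in> Obj2 K \<Longrightarrow> f \<in> Obj (Hom2 K x y) \<Longrightarrow>
      PComp \<gamma> (x, y, y) (Ide2 K y, f) \<cdot>\<^bsub>PHomCat L \<gamma> x y\<^esub>
        hcomp2 L (PObj \<gamma> x) (PObj \<gamma> y) (PObj \<gamma> y)
          (PUnit \<gamma> y) (Ide (PHomCat L \<gamma> x y) (PMap1 \<gamma> x y f))
      = Ide (PHomCat L \<gamma> x y) (PMap1 \<gamma> x y f)"
    and pcoh_right: "x \<in> Obj2 K \<Longrightarrow> y \<in> Obj2 K \<Longrightarrow> f \<in> Obj (Hom2 K x y) \<Longrightarrow>
      PComp \<gamma> (x, x, y) (f, Ide2 K x) \<cdot>\<^bsub>PHomCat L \<gamma> x y\<^esub>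
        hcomp2 L (PObj \<gamma> x) (PObj \<gamma> x) (PObj \<gamma> y)
          (Ide (PHomCat L \<gamma> x y) (PMap1 \<gamma> x y f)) (PUnit \<gamma> x)
      = Ide (PHomCat L \<gamma> x y) (PMap1 \<gamma> x y f)"
    and pcoh_assoc: "w \<in> Obj2 K \<Longrightarrow> x \<in> Obj2 K \<Longrightarrow> y \<in> Obj2 K \<Longrightarrow> z \<in> Obj2 K \<Longrightarrow>
      f \<in> Obj (Hom2 K w x) \<Longrightarrow> g \<in> Obj (Hom2 K x y) \<Longrightarrow> h \<in> Obj (Hom2 K y z) \<Longrightarrow>
      PComp \<gamma> (w, x, z) (hcomp1 K x y z h g, f) \<cdot>\<^bsub>PHomCat L \<gamma> w z\<^esub>
        hcomp2 L (PObj \<gamma> w) (PObj \<gamma> x) (PObj \<gamma> z)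
          (PComp \<gamma> (x, y, z) (h, g)) (Ide (PHomCat L \<gamma> w x) (PMap1 \<gamma> w x f))
      = PComp \<gamma> (w, y, z) (h, hcomp1 K w x y g f) \<cdot>\<^bsub>PHomCat L \<gamma> w z\<^esub>
        hcomp2 L (PObj \<gamma> w) (PObj \<gamma> y) (PObj \<gamma> z)
          (Ide (PHomCat L \<gamma> y z) (PMap1 \<gamma> y z h)) (PComp \<gamma> (w, x, y) (g, f))"

definition id_two_fct :: "('o, 'm, 't) two_cat \<Rightarrow> ('o, 'm, 't, 'o, 'm, 't) two_fct" where
  "id_two_fct K =
     \<lparr>PObj = \<lambda>x\<in>Obj2 K. x,
      PHom = \<lambda>(x, y)\<in>Obj2 K \<times> Obj2 K. id_fct (Hom2 K x y),
      PUnit = \<lambda>x\<in>Obj2 K. Ide (Hom2 K x x) (Ide2 K x),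
      PComp = \<lambda>(x, y, z)\<in>Obj2 K \<times> Obj2 K \<times> Obj2 K.
        \<lambda>(g, f)\<in>Obj (Hom2 K y z) \<times> Obj (Hom2 K x y).
          Ide (Hom2 K x z) (hcomp1 K x y z g f)\<rparr>"

definition comp_two_fct ::
  "('o, 'm, 't) two_cat \<Rightarrow> ('q, 'k, 'v) two_cat
    \<Rightarrow> ('p, 'n, 'u, 'q, 'k, 'v) two_fct \<Rightarrow> ('o, 'm, 't, 'p, 'n, 'u) two_fct
    \<Rightarrow> ('o, 'm, 't, 'q, 'k, 'v) two_fct" where
  "comp_two_fct K M \<delta> \<gamma> =
     \<lparr>PObj = compose (Obj2 K) (PObj \<delta>) (PObj \<gamma>),
      PHom = \<lambda>(x, y)\<in>Obj2 K \<times> Obj2 K.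
        comp_fct (Hom2 K x y) (PHom \<delta> (PObj \<gamma> x, PObj \<gamma> y)) (PHom \<gamma> (x, y)),
      PUnit = \<lambda>x\<in>Obj2 K.
        PMap2 \<delta> (PObj \<gamma> x) (PObj \<gamma> x) (PUnit \<gamma> x)
          \<cdot>\<^bsub>PHomCat M \<delta> (PObj \<gamma> x) (PObj \<gamma> x)\<^esub> PUnit \<delta> (PObj \<gamma> x),
      PComp = \<lambda>(x, y, z)\<in>Obj2 K \<times> Obj2 K \<times> Obj2 K.
        \<lambda>(g, f)\<in>Obj (Hom2 K y z) \<times> Obj (Hom2 K x y).
          PMap2 \<delta> (PObj \<gamma> x) (PObj \<gamma> z) (PComp \<gamma> (x, y, z) (g, f))
            \<cdot>\<^bsub>PHomCat M \<delta> (PObj \<gamma> x) (PObj \<gamma> z)\<^esub>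
          PComp \<delta> (PObj \<gamma> x, PObj \<gamma> y, PObj \<gamma> z) (PMap1 \<gamma> y z g, PMap1 \<gamma> x y f)\<rparr>"

locale two_morphism = G: two_functor K L \<gamma> + G': two_functor K L \<gamma>'
  for K :: "('o, 'm, 't) two_cat" and L :: "('p, 'n, 'u) two_cat"
    and \<gamma> :: "('o, 'm, 't, 'p, 'n, 'u) two_fct" and \<gamma>' :: "('o, 'm, 't, 'p, 'n, 'u) two_fct" +
  fixes \<alpha> :: "'o \<times> 'o \<Rightarrow> 'm \<Rightarrow> 'u"
  assumes same_objects: "x \<in> Obj2 K \<Longrightarrow> PObj \<gamma> x = PObj \<gamma>' x"
    and family_ext: "\<alpha> \<in> extensional (Obj2 K \<times> Obj2 K)"
    and family_nat: "x \<in> Obj2 K \<Longrightarrow> y \<in> Obj2 K \<Longrightarrow>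
      nat_trans (Hom2 K x y) (PHomCat L \<gamma> x y) (PHom \<gamma> (x, y)) (PHom \<gamma>' (x, y)) (\<alpha> (x, y))"
    and family_comp: "x \<in> Obj2 K \<Longrightarrow> y \<in> Obj2 K \<Longrightarrow> z \<in> Obj2 K \<Longrightarrow>
      f \<in> Obj (Hom2 K x y) \<Longrightarrow> g \<in> Obj (Hom2 K y z) \<Longrightarrow>
      \<alpha> (x, z) (hcomp1 K x y z g f) \<cdot>\<^bsub>PHomCat L \<gamma> x z\<^esub> PComp \<gamma> (x, y, z) (g, f)
      = PComp \<gamma>' (x, y, z) (g, f) \<cdot>\<^bsub>PHomCat L \<gamma> x z\<^esub>
        hcomp2 L (PObj \<gamma> x) (PObj \<gamma> y) (PObj \<gamma> z) (\<alpha> (y, z) g) (\<alpha> (x, y) f)"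
    and family_unit: "x \<in> Obj2 K \<Longrightarrow>
      \<alpha> (x, x) (Ide2 K x) \<cdot>\<^bsub>PHomCat L \<gamma> x x\<^esub> PUnit \<gamma> x = PUnit \<gamma>' x"

definition invertible_two_morphism ::
  "('o, 'm, 't) two_cat \<Rightarrow> ('p, 'n, 'u) two_cat
    \<Rightarrow> ('o, 'm, 't, 'p, 'n, 'u) two_fct \<Rightarrow> ('o, 'm, 't, 'p, 'n, 'u) two_fct
    \<Rightarrow> ('o \<times> 'o \<Rightarrow> 'm \<Rightarrow> 'u) \<Rightarrow> bool" where
  "invertible_two_morphism K L \<gamma> \<gamma>' \<alpha> \<longleftrightarrow> two_morphism K L \<gamma> \<gamma>' \<alpha> \<and>
     (\<forall>x \<in> Obj2 K. \<forall>y \<in> Obj2 K.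
        nat_iso (Hom2 K x y) (PHomCat L \<gamma> x y) (PHom \<gamma> (x, y)) (PHom \<gamma>' (x, y)) (\<alpha> (x, y)))"

definition Fun2 ::
  "('o, 'm, 't) two_cat \<Rightarrow> ('p, 'n, 'u) two_cat
    \<Rightarrow> (('o, 'm, 't, 'p, 'n, 'u) two_fct,
        ('o, 'm, 't, 'p, 'n, 'u) two_fct \<times> ('o \<times> 'o \<Rightarrow> 'm \<Rightarrow> 'u)
          \<times> ('o, 'm, 't, 'p, 'n, 'u) two_fct) cat" where
  "Fun2 K L =
     \<lparr>Obj = {\<gamma>. two_functor K L \<gamma>},
      Arr = {(\<gamma>, \<alpha>, \<gamma>'). two_morphism K L \<gamma> \<gamma>' \<alpha>},
      Dom = \<lambda>(\<gamma>, \<alpha>, \<gamma>'). \<gamma>,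
      Cod = \<lambda>(\<gamma>, \<alpha>, \<gamma>'). \<gamma>',
      Ide = \<lambda>\<gamma>. (\<gamma>,
        \<lambda>(x, y)\<in>Obj2 K \<times> Obj2 K. \<lambda>f\<in>Obj (Hom2 K x y). Ide (PHomCat L \<gamma> x y) (PMap1 \<gamma> x y f), \<gamma>),
      Comp = \<lambda>(\<gamma>', \<beta>, \<gamma>'') (\<gamma>, \<alpha>, \<delta>). (\<gamma>,
        \<lambda>(x, y)\<in>Obj2 K \<times> Obj2 K. \<lambda>f\<in>Obj (Hom2 K x y).
          \<beta> (x, y) f \<cdot>\<^bsub>PHomCat L \<gamma> x y\<^esub> \<alpha> (x, y) f, \<gamma>'')\<rparr>"

definition strong_equivalence ::
  "('o, 'm, 't) two_cat \<Rightarrow> ('p, 'n, 'u) two_cat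
    \<Rightarrow> ('o, 'm, 't, 'p, 'n, 'u) two_fct \<Rightarrow> bool" where
  "strong_equivalence K L \<gamma> \<longleftrightarrow> two_functor K L \<gamma> \<and>
     (\<exists>\<gamma>'. two_functor L K \<gamma>' \<and>
        (\<exists>\<alpha>. invertible_two_morphism K K (id_two_fct K) (comp_two_fct K K \<gamma>' \<gamma>) \<alpha>) \<and>
        (\<exists>\<beta>. invertible_two_morphism L L (comp_two_fct L L \<gamma> \<gamma>') (id_two_fct L) \<beta>))"

section \<open>The simplicial replacement\<close>

definition discrete_cat :: "'x set \<Rightarrow> ('x, 'x) cat" where
  "discrete_cat S =
     \<lparr>Obj = S, Arr = S, Dom = (\<lambda>x. x), Cod = (\<lambda>x. x), Ide = (\<lambda>x. x), Comp = (\<lambda>g f. f)\<rparr>"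

text \<open>A category as a strict 2-category with discrete categories of morphisms, and a functor
  as a 2-functor whose unit and composition isomorphisms are identities.\<close>

definition cat_as_two_cat :: "('o, 'a) cat \<Rightarrow> ('o, 'a, 'a) two_cat" where
  "cat_as_two_cat A =
     \<lparr>Obj2 = Obj A,
      Hom2 = \<lambda>x y. discrete_cat (hom A x y),
      Ide2 = Ide A,
      Comp2 = \<lambda>x y z.
        \<lparr>FObj = \<lambda>(g, f)\<in>hom A y z \<times> hom A x y. g \<cdot>\<^bsub>A\<^esub> f,
         FArr = \<lambda>(g, f)\<in>hom A y z \<times> hom A x y. g \<cdot>\<^bsub>A\<^esub> f\<rparr>\<rparr>"

definition fct_as_two_fct ::
  "('o, 'a) cat \<Rightarrow> ('o, 'a, 'p, 'b) fct \<Rightarrow> ('o, 'a, 'a, 'p, 'b, 'b) two_fct" where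
  "fct_as_two_fct A F =
     \<lparr>PObj = FObj F,
      PHom = \<lambda>(x, y)\<in>Obj A \<times> Obj A.
        \<lparr>FObj = restrict (FArr F) (hom A x y), FArr = restrict (FArr F) (hom A x y)\<rparr>,
      PUnit = \<lambda>x\<in>Obj A. FArr F (Ide A x),
      PComp = \<lambda>(x, y, z)\<in>Obj A \<times> Obj A \<times> Obj A.
        \<lambda>(g, f)\<in>hom A y z \<times> hom A x y. FArr F (g \<cdot>\<^bsub>A\<^esub> f)\<rparr>"

definition ordinal :: "nat \<Rightarrow> (nat, nat \<times> nat) cat" where
  "ordinal n =
     \<lparr>Obj = {0..n}, Arr = {(i, j). i \<le> j \<and> j \<le> n}, Dom = fst, Cod = snd,
      Ide = \<lambda>i. (i, i), Comp = \<lambda>(j', k) (i, j). (i, k)\<rparr>"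

definition ordinal_fct :: "delta_arr \<Rightarrow> (nat, nat \<times> nat, nat, nat \<times> nat) fct" where
  "ordinal_fct = (\<lambda>(m, f, n).
     \<lparr>FObj = f, FArr = \<lambda>(i, j)\<in>Arr (ordinal m). (f i, f j)\<rparr>)"

text \<open>Precomposition with a 2-functor \<open>\<phi> : K \<rightarrow> L\<close>.\<close>

definition precomp ::
  "('o, 'm, 't) two_cat \<Rightarrow> ('p, 'n, 'u) two_cat \<Rightarrow> ('q, 'k, 'v) two_cat
    \<Rightarrow> ('o, 'm, 't, 'p, 'n, 'u) two_fct
    \<Rightarrow> (('p, 'n, 'u, 'q, 'k, 'v) two_fct,
        ('p, 'n, 'u, 'q, 'k, 'v) two_fct \<times> ('p \<times> 'p \<Rightarrow> 'n \<Rightarrow> 'v)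
          \<times> ('p, 'n, 'u, 'q, 'k, 'v) two_fct,
        ('o, 'm, 't, 'q, 'k, 'v) two_fct,
        ('o, 'm, 't, 'q, 'k, 'v) two_fct \<times> ('o \<times> 'o \<Rightarrow> 'm \<Rightarrow> 'v)
          \<times> ('o, 'm, 't, 'q, 'k, 'v) two_fct) fct" where
  "precomp K L M \<phi> =
     \<lparr>FObj = \<lambda>\<gamma>\<in>Obj (Fun2 L M). comp_two_fct K M \<gamma> \<phi>,
      FArr = \<lambda>(\<gamma>, \<alpha>, \<gamma>')\<in>Arr (Fun2 L M).
        (comp_two_fct K M \<gamma> \<phi>,
         \<lambda>(x, y)\<in>Obj2 K \<times> Obj2 K. \<lambda>f\<in>Obj (Hom2 K x y).
           \<alpha> (PObj \<phi> x, PObj \<phi> y) (PMap1 \<phi> x y f),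
         comp_two_fct K M \<gamma>' \<phi>)\<rparr>"

type_synonym ('o, 'm, 't) simplex = "(nat, nat \<times> nat, nat \<times> nat, 'o, 'm, 't) two_fct"

type_synonym ('o, 'm, 't) simplex_arr =
  "('o, 'm, 't) simplex \<times> (nat \<times> nat \<Rightarrow> nat \<times> nat \<Rightarrow> 't) \<times> ('o, 'm, 't) simplex"

definition simplices ::
  "('o, 'm, 't) two_cat \<Rightarrow> nat \<Rightarrow> (('o, 'm, 't) simplex, ('o, 'm, 't) simplex_arr) cat" where
  "simplices K n = Fun2 (cat_as_two_cat (ordinal n)) K"

definition simplices_transition ::
  "('o, 'm, 't) two_cat \<Rightarrow> delta_arr
    \<Rightarrow> (('o, 'm, 't) simplex, ('o, 'm, 't) simplex_arr,
        ('o, 'm, 't) simplex, ('o, 'm, 't) simplex_arr) fct" where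
  "simplices_transition K f =
     precomp (cat_as_two_cat (ordinal (Dom Delta f))) (cat_as_two_cat (ordinal (Cod Delta f))) K
       (fct_as_two_fct (ordinal (Dom Delta f)) (ordinal_fct f))"

definition simp_repl ::
  "('o, 'm, 't) two_cat
    \<Rightarrow> (nat \<times> ('o, 'm, 't) simplex,
        delta_arr \<times> ('o, 'm, 't) simplex_arr \<times> ('o, 'm, 't) simplex) cat" where
  "simp_repl K = grothendieck Delta (simplices K) (simplices_transition K)"

definition simp_repl_proj ::
  "('o, 'm, 't) two_cat
    \<Rightarrow> (nat \<times> ('o, 'm, 't) simplex,
        delta_arr \<times> ('o, 'm, 't) simplex_arr \<times> ('o, 'm, 't) simplex, nat, delta_arr) fct" where
  "simp_repl_proj K = grothendieck_proj Delta (simplices K) (simplices_transition K)"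

end

theory Submission
  imports Defs
begin

text \<open>
 Existence is a strictification by paths. The objects of \<open>R\<close> are the objects of \<open>C\<close> over \<open>[0]\<close>, and a
 1-morphism is a composable list of objects over \<open>[1]\<close>, so that composition is concatenation, which is
 strictly associative and unital. By the Segal condition every path \<open>L\<close> of length \<open>n\<close> is the spine of an object
 \<open>T L\<close> over \<open>[n]\<close>, and 2-morphisms \<open>L \<rightarrow> M\<close> are the arrows over the identity of \<open>[1]\<close> between the long edges of \<open>T L\<close>
 and \<open>T M\<close>; they compose horizontally inside \<open>T (L @ L')\<close>. The equivalence sends an object over \<open>[n]\<close> to the
 2-functor formed by its vertices and its edges, the latter as paths of length one.

 Uniqueness: an equivalence over \<open>\<Delta>\<close> between two simplicial replacements preserves cartesian arrows. Its values
 on simplices of dimension 0, 1 and 2 give the objects, the 1- and 2-morphisms and the composition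
 isomorphisms of a 2-functor, whose coherence is read off simplices of dimension 3. This 2-functor is
 bijective on objects and an equivalence on categories of morphisms, hence a strong equivalence.
\<close>

text \<open>Both halves rest on one rigidity principle: with matching vertices, an arrow over a
  fixed map of \<open>Delta\<close> is determined by its restrictions to consecutive edges and can
  be prescribed there. In a Segal-style 2-category this comes from splitting off the last edge
  repeatedly; in a simplicial replacement the composition isomorphisms extend 2-cells from
  consecutive edges. Fillers over \<open>[2]\<close> and \<open>[3]\<close> therefore exist and are
  unique, and associativity compares two readings of one filler. The obstacle is that realizations
  are chosen: the realization of a segment is not literally a face of the realization of a longer
  path. It is compared with that face by a canonical isomorphism, so horizontal composites are
  conjugated by such comparisons, and uniqueness on edges makes the comparisons functorial.
  Discreteness over \<open>[0]\<close> makes vertices strictly equal, so that paths can be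
  concatenated. For uniqueness, a strong equivalence has to be bijective on objects, since
  2-morphisms require equal object maps; this holds because arrows of a simplicial replacement match
  vertices strictly.\<close>

abbreviation comp_in ("_ \<cdot>[_]/ _" [71, 0, 70] 70) where "g \<cdot>[C] f \<equiv> Comp C g f"

section \<open>Categories\<close>

lemma hom_iff [simp]: "f \<in> hom C x y \<longleftrightarrow> f \<in> Arr C \<and> Dom C f = x \<and> Cod C f = y"
 by (simp add: hom_def)

text \<open>Membership in \<open>Arr\<close> with equations for \<open>Dom\<close> and
  \<open>Cod\<close> replaces the \<open>hom\<close> sets of the locale, so that the simplifier can
  discharge the side conditions. Associativity is oriented to the right, and later rewrite rules are
  shaped for this normal form.\<close>

lemma category_simps [simp]:
 assumes "category C"
 shows "f \<in> Arr C ==> Dom C f \<in> Obj C"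
  and "f \<in> Arr C ==> Cod C f \<in> Obj C"
  and "x \<in> Obj C ==> Ide C x \<in> Arr C"
  and "x \<in> Obj C ==> Dom C (Ide C x) = x"
  and "x \<in> Obj C ==> Cod C (Ide C x) = x"
  and "f \<in> Arr C ==> g \<in> Arr C ==> Dom C g = Cod C f ==> g \<cdot>[C] f \<in> Arr C"
  and "f \<in> Arr C ==> g \<in> Arr C ==> Dom C g = Cod C f ==> Dom C (g \<cdot>[C] f) = Dom C f"
  and "f \<in> Arr C ==> g \<in> Arr C ==> Dom C g = Cod C f ==> Cod C (g \<cdot>[C] f) = Cod C g"
  and "f \<in> Arr C ==> Cod C f = x ==> Ide C x \<cdot>[C] f = f"
  and "f \<in> Arr C ==> Dom C f = x ==> f \<cdot>[C] Ide C x = f"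
  and "f \<in> Arr C ==> g \<in> Arr C ==> h \<in> Arr C ==> Dom C g = Cod C f ==> Dom C h = Cod C g
   ==> (h \<cdot>[C] g) \<cdot>[C] f = h \<cdot>[C] (g \<cdot>[C] f)"
 using category.dom_obj[OF assms] category.cod_obj[OF assms] category.ide_hom[OF assms]
  category.comp_hom[OF assms] category.ide_left[OF assms] category.ide_right[OF assms]
  category.comp_assoc[OF assms] by auto

lemma categoryI:
 assumes "\<And>f. f \<in> Arr C ==> Dom C f \<in> Obj C \<and> Cod C f \<in> Obj C"
  and "\<And>x. x \<in> Obj C ==> Ide C x \<in> Arr C \<and> Dom C (Ide C x) = x \<and> Cod C (Ide C x) = x"
  and "\<And>f g. f \<in> Arr C ==> g \<in> Arr C ==> Dom C g = Cod C f ==>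
   g \<cdot>[C] f \<in> Arr C \<and> Dom C (g \<cdot>[C] f) = Dom C f \<and> Cod C (g \<cdot>[C] f) = Cod C g"
  and "\<And>f. f \<in> Arr C ==> Ide C (Cod C f) \<cdot>[C] f = f \<and> f \<cdot>[C] Ide C (Dom C f) = f"
  and "\<And>f g h. f \<in> Arr C ==> g \<in> Arr C ==> h \<in> Arr C ==> Dom C g = Cod C f ==>
   Dom C h = Cod C g ==> h \<cdot>[C] (g \<cdot>[C] f) = (h \<cdot>[C] g) \<cdot>[C] f"
 shows "category C"
 by (rule category.intro) (use assms in auto)

section \<open>Inverses of isomorphisms as terms\<close>

definition inv_arr :: "('o, 'a) cat => 'a => 'a" where
 "inv_arr C f = (SOME g. g \<in> hom C (Cod C f) (Dom C f) \<and>
   g \<cdot>[C] f = Ide C (Dom C f) \<and> f \<cdot>[C] g = Ide C (Cod C f))"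

lemma iso_arr [simp]: "iso C f ==> f \<in> Arr C"
 by (simp add: iso_def)

lemma inv_arr_simps [simp]:
 assumes "iso C f"
 shows "inv_arr C f \<in> Arr C" "Dom C (inv_arr C f) = Cod C f" "Cod C (inv_arr C f) = Dom C f"
  "inv_arr C f \<cdot>[C] f = Ide C (Dom C f)" "f \<cdot>[C] inv_arr C f = Ide C (Cod C f)"
proof -
 have "\<exists>g. g \<in> hom C (Cod C f) (Dom C f) \<and>
   g \<cdot>[C] f = Ide C (Dom C f) \<and> f \<cdot>[C] g = Ide C (Cod C f)"
  using assms unfolding iso_def by blast
 from someI_ex[OF this, folded inv_arr_def]
 show "inv_arr C f \<in> Arr C" "Dom C (inv_arr C f) = Cod C f" "Cod C (inv_arr C f) = Dom C f"
  "inv_arr C f \<cdot>[C] f = Ide C (Dom C f)" "f \<cdot>[C] inv_arr C f = Ide C (Cod C f)"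
  by auto
qed

lemma isoI:
 assumes "f \<in> Arr C" "g \<in> Arr C" "Dom C g = Cod C f" "Cod C g = Dom C f"
  "g \<cdot>[C] f = Ide C (Dom C f)" "f \<cdot>[C] g = Ide C (Cod C f)"
 shows "iso C f"
 unfolding iso_def using assms by (intro conjI bexI[of _ g]) simp_all

text \<open>In right-nested composites an adjacent pair of inverses is hidden in front of a third
  factor, so cancellation is needed in this form as well.\<close>

lemma inv_arr_cancel [simp]:
 assumes "category C" "iso C f"
 shows "g \<in> Arr C ==> Cod C g = Dom C f ==> inv_arr C f \<cdot>[C] (f \<cdot>[C] g) = g"
  and "g \<in> Arr C ==> Cod C g = Cod C f ==> f \<cdot>[C] (inv_arr C f \<cdot>[C] g) = g"
proof -
 show "inv_arr C f \<cdot>[C] (f \<cdot>[C] g) = g" if "g \<in> Arr C" "Cod C g = Dom C f"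
  using that assms by (subst category_simps(11)[symmetric]) simp_all
 show "f \<cdot>[C] (inv_arr C f \<cdot>[C] g) = g" if "g \<in> Arr C" "Cod C g = Cod C f"
  using that assms by (subst category_simps(11)[symmetric]) simp_all
qed

text \<open>A left inverse of an isomorphism is its two-sided inverse: insert
  \<open>g f = id\<close> in front of the chosen inverse.\<close>

lemma inv_arr_unique:
 assumes "category C" "iso C f" "g \<in> Arr C" "Dom C g = Cod C f" "g \<cdot>[C] f = Ide C (Dom C f)"
 shows "inv_arr C f = g"
proof -
 \<comment> \<open>The codomain of \<open>g\<close> is not assumed; it is read off by comparing the
   codomains of the two sides of \<open>g f = id\<close>.\<close>
 have "Cod C (g \<cdot>[C] f) = Cod C (Ide C (Dom C f))" using assms by simp
 then have "Cod C g = Dom C f" using assms(1-4) by simp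
 have "inv_arr C f = (g \<cdot>[C] f) \<cdot>[C] inv_arr C f"
  unfolding assms(5) using assms(1-4) by simp
 also have "\<dots> = g" using assms(1-4) \<open>Cod C g = Dom C f\<close> by simp
 finally show ?thesis .
qed

lemma iso_inv_arr [simp]: "iso C f ==> iso C (inv_arr C f)"
 by (rule isoI[of _ _ f]) simp_all

lemma iso_Ide [simp]: "category C ==> x \<in> Obj C ==> iso C (Ide C x)"
 by (rule isoI[of _ _ "Ide C x"]) simp_all

lemma inv_arr_Ide [simp]: "category C ==> x \<in> Obj C ==> inv_arr C (Ide C x) = Ide C x"
 by (rule inv_arr_unique) simp_all

lemma iso_comp [simp]:
 "category C ==> iso C f ==> iso C g ==> Dom C g = Cod C f ==> iso C (g \<cdot>[C] f)"
 by (rule isoI[of _ _ "inv_arr C f \<cdot>[C] inv_arr C g"]) simp_all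

lemma inv_arr_comp:
 "category C ==> iso C f ==> iso C g ==> Dom C g = Cod C f ==>
  inv_arr C (g \<cdot>[C] f) = inv_arr C f \<cdot>[C] inv_arr C g"
 by (rule inv_arr_unique) simp_all

lemma iso_cancel_left:
 assumes "category C" "iso C f" "f \<cdot>[C] g = f \<cdot>[C] h"
  "g \<in> Arr C" "h \<in> Arr C" "Cod C g = Dom C f" "Cod C h = Dom C f"
 shows "g = h"
proof -
 have "inv_arr C f \<cdot>[C] (f \<cdot>[C] g) = g" "inv_arr C f \<cdot>[C] (f \<cdot>[C] h) = h"
  using assms(1,2,4-7) by simp_all
 then show ?thesis using assms(3) by metis
qed

lemma iso_cancel_right:
 assumes "category C" "iso C f" "g \<cdot>[C] f = h \<cdot>[C] f"
  "g \<in> Arr C" "h \<in> Arr C" "Dom C g = Cod C f" "Dom C h = Cod C f"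
 shows "g = h"
proof -
 have "(g \<cdot>[C] f) \<cdot>[C] inv_arr C f = g" "(h \<cdot>[C] f) \<cdot>[C] inv_arr C f = h"
  using assms(1,2,4-7) by simp_all
 then show ?thesis using assms(3) by metis
qed

lemma inv_arr_eq_left:
 assumes "category C" "iso C f" "g \<in> Arr C" "Cod C g = Cod C f" "h \<in> Arr C" "Cod C h = Dom C f"
 shows "inv_arr C f \<cdot>[C] g = h \<longleftrightarrow> g = f \<cdot>[C] h"
 using assms by auto

section \<open>Functors and natural isomorphisms in pointwise form\<close>

lemma cat_functorI:
 assumes "category A" "category B" "FObj F \<in> Obj A \<rightarrow>\<^sub>E Obj B" "FArr F \<in> extensional (Arr A)"
  "\<And>f. f \<in> Arr A ==> FArr F f \<in> Arr B \<and> Dom B (FArr F f) = FObj F (Dom A f)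
    \<and> Cod B (FArr F f) = FObj F (Cod A f)"
  "\<And>x. x \<in> Obj A ==> FArr F (Ide A x) = Ide B (FObj F x)"
  "\<And>f g. f \<in> Arr A ==> g \<in> Arr A ==> Dom A g = Cod A f ==>
    FArr F (g \<cdot>[A] f) = FArr F g \<cdot>[B] FArr F f"
 shows "cat_functor A B F"
 using assms by (auto intro!: cat_functor.intro cat_functor_axioms.intro)

lemma cat_functor_simps [simp]:
 assumes "cat_functor A B F"
 shows "x \<in> Obj A ==> FObj F x \<in> Obj B"
  "f \<in> Arr A ==> FArr F f \<in> Arr B"
  "f \<in> Arr A ==> Dom B (FArr F f) = FObj F (Dom A f)"
  "f \<in> Arr A ==> Cod B (FArr F f) = FObj F (Cod A f)"
  "x \<in> Obj A ==> FArr F (Ide A x) = Ide B (FObj F x)"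
  "f \<in> Arr A ==> g \<in> Arr A ==> Dom A g = Cod A f ==>
    FArr F (g \<cdot>[A] f) = FArr F g \<cdot>[B] FArr F f"
proof -
 interpret cat_functor A B F by fact
 show "x \<in> Obj A ==> FObj F x \<in> Obj B" using obj_map by auto
 show "f \<in> Arr A ==> FArr F f \<in> Arr B"
  "f \<in> Arr A ==> Dom B (FArr F f) = FObj F (Dom A f)"
  "f \<in> Arr A ==> Cod B (FArr F f) = FObj F (Cod A f)"
  using arr_map[of f "Dom A f" "Cod A f"] by auto
 show "x \<in> Obj A ==> FArr F (Ide A x) = Ide B (FObj F x)" by (rule map_ide)
 show "f \<in> Arr A ==> g \<in> Arr A ==> Dom A g = Cod A f ==>
    FArr F (g \<cdot>[A] f) = FArr F g \<cdot>[B] FArr F f"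
  using map_comp[of f "Dom A f" "Cod A f" g "Cod A g"] by auto
qed

lemma cat_functor_cat:
 assumes "cat_functor A B F" shows "category A" "category B"
 using assms by (auto simp: cat_functor_def)

lemma cat_functor_ext:
 assumes "cat_functor A B F"
 shows "x \<notin> Obj A ==> FObj F x = undefined" "f \<notin> Arr A ==> FArr F f = undefined"
 using cat_functor.obj_map[OF assms] cat_functor.arr_ext[OF assms]
 by (auto simp: extensional_def PiE_def)

text \<open>Agreement on the carriers suffices because both functors are \<open>undefined\<close>
  off them.\<close>

lemma fct_eqI:
 fixes F G :: "('o, 'a, 'p, 'b) fct"
 assumes "cat_functor A B F" "cat_functor A B' G"
  "\<And>x. x \<in> Obj A ==> FObj F x = FObj G x" "\<And>f. f \<in> Arr A ==> FArr F f = FArr G f"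
 shows "F = G"
proof -
 have "FObj F x = FObj G x" for x
  using assms(3) cat_functor_ext(1)[OF assms(1)] cat_functor_ext(1)[OF assms(2)] by (cases "x \<in> Obj A") auto
 moreover have "FArr F f = FArr G f" for f
  using assms(4) cat_functor_ext(2)[OF assms(1)] cat_functor_ext(2)[OF assms(2)] by (cases "f \<in> Arr A") auto
 ultimately have "FObj F = FObj G" "FArr F = FArr G" by auto
 then show ?thesis by simp
qed

lemma functor_iso:
 assumes "cat_functor A B F" "iso A f"
 shows "iso B (FArr F f)"
proof (rule isoI[of _ _ "FArr F (inv_arr A f)"])
 have c: "category A" using assms(1) by (rule cat_functor_cat)
 show "FArr F (inv_arr A f) \<cdot>[B] FArr F f = Ide B (Dom B (FArr F f))"
  "FArr F f \<cdot>[B] FArr F (inv_arr A f) = Ide B (Cod B (FArr F f))"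
  using assms c by (simp_all flip: cat_functor_simps(6)[OF assms(1)])
qed (use assms in simp_all)

lemma functor_inv_arr:
 assumes "cat_functor A B F" "iso A f"
 shows "FArr F (inv_arr A f) = inv_arr B (FArr F f)"
proof -
 have c: "category A" "category B" using assms(1) by (auto dest: cat_functor_cat)
 show ?thesis
  by (rule inv_arr_unique[symmetric])
   (use assms c functor_iso[OF assms] in \<open>simp_all flip: cat_functor_simps(6)[OF assms(1)]\<close>)
qed

lemma id_fct_simps [simp]:
 "x \<in> Obj A ==> FObj (id_fct A) x = x" "f \<in> Arr A ==> FArr (id_fct A) f = f"
 by (auto simp: id_fct_def)

lemma comp_fct_simps [simp]:
 "x \<in> Obj A ==> FObj (comp_fct A G F) x = FObj G (FObj F x)"
 "f \<in> Arr A ==> FArr (comp_fct A G F) f = FArr G (FArr F f)"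
 by (auto simp: comp_fct_def compose_def)

lemma id_fct_functor [simp]: "category A ==> cat_functor A A (id_fct A)"
 by (rule cat_functorI) (auto simp: id_fct_def)

lemma comp_fct_functor [simp]:
 assumes "cat_functor A B F" "cat_functor B C G"
 shows "cat_functor A C (comp_fct A G F)"
proof -
 have c: "category A" "category B" "category C" using assms by (auto dest: cat_functor_cat)
 show ?thesis
  by (rule cat_functorI) (use assms c in \<open>auto simp: comp_fct_def compose_def\<close>)
qed

lemma nat_isoI:
 assumes "cat_functor A B F" "cat_functor A B G" "\<tau> \<in> extensional (Obj A)"
  "\<And>x. x \<in> Obj A ==> iso B (\<tau> x) \<and> Dom B (\<tau> x) = FObj F x \<and> Cod B (\<tau> x) = FObj G x"
  "\<And>f. f \<in> Arr A ==> \<tau> (Cod A f) \<cdot>[B] FArr F f = FArr G f \<cdot>[B] \<tau> (Dom A f)"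
 shows "nat_iso A B F G \<tau>"
 using assms by (auto simp: nat_iso_def intro!: nat_trans.intro nat_trans_axioms.intro)

lemma nat_isoD:
 assumes "nat_iso A B F G \<tau>"
 shows "cat_functor A B F" "cat_functor A B G" "\<tau> \<in> extensional (Obj A)"
  "\<And>x. x \<in> Obj A ==> iso B (\<tau> x)" "\<And>x. x \<in> Obj A ==> Dom B (\<tau> x) = FObj F x"
  "\<And>x. x \<in> Obj A ==> Cod B (\<tau> x) = FObj G x"
  "\<And>f. f \<in> Arr A ==> \<tau> (Cod A f) \<cdot>[B] FArr F f = FArr G f \<cdot>[B] \<tau> (Dom A f)"
 using assms unfolding nat_iso_def nat_trans_def nat_trans_axioms_def by auto

lemma nat_iso_sym:
 assumes "nat_iso A B F G \<tau>"
 shows "nat_iso A B G F (\<lambda>x\<in>Obj A. inv_arr B (\<tau> x))"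
proof (rule nat_isoI)
 note [simp] = nat_isoD(1-6)[OF assms] cat_functor_simps[OF nat_isoD(1)[OF assms]]
  cat_functor_simps[OF nat_isoD(2)[OF assms]]
 have [simp]: "category A" "category B" using cat_functor_cat[OF nat_isoD(1)[OF assms]] by auto
 fix f assume f: "f \<in> Arr A"
 have "\<tau> (Cod A f) \<cdot>[B] FArr F f \<cdot>[B] inv_arr B (\<tau> (Dom A f))
   = (\<tau> (Cod A f) \<cdot>[B] FArr F f) \<cdot>[B] inv_arr B (\<tau> (Dom A f))"
  using f by simp
 also have "\<dots> = FArr G f"
  unfolding nat_isoD(7)[OF assms f] using f by simp
 finally show "(\<lambda>x\<in>Obj A. inv_arr B (\<tau> x)) (Cod A f) \<cdot>[B] FArr G f
   = FArr F f \<cdot>[B] (\<lambda>x\<in>Obj A. inv_arr B (\<tau> x)) (Dom A f)"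
  using f by (simp add: inv_arr_eq_left)
qed (use nat_isoD[OF assms] in auto)

section \<open>Equivalences of categories\<close>

definition fully_faithful :: "('o, 'a) cat => ('p, 'b) cat => ('o, 'a, 'p, 'b) fct => bool" where
 "fully_faithful A B F \<longleftrightarrow>
   (\<forall>x \<in> Obj A. \<forall>y \<in> Obj A. \<forall>g \<in> hom B (FObj F x) (FObj F y). \<exists>!f. f \<in> hom A x y \<and> FArr F f = g)"

definition ess_surjective :: "('o, 'a) cat => ('p, 'b) cat => ('o, 'a, 'p, 'b) fct => bool" where
 "ess_surjective A B F \<longleftrightarrow>
   (\<forall>b \<in> Obj B. \<exists>x \<in> Obj A. \<exists>e. iso B e \<and> Dom B e = FObj F x \<and> Cod B e = b)"

lemma fully_faithfulD:
 assumes "fully_faithful A B F" "x \<in> Obj A" "y \<in> Obj A"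
  "g \<in> Arr B" "Dom B g = FObj F x" "Cod B g = FObj F y"
 shows "\<exists>f \<in> Arr A. Dom A f = x \<and> Cod A f = y \<and> FArr F f = g"
 using assms unfolding fully_faithful_def by (metis hom_iff)

lemma faithfulD:
 assumes "fully_faithful A B F" "cat_functor A B F" "f \<in> Arr A" "f' \<in> Arr A"
  "Dom A f = Dom A f'" "Cod A f = Cod A f'" "FArr F f = FArr F f'"
 shows "f = f'"
proof -
 have "category A" using assms(2) by (rule cat_functor_cat)
 then have "\<exists>!h. h \<in> hom A (Dom A f) (Cod A f) \<and> FArr F h = FArr F f"
  using assms unfolding fully_faithful_def by auto
 then show ?thesis using assms by (metis hom_iff)
qed

lemma fully_faithfulI:
 assumes "\<And>x y g. x \<in> Obj A ==> y \<in> Obj A ==> g \<in> Arr B ==> Dom B g = FObj F x ==>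
   Cod B g = FObj F y ==> \<exists>f \<in> Arr A. Dom A f = x \<and> Cod A f = y \<and> FArr F f = g"
  and "\<And>f f'. f \<in> Arr A ==> f' \<in> Arr A ==> Dom A f = Dom A f' ==> Cod A f = Cod A f' ==>
   FArr F f = FArr F f' ==> f = f'"
 shows "fully_faithful A B F"
 unfolding fully_faithful_def
proof (intro ballI)
 fix x y g assume h: "x \<in> Obj A" "y \<in> Obj A" "g \<in> hom B (FObj F x) (FObj F y)"
 then obtain f where "f \<in> Arr A" "Dom A f = x" "Cod A f = y" "FArr F f = g"
  using assms(1)[of x y g] by auto
 then show "\<exists>!f. f \<in> hom A x y \<and> FArr F f = g"
  using assms(2) by (intro ex1I[of _ f]) auto
qed

lemma iso_reflect:
 assumes "fully_faithful A B F" "cat_functor A B F" "f \<in> Arr A" "iso B (FArr F f)"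
 shows "iso A f"
proof -
 have [simp]: "category A" "category B" using assms(2) by (auto dest: cat_functor_cat)
 obtain g where g: "g \<in> Arr A" "Dom A g = Cod A f" "Cod A g = Dom A f" "FArr F g = inv_arr B (FArr F f)"
  using fully_faithfulD[OF assms(1), of "Cod A f" "Dom A f" "inv_arr B (FArr F f)"] assms(2-4) by auto
 show ?thesis
  by (rule isoI[of _ _ g]; (rule faithfulD[OF assms(1,2)])?) (use g assms(2-4) in simp_all)
qed

lemma equivalence_sym:
 assumes "equivalence A B F"
 obtains G \<epsilon> where "equivalence B A G" "nat_iso B B (comp_fct B F G) (id_fct B) \<epsilon>"
proof -
 obtain G \<eta> \<epsilon> where h: "cat_functor A B F" "cat_functor B A G"
   "nat_iso A A (id_fct A) (comp_fct A G F) \<eta>" "nat_iso B B (comp_fct B F G) (id_fct B) \<epsilon>"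
  using assms unfolding equivalence_def by blast
 have "equivalence B A G"
  unfolding equivalence_def using h nat_iso_sym[OF h(3)] nat_iso_sym[OF h(4)] by blast
 then show ?thesis using that h(4) by blast
qed

text \<open>Naturality of the unit equates \<open>\<eta> y\<close> after \<open>f\<close> with
  \<open>G (F f)\<close> after \<open>\<eta> x\<close>, so \<open>F f\<close> determines the former,
  and \<open>\<eta> y\<close> can be cancelled.\<close>

lemma equivalence_faithful:
 assumes "equivalence A B F" "f \<in> Arr A" "f' \<in> Arr A"
  "Dom A f = Dom A f'" "Cod A f = Cod A f'" "FArr F f = FArr F f'"
 shows "f = f'"
proof -
 obtain G \<eta> where h: "cat_functor A B F" "cat_functor B A G"
   "nat_iso A A (id_fct A) (comp_fct A G F) \<eta>"
  using assms unfolding equivalence_def by blast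
 have [simp]: "category A" using h(1) by (rule cat_functor_cat)
 note n = nat_isoD[OF h(3)]
 have "\<eta> (Cod A f) \<cdot>[A] f = \<eta> (Cod A f) \<cdot>[A] f'"
  using n(7)[of f] n(7)[of f'] assms by simp
 then show ?thesis
  by (rule iso_cancel_left[rotated 2]) (use assms n in auto)
qed

text \<open>Both directions matter: the Segal condition is given by quasi-inverses but is used
  through fullness, faithfulness and essential surjectivity, and the equivalence constructed at the
  end is established by these properties.\<close>

lemma equivalence_iff:
 "equivalence A B F \<longleftrightarrow> cat_functor A B F \<and> fully_faithful A B F \<and> ess_surjective A B F"
proof (intro iffI conjI)
 assume e: "equivalence A B F"
 then obtain G \<eta> \<epsilon> where h: "cat_functor A B F" "cat_functor B A G"
   "nat_iso A A (id_fct A) (comp_fct A G F) \<eta>" "nat_iso B B (comp_fct B F G) (id_fct B) \<epsilon>"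
  unfolding equivalence_def by blast
 have eG: "equivalence B A G"
  unfolding equivalence_def using h nat_iso_sym[OF h(3)] nat_iso_sym[OF h(4)] by blast
 show "cat_functor A B F" by fact
 have [simp]: "category A" "category B" using h(1) by (auto dest: cat_functor_cat)
 note n = nat_isoD[OF h(3)]
 show "fully_faithful A B F"
 proof (rule fully_faithfulI)
  fix x y g assume g: "x \<in> Obj A" "y \<in> Obj A" "g \<in> Arr B" "Dom B g = FObj F x" "Cod B g = FObj F y"
  \<comment> \<open>The only candidate: naturality of the unit forces \<open>\<eta> y\<close> after
    \<open>f\<close> to be \<open>G g\<close> after \<open>\<eta> x\<close> for any preimage
    \<open>f\<close> of \<open>g\<close>.\<close>
  define f where "f = inv_arr A (\<eta> y) \<cdot>[A] FArr G g \<cdot>[A] \<eta> x"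
  have f: "f \<in> Arr A" "Dom A f = x" "Cod A f = y"
   using g h(1,2) n(4-6)[of x] n(4-6)[of y] by (simp_all add: f_def)
  have "FArr G (FArr F f) \<cdot>[A] \<eta> x = \<eta> y \<cdot>[A] f" using n(7)[OF f(1)] f by simp
  also have "\<dots> = FArr G g \<cdot>[A] \<eta> x"
   using g h(1,2) n(4-6)[of x] n(4-6)[of y] by (simp add: f_def)
  finally have "FArr G (FArr F f) = FArr G g"
   by (rule iso_cancel_right[rotated 2]) (use g h(1,2) n(4-6)[of x] f in auto)
  \<comment> \<open>\<open>G\<close> is itself an equivalence, hence faithful, and this removes the
    outer \<open>G\<close>.\<close>
  then have "FArr F f = g"
   by (rule equivalence_faithful[OF eG, rotated 4]) (use f g h(1) in auto)
  then show "\<exists>f \<in> Arr A. Dom A f = x \<and> Cod A f = y \<and> FArr F f = g" using f by blast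
 qed (rule equivalence_faithful[OF e])
 show "ess_surjective A B F"
  unfolding ess_surjective_def
 proof
  fix b assume b: "b \<in> Obj B"
  then show "\<exists>x\<in>Obj A. \<exists>e. iso B e \<and> Dom B e = FObj F x \<and> Cod B e = b"
   using h(2) nat_isoD(4-6)[OF h(4), of b] by (intro bexI[of _ "FObj G b"] exI[of _ "\<epsilon> b"]) auto
 qed
next
 assume a: "cat_functor A B F \<and> fully_faithful A B F \<and> ess_surjective A B F"
 then have F: "cat_functor A B F" and ff: "fully_faithful A B F" and es: "ess_surjective A B F" by auto
 have [simp]: "category A" "category B" using F by (auto dest: cat_functor_cat)
 note F [simp] and [simp] = cat_functor_simps[OF F] functor_iso[OF F]
 obtain g e where ge: "\<And>b. b \<in> Obj B ==> g b \<in> Obj A \<and> iso B (e b) \<and> Dom B (e b) = FObj F (g b) \<and> Cod B (e b) = b"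
  using es unfolding ess_surjective_def by metis
 note ge' [simp] = conjunct1[OF ge] conjunct1[OF conjunct2[OF ge]]
  conjunct1[OF conjunct2[OF conjunct2[OF ge]]] conjunct2[OF conjunct2[OF conjunct2[OF ge]]]
 \<comment> \<open>The value of the quasi-inverse on \<open>k\<close> is the preimage under
   \<open>F\<close> of the conjugate of \<open>k\<close> by the chosen isomorphisms
   \<open>e\<close>; faithfulness of \<open>F\<close> will make this functorial.\<close>
 have "\<exists>f. f \<in> Arr A \<and> Dom A f = g (Dom B k) \<and> Cod A f = g (Cod B k) \<and>
   FArr F f = inv_arr B (e (Cod B k)) \<cdot>[B] k \<cdot>[B] e (Dom B k)" if "k \<in> Arr B" for k
  using fully_faithfulD[OF ff, of "g (Dom B k)" "g (Cod B k)"
    "inv_arr B (e (Cod B k)) \<cdot>[B] k \<cdot>[B] e (Dom B k)"] that by auto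
 then obtain p where p: "\<And>k. k \<in> Arr B ==> p k \<in> Arr A \<and> Dom A (p k) = g (Dom B k) \<and>
   Cod A (p k) = g (Cod B k) \<and> FArr F (p k) = inv_arr B (e (Cod B k)) \<cdot>[B] k \<cdot>[B] e (Dom B k)"
  by metis
 note p' [simp] = conjunct1[OF p] conjunct1[OF conjunct2[OF p]]
  conjunct1[OF conjunct2[OF conjunct2[OF p]]] conjunct2[OF conjunct2[OF conjunct2[OF p]]]
 define G where "G = \<lparr>FObj = \<lambda>b\<in>Obj B. g b, FArr = \<lambda>k\<in>Arr B. p k\<rparr>"
 have G [simp]: "b \<in> Obj B ==> FObj G b = g b" "k \<in> Arr B ==> FArr G k = p k" for b k
  by (auto simp: G_def)
 have GF [simp]: "cat_functor B A G"
 proof (rule cat_functorI)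
  fix b assume "b \<in> Obj B"
  then show "FArr G (Ide B b) = Ide A (FObj G b)" by (auto intro!: faithfulD[OF ff F])
 next
  fix f k assume "f \<in> Arr B" "k \<in> Arr B" "Dom B k = Cod B f"
  then show "FArr G (k \<cdot>[B] f) = FArr G k \<cdot>[A] FArr G f" by (auto intro!: faithfulD[OF ff F])
 qed (auto simp: G_def)
 have "\<exists>f. f \<in> Arr A \<and> Dom A f = x \<and> Cod A f = g (FObj F x) \<and>
   FArr F f = inv_arr B (e (FObj F x))" if "x \<in> Obj A" for x
  using fully_faithfulD[OF ff, of x "g (FObj F x)" "inv_arr B (e (FObj F x))"] that by auto
 then obtain q where q: "\<And>x. x \<in> Obj A ==> q x \<in> Arr A \<and> Dom A (q x) = x \<and> Cod A (q x) = g (FObj F x) \<and>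
   FArr F (q x) = inv_arr B (e (FObj F x))" by metis
 note q' [simp] = conjunct1[OF q] conjunct1[OF conjunct2[OF q]]
  conjunct1[OF conjunct2[OF conjunct2[OF q]]] conjunct2[OF conjunct2[OF conjunct2[OF q]]]
 have "nat_iso A A (id_fct A) (comp_fct A G F) (\<lambda>x\<in>Obj A. q x)"
 proof (rule nat_isoI)
  fix x assume x: "x \<in> Obj A"
  then have "iso A (q x)" by (intro iso_reflect[OF ff F]) simp_all
  then show "iso A ((\<lambda>x\<in>Obj A. q x) x) \<and> Dom A ((\<lambda>x\<in>Obj A. q x) x) = FObj (id_fct A) x \<and>
    Cod A ((\<lambda>x\<in>Obj A. q x) x) = FObj (comp_fct A G F) x"
   using x by simp
 next
  fix f assume f: "f \<in> Arr A"
  then show "(\<lambda>x\<in>Obj A. q x) (Cod A f) \<cdot>[A] FArr (id_fct A) f =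
    FArr (comp_fct A G F) f \<cdot>[A] (\<lambda>x\<in>Obj A. q x) (Dom A f)"
   by (auto intro!: faithfulD[OF ff F])
 qed (simp_all add: comp_fct_functor[OF F GF])
 moreover have "nat_iso B B (comp_fct B F G) (id_fct B) (\<lambda>b\<in>Obj B. e b)"
  by (rule nat_isoI) (simp_all add: comp_fct_functor[OF GF F])
 ultimately show "equivalence A B F"
  unfolding equivalence_def using F GF by blast
qed

text \<open>Working with full faithfulness and essential surjectivity avoids pasting units and
  counits.\<close>

lemma equivalence_comp:
 assumes "equivalence A B F" "equivalence B C G"
 shows "equivalence A C (comp_fct A G F)"
proof -
 note F = assms(1)[unfolded equivalence_iff] and G = assms(2)[unfolded equivalence_iff]
 have FG [simp]: "cat_functor A B F" "cat_functor B C G" using F G by auto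
 have [simp]: "category A" "category B" "category C"
  using cat_functor_cat[OF FG(1)] cat_functor_cat[OF FG(2)] by auto
 note [simp] = cat_functor_simps[OF FG(1)] cat_functor_simps[OF FG(2)] functor_iso[OF FG(2)]
 have "fully_faithful A C (comp_fct A G F)"
 proof (rule fully_faithfulI)
  fix x y k assume k: "x \<in> Obj A" "y \<in> Obj A" "k \<in> Arr C"
   "Dom C k = FObj (comp_fct A G F) x" "Cod C k = FObj (comp_fct A G F) y"
  then obtain g where g: "g \<in> Arr B" "Dom B g = FObj F x" "Cod B g = FObj F y" "FArr G g = k"
   using fully_faithfulD[of B C G "FObj F x" "FObj F y" k] G by auto
  then obtain f where "f \<in> Arr A" "Dom A f = x" "Cod A f = y" "FArr F f = g"
   using fully_faithfulD[of A B F x y g] F k by auto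
  then show "\<exists>f \<in> Arr A. Dom A f = x \<and> Cod A f = y \<and> FArr (comp_fct A G F) f = k"
   using g by auto
 next
  fix f f' assume f: "f \<in> Arr A" "f' \<in> Arr A" "Dom A f = Dom A f'" "Cod A f = Cod A f'"
   "FArr (comp_fct A G F) f = FArr (comp_fct A G F) f'"
  then have "FArr F f = FArr F f'" by (intro equivalence_faithful[OF assms(2)]) auto
  then show "f = f'" using f by (intro equivalence_faithful[OF assms(1)]) auto
 qed
 moreover have "ess_surjective A C (comp_fct A G F)"
  unfolding ess_surjective_def
 proof
  fix c assume c: "c \<in> Obj C"
  obtain b e where b: "b \<in> Obj B" "iso C e" "Dom C e = FObj G b" "Cod C e = c"
   using G c unfolding ess_surjective_def by blast
  obtain a e' where a: "a \<in> Obj A" "iso B e'" "Dom B e' = FObj F a" "Cod B e' = b"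
   using F b(1) unfolding ess_surjective_def by blast
  show "\<exists>x\<in>Obj A. \<exists>e. iso C e \<and> Dom C e = FObj (comp_fct A G F) x \<and> Cod C e = c"
   using a b by (intro bexI[of _ a] exI[of _ "e \<cdot>[C] FArr G e'"]) auto
 qed
 ultimately show ?thesis by (simp add: equivalence_iff comp_fct_functor[OF FG])
qed

section \<open>The category \<open>\<Delta>\<close>\<close>

definition app :: "delta_arr => nat => nat" where
 "app \<phi> = fst (snd \<phi>)"

lemma Delta_Obj [simp]: "n \<in> Obj Delta"
 by (simp add: Delta_def)

lemma Delta_arr_iff: "\<phi> \<in> Arr Delta \<longleftrightarrow>
  app \<phi> \<in> {0..Dom Delta \<phi>} \<rightarrow>\<^sub>E {0..Cod Delta \<phi>} \<and> mono_on {0..Dom Delta \<phi>} (app \<phi>)"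
 by (cases \<phi>) (simp add: Delta_def app_def)

lemma Delta_arrI:
 assumes "app \<phi> \<in> extensional {0..Dom Delta \<phi>}" "\<And>i. i \<le> Dom Delta \<phi> ==> app \<phi> i \<le> Cod Delta \<phi>"
  "\<And>i j. i \<le> j ==> j \<le> Dom Delta \<phi> ==> app \<phi> i \<le> app \<phi> j"
 shows "\<phi> \<in> Arr Delta"
 unfolding Delta_arr_iff mono_on_def PiE_def Pi_def using assms by auto

lemma Delta_eqI:
 assumes "\<phi> \<in> Arr Delta" "\<psi> \<in> Arr Delta" "Dom Delta \<phi> = Dom Delta \<psi>" "Cod Delta \<phi> = Cod Delta \<psi>"
  "\<And>i. i \<le> Dom Delta \<psi> ==> app \<phi> i = app \<psi> i"
 shows "\<phi> = \<psi>"
proof -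
 have "app \<phi> = app \<psi>"
  using assms by (intro PiE_ext[of _ "{0..Dom Delta \<psi>}" "\<lambda>_. {0..Cod Delta \<psi>}"]) (auto simp: Delta_arr_iff)
 then show ?thesis using assms(3,4) by (cases \<phi>; cases \<psi>) (simp add: Delta_def app_def)
qed

lemma app_le: "\<phi> \<in> Arr Delta ==> i \<le> Dom Delta \<phi> ==> app \<phi> i \<le> Cod Delta \<phi>"
 by (auto simp: Delta_arr_iff PiE_def Pi_def)

lemma app_le' [simp]: "\<phi> \<in> Arr Delta ==> i \<le> Dom Delta \<phi> ==> Cod Delta \<phi> = n ==> app \<phi> i \<le> n"
 using app_le by blast

lemma app_mono [simp]: "\<phi> \<in> Arr Delta ==> i \<le> j ==> j \<le> Dom Delta \<phi> ==> app \<phi> i \<le> app \<phi> j"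
 by (auto simp: Delta_arr_iff mono_on_def)

lemma app_Ide [simp]: "i \<le> n ==> app (Ide Delta n) i = i"
 by (simp add: Delta_def app_def)

lemma app_comp [simp]: "i \<le> Dom Delta \<phi> ==> app (\<psi> \<cdot>[Delta] \<phi>) i = app \<psi> (app \<phi> i)"
 by (cases \<phi>; cases \<psi>) (simp add: Delta_def app_def compose_def)

lemma Delta_Dom_comp: "Dom Delta (\<psi> \<cdot>[Delta] \<phi>) = Dom Delta \<phi>" "Cod Delta (\<psi> \<cdot>[Delta] \<phi>) = Cod Delta \<psi>"
 "Dom Delta (Ide Delta n) = n" "Cod Delta (Ide Delta n) = n"
 by (cases \<phi>; cases \<psi>; simp add: Delta_def)+

lemma Delta_category [simp]: "category Delta"
proof (rule categoryI)
 show comp: "\<psi> \<cdot>[Delta] \<phi> \<in> Arr Delta \<and> Dom Delta (\<psi> \<cdot>[Delta] \<phi>) = Dom Delta \<phi> \<and>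
   Cod Delta (\<psi> \<cdot>[Delta] \<phi>) = Cod Delta \<psi>"
  if "\<phi> \<in> Arr Delta" "\<psi> \<in> Arr Delta" "Dom Delta \<psi> = Cod Delta \<phi>" for \<phi> \<psi>
 proof -
  have "app (\<psi> \<cdot>[Delta] \<phi>) \<in> extensional {0..Dom Delta \<phi>}"
   by (cases \<phi>; cases \<psi>) (simp add: Delta_def app_def)
  then have "\<psi> \<cdot>[Delta] \<phi> \<in> Arr Delta"
   by (rule_tac Delta_arrI) (use that in \<open>simp_all add: Delta_Dom_comp\<close>)
  then show ?thesis by (simp add: Delta_Dom_comp)
 qed
 show ide: "Ide Delta n \<in> Arr Delta \<and> Dom Delta (Ide Delta n) = n \<and> Cod Delta (Ide Delta n) = n" for n
  by (simp add: Delta_def mono_on_def)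
 show "Ide Delta (Cod Delta \<phi>) \<cdot>[Delta] \<phi> = \<phi> \<and> \<phi> \<cdot>[Delta] Ide Delta (Dom Delta \<phi>) = \<phi>"
  if "\<phi> \<in> Arr Delta" for \<phi>
  using that comp ide by (intro conjI Delta_eqI) (simp_all add: Delta_Dom_comp)
 show "\<chi> \<cdot>[Delta] (\<psi> \<cdot>[Delta] \<phi>) = (\<chi> \<cdot>[Delta] \<psi>) \<cdot>[Delta] \<phi>"
  if "\<phi> \<in> Arr Delta" "\<psi> \<in> Arr Delta" "\<chi> \<in> Arr Delta" "Dom Delta \<psi> = Cod Delta \<phi>"
   "Dom Delta \<chi> = Cod Delta \<psi>" for \<phi> \<psi> \<chi>
  using that comp by (intro Delta_eqI) (simp_all add: Delta_Dom_comp)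
qed simp_all

text \<open>A left inverse makes \<open>f\<close> injective, so the weakly increasing
  \<open>f\<close> is strictly increasing up to \<open>m\<close> and cannot fall below the
  diagonal.\<close>

lemma mono_inj_ge:
 fixes f :: "nat => nat"
 assumes "\<And>i j. i \<le> j ==> j \<le> m ==> f i \<le> f j" "\<And>i. i \<le> m ==> g (f i) = i" "i \<le> m"
 shows "i \<le> f i"
 using assms(3)
proof (induction i)
 case (Suc i)
 have "f i \<noteq> f (Suc i)"
  using assms(2)[of i] assms(2)[of "Suc i"] Suc.prems by (metis Suc_leD n_not_Suc_n)
 then show ?case using Suc assms(1)[of i "Suc i"] by simp
qed simp

text \<open>The bound \<open>i \<le> f i\<close> holds for the map and for its inverse; at the top
  elements it equates the two ordinals, and the two bounds together force the identity.\<close>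

lemma Delta_iso_Ide:
 assumes "iso Delta \<phi>"
 shows "\<phi> = Ide Delta (Dom Delta \<phi>)"
proof -
 define \<psi> where "\<psi> = inv_arr Delta \<phi>"
 have [simp]: "\<phi> \<in> Arr Delta" "\<psi> \<in> Arr Delta" "Dom Delta \<psi> = Cod Delta \<phi>" "Cod Delta \<psi> = Dom Delta \<phi>"
  using assms by (simp_all add: \<psi>_def)
 have 1: "app \<psi> (app \<phi> i) = i" if "i \<le> Dom Delta \<phi>" for i
  using assms that by (simp add: \<psi>_def flip: app_comp)
 have 2: "app \<phi> (app \<psi> i) = i" if "i \<le> Cod Delta \<phi>" for i
  using assms that by (simp add: \<psi>_def flip: app_comp)
 have a: "i \<le> app \<phi> i" if "i \<le> Dom Delta \<phi>" for i
  by (rule mono_inj_ge[of "Dom Delta \<phi>" "app \<phi>" "app \<psi>"]) (use 1 that in auto)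
 have b: "i \<le> app \<psi> i" if "i \<le> Cod Delta \<phi>" for i
  by (rule mono_inj_ge[of "Cod Delta \<phi>" "app \<psi>" "app \<phi>"]) (use 2 that in auto)
 have "Dom Delta \<phi> \<le> Cod Delta \<phi>" "Cod Delta \<phi> \<le> Dom Delta \<phi>"
  using le_trans[OF a[of "Dom Delta \<phi>"] app_le[of \<phi> "Dom Delta \<phi>"]]
   le_trans[OF b[of "Cod Delta \<phi>"] app_le[of \<psi> "Cod Delta \<phi>"]] by simp_all
 then have "Cod Delta \<phi> = Dom Delta \<phi>" by simp
 moreover have "app \<phi> i = i" if "i \<le> Dom Delta \<phi>" for i
  using a[OF that] b[of "app \<phi> i"] 1[OF that] app_le[of \<phi> i] that by simp
 ultimately show ?thesis by (intro Delta_eqI) simp_all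
qed

text \<open>The map \<open>[length xs - 1] \<rightarrow> [n]\<close> with list of values \<open>xs\<close>.\<close>

definition dl :: "nat => nat list => delta_arr" where
 "dl n xs = (length xs - 1, \<lambda>i\<in>{0..length xs - 1}. xs ! i, n)"

lemma dl_simps [simp]:
 "Dom Delta (dl n xs) = length xs - 1" "Cod Delta (dl n xs) = n" "i < length xs ==> app (dl n xs) i = xs ! i"
 by (auto simp: dl_def Delta_def app_def)

lemma dl_arr [simp]: "xs \<noteq> [] ==> sorted xs ==> \<forall>x\<in>set xs. x \<le> n ==> dl n xs \<in> Arr Delta"
proof (rule Delta_arrI)
 assume xs: "xs \<noteq> []" "sorted xs" "\<forall>x\<in>set xs. x \<le> n"
 then have less: "i \<le> length xs - 1 ==> i < length xs" for i by (cases xs) auto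
 show "app (dl n xs) \<in> extensional {0..Dom Delta (dl n xs)}" by (simp add: dl_def app_def Delta_def)
 show "app (dl n xs) i \<le> Cod Delta (dl n xs)" if "i \<le> Dom Delta (dl n xs)" for i
  using xs that less[of i] by simp
 show "app (dl n xs) i \<le> app (dl n xs) j" if "i \<le> j" "j \<le> Dom Delta (dl n xs)" for i j
  using xs that less[of i] less[of j] by (simp add: sorted_nth_mono)
qed

lemma dl_comp [simp]:
 assumes "\<phi> \<in> Arr Delta" "Dom Delta \<phi> = n" "xs \<noteq> []" "sorted xs" "\<forall>x\<in>set xs. x \<le> n"
 shows "\<phi> \<cdot>[Delta] dl n xs = dl (Cod Delta \<phi>) (map (app \<phi>) xs)"
proof -
 have s: "sorted (map (app \<phi>) xs)"
  unfolding sorted_map using assms by (intro sorted_wrt_mono_rel[OF _ assms(4)]) auto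
 show ?thesis
  by (rule Delta_eqI) (use assms s in \<open>auto simp: Suc_leI less_Suc_eq_le nth_mem dest: le_less_trans\<close>)
qed

lemma dl_Ide: "dl n [0..<Suc n] = Ide Delta n"
 by (rule Delta_eqI) (auto simp del: upt_Suc)

lemma init_seg_dl: "init_seg k n = dl n [0..<Suc k]"
 by (auto simp: init_seg_def dl_def fun_eq_iff simp del: upt_Suc)

lemma term_seg_dl: "k \<le> n ==> term_seg k n = dl n [n - k..<Suc n]"
 by (auto simp: term_seg_def dl_def fun_eq_iff simp del: upt_Suc)

section \<open>Strict 2-categories\<close>

lemma prod_cat_simps [simp]:
 "Obj (prod_cat A B) = Obj A \<times> Obj B" "Arr (prod_cat A B) = Arr A \<times> Arr B"
 "Dom (prod_cat A B) (f, g) = (Dom A f, Dom B g)" "Cod (prod_cat A B) (f, g) = (Cod A f, Cod B g)"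
 "Ide (prod_cat A B) (x, y) = (Ide A x, Ide B y)"
 "(f', g') \<cdot>[prod_cat A B] (f, g) = (f' \<cdot>[A] f, g' \<cdot>[B] g)"
 by (simp_all add: prod_cat_def)

lemma prod_cat_category [simp]:
 assumes [simp]: "category A" "category B"
 shows "category (prod_cat A B)"
 by (rule categoryI) auto

lemma prod_fct_simps [simp]:
 "x \<in> Obj A ==> y \<in> Obj B ==> FObj (prod_fct A B F G) (x, y) = (FObj F x, FObj G y)"
 "f \<in> Arr A ==> g \<in> Arr B ==> FArr (prod_fct A B F G) (f, g) = (FArr F f, FArr G g)"
 by (auto simp: prod_fct_def)

lemma prod_fct_functor [simp]:
 assumes F: "cat_functor A A' F" and G: "cat_functor B B' G"
 shows "cat_functor (prod_cat A B) (prod_cat A' B') (prod_fct A B F G)"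
proof -
 note [simp] = cat_functor_cat[OF F] cat_functor_cat[OF G] cat_functor_simps[OF F] cat_functor_simps[OF G]
 show ?thesis by (rule cat_functorI) (auto simp: prod_fct_def)
qed

context strict_2_category begin

lemmas [simp] = hom_category ide2_obj unit_left1 unit_right1 unit_left2 unit_right2

lemma hcomp_simps [simp]:
 assumes "x \<in> Obj2 K" "y \<in> Obj2 K" "z \<in> Obj2 K"
 shows "g \<in> Obj (Hom2 K y z) ==> f \<in> Obj (Hom2 K x y) ==> hcomp1 K x y z g f \<in> Obj (Hom2 K x z)"
  and "b \<in> Arr (Hom2 K y z) ==> a \<in> Arr (Hom2 K x y) ==> hcomp2 K x y z b a \<in> Arr (Hom2 K x z)"
  and "b \<in> Arr (Hom2 K y z) ==> a \<in> Arr (Hom2 K x y) ==> Dom (Hom2 K x z) (hcomp2 K x y z b a) =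
   hcomp1 K x y z (Dom (Hom2 K y z) b) (Dom (Hom2 K x y) a)"
  and "b \<in> Arr (Hom2 K y z) ==> a \<in> Arr (Hom2 K x y) ==> Cod (Hom2 K x z) (hcomp2 K x y z b a) =
   hcomp1 K x y z (Cod (Hom2 K y z) b) (Cod (Hom2 K x y) a)"
  and "g \<in> Obj (Hom2 K y z) ==> f \<in> Obj (Hom2 K x y) ==>
   hcomp2 K x y z (Ide (Hom2 K y z) g) (Ide (Hom2 K x y) f) = Ide (Hom2 K x z) (hcomp1 K x y z g f)"
 using cat_functor_simps[OF comp2_functor[OF assms]]
  cat_functor_simps(5)[OF comp2_functor[OF assms], of "(g, f)"] by auto

lemma interchange:
 assumes "x \<in> Obj2 K" "y \<in> Obj2 K" "z \<in> Obj2 K" "b \<in> Arr (Hom2 K y z)" "a \<in> Arr (Hom2 K x y)"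
  "b' \<in> Arr (Hom2 K y z)" "a' \<in> Arr (Hom2 K x y)" "Dom (Hom2 K y z) b' = Cod (Hom2 K y z) b"
  "Dom (Hom2 K x y) a' = Cod (Hom2 K x y) a"
 shows "hcomp2 K x y z b' a' \<cdot>[Hom2 K x z] hcomp2 K x y z b a =
  hcomp2 K x y z (b' \<cdot>[Hom2 K y z] b) (a' \<cdot>[Hom2 K x y] a)"
 using cat_functor_simps(6)[OF comp2_functor[OF assms(1-3)], of "(b, a)" "(b', a')"] assms by simp

text \<open>Composites are nested to the right, so two horizontal composites usually meet in front
  of a third factor; interchange is needed in this shape.\<close>

lemma interchange_assoc:
 assumes "x \<in> Obj2 K" "y \<in> Obj2 K" "z \<in> Obj2 K" "b \<in> Arr (Hom2 K y z)" "a \<in> Arr (Hom2 K x y)"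
  "b' \<in> Arr (Hom2 K y z)" "a' \<in> Arr (Hom2 K x y)" "Dom (Hom2 K y z) b' = Cod (Hom2 K y z) b"
  "Dom (Hom2 K x y) a' = Cod (Hom2 K x y) a" "c \<in> Arr (Hom2 K x z)"
  "Cod (Hom2 K x z) c = hcomp1 K x y z (Dom (Hom2 K y z) b) (Dom (Hom2 K x y) a)"
 shows "hcomp2 K x y z b' a' \<cdot>[Hom2 K x z] (hcomp2 K x y z b a \<cdot>[Hom2 K x z] c) =
  hcomp2 K x y z (b' \<cdot>[Hom2 K y z] b) (a' \<cdot>[Hom2 K x y] a) \<cdot>[Hom2 K x z] c"
 using assms by (simp add: interchange flip: category_simps(11))

lemma hcomp_iso [simp]:
 assumes "x \<in> Obj2 K" "y \<in> Obj2 K" "z \<in> Obj2 K" "iso (Hom2 K y z) b" "iso (Hom2 K x y) a"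
 shows "iso (Hom2 K x z) (hcomp2 K x y z b a)"
 by (rule isoI[of _ _ "hcomp2 K x y z (inv_arr (Hom2 K y z) b) (inv_arr (Hom2 K x y) a)"])
  (use assms in \<open>simp_all add: interchange\<close>)

end

section \<open>Simplices of a strict 2-category\<close>

lemma discrete_cat_simps [simp]:
 "Obj (discrete_cat S) = S" "Arr (discrete_cat S) = S" "Dom (discrete_cat S) f = f"
 "Cod (discrete_cat S) f = f" "Ide (discrete_cat S) f = f" "g \<cdot>[discrete_cat S] f = f"
 by (simp_all add: discrete_cat_def)

lemma discrete_cat_category [simp]: "category (discrete_cat S)"
 by (rule categoryI) auto

lemma cat_as_two_cat_simps [simp]:
 "Obj2 (cat_as_two_cat A) = Obj A" "Hom2 (cat_as_two_cat A) x y = discrete_cat (hom A x y)"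
 "Ide2 (cat_as_two_cat A) = Ide A"
 "g \<in> hom A y z ==> f \<in> hom A x y ==> hcomp1 (cat_as_two_cat A) x y z g f = g \<cdot>[A] f"
 "g \<in> hom A y z ==> f \<in> hom A x y ==> hcomp2 (cat_as_two_cat A) x y z g f = g \<cdot>[A] f"
 by (simp_all add: cat_as_two_cat_def)

lemma cat_as_two_cat_strict [simp]:
 assumes [simp]: "category A"
 shows "strict_2_category (cat_as_two_cat A)"
proof (rule strict_2_category.intro)
 fix x y z assume "x \<in> Obj2 (cat_as_two_cat A)" "y \<in> Obj2 (cat_as_two_cat A)" "z \<in> Obj2 (cat_as_two_cat A)"
 then show "cat_functor (prod_cat (Hom2 (cat_as_two_cat A) y z) (Hom2 (cat_as_two_cat A) x y))
   (Hom2 (cat_as_two_cat A) x z) (Comp2 (cat_as_two_cat A) x y z)"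
  by (intro cat_functorI) (auto simp: cat_as_two_cat_def)
qed auto

lemma ordinal_simps [simp]:
 "Obj (ordinal n) = {0..n}" "Ide (ordinal n) i = (i, i)" "(j', k) \<cdot>[ordinal n] (i, j) = (i, k)"
 "hom (ordinal n) i j = (if i \<le> j \<and> j \<le> n then {(i, j)} else {})"
 by (auto simp: ordinal_def hom_def)

lemma ordinal_category [simp]: "category (ordinal n)"
 by (rule categoryI) (auto simp: ordinal_def)

abbreviation "ord2 n \<equiv> cat_as_two_cat (ordinal n)"

text \<open>A simplex \<open>\<sigma>\<close> of \<open>K\<close> is determined by its vertices, its 1-cells \<open>sM \<sigma> i j\<close> and its unit and composition
 isomorphisms; \<open>mkS\<close> assembles a simplex from such data.\<close>

definition sM :: "('o, 'm, 't) simplex => nat => nat => 'm" where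
 "sM \<sigma> i j = FObj (PHom \<sigma> (i, j)) (i, j)"

definition sC :: "('o, 'm, 't) simplex => nat => nat => nat => 't" where
 "sC \<sigma> i j k = PComp \<sigma> (i, j, k) ((j, k), (i, j))"

definition mkS :: "('o, 'm, 't) two_cat => nat => (nat => 'o) => (nat => nat => 'm) => (nat => 't) =>
  (nat => nat => nat => 't) => ('o, 'm, 't) simplex" where
 "mkS K n V M U P =
   \<lparr>PObj = \<lambda>i\<in>{0..n}. V i,
   PHom = \<lambda>(i, j)\<in>{0..n} \<times> {0..n}.
    \<lparr>FObj = \<lambda>f\<in>hom (ordinal n) i j. M i j,
     FArr = \<lambda>f\<in>hom (ordinal n) i j. Ide (Hom2 K (V i) (V j)) (M i j)\<rparr>,
   PUnit = \<lambda>i\<in>{0..n}. U i,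
   PComp = \<lambda>(i, j, k)\<in>{0..n} \<times> {0..n} \<times> {0..n}.
    \<lambda>(g, f)\<in>hom (ordinal n) j k \<times> hom (ordinal n) i j. P i j k\<rparr>"

lemma mkS_simps [simp]:
 "i \<le> n ==> PObj (mkS K n V M U P) i = V i"
 "i \<le> n ==> PUnit (mkS K n V M U P) i = U i"
 "i \<le> j ==> j \<le> n ==> sM (mkS K n V M U P) i j = M i j"
 "i \<le> j ==> j \<le> k ==> k \<le> n ==> sC (mkS K n V M U P) i j k = P i j k"
 by (auto simp: mkS_def sM_def sC_def)

lemma mkS_cong:
 assumes "\<And>i. i \<le> n ==> V i = V' i" "\<And>i j. i \<le> j ==> j \<le> n ==> M i j = M' i j"
  "\<And>i. i \<le> n ==> U i = U' i" "\<And>i j k. i \<le> j ==> j \<le> k ==> k \<le> n ==> P i j k = P' i j k"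
 shows "mkS K n V M U P = mkS K n V' M' U' P'"
 unfolding mkS_def by (auto simp: assms fun_eq_iff restrict_def)

text \<open>A pair \<open>i \<le> j\<close> carries exactly one arrow of the ordinal, so a 2-functor
  out of \<open>[n]\<close> reduces to this indexed data; naturality is automatic because the
  categories of morphisms of the ordinal are discrete.\<close>

locale simplex_data = strict_2_category K for K :: "('o, 'm, 't) two_cat" +
 fixes n :: nat and V :: "nat => 'o" and M :: "nat => nat => 'm" and U :: "nat => 't"
  and P :: "nat => nat => nat => 't"
 assumes V_obj [simp]: "i \<le> n ==> V i \<in> Obj2 K"
  and M_obj [simp]: "i \<le> j ==> j \<le> n ==> M i j \<in> Obj (Hom2 K (V i) (V j))"
  and U_iso [simp]: "i \<le> n ==> iso (Hom2 K (V i) (V i)) (U i)"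
  and U_dom [simp]: "i \<le> n ==> Dom (Hom2 K (V i) (V i)) (U i) = Ide2 K (V i)"
  and U_cod [simp]: "i \<le> n ==> Cod (Hom2 K (V i) (V i)) (U i) = M i i"
  and P_iso [simp]: "i \<le> j ==> j \<le> k ==> k \<le> n ==> iso (Hom2 K (V i) (V k)) (P i j k)"
  and P_dom [simp]: "i \<le> j ==> j \<le> k ==> k \<le> n ==>
   Dom (Hom2 K (V i) (V k)) (P i j k) = hcomp1 K (V i) (V j) (V k) (M j k) (M i j)"
  and P_cod [simp]: "i \<le> j ==> j \<le> k ==> k \<le> n ==> Cod (Hom2 K (V i) (V k)) (P i j k) = M i k"
  and P_left: "i \<le> j ==> j \<le> n ==> P i j j \<cdot>[Hom2 K (V i) (V j)]
   hcomp2 K (V i) (V j) (V j) (U j) (Ide (Hom2 K (V i) (V j)) (M i j)) = Ide (Hom2 K (V i) (V j)) (M i j)"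
  and P_right: "i \<le> j ==> j \<le> n ==> P i i j \<cdot>[Hom2 K (V i) (V j)]
   hcomp2 K (V i) (V i) (V j) (Ide (Hom2 K (V i) (V j)) (M i j)) (U i) = Ide (Hom2 K (V i) (V j)) (M i j)"
  and P_assoc: "i \<le> j ==> j \<le> k ==> k \<le> l ==> l \<le> n ==>
   P i j l \<cdot>[Hom2 K (V i) (V l)]
    hcomp2 K (V i) (V j) (V l) (P j k l) (Ide (Hom2 K (V i) (V j)) (M i j)) =
   P i k l \<cdot>[Hom2 K (V i) (V l)]
    hcomp2 K (V i) (V k) (V l) (Ide (Hom2 K (V k) (V l)) (M k l)) (P i j k)"

lemma (in simplex_data) mkS_two_functor: "two_functor (ord2 n) K (mkS K n V M U P)"
proof -
 let ?\<sigma> = "mkS K n V M U P"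
 have F: "PHom ?\<sigma> (i, j) = \<lparr>FObj = \<lambda>f\<in>hom (ordinal n) i j. M i j,
   FArr = \<lambda>f\<in>hom (ordinal n) i j. Ide (Hom2 K (V i) (V j)) (M i j)\<rparr>" if "i \<le> n" "j \<le> n" for i j
  using that by (auto simp: mkS_def)
 have O: "PObj ?\<sigma> i = V i" "PUnit ?\<sigma> i = U i" if "i \<le> n" for i using that by simp_all
 have C: "PComp ?\<sigma> (i, j, k) = (\<lambda>(g, f)\<in>hom (ordinal n) j k \<times> hom (ordinal n) i j. P i j k)"
  if "i \<le> n" "j \<le> n" "k \<le> n" for i j k using that by (auto simp: mkS_def)
 have fct: "cat_functor (Hom2 (ord2 n) i j) (Hom2 K (V i) (V j)) (PHom ?\<sigma> (i, j))" if "i \<le> n" "j \<le> n" for i j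
  unfolding F[OF that] by (rule cat_functorI) (use that in \<open>auto split: if_splits\<close>)
 show ?thesis
 proof (intro two_functor.intro two_functor_axioms.intro)
  show "strict_2_category K" by unfold_locales
  fix x y z assume xyz: "x \<in> Obj2 (ord2 n)" "y \<in> Obj2 (ord2 n)" "z \<in> Obj2 (ord2 n)"
  have "cat_functor (prod_cat (Hom2 (ord2 n) y z) (Hom2 (ord2 n) x y)) (Hom2 K (V x) (V z))
    (comp_fct (prod_cat (Hom2 (ord2 n) y z) (Hom2 (ord2 n) x y)) (Comp2 K (V x) (V y) (V z))
     (prod_fct (Hom2 (ord2 n) y z) (Hom2 (ord2 n) x y) (PHom ?\<sigma> (y, z)) (PHom ?\<sigma> (x, y))))"
   using xyz by (intro comp_fct_functor[OF prod_fct_functor[OF fct fct]] comp2_functor) auto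
  moreover have "cat_functor (prod_cat (Hom2 (ord2 n) y z) (Hom2 (ord2 n) x y)) (Hom2 K (V x) (V z))
    (comp_fct (prod_cat (Hom2 (ord2 n) y z) (Hom2 (ord2 n) x y)) (PHom ?\<sigma> (x, z)) (Comp2 (ord2 n) x y z))"
   using xyz by (intro comp_fct_functor[OF strict_2_category.comp2_functor fct]) auto
  ultimately show "nat_iso (prod_cat (Hom2 (ord2 n) y z) (Hom2 (ord2 n) x y)) (PHomCat K ?\<sigma> x z)
    (comp_fct (prod_cat (Hom2 (ord2 n) y z) (Hom2 (ord2 n) x y))
     (Comp2 K (PObj ?\<sigma> x) (PObj ?\<sigma> y) (PObj ?\<sigma> z))
     (prod_fct (Hom2 (ord2 n) y z) (Hom2 (ord2 n) x y) (PHom ?\<sigma> (y, z)) (PHom ?\<sigma> (x, y))))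
    (comp_fct (prod_cat (Hom2 (ord2 n) y z) (Hom2 (ord2 n) x y)) (PHom ?\<sigma> (x, z)) (Comp2 (ord2 n) x y z))
    (PComp ?\<sigma> (x, y, z))"
   using xyz by (intro nat_isoI) (auto simp: C F O split: if_splits simp del: mkS_simps)
 next
  fix x y assume "x \<in> Obj2 (ord2 n)" "y \<in> Obj2 (ord2 n)"
  then show "cat_functor (Hom2 (ord2 n) x y) (PHomCat K ?\<sigma> x y) (PHom ?\<sigma> (x, y))"
   using fct[of x y] by simp
 next
  fix x y f assume "x \<in> Obj2 (ord2 n)" "y \<in> Obj2 (ord2 n)" "f \<in> Obj (Hom2 (ord2 n) x y)"
  then show "PComp ?\<sigma> (x, y, y) (Ide2 (ord2 n) y, f) \<cdot>[PHomCat K ?\<sigma> x y]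
    hcomp2 K (PObj ?\<sigma> x) (PObj ?\<sigma> y) (PObj ?\<sigma> y)
     (PUnit ?\<sigma> y) (Ide (PHomCat K ?\<sigma> x y) (PMap1 ?\<sigma> x y f))
   = Ide (PHomCat K ?\<sigma> x y) (PMap1 ?\<sigma> x y f)"
   by (auto simp: F C O P_left split: if_splits simp del: mkS_simps)
 next
  fix x y f assume "x \<in> Obj2 (ord2 n)" "y \<in> Obj2 (ord2 n)" "f \<in> Obj (Hom2 (ord2 n) x y)"
  then show "PComp ?\<sigma> (x, x, y) (f, Ide2 (ord2 n) x) \<cdot>[PHomCat K ?\<sigma> x y]
    hcomp2 K (PObj ?\<sigma> x) (PObj ?\<sigma> x) (PObj ?\<sigma> y)
     (Ide (PHomCat K ?\<sigma> x y) (PMap1 ?\<sigma> x y f)) (PUnit ?\<sigma> x)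
   = Ide (PHomCat K ?\<sigma> x y) (PMap1 ?\<sigma> x y f)"
   by (auto simp: F C O P_right split: if_splits simp del: mkS_simps)
 next
  fix w x y z f g h
  assume "w \<in> Obj2 (ord2 n)" "x \<in> Obj2 (ord2 n)" "y \<in> Obj2 (ord2 n)" "z \<in> Obj2 (ord2 n)"
   "f \<in> Obj (Hom2 (ord2 n) w x)" "g \<in> Obj (Hom2 (ord2 n) x y)" "h \<in> Obj (Hom2 (ord2 n) y z)"
  then show "PComp ?\<sigma> (w, x, z) (hcomp1 (ord2 n) x y z h g, f) \<cdot>[PHomCat K ?\<sigma> w z]
    hcomp2 K (PObj ?\<sigma> w) (PObj ?\<sigma> x) (PObj ?\<sigma> z)
     (PComp ?\<sigma> (x, y, z) (h, g)) (Ide (PHomCat K ?\<sigma> w x) (PMap1 ?\<sigma> w x f))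
   = PComp ?\<sigma> (w, y, z) (h, hcomp1 (ord2 n) w x y g f) \<cdot>[PHomCat K ?\<sigma> w z]
    hcomp2 K (PObj ?\<sigma> w) (PObj ?\<sigma> y) (PObj ?\<sigma> z)
     (Ide (PHomCat K ?\<sigma> y z) (PMap1 ?\<sigma> y z h)) (PComp ?\<sigma> (w, x, y) (g, f))"
   by (auto simp: F C O P_assoc split: if_splits simp del: mkS_simps)
 qed (auto simp: O F fct simp del: mkS_simps split: if_splits, auto simp: mkS_def)
qed

abbreviation is_simplex :: "('o, 'm, 't) two_cat => nat => ('o, 'm, 't) simplex => bool" where
 "is_simplex K n \<sigma> \<equiv> two_functor (ord2 n) K \<sigma>"

lemma two_functor_PComp:
 assumes "two_functor K L \<gamma>" "x \<in> Obj2 K" "y \<in> Obj2 K" "z \<in> Obj2 K"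
  "g \<in> Obj (Hom2 K y z)" "f \<in> Obj (Hom2 K x y)"
 shows "iso (PHomCat L \<gamma> x z) (PComp \<gamma> (x, y, z) (g, f))"
  "Dom (PHomCat L \<gamma> x z) (PComp \<gamma> (x, y, z) (g, f)) =
   hcomp1 L (PObj \<gamma> x) (PObj \<gamma> y) (PObj \<gamma> z) (PMap1 \<gamma> y z g) (PMap1 \<gamma> x y f)"
  "Cod (PHomCat L \<gamma> x z) (PComp \<gamma> (x, y, z) (g, f)) = PMap1 \<gamma> x z (hcomp1 K x y z g f)"
proof -
 interpret two_functor K L \<gamma> by fact
 note n = nat_isoD[OF pcomp_nat_iso[OF assms(2-4)]]
 show "iso (PHomCat L \<gamma> x z) (PComp \<gamma> (x, y, z) (g, f))"
  "Dom (PHomCat L \<gamma> x z) (PComp \<gamma> (x, y, z) (g, f)) =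
   hcomp1 L (PObj \<gamma> x) (PObj \<gamma> y) (PObj \<gamma> z) (PMap1 \<gamma> y z g) (PMap1 \<gamma> x y f)"
  "Cod (PHomCat L \<gamma> x z) (PComp \<gamma> (x, y, z) (g, f)) = PMap1 \<gamma> x z (hcomp1 K x y z g f)"
  using n(4-6)[of "(g, f)"] assms by auto
qed

lemma two_functor_PComp_natural:
 assumes "two_functor K L \<gamma>" "x \<in> Obj2 K" "y \<in> Obj2 K" "z \<in> Obj2 K"
  "b \<in> Arr (Hom2 K y z)" "a \<in> Arr (Hom2 K x y)"
 shows "PComp \<gamma> (x, y, z) (Cod (Hom2 K y z) b, Cod (Hom2 K x y) a) \<cdot>[PHomCat L \<gamma> x z]
   hcomp2 L (PObj \<gamma> x) (PObj \<gamma> y) (PObj \<gamma> z) (PMap2 \<gamma> y z b) (PMap2 \<gamma> x y a) =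
  PMap2 \<gamma> x z (hcomp2 K x y z b a) \<cdot>[PHomCat L \<gamma> x z]
   PComp \<gamma> (x, y, z) (Dom (Hom2 K y z) b, Dom (Hom2 K x y) a)"
proof -
 interpret two_functor K L \<gamma> by fact
 show ?thesis using nat_isoD(7)[OF pcomp_nat_iso[OF assms(2-4)], of "(b, a)"] assms by auto
qed

lemma simplex_data_simplex:
 assumes "is_simplex K n \<sigma>"
 shows "simplex_data K n (PObj \<sigma>) (sM \<sigma>) (PUnit \<sigma>) (sC \<sigma>)"
proof -
 interpret two_functor "ord2 n" K \<sigma> by fact
 have O: "PObj \<sigma> i \<in> Obj2 K" if "i \<le> n" for i using that pobj_map by auto
 note f = phom_functor[simplified]
 note u = two_functor_PComp[OF assms, simplified]
 show ?thesis
 proof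
  fix i j assume "i \<le> j" "j \<le> n"
  then show "sM \<sigma> i j \<in> Obj (PHomCat K \<sigma> i j)"
   using cat_functor_simps(1)[OF f[of i j], of "(i, j)"] by (simp add: sM_def)
  show "sC \<sigma> i j j \<cdot>[PHomCat K \<sigma> i j] hcomp2 K (PObj \<sigma> i) (PObj \<sigma> j) (PObj \<sigma> j)
    (PUnit \<sigma> j) (Ide (PHomCat K \<sigma> i j) (sM \<sigma> i j)) = Ide (PHomCat K \<sigma> i j) (sM \<sigma> i j)"
   "sC \<sigma> i i j \<cdot>[PHomCat K \<sigma> i j] hcomp2 K (PObj \<sigma> i) (PObj \<sigma> i) (PObj \<sigma> j)
    (Ide (PHomCat K \<sigma> i j) (sM \<sigma> i j)) (PUnit \<sigma> i) = Ide (PHomCat K \<sigma> i j) (sM \<sigma> i j)"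
   using pcoh_left[of i j "(i, j)"] pcoh_right[of i j "(i, j)"] \<open>i \<le> j\<close> \<open>j \<le> n\<close>
   by (simp_all add: sC_def sM_def)
 next
  fix i assume i: "i \<le> n"
  show "iso (PHomCat K \<sigma> i i) (PUnit \<sigma> i)"
   "Dom (PHomCat K \<sigma> i i) (PUnit \<sigma> i) = Ide2 K (PObj \<sigma> i)"
   "Cod (PHomCat K \<sigma> i i) (PUnit \<sigma> i) = sM \<sigma> i i"
   using punit_iso[of i] punit_hom[of i] i by (simp_all add: sM_def)
 next
  fix i j k assume "i \<le> j" "j \<le> k" "k \<le> n"
  then show "iso (PHomCat K \<sigma> i k) (sC \<sigma> i j k)"
   "Dom (PHomCat K \<sigma> i k) (sC \<sigma> i j k) =
    hcomp1 K (PObj \<sigma> i) (PObj \<sigma> j) (PObj \<sigma> k) (sM \<sigma> j k) (sM \<sigma> i j)"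
   "Cod (PHomCat K \<sigma> i k) (sC \<sigma> i j k) = sM \<sigma> i k"
   using u[of i j k "(j, k)" "(i, j)"] by (simp_all add: sC_def sM_def)
 next
  fix i j k l assume "i \<le> j" "j \<le> k" "k \<le> l" "l \<le> n"
  then show "sC \<sigma> i j l \<cdot>[PHomCat K \<sigma> i l]
    hcomp2 K (PObj \<sigma> i) (PObj \<sigma> j) (PObj \<sigma> l) (sC \<sigma> j k l) (Ide (PHomCat K \<sigma> i j) (sM \<sigma> i j)) =
   sC \<sigma> i k l \<cdot>[PHomCat K \<sigma> i l]
    hcomp2 K (PObj \<sigma> i) (PObj \<sigma> k) (PObj \<sigma> l) (Ide (PHomCat K \<sigma> k l) (sM \<sigma> k l)) (sC \<sigma> i j k)"
   using pcoh_assoc[of i j k l "(i, j)" "(j, k)" "(k, l)"] by (simp add: sC_def sM_def)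
 qed (use O in auto)
qed

lemma simplex_PArr:
 assumes "is_simplex K n \<sigma>" "i \<le> j" "j \<le> n"
 shows "FArr (PHom \<sigma> (i, j)) (i, j) = Ide (PHomCat K \<sigma> i j) (sM \<sigma> i j)"
proof -
 interpret two_functor "ord2 n" K \<sigma> by fact
 show ?thesis
  using cat_functor_simps(5)[OF phom_functor[of i j], of "(i, j)"] assms by (simp add: sM_def)
qed

text \<open>The functors \<open>PHom\<close> send 2-cells to identities by
  \<open>simplex_PArr\<close>, and extensionality fixes every value off the carriers, so nothing is
  lost in passing to the indexed data. Equality of simplices becomes a pointwise question.\<close>

lemma simplex_mkS:
 assumes "is_simplex K n \<sigma>"
 shows "mkS K n (PObj \<sigma>) (sM \<sigma>) (PUnit \<sigma>) (sC \<sigma>) = \<sigma>"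
proof -
 interpret two_functor "ord2 n" K \<sigma> by fact
 let ?\<tau> = "mkS K n (PObj \<sigma>) (sM \<sigma>) (PUnit \<sigma>) (sC \<sigma>)"
 have "PObj ?\<tau> = PObj \<sigma>"
  using pobj_map by (auto simp: mkS_def PiE_def extensional_def restrict_def fun_eq_iff)
 moreover have "PUnit ?\<tau> = PUnit \<sigma>"
  using punit_ext by (auto simp: mkS_def extensional_def restrict_def fun_eq_iff)
 moreover have "PHom ?\<tau> = PHom \<sigma>"
 proof
  fix p :: "nat \<times> nat"
  obtain i j where p: "p = (i, j)" by (cases p)
  show "PHom ?\<tau> p = PHom \<sigma> p"
  proof (cases "i \<le> n \<and> j \<le> n")
   case True
   then have f: "cat_functor (discrete_cat (hom (ordinal n) i j)) (PHomCat K \<sigma> i j) (PHom \<sigma> (i, j))"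
    using phom_functor[of i j] by simp
   have "FObj (PHom ?\<tau> p) = FObj (PHom \<sigma> p)"
    using True cat_functor_ext(1)[OF f] by (auto simp: p mkS_def fun_eq_iff restrict_def sM_def)
   moreover have "FArr (PHom ?\<tau> p) = FArr (PHom \<sigma> p)"
    using True cat_functor_ext(2)[OF f] simplex_PArr[OF assms, of i j]
    by (auto simp: p mkS_def fun_eq_iff restrict_def)
   ultimately show ?thesis by simp
  next
   case False
   then show ?thesis using phom_ext by (auto simp: p mkS_def extensional_def)
  qed
 qed
 moreover have "PComp ?\<tau> = PComp \<sigma>"
 proof
  fix p :: "nat \<times> nat \<times> nat"
  obtain i j k where p: "p = (i, j, k)" by (cases p)
  show "PComp ?\<tau> p = PComp \<sigma> p"
  proof (cases "i \<le> n \<and> j \<le> n \<and> k \<le> n")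
   case True
   have "PComp \<sigma> (i, j, k) \<in> extensional (hom (ordinal n) j k \<times> hom (ordinal n) i j)"
    using nat_isoD(3)[OF pcomp_nat_iso[of i j k]] True by simp
   then show ?thesis
    using True by (auto simp: p mkS_def fun_eq_iff restrict_def sC_def extensional_def split: if_splits)
  next
   case False
   then show ?thesis using pcomp_ext by (auto simp: p mkS_def extensional_def)
  qed
 qed
 ultimately show ?thesis by simp
qed

lemma simplex_eqI:
 assumes "is_simplex K n \<sigma>" "is_simplex K n \<tau>" "\<And>i. i \<le> n ==> PObj \<sigma> i = PObj \<tau> i"
  "\<And>i j. i \<le> j ==> j \<le> n ==> sM \<sigma> i j = sM \<tau> i j"
  "\<And>i. i \<le> n ==> PUnit \<sigma> i = PUnit \<tau> i"
  "\<And>i j k. i \<le> j ==> j \<le> k ==> k \<le> n ==> sC \<sigma> i j k = sC \<tau> i j k"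
 shows "\<sigma> = \<tau>"
 using mkS_cong[of n "PObj \<sigma>" "PObj \<tau>" "sM \<sigma>" "sM \<tau>" "PUnit \<sigma>" "PUnit \<tau>" "sC \<sigma>" "sC \<tau>" K]
  simplex_mkS[OF assms(1)] simplex_mkS[OF assms(2)] assms(3-) by metis

section \<open>Morphisms of simplices\<close>

text \<open>Only one family of vertices occurs: a 2-morphism between simplices requires equal object
  maps, so all cells live in the same categories of morphisms.\<close>

definition smor :: "('o, 'm, 't) two_cat => nat => (nat => 'o) => (nat => nat => 'm) => (nat => 't) =>
  (nat => nat => nat => 't) => (nat => nat => 'm) => (nat => 't) =>
  (nat => nat => nat => 't) => (nat => nat => 't) => bool" where
 "smor K n V M U P M' U' P' a \<longleftrightarrow>
   (\<forall>i j. i \<le> j \<longrightarrow> j \<le> n \<longrightarrow> a i j \<in> hom (Hom2 K (V i) (V j)) (M i j) (M' i j)) \<and>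
   (\<forall>i j k. i \<le> j \<longrightarrow> j \<le> k \<longrightarrow> k \<le> n \<longrightarrow>
    a i k \<cdot>[Hom2 K (V i) (V k)] P i j k =
    P' i j k \<cdot>[Hom2 K (V i) (V k)] hcomp2 K (V i) (V j) (V k) (a j k) (a i j)) \<and>
   (\<forall>i. i \<le> n \<longrightarrow> a i i \<cdot>[Hom2 K (V i) (V i)] U i = U' i)"

lemma smorD:
 assumes "smor K n V M U P M' U' P' a"
 shows "i \<le> j ==> j \<le> n ==> a i j \<in> Arr (Hom2 K (V i) (V j))"
  "i \<le> j ==> j \<le> n ==> Dom (Hom2 K (V i) (V j)) (a i j) = M i j"
  "i \<le> j ==> j \<le> n ==> Cod (Hom2 K (V i) (V j)) (a i j) = M' i j"
  "i \<le> j ==> j \<le> k ==> k \<le> n ==> a i k \<cdot>[Hom2 K (V i) (V k)] P i j k =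
    P' i j k \<cdot>[Hom2 K (V i) (V k)] hcomp2 K (V i) (V j) (V k) (a j k) (a i j)"
  "i \<le> n ==> a i i \<cdot>[Hom2 K (V i) (V i)] U i = U' i"
 using assms by (simp_all add: smor_def)

lemma smorI:
 assumes "\<And>i j. i \<le> j ==> j \<le> n ==> a i j \<in> hom (Hom2 K (V i) (V j)) (M i j) (M' i j)"
  "\<And>i j k. i \<le> j ==> j \<le> k ==> k \<le> n ==> a i k \<cdot>[Hom2 K (V i) (V k)] P i j k =
    P' i j k \<cdot>[Hom2 K (V i) (V k)] hcomp2 K (V i) (V j) (V k) (a j k) (a i j)"
  "\<And>i. i \<le> n ==> a i i \<cdot>[Hom2 K (V i) (V i)] U i = U' i"
 shows "smor K n V M U P M' U' P' a"
 using assms unfolding smor_def by blast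

lemma smor_cong:
 assumes "\<And>i. i \<le> n ==> V i = W i" "\<And>i j. i \<le> j ==> j \<le> n ==> a i j = b i j"
  "\<And>i j. i \<le> j ==> j \<le> n ==> M' i j = N' i j" "\<And>i. i \<le> n ==> U' i = W' i"
  "\<And>i j k. i \<le> j ==> j \<le> k ==> k \<le> n ==> P' i j k = Q' i j k"
 shows "smor K n V M U P M' U' P' a \<longleftrightarrow> smor K n W M U P N' W' Q' b"
proof -
 have "i \<le> j ==> j \<le> n ==> V i = W i" "i \<le> j ==> j \<le> k ==> k \<le> n ==> V i = W i"
  "i \<le> j ==> j \<le> k ==> k \<le> n ==> V j = W j" "i \<le> j ==> j \<le> k ==> k \<le> n ==> a i j = b i j"
  "i \<le> j ==> j \<le> k ==> k \<le> n ==> a i k = b i k" for i j k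
  using assms(1,2) by auto
 then show ?thesis unfolding smor_def using assms by (simp cong: imp_cong conj_cong)
qed

lemma smor_reindex:
 assumes "smor K n V M U P M' U' P' a" "\<phi> \<in> Arr Delta" "Cod Delta \<phi> = n"
 shows "smor K (Dom Delta \<phi>) (\<lambda>i. V (app \<phi> i)) (\<lambda>i j. M (app \<phi> i) (app \<phi> j)) (\<lambda>i. U (app \<phi> i))
  (\<lambda>i j k. P (app \<phi> i) (app \<phi> j) (app \<phi> k)) (\<lambda>i j. M' (app \<phi> i) (app \<phi> j)) (\<lambda>i. U' (app \<phi> i))
  (\<lambda>i j k. P' (app \<phi> i) (app \<phi> j) (app \<phi> k)) (\<lambda>i j. a (app \<phi> i) (app \<phi> j))"
 by (rule smorI) (use assms(2,3) in \<open>simp_all add: smorD[OF assms(1)]\<close>)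

lemma simplex_data_reindex:
 assumes "simplex_data K n V M U P" "\<phi> \<in> Arr Delta" "Cod Delta \<phi> = n"
 shows "simplex_data K (Dom Delta \<phi>) (\<lambda>i. V (app \<phi> i)) (\<lambda>i j. M (app \<phi> i) (app \<phi> j)) (\<lambda>i. U (app \<phi> i))
  (\<lambda>i j k. P (app \<phi> i) (app \<phi> j) (app \<phi> k))"
proof -
 interpret simplex_data K n V M U P by fact
 show ?thesis
  using assms(2,3) by unfold_locales (simp_all add: P_left P_right P_assoc)
qed

text \<open>Equality of vertices is available only on \<open>0, ..., n\<close>; transporting the
  data along it lets two simplices share one vertex function.\<close>

lemma simplex_data_cong:
 assumes "\<And>i. i \<le> n ==> V i = W i" "simplex_data K n V M U P"
 shows "simplex_data K n W M U P"
proof -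
 interpret simplex_data K n V M U P by fact
 have e: "W i = V i" if "i \<le> n" for i using that assms(1) by simp
 show ?thesis
  by unfold_locales (simp_all add: e P_left P_right P_assoc)
qed

section \<open>Extension of 2-cells from the consecutive edges of a simplex\<close>

locale simplex_pair = S: simplex_data K n V M U P + T: simplex_data K n V M' U' P'
 for K :: "('o, 'm, 't) two_cat" and n V M U P M' U' P'
begin

abbreviation "HV i j \<equiv> Hom2 K (V i) (V j)"
abbreviation "hV i j k \<equiv> hcomp2 K (V i) (V j) (V k)"

abbreviation mor :: "(nat => nat => 't) => bool" where
 "mor a \<equiv> smor K n V M U P M' U' P' a"

lemma mor_unit: "mor a ==> i \<le> n ==> a i i = U' i \<cdot>[HV i i] inv_arr (HV i i) (U i)"
 using smorD(5)[of K n V M U P M' U' P' a i, symmetric] by (simp add: smorD(1-3))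

lemma mor_comp:
 assumes "mor a" "i \<le> j" "j \<le> k" "k \<le> n"
 shows "a i k = P' i j k \<cdot>[HV i k] hV i j k (a j k) (a i j)
  \<cdot>[HV i k] inv_arr (HV i k) (P i j k)"
proof -
 note [simp] = smorD(1-3)[OF assms(1)]
 have "a i k = (a i k \<cdot>[HV i k] P i j k) \<cdot>[HV i k] inv_arr (HV i k) (P i j k)"
  using assms by simp
 also have "\<dots> = P' i j k \<cdot>[HV i k] hV i j k (a j k) (a i j)
  \<cdot>[HV i k] inv_arr (HV i k) (P i j k)"
  using assms by (subst smorD(4)[OF assms(1)]) simp_all
 finally show ?thesis .
qed

text \<open>The compatibility conditions can be solved for \<open>a i i\<close> and for
  \<open>a i k\<close>, since unit and composition cells are invertible; peeling off the last edge
  then determines every component.\<close>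

lemma mor_spine_unique:
 assumes "mor a" "mor b" "\<And>i. i < n ==> a i (Suc i) = b i (Suc i)" "i \<le> j" "j \<le> n"
 shows "a i j = b i j"
 using assms(4,5)
proof (induction rule: dec_induct)
 case base
 then show ?case using mor_unit[OF assms(1)] mor_unit[OF assms(2)] by simp
next
 case (step j)
 then show ?case
  using mor_comp[OF assms(1), of i j "Suc j"] mor_comp[OF assms(2), of i j "Suc j"] assms(3)[of j] by simp
qed

text \<open>A family on consecutive vertices is extended along the composition isomorphisms; the
 compatibility with all of them follows by induction on the last vertex.\<close>

fun extend :: "(nat => 't) => nat => nat => 't" where
 "extend s i 0 = U' i \<cdot>[HV i i] inv_arr (HV i i) (U i)"
| "extend s i (Suc d) = P' i (i + d) (Suc (i + d)) \<cdot>[HV i (Suc (i + d))]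
   (hV i (i + d) (Suc (i + d)) (s (i + d)) (extend s i d)
    \<cdot>[HV i (Suc (i + d))] inv_arr (HV i (Suc (i + d))) (P i (i + d) (Suc (i + d))))"

lemma mor_spine_exists:
 assumes s: "\<And>i. i < n ==> s i \<in> hom (HV i (Suc i)) (M i (Suc i)) (M' i (Suc i))"
 obtains a where "mor a" "\<And>i. i < n ==> a i (Suc i) = s i"
  "(\<forall>i < n. iso (HV i (Suc i)) (s i)) \<longrightarrow>
   (\<forall>i j. i \<le> j \<longrightarrow> j \<le> n \<longrightarrow> iso (HV i j) (a i j))"
proof -
 define a where "a i j = extend s i (j - i)" for i j
 have a0: "a i i = U' i \<cdot>[HV i i] inv_arr (HV i i) (U i)" for i
  by (simp add: a_def)
 have aS: "a i (Suc j) = P' i j (Suc j) \<cdot>[HV i (Suc j)]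
   (hV i j (Suc j) (s j) (a i j)
    \<cdot>[HV i (Suc j)] inv_arr (HV i (Suc j)) (P i j (Suc j)))" if "i \<le> j" for i j
 proof -
  obtain d where "j = i + d" using le_Suc_ex[OF \<open>i \<le> j\<close>] by auto
  moreover have "Suc (i + d) - i = Suc d" by simp
  ultimately show ?thesis by (simp add: a_def del: Suc_diff_le)
 qed
 have [simp]: "s i \<in> Arr (HV i (Suc i))" "Dom (HV i (Suc i)) (s i) = M i (Suc i)"
  "Cod (HV i (Suc i)) (s i) = M' i (Suc i)" if "i < n" for i
  using s[OF that] by auto
 have a: "a i j \<in> Arr (HV i j) \<and> Dom (HV i j) (a i j) = M i j \<and>
  Cod (HV i j) (a i j) = M' i j" if "i \<le> j" "j \<le> n" for i j
  using that by (induction rule: dec_induct) (simp_all add: a0 aS)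
 then have [simp]: "i \<le> j ==> j \<le> n ==> a i j \<in> Arr (HV i j)"
  "i \<le> j ==> j \<le> n ==> Dom (HV i j) (a i j) = M i j"
  "i \<le> j ==> j \<le> n ==> Cod (HV i j) (a i j) = M' i j" for i j by auto
 \<comment> \<open>The recursion is exactly the required compatibility for triples whose last two
   vertices are consecutive; it seeds the induction for all other triples.\<close>
 have sa: "a i (Suc j) \<cdot>[HV i (Suc j)] P i j (Suc j) =
   P' i j (Suc j) \<cdot>[HV i (Suc j)] hV i j (Suc j) (s j) (a i j)"
  if "i \<le> j" "j < n" for i j using that by (simp add: aS)
 text \<open>Both unit laws have the same shape: the unit isomorphisms cancel against \<open>a i i\<close>.\<close>
 have left: "a i j \<cdot>[HV i j] P i j j =
   P' i j j \<cdot>[HV i j] hV i j j (a j j) (a i j)" if "i \<le> j" "j \<le> n" for i j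
 proof (rule iso_cancel_right[of "HV i j"
    "hV i j j (U j) (Ide (HV i j) (M i j))"])
  \<comment> \<open>Writing \<open>a i j\<close> as a horizontal composite with the identity of the
    unit gives the left unit law of the target something to act on.\<close>
  have "a i j = hV i j j (Ide (HV j j) (Ide2 K (V j))) (a i j)"
   using that by simp
  then have "a i j = (P' i j j \<cdot>[HV i j]
    hV i j j (U' j) (Ide (HV i j) (M' i j))) \<cdot>[HV i j]
    hV i j j (Ide (HV j j) (Ide2 K (V j))) (a i j)"
   using that by (simp add: T.P_left)
  then show "(a i j \<cdot>[HV i j] P i j j) \<cdot>[HV i j]
    hV i j j (U j) (Ide (HV i j) (M i j)) =
   (P' i j j \<cdot>[HV i j] hV i j j (a j j) (a i j)) \<cdot>[HV i j]
    hV i j j (U j) (Ide (HV i j) (M i j))"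
   using that by (simp add: S.P_left S.interchange a0 del: S.unit_left2)
 qed (use that in simp_all)
 have comp: "a i k \<cdot>[HV i k] P i j k =
   P' i j k \<cdot>[HV i k] hV i j k (a j k) (a i j)"
  if "i \<le> j" "j \<le> k" "k \<le> n" for i j k
  using that(2,3)
 proof (induction rule: dec_induct)
  case base
  then show ?case using left that by simp
 next
  case (step k)
  have ijk: "i \<le> j" "j \<le> k" "k < n" "i \<le> k" using step that by auto
  have IH: "a i k \<cdot>[HV i k] P i j k =
   P' i j k \<cdot>[HV i k] hV i j k (a j k) (a i j)" using step by simp
  let ?H = "HV i (Suc k)"
  show ?case
  \<comment> \<open>After whiskering with \<open>P j k (Suc k)\<close>, associativity of
    \<open>P\<close> moves the composite to the triple \<open>i, k, Suc k\<close>, where the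
    recursion and the induction hypothesis apply; associativity of \<open>P'\<close> moves it
    back.\<close>
  proof (rule iso_cancel_right[of ?H
     "hV i j (Suc k) (P j k (Suc k)) (Ide (HV i j) (M i j))"])
   have "(a i (Suc k) \<cdot>[?H] P i j (Suc k)) \<cdot>[?H]
     hV i j (Suc k) (P j k (Suc k)) (Ide (HV i j) (M i j)) =
     (a i (Suc k) \<cdot>[?H] P i k (Suc k)) \<cdot>[?H]
     hV i k (Suc k) (Ide (HV k (Suc k)) (M k (Suc k))) (P i j k)"
    using ijk S.P_assoc[of i j k "Suc k"] by simp
   also have "\<dots> = P' i k (Suc k) \<cdot>[?H] hV i k (Suc k) (s k)
     (a i k \<cdot>[HV i k] P i j k)"
    unfolding sa[OF ijk(4,3)] using ijk by (simp add: S.interchange)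
   also have "\<dots> = (P' i k (Suc k) \<cdot>[?H]
     hV i k (Suc k) (Ide (HV k (Suc k)) (M' k (Suc k))) (P' i j k)) \<cdot>[?H]
     hV i k (Suc k) (s k) (hV i j k (a j k) (a i j))"
    unfolding IH using ijk by (simp add: S.interchange)
   also have "\<dots> = P' i j (Suc k) \<cdot>[?H] hV i j (Suc k)
     (P' j k (Suc k) \<cdot>[HV j (Suc k)] hV j k (Suc k) (s k) (a j k)) (a i j)"
    unfolding T.P_assoc[OF ijk(1,2) le_SucI[OF order_refl] Suc_leI[OF ijk(3)], symmetric]
    using ijk by (simp add: S.interchange S.assoc2)
   also have "\<dots> = (P' i j (Suc k) \<cdot>[?H] hV i j (Suc k) (a j (Suc k)) (a i j)) \<cdot>[?H]
     hV i j (Suc k) (P j k (Suc k)) (Ide (HV i j) (M i j))"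
    unfolding sa[OF ijk(2,3), symmetric] using ijk by (simp add: S.interchange S.assoc1)
   finally show "(a i (Suc k) \<cdot>[?H] P i j (Suc k)) \<cdot>[?H]
     hV i j (Suc k) (P j k (Suc k)) (Ide (HV i j) (M i j)) =
    (P' i j (Suc k) \<cdot>[?H] hV i j (Suc k) (a j (Suc k)) (a i j)) \<cdot>[?H]
     hV i j (Suc k) (P j k (Suc k)) (Ide (HV i j) (M i j))" .
  qed (use ijk in \<open>simp_all add: S.assoc1\<close>)
 qed
 have "mor a"
  by (rule smorI) (simp_all add: comp a0)
 moreover have "a i (Suc i) = s i" if "i < n" for i
 proof -
  have [simp]: "Suc i \<le> n" using that by simp
  \<comment> \<open>The recursion yields a conjugate of the composite of \<open>s i\<close> with
    \<open>a i i\<close>; the degenerate triple \<open>i, i, Suc i\<close> and the right unit laws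
    of both simplices reduce it to \<open>s i\<close>.\<close>
  have "a i (Suc i) = a i (Suc i) \<cdot>[HV i (Suc i)] P i i (Suc i) \<cdot>[HV i (Suc i)]
    hV i i (Suc i) (Ide (HV i (Suc i)) (M i (Suc i))) (U i)"
   using that by (simp add: S.P_right)
  also have "\<dots> = (a i (Suc i) \<cdot>[HV i (Suc i)] P i i (Suc i)) \<cdot>[HV i (Suc i)]
    hV i i (Suc i) (Ide (HV i (Suc i)) (M i (Suc i))) (U i)"
   using that by simp
  also have "\<dots> = P' i i (Suc i) \<cdot>[HV i (Suc i)] hV i i (Suc i) (s i) (U' i)"
   using that by (simp add: sa S.interchange a0)
  also have "\<dots> = (P' i i (Suc i) \<cdot>[HV i (Suc i)]
    hV i i (Suc i) (Ide (HV i (Suc i)) (M' i (Suc i))) (U' i))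
    \<cdot>[HV i (Suc i)]
    hV i i (Suc i) (s i) (Ide (HV i i) (Ide2 K (V i)))"
   using that by (simp add: S.interchange del: S.unit_right2)
  also have "\<dots> = s i"
   unfolding T.P_right[OF le_SucI[OF order_refl] \<open>Suc i \<le> n\<close>] using that by simp
  finally show ?thesis .
 qed
 moreover have "iso (HV i j) (a i j)"
  if "\<And>i. i < n ==> iso (HV i (Suc i)) (s i)" "i \<le> j" "j \<le> n" for i j
  using that(2,3) by (induction rule: dec_induct) (simp_all add: a0 aS that(1))
 ultimately show ?thesis using that by blast
qed

end

lemma smor_comp:
 assumes "simplex_pair K n V M U P M' U' P'" "simplex_data K n V M'' U'' P''"
  "smor K n V M U P M' U' P' a" "smor K n V M' U' P' M'' U'' P'' b"
 shows "smor K n V M U P M'' U'' P'' (\<lambda>i j. b i j \<cdot>[Hom2 K (V i) (V j)] a i j)"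
proof -
 interpret simplex_pair K n V M U P M' U' P' by fact
 interpret R: simplex_data K n V M'' U'' P'' by fact
 note [simp] = smorD(1-3,5)[OF assms(3)] smorD(1-3,5)[OF assms(4)]
 show ?thesis
 proof (rule smorI)
  fix i j k assume ijk: "i \<le> j" "j \<le> k" "k \<le> n"
  let ?H = "Hom2 K (V i) (V k)"
  have "(b i k \<cdot>[?H] a i k) \<cdot>[?H] P i j k = (b i k \<cdot>[?H] P' i j k) \<cdot>[?H] hcomp2 K (V i) (V j) (V k) (a j k) (a i j)"
   using ijk by (simp add: smorD(4)[OF assms(3)])
  also have "\<dots> = P'' i j k \<cdot>[?H] hcomp2 K (V i) (V j) (V k) (b j k \<cdot>[Hom2 K (V j) (V k)] a j k)
    (b i j \<cdot>[Hom2 K (V i) (V j)] a i j)"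
   unfolding smorD(4)[OF assms(4) ijk] using ijk by (simp add: S.interchange)
  finally show "(b i k \<cdot>[?H] a i k) \<cdot>[?H] P i j k =
    P'' i j k \<cdot>[?H] hcomp2 K (V i) (V j) (V k) (b j k \<cdot>[Hom2 K (V j) (V k)] a j k)
    (b i j \<cdot>[Hom2 K (V i) (V j)] a i j)" .
 qed simp_all
qed

lemma smor_Ide:
 assumes "simplex_data K n V M U P"
 shows "smor K n V M U P M U P (\<lambda>i j. Ide (Hom2 K (V i) (V j)) (M i j))"
proof -
 interpret simplex_data K n V M U P by fact
 show ?thesis by (rule smorI) simp_all
qed

section \<open>The simplicial replacement\<close>

definition spull :: "('o, 'm, 't) two_cat => delta_arr => ('o, 'm, 't) simplex => ('o, 'm, 't) simplex" where
 "spull K \<phi> \<tau> = FObj (simplices_transition K \<phi>) \<tau>"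

definition mk2 :: "nat => (nat => nat => 't) => nat \<times> nat => nat \<times> nat => 't" where
 "mk2 n a = (\<lambda>(i, j)\<in>{0..n} \<times> {0..n}. \<lambda>f\<in>hom (ordinal n) i j. a i j)"

lemma mk2_simps [simp]: "i \<le> j ==> j \<le> n ==> mk2 n a (i, j) (i, j) = a i j"
 by (auto simp: mk2_def)

lemma mk2_cong: "(\<And>i j. i \<le> j ==> j \<le> n ==> a i j = b i j) ==> mk2 n a = mk2 n b"
 by (auto simp: mk2_def fun_eq_iff restrict_def)

text \<open>An arrow of the Grothendieck construction stores a full morphism of the fiber, target
  included; here that target is recomputed from \<open>\<tau>\<close>, so an arrow is given by the
  map, the two simplices and the family \<open>a\<close>.\<close>

definition garr :: "('o, 'm, 't) two_cat => delta_arr => ('o, 'm, 't) simplex => (nat => nat => 't) =>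
  ('o, 'm, 't) simplex => delta_arr \<times> ('o, 'm, 't) simplex_arr \<times> ('o, 'm, 't) simplex" where
 "garr K \<phi> \<sigma> a \<tau> = (\<phi>, (\<sigma>, mk2 (Dom Delta \<phi>) a, spull K \<phi> \<tau>), \<tau>)"

text \<open>The pair \<open>(i, j)\<close> is the only arrow of the ordinal from \<open>i\<close> to
  \<open>j\<close>, so evaluating there loses nothing.\<close>

definition gc :: "delta_arr \<times> ('o, 'm, 't) simplex_arr \<times> ('o, 'm, 't) simplex => nat => nat => 't" where
 "gc h i j = fst (snd (fst (snd h))) (i, j) (i, j)"

text \<open>The vertex equation is what allows the cells of \<open>\<sigma>\<close> to be read in
  the categories of morphisms of the pulled back \<open>\<tau>\<close>.\<close>

definition arr_data :: "('o, 'm, 't) two_cat => delta_arr => ('o, 'm, 't) simplex => ('o, 'm, 't) simplex =>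
  (nat => nat => 't) => bool" where
 "arr_data K \<phi> \<sigma> \<tau> a \<longleftrightarrow> \<phi> \<in> Arr Delta \<and> is_simplex K (Dom Delta \<phi>) \<sigma> \<and> is_simplex K (Cod Delta \<phi>) \<tau> \<and>
   (\<forall>i \<le> Dom Delta \<phi>. PObj \<sigma> i = PObj \<tau> (app \<phi> i)) \<and>
   smor K (Dom Delta \<phi>) (\<lambda>i. PObj \<tau> (app \<phi> i)) (sM \<sigma>) (PUnit \<sigma>) (sC \<sigma>)
    (\<lambda>i j. sM \<tau> (app \<phi> i) (app \<phi> j)) (\<lambda>i. PUnit \<tau> (app \<phi> i))
    (\<lambda>i j k. sC \<tau> (app \<phi> i) (app \<phi> j) (app \<phi> k)) a"

text \<open>A map of ordinals is a strict 2-functor: its own unit and composition cells contribute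
  identities, and those of the composite are the reindexed cells of \<open>\<tau>\<close>.\<close>

lemma spull_mkS:
 assumes \<phi>: "\<phi> \<in> Arr Delta" and \<tau>: "is_simplex K (Cod Delta \<phi>) \<tau>"
 shows "spull K \<phi> \<tau> = mkS K (Dom Delta \<phi>) (\<lambda>i. PObj \<tau> (app \<phi> i)) (\<lambda>i j. sM \<tau> (app \<phi> i) (app \<phi> j))
  (\<lambda>i. PUnit \<tau> (app \<phi> i)) (\<lambda>i j k. sC \<tau> (app \<phi> i) (app \<phi> j) (app \<phi> k))"
proof -
 interpret simplex_data K "Cod Delta \<phi>" "PObj \<tau>" "sM \<tau>" "PUnit \<tau>" "sC \<tau>"
  using \<tau> by (rule simplex_data_simplex)
 define m n f where mnf: "m = Dom Delta \<phi>" "n = Cod Delta \<phi>" "f = app \<phi>"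
 have p: "\<phi> = (m, f, n)" by (cases \<phi>) (simp add: mnf Delta_def app_def)
 have le [simp]: "i \<le> m ==> f i \<le> n" for i using app_le[OF \<phi>] mnf by simp
 have mono [simp]: "i \<le> j ==> j \<le> m ==> f i \<le> f j" for i j using app_mono[OF \<phi>] mnf by simp
 note \<tau>' = \<tau>[folded mnf]
 note data [simp] = V_obj[folded mnf] M_obj[folded mnf] U_iso[folded mnf] U_dom[folded mnf] U_cod[folded mnf]
  P_iso[folded mnf] P_dom[folded mnf] P_cod[folded mnf]
 define \<psi> where "\<psi> = fct_as_two_fct (ordinal m) (ordinal_fct \<phi>)"
 have s: "spull K \<phi> \<tau> = comp_two_fct (ord2 m) K \<tau> \<psi>"
  using \<tau>' by (simp add: spull_def simplices_transition_def precomp_def Fun2_def p \<psi>_def Delta_def)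
 have PA: "FArr (PHom \<tau> (f i, f j)) (f i, f j) = Ide (Hom2 K (PObj \<tau> (f i)) (PObj \<tau> (f j))) (sM \<tau> (f i) (f j))"
  if "i \<le> j" "j \<le> m" for i j using simplex_PArr[OF \<tau>', of "f i" "f j"] that by simp
 have O: "PObj \<psi> = f"
  by (simp add: \<psi>_def fct_as_two_fct_def ordinal_fct_def p)
 have H: "PHom \<psi> (i, j) = \<lparr>FObj = \<lambda>u\<in>hom (ordinal m) i j. (f i, f j), FArr = \<lambda>u\<in>hom (ordinal m) i j. (f i, f j)\<rparr>"
  if "i \<le> m" "j \<le> m" for i j
  using that by (auto simp: \<psi>_def fct_as_two_fct_def ordinal_fct_def p fun_eq_iff restrict_def ordinal_def)
 have U: "PUnit \<psi> i = (f i, f i)" if "i \<le> m" for i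
  using that by (auto simp: \<psi>_def fct_as_two_fct_def ordinal_fct_def p ordinal_def)
 have C: "PComp \<psi> (i, j, k) ((j, k), (i, j)) = (f i, f k)" if "i \<le> j" "j \<le> k" "k \<le> m" for i j k
  using that by (auto simp: \<psi>_def fct_as_two_fct_def ordinal_fct_def p ordinal_def hom_def)
 let ?R = "mkS K m (\<lambda>i. PObj \<tau> (f i)) (\<lambda>i j. sM \<tau> (f i) (f j)) (\<lambda>i. PUnit \<tau> (f i)) (\<lambda>i j k. sC \<tau> (f i) (f j) (f k))"
 have "PObj (comp_two_fct (ord2 m) K \<tau> \<psi>) = PObj ?R"
  by (simp add: comp_two_fct_def mkS_def O compose_def)
 moreover have "PHom (comp_two_fct (ord2 m) K \<tau> \<psi>) = PHom ?R"
 proof -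
  have "comp_fct (discrete_cat (hom (ordinal m) i j)) (PHom \<tau> (f i, f j)) (PHom \<psi> (i, j)) = PHom ?R (i, j)"
   if "i \<le> m" "j \<le> m" for i j
   using that PA by (auto simp: comp_fct_def H mkS_def compose_def restrict_def fun_eq_iff sM_def)
  then show ?thesis
   by (auto simp: comp_two_fct_def O fun_eq_iff restrict_def simp del: ordinal_simps(4)) (auto simp: mkS_def)
 qed
 moreover have "PUnit (comp_two_fct (ord2 m) K \<tau> \<psi>) = PUnit ?R"
  using PA by (auto simp: comp_two_fct_def mkS_def O U restrict_def fun_eq_iff)
 moreover have "PComp (comp_two_fct (ord2 m) K \<tau> \<psi>) = PComp ?R"
 proof -
  have "PComp (comp_two_fct (ord2 m) K \<tau> \<psi>) (i, j, k) = PComp ?R (i, j, k)"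
   if ijk: "i \<le> m" "j \<le> m" "k \<le> m" for i j k
  proof (cases "i \<le> j \<and> j \<le> k")
   case True
   then have "sC \<tau> (f i) (f j) (f k) = PComp \<tau> (f i, f j, f k) ((f j, f k), (f i, f j))"
    by (simp add: sC_def)
   then have "FArr (PHom \<tau> (f i, f k)) (f i, f k) \<cdot>[Hom2 K (PObj \<tau> (f i)) (PObj \<tau> (f k))]
     PComp \<tau> (f i, f j, f k) ((f j, f k), (f i, f j)) = sC \<tau> (f i) (f j) (f k)"
    using ijk True PA[of i k] P_cod[of "f i" "f j" "f k", folded mnf] P_iso[of "f i" "f j" "f k", folded mnf]
    by simp
   then show ?thesis
    using ijk True C[of i j k] H[of i j] H[of j k]
    by (simp add: comp_two_fct_def mkS_def O) (auto simp: restrict_def fun_eq_iff)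
  next
   case False
   then show ?thesis
    using ijk by (auto simp: comp_two_fct_def mkS_def restrict_def fun_eq_iff)
  qed
  then show ?thesis by (auto simp: comp_two_fct_def mkS_def fun_eq_iff restrict_def)
 qed
 ultimately show ?thesis unfolding s mnf by simp
qed

lemma spull_simps [simp]:
 assumes "\<phi> \<in> Arr Delta" "is_simplex K (Cod Delta \<phi>) \<tau>"
 shows "i \<le> Dom Delta \<phi> ==> PObj (spull K \<phi> \<tau>) i = PObj \<tau> (app \<phi> i)"
  "i \<le> Dom Delta \<phi> ==> PUnit (spull K \<phi> \<tau>) i = PUnit \<tau> (app \<phi> i)"
  "i \<le> j ==> j \<le> Dom Delta \<phi> ==> sM (spull K \<phi> \<tau>) i j = sM \<tau> (app \<phi> i) (app \<phi> j)"
  "i \<le> j ==> j \<le> k ==> k \<le> Dom Delta \<phi> ==>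
   sC (spull K \<phi> \<tau>) i j k = sC \<tau> (app \<phi> i) (app \<phi> j) (app \<phi> k)"
  "is_simplex K (Dom Delta \<phi>) (spull K \<phi> \<tau>)"
 using simplex_data.mkS_two_functor[OF simplex_data_reindex[OF simplex_data_simplex[OF assms(2)] assms(1) refl]]
 by (simp_all add: spull_mkS[OF assms])

lemma spull_Ide [simp]: "is_simplex K n \<tau> ==> spull K (Ide Delta n) \<tau> = \<tau>"
 using spull_simps(5)[of "Ide Delta n" K \<tau>] by (intro simplex_eqI[of n K]) simp_all

text \<open>This strict functoriality is what the Grothendieck construction needs for its composites
  to have the right target.\<close>

lemma spull_comp:
 assumes "\<phi> \<in> Arr Delta" "\<psi> \<in> Arr Delta" "Dom Delta \<psi> = Cod Delta \<phi>" "is_simplex K (Cod Delta \<psi>) \<tau>"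
 shows "spull K \<phi> (spull K \<psi> \<tau>) = spull K (\<psi> \<cdot>[Delta] \<phi>) \<tau>"
proof (rule simplex_eqI)
 have [simp]: "is_simplex K (Cod Delta \<phi>) (spull K \<psi> \<tau>)" using assms spull_simps(5)[of \<psi> K \<tau>] by simp
 show "is_simplex K (Dom Delta \<phi>) (spull K \<phi> (spull K \<psi> \<tau>))" using assms by simp
 show "is_simplex K (Dom Delta \<phi>) (spull K (\<psi> \<cdot>[Delta] \<phi>) \<tau>)"
  using spull_simps(5)[of "\<psi> \<cdot>[Delta] \<phi>" K \<tau>] assms by simp
qed (use assms spull_simps(5)[of \<psi> K \<tau>] in simp_all)

text \<open>Over a discrete category only naturality at identities has to be checked, so a
  2-morphism amounts to an indexed family, from which extensionality recovers it.\<close>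

lemma two_morphism_iff:
 assumes \<phi>: "\<phi> \<in> Arr Delta" and \<sigma>: "is_simplex K (Dom Delta \<phi>) \<sigma>" and \<tau>: "is_simplex K (Cod Delta \<phi>) \<tau>"
 shows "two_morphism (ord2 (Dom Delta \<phi>)) K \<sigma> (spull K \<phi> \<tau>) \<alpha> \<longleftrightarrow>
  (\<exists>a. arr_data K \<phi> \<sigma> \<tau> a \<and> \<alpha> = mk2 (Dom Delta \<phi>) a)"
proof
 let ?m = "Dom Delta \<phi>"
 assume "two_morphism (ord2 ?m) K \<sigma> (spull K \<phi> \<tau>) \<alpha>"
 then interpret two_morphism "ord2 ?m" K \<sigma> "spull K \<phi> \<tau>" \<alpha> .
 interpret S: simplex_data K ?m "PObj \<sigma>" "sM \<sigma>" "PUnit \<sigma>" "sC \<sigma>"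
  using \<sigma> by (rule simplex_data_simplex)
 define a where "a i j = \<alpha> (i, j) (i, j)" for i j
 have O: "PObj \<sigma> i = PObj \<tau> (app \<phi> i)" if "i \<le> ?m" for i
  using same_objects[of i] that \<phi> \<tau> by simp
 have n: "nat_trans (Hom2 (ord2 ?m) i j) (PHomCat K \<sigma> i j) (PHom \<sigma> (i, j)) (PHom (spull K \<phi> \<tau>) (i, j)) (\<alpha> (i, j))"
  if "i \<le> ?m" "j \<le> ?m" for i j using family_nat[of i j] that by simp
 have "smor K ?m (PObj \<sigma>) (sM \<sigma>) (PUnit \<sigma>) (sC \<sigma>) (sM (spull K \<phi> \<tau>)) (PUnit (spull K \<phi> \<tau>)) (sC (spull K \<phi> \<tau>)) a"
 proof (rule smorI)
  fix i j assume "i \<le> j" "j \<le> ?m"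
  then show "a i j \<in> hom (PHomCat K \<sigma> i j) (sM \<sigma> i j) (sM (spull K \<phi> \<tau>) i j)"
   using nat_trans.component[OF n[of i j], of "(i, j)"] by (simp add: a_def sM_def)
 next
  fix i j k assume "i \<le> j" "j \<le> k" "k \<le> ?m"
  then show "a i k \<cdot>[PHomCat K \<sigma> i k] sC \<sigma> i j k =
    sC (spull K \<phi> \<tau>) i j k \<cdot>[PHomCat K \<sigma> i k] hcomp2 K (PObj \<sigma> i) (PObj \<sigma> j) (PObj \<sigma> k) (a j k) (a i j)"
   using family_comp[of i j k "(i, j)" "(j, k)"] by (simp add: a_def sC_def)
 next
  fix i assume "i \<le> ?m"
  then show "a i i \<cdot>[PHomCat K \<sigma> i i] PUnit \<sigma> i = PUnit (spull K \<phi> \<tau>) i"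
   using family_unit[of i] by (simp add: a_def)
 qed
 then have "smor K ?m (\<lambda>i. PObj \<tau> (app \<phi> i)) (sM \<sigma>) (PUnit \<sigma>) (sC \<sigma>) (\<lambda>i j. sM \<tau> (app \<phi> i) (app \<phi> j))
   (\<lambda>i. PUnit \<tau> (app \<phi> i)) (\<lambda>i j k. sC \<tau> (app \<phi> i) (app \<phi> j) (app \<phi> k)) a"
  by (rule smor_cong[THEN iffD1, rotated -1]) (use O \<phi> \<tau> in simp_all)
 then have "arr_data K \<phi> \<sigma> \<tau> a" using O \<phi> \<sigma> \<tau> by (simp add: arr_data_def)
 moreover have "\<alpha> = mk2 ?m a"
 proof
  fix p :: "nat \<times> nat"
  obtain i j where p: "p = (i, j)" by (cases p)
  show "\<alpha> p = mk2 ?m a p"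
  proof (cases "i \<le> ?m \<and> j \<le> ?m")
   case True
   then show ?thesis
    using nat_trans.component_ext[OF n[of i j]]
    by (auto simp: p mk2_def a_def fun_eq_iff extensional_def restrict_def split: if_splits)
  next
   case False
   then show ?thesis using family_ext by (auto simp: p mk2_def extensional_def)
  qed
 qed
 ultimately show "\<exists>a. arr_data K \<phi> \<sigma> \<tau> a \<and> \<alpha> = mk2 ?m a" by blast
next
 let ?m = "Dom Delta \<phi>"
 assume "\<exists>a. arr_data K \<phi> \<sigma> \<tau> a \<and> \<alpha> = mk2 ?m a"
 then obtain a where a: "arr_data K \<phi> \<sigma> \<tau> a" "\<alpha> = mk2 ?m a" by blast
 let ?\<tau> = "spull K \<phi> \<tau>"
 have O: "PObj \<sigma> i = PObj \<tau> (app \<phi> i)" "PObj ?\<tau> i = PObj \<sigma> i" if "i \<le> ?m" for i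
  using a(1) that \<phi> \<tau> by (auto simp: arr_data_def)
 interpret S: simplex_data K ?m "PObj \<sigma>" "sM \<sigma>" "PUnit \<sigma>" "sC \<sigma>"
  using \<sigma> by (rule simplex_data_simplex)
 have \<tau>': "is_simplex K ?m ?\<tau>" using \<phi> \<tau> by simp
 interpret T: simplex_data K ?m "PObj ?\<tau>" "sM ?\<tau>" "PUnit ?\<tau>" "sC ?\<tau>"
  using \<tau>' by (rule simplex_data_simplex)
 have s: "smor K ?m (PObj \<sigma>) (sM \<sigma>) (PUnit \<sigma>) (sC \<sigma>) (sM ?\<tau>) (PUnit ?\<tau>) (sC ?\<tau>) a"
 proof -
  have "smor K ?m (\<lambda>i. PObj \<tau> (app \<phi> i)) (sM \<sigma>) (PUnit \<sigma>) (sC \<sigma>) (\<lambda>i j. sM \<tau> (app \<phi> i) (app \<phi> j))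
   (\<lambda>i. PUnit \<tau> (app \<phi> i)) (\<lambda>i j k. sC \<tau> (app \<phi> i) (app \<phi> j) (app \<phi> k)) a"
   using a(1) by (simp add: arr_data_def)
  then show ?thesis
   by (rule smor_cong[THEN iffD1, rotated -1]) (use O \<phi> \<tau> in simp_all)
 qed
 have nt: "nat_trans (Hom2 (ord2 ?m) i j) (PHomCat K \<sigma> i j) (PHom \<sigma> (i, j)) (PHom ?\<tau> (i, j)) (\<alpha> (i, j))"
  if ij: "i \<le> ?m" "j \<le> ?m" for i j
 proof (intro nat_trans.intro nat_trans_axioms.intro)
  show "cat_functor (Hom2 (ord2 ?m) i j) (PHomCat K \<sigma> i j) (PHom \<sigma> (i, j))"
   using two_functor.phom_functor[OF \<sigma>, of i j] ij by simp
  show "cat_functor (Hom2 (ord2 ?m) i j) (PHomCat K \<sigma> i j) (PHom ?\<tau> (i, j))"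
   using two_functor.phom_functor[OF \<tau>', of i j] ij O by simp
  show "\<alpha> (i, j) \<in> extensional (Obj (Hom2 (ord2 ?m) i j))"
   using ij by (auto simp: a mk2_def)
  show "\<alpha> (i, j) x \<in> hom (PHomCat K \<sigma> i j) (FObj (PHom \<sigma> (i, j)) x) (FObj (PHom ?\<tau> (i, j)) x)"
   if "x \<in> Obj (Hom2 (ord2 ?m) i j)" for x
   using that ij smorD(1-3)[OF s, of i j] by (auto simp: a sM_def split: if_splits)
  show "\<alpha> (i, j) y \<cdot>[PHomCat K \<sigma> i j] FArr (PHom \<sigma> (i, j)) f =
    FArr (PHom ?\<tau> (i, j)) f \<cdot>[PHomCat K \<sigma> i j] \<alpha> (i, j) x"
   if "f \<in> hom (Hom2 (ord2 ?m) i j) x y" for f x y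
   using that ij smorD(1-3)[OF s, of i j] simplex_PArr[OF \<sigma>, of i j] simplex_PArr[OF \<tau>', of i j] O
    S.hom_category[OF S.V_obj S.V_obj, of i j]
   by (auto simp: a split: if_splits)
 qed
 show "two_morphism (ord2 ?m) K \<sigma> ?\<tau> \<alpha>"
 proof (intro two_morphism.intro two_morphism_axioms.intro \<sigma> \<tau>')
  fix x y z f g assume "x \<in> Obj2 (ord2 ?m)" "y \<in> Obj2 (ord2 ?m)" "z \<in> Obj2 (ord2 ?m)"
   "f \<in> Obj (Hom2 (ord2 ?m) x y)" "g \<in> Obj (Hom2 (ord2 ?m) y z)"
  then show "\<alpha> (x, z) (hcomp1 (ord2 ?m) x y z g f) \<cdot>[PHomCat K \<sigma> x z] PComp \<sigma> (x, y, z) (g, f)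
   = PComp ?\<tau> (x, y, z) (g, f) \<cdot>[PHomCat K \<sigma> x z]
    hcomp2 K (PObj \<sigma> x) (PObj \<sigma> y) (PObj \<sigma> z) (\<alpha> (y, z) g) (\<alpha> (x, y) f)"
   using smorD(4)[OF s, of x y z] by (auto simp: a sC_def split: if_splits)
 next
  fix x assume "x \<in> Obj2 (ord2 ?m)"
  then show "\<alpha> (x, x) (Ide2 (ord2 ?m) x) \<cdot>[PHomCat K \<sigma> x x] PUnit \<sigma> x = PUnit ?\<tau> x"
   using smorD(5)[OF s, of x] by (simp add: a)
 next
  show "\<alpha> \<in> extensional (Obj2 (ord2 ?m) \<times> Obj2 (ord2 ?m))" by (auto simp: a mk2_def)
 qed (use nt O in auto)
qed

abbreviation SR :: "('o, 'm, 't) two_cat => (nat \<times> ('o, 'm, 't) simplex,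
  delta_arr \<times> ('o, 'm, 't) simplex_arr \<times> ('o, 'm, 't) simplex) cat" where
 "SR \<equiv> simp_repl"

lemma SR_Obj [simp]: "(n, \<sigma>) \<in> Obj (SR K) \<longleftrightarrow> is_simplex K n \<sigma>"
 by (simp add: simp_repl_def grothendieck_def simplices_def Fun2_def)

lemma SR_Arr_iff: "h \<in> Arr (SR K) \<longleftrightarrow> (\<exists>\<phi> \<sigma> a \<tau>. arr_data K \<phi> \<sigma> \<tau> a \<and> h = garr K \<phi> \<sigma> a \<tau>)"
proof -
 obtain \<phi> \<sigma> \<alpha> \<sigma>' \<tau> where h: "h = (\<phi>, (\<sigma>, \<alpha>, \<sigma>'), \<tau>)" by (metis prod_cases3)
 have "h \<in> Arr (SR K) \<longleftrightarrow> \<phi> \<in> Arr Delta \<and> two_morphism (ord2 (Dom Delta \<phi>)) K \<sigma> \<sigma>' \<alpha> \<and>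
   is_simplex K (Cod Delta \<phi>) \<tau> \<and> \<sigma>' = spull K \<phi> \<tau>"
  by (simp add: h simp_repl_def grothendieck_def simplices_def Fun2_def spull_def)
 also have "\<dots> \<longleftrightarrow> (\<exists>a. arr_data K \<phi> \<sigma> \<tau> a \<and> h = garr K \<phi> \<sigma> a \<tau>)"
  using two_morphism_iff[of \<phi> K \<sigma> \<tau> \<alpha>]
  by (auto simp: h garr_def two_morphism_def arr_data_def)
 finally show ?thesis by (auto simp: h garr_def simp del: split_paired_Ex)
qed

lemma SR_Dom [simp]: "Dom (SR K) (garr K \<phi> \<sigma> a \<tau>) = (Dom Delta \<phi>, \<sigma>)"
 and SR_Cod [simp]: "Cod (SR K) (garr K \<phi> \<sigma> a \<tau>) = (Cod Delta \<phi>, \<tau>)"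
 and fst_garr [simp]: "fst (garr K \<phi> \<sigma> a \<tau>) = \<phi>"
 and gc_garr [simp]: "i \<le> j ==> j \<le> Dom Delta \<phi> ==> gc (garr K \<phi> \<sigma> a \<tau>) i j = a i j"
 by (simp_all add: simp_repl_def grothendieck_def simplices_def Fun2_def garr_def gc_def)

lemma garr_cong: "(\<And>i j. i \<le> j ==> j \<le> Dom Delta \<phi> ==> a i j = b i j) ==> garr K \<phi> \<sigma> a \<tau> = garr K \<phi> \<sigma> b \<tau>"
 using mk2_cong[of "Dom Delta \<phi>" a b] by (simp add: garr_def)

lemma SR_Ide:
 assumes "is_simplex K n \<sigma>"
 shows "Ide (SR K) (n, \<sigma>) = garr K (Ide Delta n) \<sigma> (\<lambda>i j. Ide (PHomCat K \<sigma> i j) (sM \<sigma> i j)) \<sigma>"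
 using assms
 by (auto simp: simp_repl_def grothendieck_def simplices_def Fun2_def garr_def mk2_def sM_def restrict_def fun_eq_iff)

text \<open>The transition functor reindexes the second family along \<open>\<phi>\<close>, after
  which 2-cells compose componentwise. The categories of morphisms are named by the vertices of
  \<open>\<sigma>\<close> because \<open>Fun2\<close> reads them off the source.\<close>

lemma SR_Comp:
 assumes a: "arr_data K \<phi> \<sigma> \<tau> a" and b: "arr_data K \<psi> \<tau> \<upsilon> b" and m: "Dom Delta \<psi> = Cod Delta \<phi>"
 shows "garr K \<psi> \<tau> b \<upsilon> \<cdot>[SR K] garr K \<phi> \<sigma> a \<tau> =
  garr K (\<psi> \<cdot>[Delta] \<phi>) \<sigma> (\<lambda>i j. b (app \<phi> i) (app \<phi> j) \<cdot>[PHomCat K \<sigma> i j] a i j) \<upsilon>"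
proof -
 have h: "\<phi> \<in> Arr Delta" "\<psi> \<in> Arr Delta" "is_simplex K (Cod Delta \<psi>) \<upsilon>" "is_simplex K (Dom Delta \<psi>) \<tau>"
  using a b by (auto simp: arr_data_def)
 let ?m = "Dom Delta \<phi>" and ?n = "Cod Delta \<phi>"
 obtain f where p: "\<phi> = (?m, f, ?n)" "f = app \<phi>" by (cases \<phi>) (simp add: Delta_def app_def)
 have "two_morphism (ord2 ?n) K \<tau> (spull K \<psi> \<upsilon>) (mk2 ?n b)"
  using two_morphism_iff[of \<psi> K \<tau> \<upsilon>] h b m by auto
 then have "FArr (simplices_transition K \<phi>) (\<tau>, mk2 ?n b, spull K \<psi> \<upsilon>) =
  (spull K \<phi> \<tau>, \<lambda>(x, y)\<in>{0..?m} \<times> {0..?m}. \<lambda>u\<in>hom (ordinal ?m) x y. mk2 ?n b (f x, f y) (f x, f y),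
   spull K (\<psi> \<cdot>[Delta] \<phi>) \<upsilon>)"
  unfolding spull_comp[OF h(1,2) m h(3), symmetric]
  using h m p
  by (auto simp: spull_def simplices_transition_def precomp_def Fun2_def fct_as_two_fct_def ordinal_fct_def
    restrict_def fun_eq_iff two_morphism_def ordinal_def hom_def split: prod.splits)
 then show ?thesis
  using h m p(2)
  by (auto simp: garr_def simp_repl_def grothendieck_def simplices_def Fun2_def mk2_def restrict_def fun_eq_iff)
qed

text \<open>The cells of \<open>\<sigma>\<close> are re-read over the vertices of
  \<open>\<tau>\<close> along \<open>\<phi>\<close>, so that both simplices share one vertex
  function and the extension results apply.\<close>

lemma arr_data_pair:
 assumes "arr_data K \<phi> \<sigma> \<tau> a"
 shows "simplex_pair K (Dom Delta \<phi>) (\<lambda>i. PObj \<tau> (app \<phi> i)) (sM \<sigma>) (PUnit \<sigma>) (sC \<sigma>)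
    (\<lambda>i j. sM \<tau> (app \<phi> i) (app \<phi> j)) (\<lambda>i. PUnit \<tau> (app \<phi> i))
    (\<lambda>i j k. sC \<tau> (app \<phi> i) (app \<phi> j) (app \<phi> k))"
proof (rule simplex_pair.intro)
 show "simplex_data K (Dom Delta \<phi>) (\<lambda>i. PObj \<tau> (app \<phi> i)) (sM \<sigma>) (PUnit \<sigma>) (sC \<sigma>)"
  by (rule simplex_data_cong[of _ "PObj \<sigma>"]) (use assms simplex_data_simplex in \<open>auto simp: arr_data_def\<close>)
 show "simplex_data K (Dom Delta \<phi>) (\<lambda>i. PObj \<tau> (app \<phi> i)) (\<lambda>i j. sM \<tau> (app \<phi> i) (app \<phi> j))
   (\<lambda>i. PUnit \<tau> (app \<phi> i)) (\<lambda>i j k. sC \<tau> (app \<phi> i) (app \<phi> j) (app \<phi> k))"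
  using assms by (intro simplex_data_reindex[OF simplex_data_simplex]) (auto simp: arr_data_def)
qed

text \<open>Reindexing the second family along \<open>\<phi>\<close> puts both families over a
  single vertex function, where they compose.\<close>

lemma arr_data_comp:
 assumes a: "arr_data K \<phi> \<sigma> \<tau> a" and b: "arr_data K \<psi> \<tau> \<upsilon> b" and m: "Dom Delta \<psi> = Cod Delta \<phi>"
 shows "arr_data K (\<psi> \<cdot>[Delta] \<phi>) \<sigma> \<upsilon> (\<lambda>i j. b (app \<phi> i) (app \<phi> j) \<cdot>[PHomCat K \<sigma> i j] a i j)"
proof -
 have h: "\<phi> \<in> Arr Delta" "\<psi> \<in> Arr Delta" "is_simplex K (Cod Delta \<psi>) \<upsilon>" "is_simplex K (Dom Delta \<phi>) \<sigma>"
  "\<And>i. i \<le> Dom Delta \<phi> ==> PObj \<sigma> i = PObj \<tau> (app \<phi> i)" "\<And>i. i \<le> Cod Delta \<phi> ==> PObj \<tau> i = PObj \<upsilon> (app \<psi> i)"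
  using a b m by (auto simp: arr_data_def)
 have e: "PObj \<tau> (app \<phi> i) = PObj \<upsilon> (app \<psi> (app \<phi> i))" if "i \<le> Dom Delta \<phi>" for i
  using h that app_le by blast
 let ?m = "Dom Delta \<phi>"
 have s: "smor K ?m (\<lambda>i. PObj \<tau> (app \<phi> i)) (\<lambda>i j. sM \<tau> (app \<phi> i) (app \<phi> j))
    (\<lambda>i. PUnit \<tau> (app \<phi> i)) (\<lambda>i j k. sC \<tau> (app \<phi> i) (app \<phi> j) (app \<phi> k))
    (\<lambda>i j. sM \<upsilon> (app \<psi> (app \<phi> i)) (app \<psi> (app \<phi> j))) (\<lambda>i. PUnit \<upsilon> (app \<psi> (app \<phi> i)))
    (\<lambda>i j k. sC \<upsilon> (app \<psi> (app \<phi> i)) (app \<psi> (app \<phi> j)) (app \<psi> (app \<phi> k))) (\<lambda>i j. b (app \<phi> i) (app \<phi> j))"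
 proof -
  have "smor K (Dom Delta \<psi>) (\<lambda>i. PObj \<upsilon> (app \<psi> i)) (sM \<tau>) (PUnit \<tau>) (sC \<tau>)
    (\<lambda>i j. sM \<upsilon> (app \<psi> i) (app \<psi> j)) (\<lambda>i. PUnit \<upsilon> (app \<psi> i))
    (\<lambda>i j k. sC \<upsilon> (app \<psi> i) (app \<psi> j) (app \<psi> k)) b" using b by (simp add: arr_data_def)
  from smor_reindex[OF this h(1)] show ?thesis
   using m by (rule_tac smor_cong[THEN iffD1, rotated -1]) (simp_all add: e)
 qed
 have d: "simplex_data K ?m (\<lambda>i. PObj \<tau> (app \<phi> i)) (\<lambda>i j. sM \<upsilon> (app \<psi> (app \<phi> i)) (app \<psi> (app \<phi> j)))
   (\<lambda>i. PUnit \<upsilon> (app \<psi> (app \<phi> i))) (\<lambda>i j k. sC \<upsilon> (app \<psi> (app \<phi> i)) (app \<psi> (app \<phi> j)) (app \<psi> (app \<phi> k)))"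
  using simplex_data_reindex[OF simplex_data_reindex[OF simplex_data_simplex[OF h(3)] h(2) refl] h(1)] m
  by (rule_tac simplex_data_cong[rotated]) (simp_all add: e)
 have "smor K ?m (\<lambda>i. PObj \<tau> (app \<phi> i)) (sM \<sigma>) (PUnit \<sigma>) (sC \<sigma>)
    (\<lambda>i j. sM \<upsilon> (app \<psi> (app \<phi> i)) (app \<psi> (app \<phi> j))) (\<lambda>i. PUnit \<upsilon> (app \<psi> (app \<phi> i)))
    (\<lambda>i j k. sC \<upsilon> (app \<psi> (app \<phi> i)) (app \<psi> (app \<phi> j)) (app \<psi> (app \<phi> k)))
    (\<lambda>i j. b (app \<phi> i) (app \<phi> j) \<cdot>[Hom2 K (PObj \<tau> (app \<phi> i)) (PObj \<tau> (app \<phi> j))] a i j)"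
  using smor_comp[OF arr_data_pair[OF a] d _ s] a by (simp add: arr_data_def)
 then have "smor K ?m (\<lambda>i. PObj \<upsilon> (app (\<psi> \<cdot>[Delta] \<phi>) i)) (sM \<sigma>) (PUnit \<sigma>) (sC \<sigma>)
    (\<lambda>i j. sM \<upsilon> (app (\<psi> \<cdot>[Delta] \<phi>) i) (app (\<psi> \<cdot>[Delta] \<phi>) j)) (\<lambda>i. PUnit \<upsilon> (app (\<psi> \<cdot>[Delta] \<phi>) i))
    (\<lambda>i j k. sC \<upsilon> (app (\<psi> \<cdot>[Delta] \<phi>) i) (app (\<psi> \<cdot>[Delta] \<phi>) j) (app (\<psi> \<cdot>[Delta] \<phi>) k))
    (\<lambda>i j. b (app \<phi> i) (app \<phi> j) \<cdot>[PHomCat K \<sigma> i j] a i j)"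
  by (rule smor_cong[THEN iffD1, rotated -1]) (simp_all add: e h(5))
 then show ?thesis using h m e by (simp add: arr_data_def)
qed

lemma arr_data_strict:
 assumes "arr_data K \<phi> \<sigma> \<tau> a"
 shows "strict_2_category K"
 using assms by (auto simp: arr_data_def two_functor_def)

lemma arr_data_simps:
 assumes "arr_data K \<phi> \<sigma> \<tau> a"
 shows "i \<le> j ==> j \<le> Dom Delta \<phi> ==> a i j \<in> Arr (PHomCat K \<sigma> i j)"
  "i \<le> j ==> j \<le> Dom Delta \<phi> ==> Dom (PHomCat K \<sigma> i j) (a i j) = sM \<sigma> i j"
  "i \<le> j ==> j \<le> Dom Delta \<phi> ==> Cod (PHomCat K \<sigma> i j) (a i j) = sM \<tau> (app \<phi> i) (app \<phi> j)"
  "i \<le> j ==> j \<le> k ==> k \<le> Dom Delta \<phi> ==> a i k \<cdot>[PHomCat K \<sigma> i k] sC \<sigma> i j k =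
   sC \<tau> (app \<phi> i) (app \<phi> j) (app \<phi> k) \<cdot>[PHomCat K \<sigma> i k]
    hcomp2 K (PObj \<sigma> i) (PObj \<sigma> j) (PObj \<sigma> k) (a j k) (a i j)"
  "i \<le> Dom Delta \<phi> ==> a i i \<cdot>[PHomCat K \<sigma> i i] PUnit \<sigma> i = PUnit \<tau> (app \<phi> i)"
  "i \<le> Dom Delta \<phi> ==> PObj \<tau> (app \<phi> i) = PObj \<sigma> i"
 using assms smorD[of K "Dom Delta \<phi>" "\<lambda>i. PObj \<tau> (app \<phi> i)" "sM \<sigma>" "PUnit \<sigma>" "sC \<sigma>"
    "\<lambda>i j. sM \<tau> (app \<phi> i) (app \<phi> j)" "\<lambda>i. PUnit \<tau> (app \<phi> i)"
    "\<lambda>i j k. sC \<tau> (app \<phi> i) (app \<phi> j) (app \<phi> k)" a]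
 by (auto simp: arr_data_def)

lemma arr_data_Ide:
 assumes "is_simplex K n \<sigma>"
 shows "arr_data K (Ide Delta n) \<sigma> \<sigma> (\<lambda>i j. Ide (PHomCat K \<sigma> i j) (sM \<sigma> i j))"
proof -
 have "smor K n (\<lambda>i. PObj \<sigma> (app (Ide Delta n) i)) (sM \<sigma>) (PUnit \<sigma>) (sC \<sigma>)
  (\<lambda>i j. sM \<sigma> (app (Ide Delta n) i) (app (Ide Delta n) j)) (\<lambda>i. PUnit \<sigma> (app (Ide Delta n) i))
  (\<lambda>i j k. sC \<sigma> (app (Ide Delta n) i) (app (Ide Delta n) j) (app (Ide Delta n) k))
  (\<lambda>i j. Ide (PHomCat K \<sigma> i j) (sM \<sigma> i j))"
  using smor_Ide[OF simplex_data_simplex[OF assms]] by (rule smor_cong[THEN iffD1, rotated -1]) simp_all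
 then show ?thesis using assms by (simp add: arr_data_def)
qed

lemma SR_garr: "arr_data K \<phi> \<sigma> \<tau> a ==> garr K \<phi> \<sigma> a \<tau> \<in> Arr (SR K)"
 using SR_Arr_iff by blast

lemma SR_category [simp]: "category (SR K)"
proof (rule categoryI)
 fix f assume "f \<in> Arr (SR K)"
 then obtain \<phi> \<sigma> a \<tau> where f: "arr_data K \<phi> \<sigma> \<tau> a" "f = garr K \<phi> \<sigma> a \<tau>" unfolding SR_Arr_iff by blast
 then have h: "\<phi> \<in> Arr Delta" "is_simplex K (Cod Delta \<phi>) \<tau>" "is_simplex K (Dom Delta \<phi>) \<sigma>"
  by (auto simp: arr_data_def)
 interpret strict_2_category K by (rule arr_data_strict[OF f(1)])
 interpret S: simplex_data K "Dom Delta \<phi>" "PObj \<sigma>" "sM \<sigma>" "PUnit \<sigma>" "sC \<sigma>" by (rule simplex_data_simplex[OF h(3)])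
 show "Dom (SR K) f \<in> Obj (SR K) \<and> Cod (SR K) f \<in> Obj (SR K)" using h by (simp add: f)
 show "Ide (SR K) (Cod (SR K) f) \<cdot>[SR K] f = f \<and> f \<cdot>[SR K] Ide (SR K) (Dom (SR K) f) = f"
  unfolding f(2) SR_Dom SR_Cod SR_Ide[OF h(2)] SR_Ide[OF h(3)]
  unfolding SR_Comp[OF f(1) arr_data_Ide[OF h(2)] Delta_Dom_comp(3)]
   SR_Comp[OF arr_data_Ide[OF h(3)] f(1) Delta_Dom_comp(4)[symmetric]]
  using h(1) arr_data_simps[OF f(1)] by (auto intro!: garr_cong)
next
 fix x assume "x \<in> Obj (SR K)"
 then obtain n \<sigma> where x: "x = (n, \<sigma>)" "is_simplex K n \<sigma>" by (cases x) auto
 then show "Ide (SR K) x \<in> Arr (SR K) \<and> Dom (SR K) (Ide (SR K) x) = x \<and> Cod (SR K) (Ide (SR K) x) = x"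
  using SR_garr[OF arr_data_Ide[OF x(2)]] by (simp add: SR_Ide)
next
 fix f g assume fg: "f \<in> Arr (SR K)" "g \<in> Arr (SR K)" "Dom (SR K) g = Cod (SR K) f"
 obtain \<phi> \<sigma> a \<tau> where f: "arr_data K \<phi> \<sigma> \<tau> a" "f = garr K \<phi> \<sigma> a \<tau>" using fg unfolding SR_Arr_iff by blast
 obtain \<psi> \<tau>' \<upsilon> b where g': "arr_data K \<psi> \<tau>' \<upsilon> b" "g = garr K \<psi> \<tau>' b \<upsilon>" using fg(2) unfolding SR_Arr_iff by blast
 have g: "arr_data K \<psi> \<tau> \<upsilon> b" "g = garr K \<psi> \<tau> b \<upsilon>" "Dom Delta \<psi> = Cod Delta \<phi>" using g' fg(3) f by auto
 have h: "\<phi> \<in> Arr Delta" "\<psi> \<in> Arr Delta" using f g by (auto simp: arr_data_def)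
 show "g \<cdot>[SR K] f \<in> Arr (SR K) \<and> Dom (SR K) (g \<cdot>[SR K] f) = Dom (SR K) f \<and>
   Cod (SR K) (g \<cdot>[SR K] f) = Cod (SR K) g"
  unfolding f(2) g(2) SR_Comp[OF f(1) g(1,3)] using SR_garr[OF arr_data_comp[OF f(1) g(1,3)]] g(3) h by simp
next
 fix f g h assume fgh: "f \<in> Arr (SR K)" "g \<in> Arr (SR K)" "h \<in> Arr (SR K)"
  "Dom (SR K) g = Cod (SR K) f" "Dom (SR K) h = Cod (SR K) g"
 obtain \<phi> \<sigma> a \<tau> where f: "arr_data K \<phi> \<sigma> \<tau> a" "f = garr K \<phi> \<sigma> a \<tau>" using fgh unfolding SR_Arr_iff by blast
 obtain \<psi> \<tau>' \<upsilon> b where g': "arr_data K \<psi> \<tau>' \<upsilon> b" "g = garr K \<psi> \<tau>' b \<upsilon>" using fgh(2) unfolding SR_Arr_iff by blast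
 have g: "arr_data K \<psi> \<tau> \<upsilon> b" "g = garr K \<psi> \<tau> b \<upsilon>" "Dom Delta \<psi> = Cod Delta \<phi>" using g' fgh(4) f by auto
 obtain \<chi> \<upsilon>' \<omega> c where h': "arr_data K \<chi> \<upsilon>' \<omega> c" "h = garr K \<chi> \<upsilon>' c \<omega>" using fgh(3) unfolding SR_Arr_iff by blast
 have h: "arr_data K \<chi> \<upsilon> \<omega> c" "h = garr K \<chi> \<upsilon> c \<omega>" "Dom Delta \<chi> = Cod Delta \<psi>" using h' fgh(5) g by auto
 have D: "\<phi> \<in> Arr Delta" "\<psi> \<in> Arr Delta" "\<chi> \<in> Arr Delta" using f g h by (auto simp: arr_data_def)
 have D': "Dom Delta \<chi> = Cod Delta (\<psi> \<cdot>[Delta] \<phi>)" "Dom Delta (\<chi> \<cdot>[Delta] \<psi>) = Cod Delta \<phi>"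
  using D g h by simp_all
 interpret strict_2_category K by (rule arr_data_strict[OF f(1)])
 interpret S: simplex_data K "Dom Delta \<phi>" "PObj \<sigma>" "sM \<sigma>" "PUnit \<sigma>" "sC \<sigma>"
  using f(1) by (intro simplex_data_simplex) (simp add: arr_data_def)
 have e: "PObj \<tau> (app \<phi> i) = PObj \<sigma> i" "PObj \<upsilon> (app \<psi> (app \<phi> i)) = PObj \<sigma> i" if "i \<le> Dom Delta \<phi>" for i
  using that arr_data_simps(6)[OF f(1), of i] arr_data_simps(6)[OF g(1), of "app \<phi> i"] g(3) D by simp_all
 show "h \<cdot>[SR K] (g \<cdot>[SR K] f) = (h \<cdot>[SR K] g) \<cdot>[SR K] f"
  unfolding f(2) g(2) h(2) SR_Comp[OF f(1) g(1,3)] SR_Comp[OF g(1) h(1,3)]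
   SR_Comp[OF arr_data_comp[OF f(1) g(1,3)] h(1) D'(1)] SR_Comp[OF f(1) arr_data_comp[OF g(1) h(1,3)] D'(2)]
  unfolding category_simps(11)[OF Delta_category D g(3) h(3)]
 proof (rule garr_cong)
  fix i j assume ij: "i \<le> j" "j \<le> Dom Delta (\<chi> \<cdot>[Delta] \<psi> \<cdot>[Delta] \<phi>)"
  then have ij': "i \<le> j" "j \<le> Dom Delta \<phi>" "i \<le> Dom Delta \<phi>" using D g(3) h(3) by simp_all
  then have ij'': "app \<phi> i \<le> app \<phi> j" "app \<phi> j \<le> Dom Delta \<psi>" "app \<psi> (app \<phi> i) \<le> app \<psi> (app \<phi> j)"
   "app \<psi> (app \<phi> j) \<le> Dom Delta \<chi>" using D g(3) h(3) by simp_all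
  show "c (app (\<psi> \<cdot>[Delta] \<phi>) i) (app (\<psi> \<cdot>[Delta] \<phi>) j) \<cdot>[PHomCat K \<sigma> i j]
     b (app \<phi> i) (app \<phi> j) \<cdot>[PHomCat K \<sigma> i j] a i j =
     (c (app \<psi> (app \<phi> i)) (app \<psi> (app \<phi> j)) \<cdot>[PHomCat K \<tau> (app \<phi> i) (app \<phi> j)]
     b (app \<phi> i) (app \<phi> j)) \<cdot>[PHomCat K \<sigma> i j] a i j"
   using arr_data_simps(1-3)[OF f(1) ij'(1,2)] arr_data_simps(1-3)[OF g(1) ij''(1,2)]
    arr_data_simps(1-3)[OF h(1) ij''(3,4)] ij' by (simp add: e)
 qed
qed

section \<open>Arrows of the simplicial replacement in terms of their components\<close>

lemma SR_arrD:
 assumes "h \<in> Arr (SR K)" "Dom (SR K) h = (m, \<sigma>)" "Cod (SR K) h = (n, \<tau>)"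
 shows "fst h \<in> Arr Delta" "Dom Delta (fst h) = m" "Cod Delta (fst h) = n"
  "arr_data K (fst h) \<sigma> \<tau> (gc h)" "h = garr K (fst h) \<sigma> (gc h) \<tau>"
proof -
 obtain \<phi> \<sigma>' a \<tau>' where h: "arr_data K \<phi> \<sigma>' \<tau>' a" "h = garr K \<phi> \<sigma>' a \<tau>'"
  using assms(1) unfolding SR_Arr_iff by blast
 then have e: "\<sigma>' = \<sigma>" "\<tau>' = \<tau>" "Dom Delta \<phi> = m" "Cod Delta \<phi> = n" using assms(2,3) by auto
 show "fst h \<in> Arr Delta" "Dom Delta (fst h) = m" "Cod Delta (fst h) = n" using h e by (auto simp: arr_data_def)
 have "smor K (Dom Delta \<phi>) V M U P M' U' P' a = smor K (Dom Delta \<phi>) V M U P M' U' P' (gc h)"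
  for V M U P M' U' P' by (rule smor_cong) (simp_all add: h(2))
 then show "arr_data K (fst h) \<sigma> \<tau> (gc h)" using h(1) by (simp add: e arr_data_def h(2))
 have "garr K \<phi> \<sigma> a \<tau> = garr K \<phi> \<sigma> (gc h) \<tau>" by (rule garr_cong) (simp add: h(2))
 then show "h = garr K (fst h) \<sigma> (gc h) \<tau>" using h(2) e by simp
qed

lemma SR_eqI:
 assumes "h \<in> Arr (SR K)" "h' \<in> Arr (SR K)" "Dom (SR K) h = Dom (SR K) h'" "Cod (SR K) h = Cod (SR K) h'"
  "fst h = fst h'" "\<And>i j. i \<le> j ==> j \<le> fst (Dom (SR K) h) ==> gc h i j = gc h' i j"
 shows "h = h'"
proof -
 obtain m \<sigma> n \<tau> where d: "Dom (SR K) h = (m, \<sigma>)" "Cod (SR K) h = (n, \<tau>)" by fastforce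
 note e = SR_arrD[OF assms(1) d] SR_arrD[OF assms(2) d[unfolded assms(3,4)]]
 have "garr K (fst h) \<sigma> (gc h) \<tau> = garr K (fst h) \<sigma> (gc h') \<tau>"
  by (rule garr_cong) (use assms(6) d e(2) in auto)
 then show ?thesis using e(5,10) assms(5) by simp
qed

lemma gc_comp:
 assumes "h \<in> Arr (SR K)" "k \<in> Arr (SR K)" "Dom (SR K) k = Cod (SR K) h" "Dom (SR K) h = (m, \<sigma>)"
  "i \<le> j" "j \<le> m"
 shows "gc (k \<cdot>[SR K] h) i j = gc k (app (fst h) i) (app (fst h) j) \<cdot>[PHomCat K \<sigma> i j] gc h i j"
  "fst (k \<cdot>[SR K] h) = fst k \<cdot>[Delta] fst h"
proof -
 obtain n \<tau> p \<upsilon> where d: "Cod (SR K) h = (n, \<tau>)" "Cod (SR K) k = (p, \<upsilon>)" by fastforce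
 note H = SR_arrD[OF assms(1,4) d(1)] and G = SR_arrD[OF assms(2) assms(3)[unfolded d(1)] d(2)]
 have m: "Dom Delta (fst k) = Cod Delta (fst h)" using H G by simp
 have e: "k \<cdot>[SR K] h = garr K (fst k \<cdot>[Delta] fst h) \<sigma>
   (\<lambda>i j. gc k (app (fst h) i) (app (fst h) j) \<cdot>[PHomCat K \<sigma> i j] gc h i j) \<upsilon>"
  using SR_Comp[OF H(4) G(4) m] H(5) G(5) by simp
 show "gc (k \<cdot>[SR K] h) i j = gc k (app (fst h) i) (app (fst h) j) \<cdot>[PHomCat K \<sigma> i j] gc h i j"
  unfolding e using assms H(1,2) G(1) m by simp
 show "fst (k \<cdot>[SR K] h) = fst k \<cdot>[Delta] fst h" unfolding e by simp
qed

lemma gc_Ide: "is_simplex K n \<sigma> ==> i \<le> j ==> j \<le> n ==>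
  gc (Ide (SR K) (n, \<sigma>)) i j = Ide (PHomCat K \<sigma> i j) (sM \<sigma> i j)"
 by (simp add: SR_Ide)

lemma fst_SR_Ide [simp]: "is_simplex K n \<sigma> ==> fst (Ide (SR K) (n, \<sigma>)) = Ide Delta n"
 by (simp add: SR_Ide)

abbreviation SP :: "('o, 'm, 't) two_cat => (nat \<times> ('o, 'm, 't) simplex,
  delta_arr \<times> ('o, 'm, 't) simplex_arr \<times> ('o, 'm, 't) simplex, nat, delta_arr) fct" where
 "SP \<equiv> simp_repl_proj"

lemma SP_simps [simp]:
 "X \<in> Obj (SR K) ==> FObj (SP K) X = fst X" "h \<in> Arr (SR K) ==> FArr (SP K) h = fst h"
 by (auto simp: simp_repl_proj_def grothendieck_proj_def simp_repl_def[symmetric])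

lemma SP_functor [simp]: "cat_functor (SR K) Delta (SP K)"
proof (rule cat_functorI)
 show "FArr (SP K) \<in> extensional (Arr (SR K))"
  by (auto simp: simp_repl_proj_def grothendieck_proj_def simp_repl_def[symmetric])
 have "FObj (SP K) \<in> extensional (Obj (SR K))"
  by (auto simp: simp_repl_proj_def grothendieck_proj_def simp_repl_def[symmetric])
 then show "FObj (SP K) \<in> Obj (SR K) \<rightarrow>\<^sub>E Obj Delta" by (simp add: PiE_def)
next
 fix f assume f: "f \<in> Arr (SR K)"
 obtain m \<sigma> n \<tau> where d: "Dom (SR K) f = (m, \<sigma>)" "Cod (SR K) f = (n, \<tau>)" by fastforce
 show "FArr (SP K) f \<in> Arr Delta \<and> Dom Delta (FArr (SP K) f) = FObj (SP K) (Dom (SR K) f) \<and>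
   Cod Delta (FArr (SP K) f) = FObj (SP K) (Cod (SR K) f)"
  using SR_arrD(1-3)[OF f d] d f category_simps(1,2)[OF SR_category f] by simp
next
 fix x assume "x \<in> Obj (SR K)"
 then show "FArr (SP K) (Ide (SR K) x) = Ide Delta (FObj (SP K) x)" by (cases x) simp
next
 fix f g assume "f \<in> Arr (SR K)" "g \<in> Arr (SR K)" "Dom (SR K) g = Cod (SR K) f"
 then show "FArr (SP K) (g \<cdot>[SR K] f) = FArr (SP K) g \<cdot>[Delta] FArr (SP K) f"
  using gc_comp(2)[of f K g "fst (Dom (SR K) f)" "snd (Dom (SR K) f)" 0 0] by simp
qed simp_all

text \<open>The 2-cells on consecutive edges are unconstrained, since every relation among the
  components can be solved by the composition isomorphisms. Invertibility is carried along because
  it will characterize cartesian arrows.\<close>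

lemma SR_fill:
 assumes "\<phi> \<in> Arr Delta" "Dom Delta \<phi> = m" "Cod Delta \<phi> = n" "is_simplex K m \<sigma>" "is_simplex K n \<tau>"
  "\<And>i. i \<le> m ==> PObj \<sigma> i = PObj \<tau> (app \<phi> i)"
  "\<And>i. i < m ==> s i \<in> hom (PHomCat K \<sigma> i (Suc i)) (sM \<sigma> i (Suc i)) (sM \<tau> (app \<phi> i) (app \<phi> (Suc i)))"
 obtains h where "h \<in> Arr (SR K)" "Dom (SR K) h = (m, \<sigma>)" "Cod (SR K) h = (n, \<tau>)" "fst h = \<phi>"
  "\<And>i. i < m ==> gc h i (Suc i) = s i"
  "(\<forall>i < m. iso (PHomCat K \<sigma> i (Suc i)) (s i)) \<longrightarrow>
   (\<forall>i j. i \<le> j \<longrightarrow> j \<le> m \<longrightarrow> iso (PHomCat K \<sigma> i j) (gc h i j))"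
proof -
 let ?V = "\<lambda>i. PObj \<tau> (app \<phi> i)"
 have "simplex_data K m ?V (sM \<sigma>) (PUnit \<sigma>) (sC \<sigma>)"
  by (rule simplex_data_cong[of _ "PObj \<sigma>"]) (use assms simplex_data_simplex in auto)
 moreover have "simplex_data K m ?V (\<lambda>i j. sM \<tau> (app \<phi> i) (app \<phi> j))
   (\<lambda>i. PUnit \<tau> (app \<phi> i)) (\<lambda>i j k. sC \<tau> (app \<phi> i) (app \<phi> j) (app \<phi> k))"
  using simplex_data_reindex[OF simplex_data_simplex[OF assms(5)] assms(1,3)] assms(2) by simp
 ultimately interpret simplex_pair K m ?V "sM \<sigma>" "PUnit \<sigma>" "sC \<sigma>" "\<lambda>i j. sM \<tau> (app \<phi> i) (app \<phi> j)"
   "\<lambda>i. PUnit \<tau> (app \<phi> i)" "\<lambda>i j k. sC \<tau> (app \<phi> i) (app \<phi> j) (app \<phi> k)" by (rule simplex_pair.intro)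
 obtain a where a: "mor a" "\<And>i. i < m ==> a i (Suc i) = s i"
  "(\<forall>i < m. iso (Hom2 K (?V i) (?V (Suc i))) (s i)) \<longrightarrow>
   (\<forall>i j. i \<le> j \<longrightarrow> j \<le> m \<longrightarrow> iso (Hom2 K (?V i) (?V j)) (a i j))"
 proof -
  have "s i \<in> hom (Hom2 K (?V i) (?V (Suc i))) (sM \<sigma> i (Suc i)) (sM \<tau> (app \<phi> i) (app \<phi> (Suc i)))"
   if "i < m" for i using assms(6)[of i] assms(6)[of "Suc i"] assms(7)[of i] that by simp
  then show thesis using that mor_spine_exists[of s] by blast
 qed
 have d: "arr_data K \<phi> \<sigma> \<tau> a" using a assms by (simp add: arr_data_def)
 show ?thesis
 proof (rule that[of "garr K \<phi> \<sigma> a \<tau>"])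
  show "(\<forall>i < m. iso (PHomCat K \<sigma> i (Suc i)) (s i)) \<longrightarrow>
    (\<forall>i j. i \<le> j \<longrightarrow> j \<le> m \<longrightarrow> iso (PHomCat K \<sigma> i j) (gc (garr K \<phi> \<sigma> a \<tau>) i j))"
   using a(3) assms(2,6) by simp
 qed (use assms a SR_garr[OF d] in auto)
qed

text \<open>Counterpart of \<open>SR_fill\<close>: together they identify arrows over a fixed map,
  between simplices with matching vertices, with families of 2-cells on consecutive edges.\<close>

lemma SR_spine_unique:
 assumes "h \<in> Arr (SR K)" "h' \<in> Arr (SR K)" "Dom (SR K) h = (m, \<sigma>)" "Dom (SR K) h' = (m, \<sigma>)"
  "Cod (SR K) h = Cod (SR K) h'" "fst h = fst h'" "\<And>i. i < m ==> gc h i (Suc i) = gc h' i (Suc i)"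
 shows "h = h'"
proof (rule SR_eqI)
 obtain n \<tau> where d: "Cod (SR K) h = (n, \<tau>)" "Cod (SR K) h' = (n, \<tau>)" using assms(5) by fastforce
 note H = SR_arrD[OF assms(1,3) d(1)] and H' = SR_arrD[OF assms(2,4) d(2)]
 interpret simplex_pair K "Dom Delta (fst h)" "\<lambda>i. PObj \<tau> (app (fst h) i)" "sM \<sigma>" "PUnit \<sigma>" "sC \<sigma>"
  "\<lambda>i j. sM \<tau> (app (fst h) i) (app (fst h) j)" "\<lambda>i. PUnit \<tau> (app (fst h) i)"
  "\<lambda>i j k. sC \<tau> (app (fst h) i) (app (fst h) j) (app (fst h) k)" by (rule arr_data_pair[OF H(4)])
 show "gc h i j = gc h' i j" if "i \<le> j" "j \<le> fst (Dom (SR K) h)" for i j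
  using H(2,4) H'(4) assms(3,6,7) that
  by (intro mor_spine_unique[of "gc h" "gc h'" i j]) (auto simp: arr_data_def)
qed (use assms in auto)

section \<open>Cartesian arrows\<close>

lemma cartesianD:
 assumes "cartesian C I \<pi> f" "f' \<in> Arr C" "Cod C f' = Cod C f" "FArr \<pi> f' = FArr \<pi> f"
 obtains f0 where "f0 \<in> Arr C" "Dom C f0 = Dom C f'" "Cod C f0 = Dom C f"
  "FArr \<pi> f0 = Ide I (FObj \<pi> (Dom C f))" "f \<cdot>[C] f0 = f'"
proof -
 have "\<exists>f0. f0 \<in> hom C (Dom C f') (Dom C f) \<and> FArr \<pi> f0 = Ide I (FObj \<pi> (Dom C f)) \<and> f \<cdot>[C] f0 = f'"
  using assms unfolding cartesian_def by blast
 then show ?thesis using that by auto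
qed

lemma cartesian_arr: "cartesian C I \<pi> f ==> f \<in> Arr C"
 by (simp add: cartesian_def)

lemma cartesian_cancel:
 assumes "cat_functor C I \<pi>" "cartesian C I \<pi> f" "u \<in> Arr C" "v \<in> Arr C" "Dom C u = Dom C v"
  "Cod C u = Dom C f" "Cod C v = Dom C f" "FArr \<pi> u = Ide I (FObj \<pi> (Dom C f))"
  "FArr \<pi> v = Ide I (FObj \<pi> (Dom C f))" "f \<cdot>[C] u = f \<cdot>[C] v"
 shows "u = v"
proof -
 have c: "category C" "category I" using assms(1) by (auto dest: cat_functor_cat)
 note [simp] = c cat_functor_simps[OF assms(1)] cartesian_arr[OF assms(2)]
 have "\<exists>!f0. f0 \<in> hom C (Dom C (f \<cdot>[C] u)) (Dom C f) \<and> FArr \<pi> f0 = Ide I (FObj \<pi> (Dom C f)) \<and>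
   f \<cdot>[C] f0 = f \<cdot>[C] u"
  using assms by (intro assms(2)[unfolded cartesian_def, THEN conjunct2, rule_format]) simp_all
 then show ?thesis using assms by (metis c(1) cartesian_arr category_simps(7) hom_iff)
qed

lemma vertical_iso_inv:
 assumes "cat_functor C I \<pi>" "iso C v" "FArr \<pi> v = Ide I x" "x \<in> Obj I"
 shows "FArr \<pi> (inv_arr C v) = Ide I x"
 using functor_inv_arr[OF assms(1,2)] assms cat_functor_cat(2)[OF assms(1)] by simp

text \<open>Factoring the identity through \<open>f\<close> gives a right inverse; uniqueness of
  factorizations makes it two-sided.\<close>

lemma vertical_cartesian_iso:
 assumes "cat_functor C I \<pi>" "cartesian C I \<pi> f" "FArr \<pi> f = Ide I (FObj \<pi> (Cod C f))"
 shows "iso C f"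
proof -
 have c [simp]: "category C" "category I" using assms(1) by (auto dest: cat_functor_cat)
 note [simp] = cat_functor_simps[OF assms(1)] cartesian_arr[OF assms(2)]
 have "Dom I (FArr \<pi> f) = FObj \<pi> (Cod C f)" unfolding assms(3) by simp
 then have e: "FObj \<pi> (Dom C f) = FObj \<pi> (Cod C f)" by simp
 obtain g where g: "g \<in> Arr C" "Dom C g = Cod C f" "Cod C g = Dom C f"
  "FArr \<pi> g = Ide I (FObj \<pi> (Dom C f))" "f \<cdot>[C] g = Ide C (Cod C f)"
  by (rule cartesianD[OF assms(2), of "Ide C (Cod C f)"]) (use assms(3) in simp_all)
 have "g \<cdot>[C] f = Ide C (Dom C f)"
 proof (rule cartesian_cancel[OF assms(1,2)])
  have "f \<cdot>[C] g \<cdot>[C] f = (f \<cdot>[C] g) \<cdot>[C] f"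
   by (rule category_simps(11)[OF c(1), symmetric]) (use g in simp_all)
  then show "f \<cdot>[C] g \<cdot>[C] f = f \<cdot>[C] Ide C (Dom C f)" unfolding g(5) by simp
 qed (use g assms(3) e in simp_all)
 then show ?thesis using g by (intro isoI[of f C g]) simp_all
qed

text \<open>Each lift factors through the other, and either round trip factors a lift through
  itself, hence is an identity.\<close>

lemma cartesian_compare:
 assumes "cat_functor C I \<pi>" "cartesian C I \<pi> f" "cartesian C I \<pi> g" "Cod C f = Cod C g" "FArr \<pi> f = FArr \<pi> g"
 obtains v where "iso C v" "Dom C v = Dom C g" "Cod C v = Dom C f" "FArr \<pi> v = Ide I (FObj \<pi> (Dom C f))"
  "f \<cdot>[C] v = g"
proof -
 have c [simp]: "category C" "category I" using assms(1) by (auto dest: cat_functor_cat)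
 note [simp] = cat_functor_simps[OF assms(1)] cartesian_arr[OF assms(2)] cartesian_arr[OF assms(3)]
 have "Dom I (FArr \<pi> f) = Dom I (FArr \<pi> g)" using assms(5) by simp
 then have e: "FObj \<pi> (Dom C f) = FObj \<pi> (Dom C g)" by simp
 obtain v where v: "v \<in> Arr C" "Dom C v = Dom C g" "Cod C v = Dom C f"
  "FArr \<pi> v = Ide I (FObj \<pi> (Dom C f))" "f \<cdot>[C] v = g"
  by (rule cartesianD[OF assms(2), of g]) (use assms(4,5) in simp_all)
 obtain w where w: "w \<in> Arr C" "Dom C w = Dom C f" "Cod C w = Dom C g"
  "FArr \<pi> w = Ide I (FObj \<pi> (Dom C g))" "g \<cdot>[C] w = f"
  by (rule cartesianD[OF assms(3), of f]) (use assms(4,5) in simp_all)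
 have "w \<cdot>[C] v = Ide C (Dom C g)"
 proof (rule cartesian_cancel[OF assms(1,3)])
  have "g \<cdot>[C] w \<cdot>[C] v = (g \<cdot>[C] w) \<cdot>[C] v"
   by (rule category_simps(11)[OF c(1), symmetric]) (use v w in simp_all)
  then show "g \<cdot>[C] w \<cdot>[C] v = g \<cdot>[C] Ide C (Dom C g)" unfolding v(5) w(5) by simp
 qed (use v w e in simp_all)
 moreover have "v \<cdot>[C] w = Ide C (Dom C f)"
 proof (rule cartesian_cancel[OF assms(1,2)])
  have "f \<cdot>[C] v \<cdot>[C] w = (f \<cdot>[C] v) \<cdot>[C] w"
   by (rule category_simps(11)[OF c(1), symmetric]) (use v w in simp_all)
  then show "f \<cdot>[C] v \<cdot>[C] w = f \<cdot>[C] Ide C (Dom C f)" unfolding v(5) w(5) by simp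
 qed (use v w e in simp_all)
 ultimately have "iso C v" using v w by (intro isoI[of v C w]) simp_all
 then show ?thesis using that v by blast
qed

text \<open>Isomorphisms of \<open>\<Delta>\<close> are identities, so an equivalence over \<open>\<Delta>\<close> has a quasi-inverse strictly
 over \<open>\<Delta>\<close>, and it automatically preserves cartesian arrows.\<close>

lemma iso_over_Delta:
 assumes "cat_functor C Delta \<pi>" "iso C f"
 shows "FArr \<pi> f = Ide Delta (FObj \<pi> (Dom C f))" "FObj \<pi> (Cod C f) = FObj \<pi> (Dom C f)"
proof -
 note [simp] = cat_functor_simps[OF assms(1)]
 show *: "FArr \<pi> f = Ide Delta (FObj \<pi> (Dom C f))"
  using Delta_iso_Ide[OF functor_iso[OF assms]] assms(2) by simp
 have "Cod Delta (FArr \<pi> f) = FObj \<pi> (Dom C f)" unfolding * by simp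
 then show "FObj \<pi> (Cod C f) = FObj \<pi> (Dom C f)" using assms(2) by simp
qed

lemma over_simps:
 assumes "comp_fct C \<rho> F = \<pi>"
 shows "x \<in> Obj C ==> FObj \<rho> (FObj F x) = FObj \<pi> x" "f \<in> Arr C ==> FArr \<rho> (FArr F f) = FArr \<pi> f"
 by (simp_all flip: assms)

text \<open>The counit consists of isomorphisms, which lie over identities of \<open>Delta\<close>;
  its naturality square therefore projects to the equality of the images of \<open>G f\<close> and
  \<open>f\<close>.\<close>

lemma quasi_inverse_over:
 assumes "cat_functor C D F" "cat_functor D C G" "cat_functor D Delta \<rho>" "cat_functor C Delta \<pi>"
  "comp_fct C \<rho> F = \<pi>" "nat_iso D D (comp_fct D F G) (id_fct D) \<epsilon>"
 shows "comp_fct D \<pi> G = \<rho>"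
proof (rule fct_eqI)
 have [simp]: "category C" "category D" using assms(1) by (auto dest: cat_functor_cat)
 note [simp] = cat_functor_simps[OF assms(1)] cat_functor_simps[OF assms(2)] cat_functor_simps[OF assms(3)]
  cat_functor_simps[OF assms(4)] over_simps[OF assms(5)]
 note e = nat_isoD[OF assms(6)]
 have o: "FObj \<rho> x = FObj \<pi> (FObj G x)" "FArr \<rho> (\<epsilon> x) = Ide Delta (FObj \<rho> x)" if "x \<in> Obj D" for x
  using iso_over_Delta[OF assms(3) e(4)[OF that]] e(5,6)[OF that] that by simp_all
 show "cat_functor D Delta (comp_fct D \<pi> G)" using comp_fct_functor assms by blast
 show "cat_functor D Delta \<rho>" by fact
 show "FObj (comp_fct D \<pi> G) x = FObj \<rho> x" if "x \<in> Obj D" for x using o(1)[OF that] that by simp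
 show "FArr (comp_fct D \<pi> G) f = FArr \<rho> f" if f: "f \<in> Arr D" for f
 proof -
  have "FArr \<rho> (\<epsilon> (Cod D f) \<cdot>[D] FArr F (FArr G f)) = FArr \<rho> (f \<cdot>[D] \<epsilon> (Dom D f))"
   using e(7)[OF f] f by simp
  then show ?thesis
   using f o(2)[of "Cod D f"] o(2)[of "Dom D f"] o(1)[of "Cod D f"] o(1)[of "Dom D f"]
    e(4-6)[of "Cod D f"] e(4-6)[of "Dom D f"] by simp
 qed
qed

text \<open>Essential surjectivity replaces a test arrow by one whose source is in the image; the
  replacement is vertical because isomorphisms of \<open>Delta\<close> are identities. Full
  faithfulness then transfers existence and uniqueness of the factorization from
  \<open>C\<close>.\<close>

lemma equivalence_preserves_cartesian:
 assumes "equivalence C D F" "cat_functor D Delta \<rho>" "cat_functor C Delta \<pi>" "comp_fct C \<rho> F = \<pi>"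
  "cartesian C Delta \<pi> f"
 shows "cartesian D Delta \<rho> (FArr F f)"
proof -
 have F: "cat_functor C D F" and ff: "fully_faithful C D F" and es: "ess_surjective C D F"
  using assms(1) by (auto simp: equivalence_iff)
 have [simp]: "category C" "category D" using F by (auto dest: cat_functor_cat)
 note [simp] = cat_functor_simps[OF F] cat_functor_simps[OF assms(2)] cat_functor_simps[OF assms(3)]
  over_simps[OF assms(4)] functor_iso[OF F] cartesian_arr[OF assms(5)]
 let ?\<phi> = "FArr \<pi> f" and ?I = "Ide Delta (FObj \<pi> (Dom C f))"
 show ?thesis
  unfolding cartesian_def
 proof (intro conjI ballI impI)
  fix f' assume f': "f' \<in> Arr D" "Cod D f' = Cod D (FArr F f) \<and> FArr \<rho> f' = FArr \<rho> (FArr F f)"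
  have "FObj \<rho> (Dom D f') = Dom Delta (FArr \<rho> f')" using f'(1) by simp
  also have "\<dots> = FObj \<pi> (Dom C f)" unfolding conjunct2[OF f'(2)] by simp
  finally have d: "FObj \<rho> (Dom D f') = FObj \<pi> (Dom C f)" .
  obtain a e where a: "a \<in> Obj C" "iso D e" "Dom D e = FObj F a" "Cod D e = Dom D f'"
   using es f' unfolding ess_surjective_def by (metis category_simps(1) \<open>category D\<close>)
  have pe: "FArr \<rho> e = ?I" "FObj \<pi> a = FObj \<pi> (Dom C f)"
   using iso_over_Delta[OF assms(2) a(2)] a d by simp_all
  have pie: "FArr \<rho> (inv_arr D e) = ?I" by (rule vertical_iso_inv[OF assms(2) a(2) pe(1)]) simp
  obtain g where g: "g \<in> Arr C" "Dom C g = a" "Cod C g = Cod C f" "FArr F g = f' \<cdot>[D] e"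
   using fully_faithfulD[OF ff, of a "Cod C f" "f' \<cdot>[D] e"] a f' by auto
  have "FArr \<pi> g = FArr \<rho> (FArr F g)" using g(1) by simp
  also have "\<dots> = ?\<phi>" unfolding g(4) using f' a pe by simp
  finally have pg: "FArr \<pi> g = ?\<phi>" .
  obtain g0 where g0: "g0 \<in> Arr C" "Dom C g0 = a" "Cod C g0 = Dom C f" "FArr \<pi> g0 = ?I" "f \<cdot>[C] g0 = g"
   by (rule cartesianD[OF assms(5), of g]) (use g pg in auto)
  let ?k = "FArr F g0 \<cdot>[D] inv_arr D e"
  show "\<exists>!f0. f0 \<in> hom D (Dom D f') (Dom D (FArr F f)) \<and>
    FArr \<rho> f0 = Ide Delta (FObj \<rho> (Dom D (FArr F f))) \<and> FArr F f \<cdot>[D] f0 = f'"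
  proof (rule ex1I[of _ ?k])
   have "FArr F f \<cdot>[D] ?k = FArr F (f \<cdot>[C] g0) \<cdot>[D] inv_arr D e"
    using g0(1-4) a f' by simp
   also have "\<dots> = f'" unfolding g0(5) g(4) using a f' by simp
   finally show "?k \<in> hom D (Dom D f') (Dom D (FArr F f)) \<and>
    FArr \<rho> ?k = Ide Delta (FObj \<rho> (Dom D (FArr F f))) \<and> FArr F f \<cdot>[D] ?k = f'"
    using g0(1-4) a f' pe pie by simp
  next
   fix k assume k: "k \<in> hom D (Dom D f') (Dom D (FArr F f)) \<and>
    FArr \<rho> k = Ide Delta (FObj \<rho> (Dom D (FArr F f))) \<and> FArr F f \<cdot>[D] k = f'"
   obtain k0 where k0: "k0 \<in> Arr C" "Dom C k0 = a" "Cod C k0 = Dom C f" "FArr F k0 = k \<cdot>[D] e"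
    using fully_faithfulD[OF ff, of a "Dom C f" "k \<cdot>[D] e"] a k by auto
   have "FArr \<pi> k0 = FArr \<rho> (FArr F k0)" using k0(1) by simp
   also have "\<dots> = ?I" unfolding k0(4) using k a pe by simp
   finally have pk: "FArr \<pi> k0 = ?I" .
   have "FArr F (f \<cdot>[C] k0) = FArr F g" using k0 g k a by (simp flip: category_simps(11))
   then have "f \<cdot>[C] k0 = g" by (rule faithfulD[OF ff F, rotated 4]) (use k0 g in simp_all)
   then have "k0 = g0"
    using cartesian_cancel[OF assms(3,5), of k0 g0] k0 g0 pk by simp
   then show "k = ?k" using k0(4) a k by (metis (no_types, lifting) category_simps(10,11) hom_iff
      inv_arr_simps(1,3,5) iso_arr \<open>category D\<close>)
  qed
 qed simp
qed

section \<open>The simplicial replacement is a fibration\<close>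

lemma SR_gc:
 assumes "h \<in> Arr (SR K)" "Dom (SR K) h = (m, \<sigma>)" "Cod (SR K) h = (n, \<tau>)"
 shows "i \<le> j ==> j \<le> m ==> gc h i j \<in> Arr (PHomCat K \<sigma> i j)"
  "i \<le> j ==> j \<le> m ==> Dom (PHomCat K \<sigma> i j) (gc h i j) = sM \<sigma> i j"
  "i \<le> j ==> j \<le> m ==> Cod (PHomCat K \<sigma> i j) (gc h i j) = sM \<tau> (app (fst h) i) (app (fst h) j)"
  "i \<le> j ==> j \<le> k ==> k \<le> m ==> gc h i k \<cdot>[PHomCat K \<sigma> i k] sC \<sigma> i j k =
   sC \<tau> (app (fst h) i) (app (fst h) j) (app (fst h) k) \<cdot>[PHomCat K \<sigma> i k]
    hcomp2 K (PObj \<sigma> i) (PObj \<sigma> j) (PObj \<sigma> k) (gc h j k) (gc h i j)"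
  "i \<le> m ==> gc h i i \<cdot>[PHomCat K \<sigma> i i] PUnit \<sigma> i = PUnit \<tau> (app (fst h) i)"
  "i \<le> m ==> PObj \<tau> (app (fst h) i) = PObj \<sigma> i"
  "is_simplex K m \<sigma>" "is_simplex K n \<tau>"
 using arr_data_simps[OF SR_arrD(4)[OF assms]] SR_arrD(1-4)[OF assms] by (auto simp: arr_data_def)

text \<open>The inverse also lies over an identity, so its component at the same pair of vertices is
  the inverse 2-cell.\<close>

lemma SR_iso_gc:
 assumes "iso (SR K) v" "Dom (SR K) v = (m, \<sigma>)" "i \<le> j" "j \<le> m"
 shows "iso (PHomCat K \<sigma> i j) (gc v i j)"
proof -
 obtain n \<tau> where c: "Cod (SR K) v = (n, \<tau>)" by fastforce
 let ?w = "inv_arr (SR K) v"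
 have v: "v \<in> Arr (SR K)" and w: "?w \<in> Arr (SR K)" "Dom (SR K) ?w = (n, \<tau>)" "Cod (SR K) ?w = (m, \<sigma>)"
  using assms(1,2) c by simp_all
 have n: "n = m" "fst v = Ide Delta m"
  using iso_over_Delta[OF SP_functor assms(1)] v c assms(2) category_simps(1,2)[OF SR_category v] by simp_all
 have m: "fst ?w = Ide Delta m"
  using iso_over_Delta[OF SP_functor iso_inv_arr[OF assms(1)]] w n category_simps(1,2)[OF SR_category w(1)] by simp
 note V = SR_gc[OF v assms(2) c] and W = SR_gc[OF w]
 have ij: "i \<le> m" "j \<le> m" "i \<le> n" "j \<le> n" using assms n by auto
 have e: "PObj \<tau> i = PObj \<sigma> i" "PObj \<tau> j = PObj \<sigma> j" using V(6)[of i] V(6)[of j] ij n by simp_all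
 show ?thesis
 proof (rule isoI[of _ _ "gc ?w i j"])
  show "gc ?w i j \<cdot>[PHomCat K \<sigma> i j] gc v i j = Ide (PHomCat K \<sigma> i j) (Dom (PHomCat K \<sigma> i j) (gc v i j))"
   using gc_comp(1)[OF v w(1) _ assms(2-4)] c w(2) assms n ij V(2,7) by (simp add: gc_Ide)
  show "gc v i j \<cdot>[PHomCat K \<sigma> i j] gc ?w i j = Ide (PHomCat K \<sigma> i j) (Cod (PHomCat K \<sigma> i j) (gc v i j))"
   using gc_comp(1)[OF w(1) v _ w(2) assms(3) ij(4)] c w(3) assms n ij e m V(3,8) by (simp add: gc_Ide)
 qed (use V W assms e n m ij in simp_all)
qed

text \<open>On consecutive edges a factorization over the identity is forced by inverting the
  2-cells of \<open>h\<close>, and prescribing it there is enough.\<close>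

lemma SR_cartesianI:
 assumes h: "h \<in> Arr (SR K)" "Dom (SR K) h = (m, \<sigma>)"
  and i: "\<And>i. i < m ==> iso (PHomCat K \<sigma> i (Suc i)) (gc h i (Suc i))"
 shows "cartesian (SR K) Delta (SP K) h"
 unfolding cartesian_def
proof (intro conjI ballI impI h(1))
 obtain n \<tau> where c: "Cod (SR K) h = (n, \<tau>)" by fastforce
 note H = SR_gc[OF h c] and H' = SR_arrD[OF h c]
 interpret simplex_data K m "PObj \<sigma>" "sM \<sigma>" "PUnit \<sigma>" "sC \<sigma>" by (rule simplex_data_simplex[OF H(7)])
 fix f' assume f': "f' \<in> Arr (SR K)" "Cod (SR K) f' = Cod (SR K) h \<and> FArr (SP K) f' = FArr (SP K) h"
 then have c': "Cod (SR K) f' = (n, \<tau>)" "fst f' = fst h" using c h by auto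
 obtain m' \<sigma>' where d': "Dom (SR K) f' = (m', \<sigma>')" by fastforce
 have m': "m' = m" using SR_arrD(2)[OF f'(1) d' c'(1)] H'(2) c'(2) by simp
 note G = SR_gc[OF f'(1) d'[unfolded m'] c'(1)]
 have e [simp]: "PObj \<sigma>' i = PObj \<sigma> i" if "i \<le> m" for i using that G(6)[of i] H(6)[of i] c' by simp
 have I: "Ide Delta (FObj (SP K) (Dom (SR K) h)) = Ide Delta m"
  using category_simps(1)[OF SR_category h(1)] h by simp
 define s where "s i = inv_arr (PHomCat K \<sigma> i (Suc i)) (gc h i (Suc i)) \<cdot>[PHomCat K \<sigma> i (Suc i)] gc f' i (Suc i)" for i
 obtain f0 where f0: "f0 \<in> Arr (SR K)" "Dom (SR K) f0 = (m, \<sigma>')" "Cod (SR K) f0 = (m, \<sigma>)" "fst f0 = Ide Delta m"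
  "\<And>i. i < m ==> gc f0 i (Suc i) = s i"
 proof (rule SR_fill[of "Ide Delta m" m m K \<sigma>' \<sigma> s])
  show "s i \<in> hom (PHomCat K \<sigma>' i (Suc i)) (sM \<sigma>' i (Suc i)) (sM \<sigma> (app (Ide Delta m) i) (app (Ide Delta m) (Suc i)))"
   if "i < m" for i
   using that i[of i] H(1-3)[of i "Suc i"] G(1-3)[of i "Suc i"] c' by (simp add: s_def)
 qed (use H G in auto)
 have hs: "gc (h \<cdot>[SR K] k) i (Suc i) = gc h i (Suc i) \<cdot>[PHomCat K \<sigma> i (Suc i)] gc k i (Suc i)"
  if "k \<in> Arr (SR K)" "Dom (SR K) k = (m, \<sigma>')" "Cod (SR K) k = (m, \<sigma>)" "fst k = Ide Delta m" "i < m" for k i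
  using gc_comp(1)[OF that(1) h(1) _ that(2), of i "Suc i"] that h by simp
 have fh: "fst (h \<cdot>[SR K] k) = fst h"
  if "k \<in> Arr (SR K)" "Dom (SR K) k = (m, \<sigma>')" "Cod (SR K) k = (m, \<sigma>)" "fst k = Ide Delta m" for k
  using gc_comp(2)[OF that(1) h(1) _ that(2), of 0 0] that h H' by simp
 show "\<exists>!f0. f0 \<in> hom (SR K) (Dom (SR K) f') (Dom (SR K) h) \<and>
   FArr (SP K) f0 = Ide Delta (FObj (SP K) (Dom (SR K) h)) \<and> h \<cdot>[SR K] f0 = f'"
  unfolding I
 proof (rule ex1I[of _ f0])
  have "h \<cdot>[SR K] f0 = f'"
  proof (rule SR_spine_unique[of _ _ _ m \<sigma>'])
   show "gc (h \<cdot>[SR K] f0) i (Suc i) = gc f' i (Suc i)" if "i < m" for i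
    using that hs[OF f0(1-4), of i] f0(5)[of i] i[of i] H(1-3)[of i "Suc i"] G(1-3)[of i "Suc i"] c'
    by (simp add: s_def)
   show "Cod (SR K) (h \<cdot>[SR K] f0) = Cod (SR K) f'"
    using category_simps(8)[OF SR_category f0(1) h(1)] f0(3) h(2) c c'(1) by simp
  qed (use f0 f' h d' m' c c' fh[OF f0(1-4)] in simp_all)
  then show "f0 \<in> hom (SR K) (Dom (SR K) f') (Dom (SR K) h) \<and> FArr (SP K) f0 = Ide Delta m \<and> h \<cdot>[SR K] f0 = f'"
   using f0 d' m' h by simp
 next
  fix k assume "k \<in> hom (SR K) (Dom (SR K) f') (Dom (SR K) h) \<and> FArr (SP K) k = Ide Delta m \<and> h \<cdot>[SR K] k = f'"
  then have k: "k \<in> Arr (SR K)" "Dom (SR K) k = (m, \<sigma>')" "Cod (SR K) k = (m, \<sigma>)" "fst k = Ide Delta m"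
   "h \<cdot>[SR K] k = f'" using d' m' h by auto
  note K = SR_gc[OF k(1-3)]
  show "k = f0"
  proof (rule SR_spine_unique[OF k(1) f0(1) k(2) f0(2)])
   show "gc k i (Suc i) = gc f0 i (Suc i)" if "i < m" for i
    using that hs[OF k(1-4), of i] f0(5)[of i] i[of i] H(1-3)[of i "Suc i"] K(1-3)[of i "Suc i"] k(4,5)
    by (simp add: s_def)
  qed (use k f0 in simp_all)
 qed
qed

text \<open>The strict pullback with identity 2-cells on consecutive edges serves as a standard
  lift. Invertibility of all its components is recorded for the converse characterization of
  cartesian arrows.\<close>

lemma SR_lift:
 assumes "\<phi> \<in> Arr Delta" "Dom Delta \<phi> = m" "Cod Delta \<phi> = n" "is_simplex K n \<tau>"
 obtains h where "cartesian (SR K) Delta (SP K) h" "h \<in> Arr (SR K)" "Dom (SR K) h = (m, spull K \<phi> \<tau>)"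
  "Cod (SR K) h = (n, \<tau>)" "fst h = \<phi>"
  "\<And>i j. i \<le> j ==> j \<le> m ==> iso (PHomCat K \<tau> (app \<phi> i) (app \<phi> j)) (gc h i j)"
proof -
 interpret T: simplex_data K n "PObj \<tau>" "sM \<tau>" "PUnit \<tau>" "sC \<tau>" by (rule simplex_data_simplex[OF assms(4)])
 define s where "s i = Ide (PHomCat K \<tau> (app \<phi> i) (app \<phi> (Suc i))) (sM \<tau> (app \<phi> i) (app \<phi> (Suc i)))" for i
 note [simp] = spull_simps[OF assms(1) assms(4)[folded assms(3)], unfolded assms(2)]
 obtain h where h: "h \<in> Arr (SR K)" "Dom (SR K) h = (m, spull K \<phi> \<tau>)" "Cod (SR K) h = (n, \<tau>)" "fst h = \<phi>"
  "\<And>i. i < m ==> gc h i (Suc i) = s i"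
  "(\<forall>i < m. iso (PHomCat K (spull K \<phi> \<tau>) i (Suc i)) (s i)) \<longrightarrow>
   (\<forall>i j. i \<le> j \<longrightarrow> j \<le> m \<longrightarrow> iso (PHomCat K (spull K \<phi> \<tau>) i j) (gc h i j))"
  by (rule SR_fill[of \<phi> m n K "spull K \<phi> \<tau>" \<tau> s]) (use assms in \<open>simp_all add: s_def\<close>)
 have i: "iso (PHomCat K (spull K \<phi> \<tau>) i j) (gc h i j)" if "i \<le> j" "j \<le> m" for i j
  using h(6) that assms by (simp add: s_def)
 then have "iso (PHomCat K \<tau> (app \<phi> i) (app \<phi> j)) (gc h i j)" if "i \<le> j" "j \<le> m" for i j
  using i[OF that] that by simp
 then show ?thesis
  using that[of h] h(1-4) i SR_cartesianI[OF h(1,2)] by simp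
qed

text \<open>Any cartesian arrow is the standard lift after a vertical isomorphism, and both factors
  have invertible components.\<close>

lemma SR_cartesianD:
 assumes h: "cartesian (SR K) Delta (SP K) h" "Dom (SR K) h = (m, \<sigma>)" and ij: "i \<le> j" "j \<le> m"
 shows "iso (PHomCat K \<sigma> i j) (gc h i j)"
proof -
 obtain n \<tau> where c: "Cod (SR K) h = (n, \<tau>)" by fastforce
 have a: "h \<in> Arr (SR K)" by (rule cartesian_arr[OF h(1)])
 note H = SR_gc[OF a h(2) c] and H' = SR_arrD[OF a h(2) c]
 obtain l where l: "cartesian (SR K) Delta (SP K) l" "l \<in> Arr (SR K)" "Dom (SR K) l = (m, spull K (fst h) \<tau>)"
  "Cod (SR K) l = (n, \<tau>)" "fst l = fst h"
  "\<And>i j. i \<le> j ==> j \<le> m ==> iso (PHomCat K \<tau> (app (fst h) i) (app (fst h) j)) (gc l i j)"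
  by (rule SR_lift[OF H'(1-3) H(8)]) blast
 obtain v where v: "iso (SR K) v" "Dom (SR K) v = (m, \<sigma>)" "Cod (SR K) v = (m, spull K (fst h) \<tau>)"
  "fst v = Ide Delta m" "l \<cdot>[SR K] v = h"
 proof (rule cartesian_compare[OF SP_functor l(1) h(1)])
  show "Cod (SR K) l = Cod (SR K) h" "FArr (SP K) l = FArr (SP K) h" using l a c by simp_all
  fix v assume "iso (SR K) v" "Dom (SR K) v = Dom (SR K) h" "Cod (SR K) v = Dom (SR K) l"
   "FArr (SP K) v = Ide Delta (FObj (SP K) (Dom (SR K) l))" "l \<cdot>[SR K] v = h"
  then show thesis
   using that[of v] l h(2) category_simps(1)[OF SR_category l(2)] by simp
 qed
 interpret simplex_data K m "PObj \<sigma>" "sM \<sigma>" "PUnit \<sigma>" "sC \<sigma>" by (rule simplex_data_simplex[OF H(7)])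
 have "gc h i j = gc l i j \<cdot>[PHomCat K \<sigma> i j] gc v i j"
  using gc_comp(1)[OF iso_arr[OF v(1)] l(2) _ v(2) ij] v l ij by simp
 moreover have "iso (PHomCat K \<sigma> i j) (gc l i j)" using l(6)[OF ij] H(6)[of i] H(6)[of j] ij by simp
 moreover have "iso (PHomCat K \<sigma> i j) (gc v i j)" by (rule SR_iso_gc[OF v(1,2) ij])
 moreover have "Dom (PHomCat K \<sigma> i j) (gc l i j) = Cod (PHomCat K \<sigma> i j) (gc v i j)"
  using SR_gc(2)[OF l(2-4) ij] SR_gc(3)[OF iso_arr[OF v(1)] v(2,3) ij] SR_gc(6)[OF iso_arr[OF v(1)] v(2,3)] v(4) ij
  by simp
 ultimately show ?thesis using ij by simp
qed

text \<open>Closure under composition follows from the characterization of cartesian arrows by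
  invertible 2-cells, a property stable under reindexing and composition.\<close>

lemma SR_fibration [simp]: "fibration (SR K) Delta (SP K)"
 unfolding fibration_def
proof (intro conjI ballI impI allI)
 fix X \<phi> assume h: "X \<in> Obj (SR K)" "\<phi> \<in> Arr Delta" "Cod Delta \<phi> = FObj (SP K) X"
 obtain n \<tau> where X: "X = (n, \<tau>)" by fastforce
 show "\<exists>f'. cartesian (SR K) Delta (SP K) f' \<and> Cod (SR K) f' = X \<and> FArr (SP K) f' = \<phi>"
 proof (rule SR_lift[OF h(2) refl, of n K \<tau>])
  fix f' assume "cartesian (SR K) Delta (SP K) f'" "f' \<in> Arr (SR K)" "Cod (SR K) f' = (n, \<tau>)" "fst f' = \<phi>"
  then show ?thesis using X by (intro exI[of _ f']) simp
 qed (use h X in simp_all)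
next
 fix f g assume fg: "cartesian (SR K) Delta (SP K) f \<and> cartesian (SR K) Delta (SP K) g \<and> Cod (SR K) f = Dom (SR K) g"
 obtain m \<sigma> n \<tau> p \<upsilon> where d: "Dom (SR K) f = (m, \<sigma>)" "Cod (SR K) f = (n, \<tau>)" "Dom (SR K) g = (n, \<tau>)"
  "Cod (SR K) g = (p, \<upsilon>)" using fg by (metis prod.collapse)
 have a: "f \<in> Arr (SR K)" "g \<in> Arr (SR K)" using fg cartesian_arr by auto
 note F = SR_gc[OF a(1) d(1,2)] and F' = SR_arrD[OF a(1) d(1,2)] and G = SR_gc[OF a(2) d(3,4)]
 interpret simplex_data K m "PObj \<sigma>" "sM \<sigma>" "PUnit \<sigma>" "sC \<sigma>" by (rule simplex_data_simplex[OF F(7)])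
 show "cartesian (SR K) Delta (SP K) (g \<cdot>[SR K] f)"
 proof (rule SR_cartesianI[of _ _ m \<sigma>])
  fix i assume i: "i < m"
  let ?i = "app (fst f) i" and ?j = "app (fst f) (Suc i)"
  have ij: "?i \<le> ?j" "?j \<le> n" "?i \<le> n" using F' i by simp_all
  have "iso (PHomCat K \<tau> ?i ?j) (gc g ?i ?j)" by (rule SR_cartesianD) (use fg d ij in auto)
  then have "iso (PHomCat K \<sigma> i (Suc i)) (gc g ?i ?j)" using F(6)[of i] F(6)[of "Suc i"] i by simp
  moreover have "iso (PHomCat K \<sigma> i (Suc i)) (gc f i (Suc i))" by (rule SR_cartesianD) (use fg d i in auto)
  ultimately show "iso (PHomCat K \<sigma> i (Suc i)) (gc (g \<cdot>[SR K] f) i (Suc i))"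
   using gc_comp(1)[OF a _ d(1), of i "Suc i"] d i F(3)[of i "Suc i"] G(2)[OF ij(1,2)] F(6)[of i] F(6)[of "Suc i"]
   by simp
 qed (use a d in simp_all)
qed simp

text \<open>A quasi-inverse of the first equivalence is followed by the second; the result lies
  strictly over \<open>Delta\<close> although the quasi-inverse was only given with no reference to
  the base.\<close>

lemma equivalence_over_span:
 assumes "equivalence_over Delta C \<pi> (SR K) (SP K) E" "equivalence_over Delta C \<pi> (SR L) (SP L) E'"
 obtains F where "equivalence (SR K) (SR L) F" "comp_fct (SR K) (SP L) F = SP K"
  "\<And>f. cartesian (SR K) Delta (SP K) f ==> cartesian (SR L) Delta (SP L) (FArr F f)"
proof -
 have E: "equivalence C (SR K) E" "cat_functor C (SR K) E" "cat_functor C Delta \<pi>" "comp_fct C (SP K) E = \<pi>"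
  and E': "equivalence C (SR L) E'" "cat_functor C (SR L) E'" "comp_fct C (SP L) E' = \<pi>"
  using assms by (auto simp: equivalence_over_def cartesian_fct_def fibration_def)
 obtain G \<epsilon> where G: "equivalence (SR K) C G" "nat_iso (SR K) (SR K) (comp_fct (SR K) E G) (id_fct (SR K)) \<epsilon>"
  by (rule equivalence_sym[OF E(1)])
 have G': "cat_functor (SR K) C G" using G(1) by (simp add: equivalence_iff)
 have o: "comp_fct (SR K) \<pi> G = SP K" by (rule quasi_inverse_over[OF E(2) G' SP_functor E(3,4) G(2)])
 let ?F = "comp_fct (SR K) E' G"
 have F: "equivalence (SR K) (SR L) ?F" by (rule equivalence_comp[OF G(1) E'(1)])
 have oF: "comp_fct (SR K) (SP L) ?F = SP K"
 proof (rule fct_eqI)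
  show "cat_functor (SR K) Delta (comp_fct (SR K) (SP L) ?F)"
   using comp_fct_functor F SP_functor unfolding equivalence_iff by blast
  show "cat_functor (SR K) Delta (SP K)" by simp
 qed (use over_simps[OF o] over_simps[OF E'(3)] cat_functor_simps[OF G'] in simp_all)
 show ?thesis
  by (rule that[OF F oF equivalence_preserves_cartesian[OF F SP_functor SP_functor oF]])
qed

section \<open>Composition of 2-functors\<close>

context two_functor begin

abbreviation "HL x y \<equiv> PHomCat L \<gamma> x y"
abbreviation "hL x y z \<equiv> hcomp2 L (PObj \<gamma> x) (PObj \<gamma> y) (PObj \<gamma> z)"

lemma PObj_in [simp]: "x \<in> Obj2 K ==> PObj \<gamma> x \<in> Obj2 L"
 using pobj_map by auto

lemmas PMap_simps [simp] = cat_functor_simps[OF phom_functor]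

lemma PUnit_simps [simp]:
 assumes "x \<in> Obj2 K"
 shows "iso (HL x x) (PUnit \<gamma> x)" "Dom (HL x x) (PUnit \<gamma> x) = Ide2 L (PObj \<gamma> x)"
  "Cod (HL x x) (PUnit \<gamma> x) = PMap1 \<gamma> x x (Ide2 K x)"
 using punit_hom[OF assms] punit_iso[OF assms] by auto

lemmas PComp_simps [simp] = two_functor_PComp[OF two_functor_axioms]

lemma PComp_natural:
 assumes "x \<in> Obj2 K" "y \<in> Obj2 K" "z \<in> Obj2 K"
  "b \<in> Arr (Hom2 K y z)" "Dom (Hom2 K y z) b = g" "Cod (Hom2 K y z) b = g'"
  "a \<in> Arr (Hom2 K x y)" "Dom (Hom2 K x y) a = f" "Cod (Hom2 K x y) a = f'"
 shows "PComp \<gamma> (x, y, z) (g', f') \<cdot>[HL x z]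
   hL x y z (PMap2 \<gamma> y z b) (PMap2 \<gamma> x y a) =
  PMap2 \<gamma> x z (hcomp2 K x y z b a) \<cdot>[HL x z] PComp \<gamma> (x, y, z) (g, f)"
 using two_functor_PComp_natural[OF two_functor_axioms assms(1-4,7)] assms by simp

end

text \<open>The natural isomorphism between composite functors on a product category is split into
  pointwise conditions, the form in which the 2-functors below are verified.\<close>

lemma two_functorI:
 assumes K: "strict_2_category K" and L: "strict_2_category L"
  and O: "PObj \<gamma> \<in> Obj2 K \<rightarrow>\<^sub>E Obj2 L"
  and ext: "PHom \<gamma> \<in> extensional (Obj2 K \<times> Obj2 K)" "PUnit \<gamma> \<in> extensional (Obj2 K)"
   "PComp \<gamma> \<in> extensional (Obj2 K \<times> Obj2 K \<times> Obj2 K)"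
  and F: "\<And>x y. x \<in> Obj2 K ==> y \<in> Obj2 K ==> cat_functor (Hom2 K x y) (PHomCat L \<gamma> x y) (PHom \<gamma> (x, y))"
  and U: "\<And>x. x \<in> Obj2 K ==> iso (PHomCat L \<gamma> x x) (PUnit \<gamma> x) \<and>
   PUnit \<gamma> x \<in> hom (PHomCat L \<gamma> x x) (Ide2 L (PObj \<gamma> x)) (PMap1 \<gamma> x x (Ide2 K x))"
  and C_ext: "\<And>x y z. x \<in> Obj2 K ==> y \<in> Obj2 K ==> z \<in> Obj2 K ==>
   PComp \<gamma> (x, y, z) \<in> extensional (Obj (Hom2 K y z) \<times> Obj (Hom2 K x y))"
  and C: "\<And>x y z g f. x \<in> Obj2 K ==> y \<in> Obj2 K ==> z \<in> Obj2 K ==>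
   g \<in> Obj (Hom2 K y z) ==> f \<in> Obj (Hom2 K x y) ==>
   iso (PHomCat L \<gamma> x z) (PComp \<gamma> (x, y, z) (g, f)) \<and> PComp \<gamma> (x, y, z) (g, f) \<in> hom (PHomCat L \<gamma> x z)
    (hcomp1 L (PObj \<gamma> x) (PObj \<gamma> y) (PObj \<gamma> z) (PMap1 \<gamma> y z g) (PMap1 \<gamma> x y f))
    (PMap1 \<gamma> x z (hcomp1 K x y z g f))"
  and nat: "\<And>x y z b a. x \<in> Obj2 K ==> y \<in> Obj2 K ==> z \<in> Obj2 K ==>
   b \<in> Arr (Hom2 K y z) ==> a \<in> Arr (Hom2 K x y) ==>
   PComp \<gamma> (x, y, z) (Cod (Hom2 K y z) b, Cod (Hom2 K x y) a) \<cdot>[PHomCat L \<gamma> x z]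
    hcomp2 L (PObj \<gamma> x) (PObj \<gamma> y) (PObj \<gamma> z) (PMap2 \<gamma> y z b) (PMap2 \<gamma> x y a) =
   PMap2 \<gamma> x z (hcomp2 K x y z b a) \<cdot>[PHomCat L \<gamma> x z]
    PComp \<gamma> (x, y, z) (Dom (Hom2 K y z) b, Dom (Hom2 K x y) a)"
  and left: "\<And>x y f. x \<in> Obj2 K ==> y \<in> Obj2 K ==> f \<in> Obj (Hom2 K x y) ==>
   PComp \<gamma> (x, y, y) (Ide2 K y, f) \<cdot>[PHomCat L \<gamma> x y]
    hcomp2 L (PObj \<gamma> x) (PObj \<gamma> y) (PObj \<gamma> y)
     (PUnit \<gamma> y) (Ide (PHomCat L \<gamma> x y) (PMap1 \<gamma> x y f))
   = Ide (PHomCat L \<gamma> x y) (PMap1 \<gamma> x y f)"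
  and right: "\<And>x y f. x \<in> Obj2 K ==> y \<in> Obj2 K ==> f \<in> Obj (Hom2 K x y) ==>
   PComp \<gamma> (x, x, y) (f, Ide2 K x) \<cdot>[PHomCat L \<gamma> x y]
    hcomp2 L (PObj \<gamma> x) (PObj \<gamma> x) (PObj \<gamma> y)
     (Ide (PHomCat L \<gamma> x y) (PMap1 \<gamma> x y f)) (PUnit \<gamma> x)
   = Ide (PHomCat L \<gamma> x y) (PMap1 \<gamma> x y f)"
  and assoc: "\<And>w x y z f g h. w \<in> Obj2 K ==> x \<in> Obj2 K ==> y \<in> Obj2 K ==> z \<in> Obj2 K ==>
   f \<in> Obj (Hom2 K w x) ==> g \<in> Obj (Hom2 K x y) ==> h \<in> Obj (Hom2 K y z) ==>
   PComp \<gamma> (w, x, z) (hcomp1 K x y z h g, f) \<cdot>[PHomCat L \<gamma> w z]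
    hcomp2 L (PObj \<gamma> w) (PObj \<gamma> x) (PObj \<gamma> z)
     (PComp \<gamma> (x, y, z) (h, g)) (Ide (PHomCat L \<gamma> w x) (PMap1 \<gamma> w x f))
   = PComp \<gamma> (w, y, z) (h, hcomp1 K w x y g f) \<cdot>[PHomCat L \<gamma> w z]
    hcomp2 L (PObj \<gamma> w) (PObj \<gamma> y) (PObj \<gamma> z)
     (Ide (PHomCat L \<gamma> y z) (PMap1 \<gamma> y z h)) (PComp \<gamma> (w, x, y) (g, f))"
 shows "two_functor K L \<gamma>"
proof (intro two_functor.intro two_functor_axioms.intro K L O ext F left right assoc)
 interpret K: strict_2_category K by fact
 interpret L: strict_2_category L by fact
 have O': "x \<in> Obj2 K ==> PObj \<gamma> x \<in> Obj2 L" for x using O by auto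
 fix x y z assume xyz: "x \<in> Obj2 K" "y \<in> Obj2 K" "z \<in> Obj2 K"
 show "nat_iso (prod_cat (Hom2 K y z) (Hom2 K x y)) (PHomCat L \<gamma> x z)
    (comp_fct (prod_cat (Hom2 K y z) (Hom2 K x y))
      (Comp2 L (PObj \<gamma> x) (PObj \<gamma> y) (PObj \<gamma> z))
      (prod_fct (Hom2 K y z) (Hom2 K x y) (PHom \<gamma> (y, z)) (PHom \<gamma> (x, y))))
    (comp_fct (prod_cat (Hom2 K y z) (Hom2 K x y)) (PHom \<gamma> (x, z)) (Comp2 K x y z))
    (PComp \<gamma> (x, y, z))"
 proof (rule nat_isoI)
  show "cat_functor (prod_cat (Hom2 K y z) (Hom2 K x y)) (PHomCat L \<gamma> x z)
   (comp_fct (prod_cat (Hom2 K y z) (Hom2 K x y)) (Comp2 L (PObj \<gamma> x) (PObj \<gamma> y) (PObj \<gamma> z))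
    (prod_fct (Hom2 K y z) (Hom2 K x y) (PHom \<gamma> (y, z)) (PHom \<gamma> (x, y))))"
   using xyz by (intro comp_fct_functor[OF prod_fct_functor[OF F F]] L.comp2_functor O')
  show "cat_functor (prod_cat (Hom2 K y z) (Hom2 K x y)) (PHomCat L \<gamma> x z)
   (comp_fct (prod_cat (Hom2 K y z) (Hom2 K x y)) (PHom \<gamma> (x, z)) (Comp2 K x y z))"
   using xyz by (intro comp_fct_functor[OF K.comp2_functor F])
 qed (use xyz C_ext[OF xyz] C[OF xyz] nat[OF xyz] in auto)
qed (use U in auto)

lemma comp_two_fct_simps [simp]:
 "x \<in> Obj2 K ==> PObj (comp_two_fct K M \<delta> \<gamma>) x = PObj \<delta> (PObj \<gamma> x)"
 "x \<in> Obj2 K ==> y \<in> Obj2 K ==> PHom (comp_two_fct K M \<delta> \<gamma>) (x, y) =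
  comp_fct (Hom2 K x y) (PHom \<delta> (PObj \<gamma> x, PObj \<gamma> y)) (PHom \<gamma> (x, y))"
 "x \<in> Obj2 K ==> PUnit (comp_two_fct K M \<delta> \<gamma>) x =
  PMap2 \<delta> (PObj \<gamma> x) (PObj \<gamma> x) (PUnit \<gamma> x) \<cdot>[PHomCat M \<delta> (PObj \<gamma> x) (PObj \<gamma> x)] PUnit \<delta> (PObj \<gamma> x)"
 "x \<in> Obj2 K ==> y \<in> Obj2 K ==> z \<in> Obj2 K ==> g \<in> Obj (Hom2 K y z) ==> f \<in> Obj (Hom2 K x y) ==>
  PComp (comp_two_fct K M \<delta> \<gamma>) (x, y, z) (g, f) =
   PMap2 \<delta> (PObj \<gamma> x) (PObj \<gamma> z) (PComp \<gamma> (x, y, z) (g, f)) \<cdot>[PHomCat M \<delta> (PObj \<gamma> x) (PObj \<gamma> z)]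
   PComp \<delta> (PObj \<gamma> x, PObj \<gamma> y, PObj \<gamma> z) (PMap1 \<gamma> y z g, PMap1 \<gamma> x y f)"
 by (simp_all add: comp_two_fct_def compose_def)

text \<open>In each law the composition cell of \<open>\<delta>\<close> is moved past the
  \<open>\<delta>\<close>-image of a cell of \<open>\<gamma>\<close> by naturality; the law for
  \<open>\<delta>\<close> and the image of the law for \<open>\<gamma>\<close> then apply
  separately.\<close>

lemma comp_two_fct_two_functor:
 assumes g: "two_functor K L \<gamma>" and d: "two_functor L M \<delta>"
 shows "two_functor K M (comp_two_fct K M \<delta> \<gamma>)"
proof -
 interpret g: two_functor K L \<gamma> by fact
 interpret d: two_functor L M \<delta> by fact
 note i = functor_iso[OF d.phom_functor]
 let ?d = "comp_two_fct K M \<delta> \<gamma>" and ?o = "\<lambda>x. PObj \<delta> (PObj \<gamma> x)"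
 let ?C = "\<lambda>x y. Hom2 M (?o x) (?o y)" and ?hc = "\<lambda>x y z. hcomp2 M (?o x) (?o y) (?o z)"
 let ?D = "\<lambda>x y z. PComp \<delta> (PObj \<gamma> x, PObj \<gamma> y, PObj \<gamma> z)" and ?M = "\<lambda>x y. PMap2 \<delta> (PObj \<gamma> x) (PObj \<gamma> y)"
 let ?l = "\<lambda>x y z. hcomp2 L (PObj \<gamma> x) (PObj \<gamma> y) (PObj \<gamma> z)" and ?e = "\<lambda>x y z. hcomp2 M (PObj ?d x) (PObj ?d y) (PObj ?d z)"
 let ?E = "\<lambda>x y. PHomCat M ?d x y"
 show ?thesis
 proof (rule two_functorI)
  fix x y assume "x \<in> Obj2 K" "y \<in> Obj2 K"
  then show "cat_functor (Hom2 K x y) (?E x y) (PHom ?d (x, y))"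
   by (simp add: comp_fct_functor[OF g.phom_functor d.phom_functor])
 next
  fix x y z b a assume h: "x \<in> Obj2 K" "y \<in> Obj2 K" "z \<in> Obj2 K" "b \<in> Arr (Hom2 K y z)" "a \<in> Arr (Hom2 K x y)"
  let ?x = "PObj \<gamma> x" and ?y = "PObj \<gamma> y" and ?z = "PObj \<gamma> z"
  let ?H = "?C x z"
  let ?P = "PComp \<gamma> (x, y, z)" and ?Q = "?D x y z"
  have "(?M x z (?P (Cod (Hom2 K y z) b, Cod (Hom2 K x y) a)) \<cdot>[?H]
    ?Q (PMap1 \<gamma> y z (Cod (Hom2 K y z) b), PMap1 \<gamma> x y (Cod (Hom2 K x y) a))) \<cdot>[?H]
    ?hc x y z
     (?M y z (PMap2 \<gamma> y z b)) (?M x y (PMap2 \<gamma> x y a)) =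
   ?M x z (?P (Cod (Hom2 K y z) b, Cod (Hom2 K x y) a)) \<cdot>[?H]
    ?M x z (?l x y z (PMap2 \<gamma> y z b) (PMap2 \<gamma> x y a)) \<cdot>[?H]
    ?Q (PMap1 \<gamma> y z (Dom (Hom2 K y z) b), PMap1 \<gamma> x y (Dom (Hom2 K x y) a))"
   using h by (subst d.PComp_natural[symmetric]) simp_all
  also have "\<dots> = ?M x z (?P (Cod (Hom2 K y z) b, Cod (Hom2 K x y) a) \<cdot>[PHomCat L \<gamma> x z]
    ?l x y z (PMap2 \<gamma> y z b) (PMap2 \<gamma> x y a)) \<cdot>[?H]
    ?Q (PMap1 \<gamma> y z (Dom (Hom2 K y z) b), PMap1 \<gamma> x y (Dom (Hom2 K x y) a))"
   using h by simp
  also have "\<dots> = ?M x z (PMap2 \<gamma> x z (hcomp2 K x y z b a)) \<cdot>[?H]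
    ?M x z (?P (Dom (Hom2 K y z) b, Dom (Hom2 K x y) a)) \<cdot>[?H]
    ?Q (PMap1 \<gamma> y z (Dom (Hom2 K y z) b), PMap1 \<gamma> x y (Dom (Hom2 K x y) a))"
   unfolding g.PComp_natural[OF h(1-4) refl refl h(5) refl refl]
   using h g.PComp_simps[of x y z "Dom (Hom2 K y z) b" "Dom (Hom2 K x y) a"] by simp
  finally show "PComp ?d (x, y, z) (Cod (Hom2 K y z) b, Cod (Hom2 K x y) a)
    \<cdot>[?E x z]
    ?e x y z
     (PMap2 ?d y z b) (PMap2 ?d x y a) =
   PMap2 ?d x z (hcomp2 K x y z b a) \<cdot>[?E x z]
    PComp ?d (x, y, z) (Dom (Hom2 K y z) b, Dom (Hom2 K x y) a)"
   using h by simp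
 next
  fix x y f assume h: "x \<in> Obj2 K" "y \<in> Obj2 K" "f \<in> Obj (Hom2 K x y)"
  let ?x = "PObj \<gamma> x" and ?y = "PObj \<gamma> y"
  let ?H = "?C x y"
  let ?f = "PMap1 \<gamma> x y f"
  let ?I = "Ide ?H (PMap1 \<delta> ?x ?y ?f)" and ?J = "Ide (PHomCat L \<gamma> x y) ?f"
  have "?D x y y (PMap1 \<gamma> y y (Ide2 K y), ?f) \<cdot>[?H]
    ?hc x y y (?M y y (PUnit \<gamma> y)) (?M x y ?J) =
    ?M x y (?l x y y (PUnit \<gamma> y) ?J) \<cdot>[?H] ?D x y y (Ide2 L ?y, ?f)"
   using h by (intro d.PComp_natural) simp_all
  note n = this
  have "?D x y y (PMap1 \<gamma> y y (Ide2 K y), ?f) \<cdot>[?H]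
    ?hc x y y
     (?M y y (PUnit \<gamma> y) \<cdot>[?C y y] PUnit \<delta> ?y) ?I =
    (?D x y y (PMap1 \<gamma> y y (Ide2 K y), ?f) \<cdot>[?H]
    ?hc x y y (?M y y (PUnit \<gamma> y)) (?M x y ?J)) \<cdot>[?H]
    ?hc x y y (PUnit \<delta> ?y) ?I"
   using h by (simp add: d.L.interchange)
  also have "\<dots> = ?M x y (?l x y y (PUnit \<gamma> y) ?J)"
   unfolding n using h d.pcoh_left[of ?x ?y ?f] by simp
  finally have "?M x y (PComp \<gamma> (x, y, y) (Ide2 K y, f)) \<cdot>[?H]
    ?D x y y (PMap1 \<gamma> y y (Ide2 K y), ?f) \<cdot>[?H]
    ?hc x y y
     (?M y y (PUnit \<gamma> y) \<cdot>[?C y y] PUnit \<delta> ?y) ?I =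
    ?M x y (PComp \<gamma> (x, y, y) (Ide2 K y, f) \<cdot>[PHomCat L \<gamma> x y] ?l x y y (PUnit \<gamma> y) ?J)"
   using h by simp
  also have "\<dots> = ?I" using g.pcoh_left[OF h] h by simp
  finally show "PComp ?d (x, y, y) (Ide2 K y, f) \<cdot>[?E x y]
    ?e x y y
     (PUnit ?d y)
     (Ide (?E x y) (PMap1 ?d x y f))
   = Ide (?E x y) (PMap1 ?d x y f)"
   using h by (simp add: i)
 next
  fix x y f assume h: "x \<in> Obj2 K" "y \<in> Obj2 K" "f \<in> Obj (Hom2 K x y)"
  let ?x = "PObj \<gamma> x" and ?y = "PObj \<gamma> y"
  let ?H = "?C x y"
  let ?f = "PMap1 \<gamma> x y f"
  let ?I = "Ide ?H (PMap1 \<delta> ?x ?y ?f)" and ?J = "Ide (PHomCat L \<gamma> x y) ?f"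
  have "?D x x y (?f, PMap1 \<gamma> x x (Ide2 K x)) \<cdot>[?H]
    ?hc x x y (?M x y ?J) (?M x x (PUnit \<gamma> x)) =
    ?M x y (?l x x y ?J (PUnit \<gamma> x)) \<cdot>[?H] ?D x x y (?f, Ide2 L ?x)"
   using h by (intro d.PComp_natural) simp_all
  note n = this
  have "?D x x y (?f, PMap1 \<gamma> x x (Ide2 K x)) \<cdot>[?H]
    ?hc x x y ?I
     (?M x x (PUnit \<gamma> x) \<cdot>[?C x x] PUnit \<delta> ?x) =
    (?D x x y (?f, PMap1 \<gamma> x x (Ide2 K x)) \<cdot>[?H]
    ?hc x x y (?M x y ?J) (?M x x (PUnit \<gamma> x))) \<cdot>[?H]
    ?hc x x y ?I (PUnit \<delta> ?x)"
   using h by (simp add: d.L.interchange)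
  also have "\<dots> = ?M x y (?l x x y ?J (PUnit \<gamma> x))"
   unfolding n using h d.pcoh_right[of ?x ?y ?f] by simp
  finally have "?M x y (PComp \<gamma> (x, x, y) (f, Ide2 K x)) \<cdot>[?H]
    ?D x x y (?f, PMap1 \<gamma> x x (Ide2 K x)) \<cdot>[?H]
    ?hc x x y ?I
     (?M x x (PUnit \<gamma> x) \<cdot>[?C x x] PUnit \<delta> ?x) =
    ?M x y (PComp \<gamma> (x, x, y) (f, Ide2 K x) \<cdot>[PHomCat L \<gamma> x y] ?l x x y ?J (PUnit \<gamma> x))"
   using h by simp
  also have "\<dots> = ?I" using g.pcoh_right[OF h] h by simp
  finally show "PComp ?d (x, x, y) (f, Ide2 K x) \<cdot>[?E x y]
    ?e x x y
     (Ide (?E x y) (PMap1 ?d x y f))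
     (PUnit ?d x)
   = Ide (?E x y) (PMap1 ?d x y f)"
   using h by (simp add: i)
 next
  fix w x y z f g h assume a: "w \<in> Obj2 K" "x \<in> Obj2 K" "y \<in> Obj2 K" "z \<in> Obj2 K"
   "f \<in> Obj (Hom2 K w x)" "g \<in> Obj (Hom2 K x y)" "h \<in> Obj (Hom2 K y z)"
  let ?w = "PObj \<gamma> w" and ?x = "PObj \<gamma> x" and ?y = "PObj \<gamma> y" and ?z = "PObj \<gamma> z"
  let ?H = "?C w z" and ?G = "PHomCat L \<gamma> w z"
  let ?f = "PMap1 \<gamma> w x f" and ?g = "PMap1 \<gamma> x y g" and ?h = "PMap1 \<gamma> y z h"
  let ?If = "Ide (?C w x) (PMap1 \<delta> ?w ?x ?f)" and ?Ih = "Ide (?C y z) (PMap1 \<delta> ?y ?z ?h)"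
  let ?Jf = "Ide (PHomCat L \<gamma> w x) ?f" and ?Jh = "Ide (PHomCat L \<gamma> y z) ?h"
  \<comment> \<open>Naturality at a composition cell of \<open>\<gamma>\<close> paired with an
    identity, on either side; these two squares separate the associativity of
    \<open>\<gamma>\<close> from that of \<open>\<delta>\<close>.\<close>
  have n1: "?D w x z (PMap1 \<gamma> x z (hcomp1 K x y z h g), ?f) \<cdot>[?H]
    ?hc w x z
     (?M x z (PComp \<gamma> (x, y, z) (h, g))) (?M w x ?Jf) =
    ?M w z (?l w x z (PComp \<gamma> (x, y, z) (h, g)) ?Jf) \<cdot>[?H]
    ?D w x z (hcomp1 L ?x ?y ?z ?h ?g, ?f)"
   using a by (intro d.PComp_natural) simp_all
  have n2: "?D w y z (?h, PMap1 \<gamma> w y (hcomp1 K w x y g f)) \<cdot>[?H]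
    ?hc w y z
     (?M y z ?Jh) (?M w y (PComp \<gamma> (w, x, y) (g, f))) =
    ?M w z (?l w y z ?Jh (PComp \<gamma> (w, x, y) (g, f))) \<cdot>[?H]
    ?D w y z (?h, hcomp1 L ?w ?x ?y ?g ?f)"
   using a by (intro d.PComp_natural) simp_all
  have "?M w z (PComp \<gamma> (w, x, z) (hcomp1 K x y z h g, f)) \<cdot>[?H]
    ?D w x z (PMap1 \<gamma> x z (hcomp1 K x y z h g), ?f) \<cdot>[?H]
    ?hc w x z
     (?M x z (PComp \<gamma> (x, y, z) (h, g)) \<cdot>[?C x z] ?D x y z (?h, ?g)) ?If =
   ?M w z (PComp \<gamma> (w, x, z) (hcomp1 K x y z h g, f)) \<cdot>[?H]
    (?D w x z (PMap1 \<gamma> x z (hcomp1 K x y z h g), ?f) \<cdot>[?H]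
    ?hc w x z
     (?M x z (PComp \<gamma> (x, y, z) (h, g))) (?M w x ?Jf)) \<cdot>[?H]
    ?hc w x z (?D x y z (?h, ?g)) ?If"
   using a by (simp add: d.L.interchange g.L.assoc1 i)
  also have "\<dots> = ?M w z (PComp \<gamma> (w, x, z) (hcomp1 K x y z h g, f) \<cdot>[?G]
    ?l w x z (PComp \<gamma> (x, y, z) (h, g)) ?Jf) \<cdot>[?H]
    ?D w x z (hcomp1 L ?x ?y ?z ?h ?g, ?f) \<cdot>[?H]
    ?hc w x z (?D x y z (?h, ?g)) ?If"
   unfolding n1 using a by simp
  also have "\<dots> = ?M w z (PComp \<gamma> (w, y, z) (h, hcomp1 K w x y g f) \<cdot>[?G]
    ?l w y z ?Jh (PComp \<gamma> (w, x, y) (g, f))) \<cdot>[?H]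
    ?D w y z (?h, hcomp1 L ?w ?x ?y ?g ?f) \<cdot>[?H]
    ?hc w y z ?Ih (?D w x y (?g, ?f))"
   using g.pcoh_assoc[OF a] d.pcoh_assoc[of ?w ?x ?y ?z ?f ?g ?h] a by simp
  also have "\<dots> = ?M w z (PComp \<gamma> (w, y, z) (h, hcomp1 K w x y g f)) \<cdot>[?H]
    (?D w y z (?h, PMap1 \<gamma> w y (hcomp1 K w x y g f)) \<cdot>[?H]
    ?hc w y z
     (?M y z ?Jh) (?M w y (PComp \<gamma> (w, x, y) (g, f)))) \<cdot>[?H]
    ?hc w y z ?Ih (?D w x y (?g, ?f))"
   unfolding n2 using a by (simp add: g.K.assoc1 g.L.assoc1)
  also have "\<dots> = ?M w z (PComp \<gamma> (w, y, z) (h, hcomp1 K w x y g f)) \<cdot>[?H]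
    ?D w y z (?h, PMap1 \<gamma> w y (hcomp1 K w x y g f)) \<cdot>[?H]
    ?hc w y z ?Ih
     (?M w y (PComp \<gamma> (w, x, y) (g, f)) \<cdot>[?C w y] ?D w x y (?g, ?f))"
   using a by (simp add: d.L.interchange i)
  finally show "PComp ?d (w, x, z) (hcomp1 K x y z h g, f)
    \<cdot>[?E w z]
    ?e w x z
     (PComp ?d (x, y, z) (h, g))
     (Ide (?E w x) (PMap1 ?d w x f))
   = PComp ?d (w, y, z) (h, hcomp1 K w x y g f) \<cdot>[?E w z]
    ?e w y z
     (Ide (?E y z) (PMap1 ?d y z h))
     (PComp ?d (w, x, y) (g, f))"
   using a by (simp add: i)
 qed (auto simp: i g.K.strict_2_category_axioms d.L.strict_2_category_axioms comp_two_fct_def compose_def)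
qed

lemma id_two_fct_simps [simp]:
 "x \<in> Obj2 K ==> PObj (id_two_fct K) x = x"
 "x \<in> Obj2 K ==> y \<in> Obj2 K ==> PHom (id_two_fct K) (x, y) = id_fct (Hom2 K x y)"
 "x \<in> Obj2 K ==> PUnit (id_two_fct K) x = Ide (Hom2 K x x) (Ide2 K x)"
 "x \<in> Obj2 K ==> y \<in> Obj2 K ==> z \<in> Obj2 K ==> g \<in> Obj (Hom2 K y z) ==> f \<in> Obj (Hom2 K x y) ==>
  PComp (id_two_fct K) (x, y, z) (g, f) = Ide (Hom2 K x z) (hcomp1 K x y z g f)"
 by (simp_all add: id_two_fct_def)

lemma (in strict_2_category) id_two_fct_two_functor: "two_functor K K (id_two_fct K)"
 by (rule two_functorI) (auto simp: strict_2_category_axioms assoc1, auto simp: id_two_fct_def)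

section \<open>A criterion for strong equivalences\<close>

lemma (in strict_2_category) inv_hcomp:
 assumes "x \<in> Obj2 K" "y \<in> Obj2 K" "z \<in> Obj2 K" "iso (Hom2 K y z) b" "iso (Hom2 K x y) a"
 shows "inv_arr (Hom2 K x z) (hcomp2 K x y z b a) =
  hcomp2 K x y z (inv_arr (Hom2 K y z) b) (inv_arr (Hom2 K x y) a)"
 by (rule inv_arr_unique) (use assms in \<open>simp_all add: interchange\<close>)

context two_functor begin

text \<open>The composition cells of the quasi-inverse constructed below are lifts of inverted
  composition cells of \<open>\<gamma>\<close>, so naturality and coherence are needed in inverted
  form.\<close>

lemma inv_PComp_natural:
 assumes "x \<in> Obj2 K" "y \<in> Obj2 K" "z \<in> Obj2 K"
  "b \<in> Arr (Hom2 K y z)" "Dom (Hom2 K y z) b = g" "Cod (Hom2 K y z) b = g'"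
  "a \<in> Arr (Hom2 K x y)" "Dom (Hom2 K x y) a = f" "Cod (Hom2 K x y) a = f'"
 shows "inv_arr (HL x z) (PComp \<gamma> (x, y, z) (g', f')) \<cdot>[HL x z]
   PMap2 \<gamma> x z (hcomp2 K x y z b a) =
  hL x y z (PMap2 \<gamma> y z b) (PMap2 \<gamma> x y a) \<cdot>[HL x z]
   inv_arr (HL x z) (PComp \<gamma> (x, y, z) (g, f))"
proof -
 note n = PComp_natural[OF assms]
 have [simp]: "g \<in> Obj (Hom2 K y z)" "g' \<in> Obj (Hom2 K y z)" "f \<in> Obj (Hom2 K x y)" "f' \<in> Obj (Hom2 K x y)"
  using assms by auto
 have "PMap2 \<gamma> x z (hcomp2 K x y z b a) = (PMap2 \<gamma> x z (hcomp2 K x y z b a) \<cdot>[HL x z]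
   PComp \<gamma> (x, y, z) (g, f)) \<cdot>[HL x z] inv_arr (HL x z) (PComp \<gamma> (x, y, z) (g, f))"
  using assms by simp
 then show ?thesis
  unfolding n[symmetric] using assms by (subst inv_arr_eq_left) simp_all
qed

lemma inv_PComp_left:
 assumes "x \<in> Obj2 K" "y \<in> Obj2 K" "f \<in> Obj (Hom2 K x y)"
 shows "inv_arr (HL x y) (PComp \<gamma> (x, y, y) (Ide2 K y, f)) =
  hL x y y (PUnit \<gamma> y) (Ide (HL x y) (PMap1 \<gamma> x y f))"
 using inv_arr_eq_left[of "HL x y" "PComp \<gamma> (x, y, y) (Ide2 K y, f)" "Ide (HL x y) (PMap1 \<gamma> x y f)"
   "hL x y y (PUnit \<gamma> y) (Ide (HL x y) (PMap1 \<gamma> x y f))"]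
  pcoh_left[OF assms] assms by simp

lemma inv_PComp_right:
 assumes "x \<in> Obj2 K" "y \<in> Obj2 K" "f \<in> Obj (Hom2 K x y)"
 shows "inv_arr (HL x y) (PComp \<gamma> (x, x, y) (f, Ide2 K x)) =
  hL x x y (Ide (HL x y) (PMap1 \<gamma> x y f)) (PUnit \<gamma> x)"
 using inv_arr_eq_left[of "HL x y" "PComp \<gamma> (x, x, y) (f, Ide2 K x)" "Ide (HL x y) (PMap1 \<gamma> x y f)"
   "hL x x y (Ide (HL x y) (PMap1 \<gamma> x y f)) (PUnit \<gamma> x)"]
  pcoh_right[OF assms] assms by simp

lemma inv_PComp_assoc:
 assumes "w \<in> Obj2 K" "x \<in> Obj2 K" "y \<in> Obj2 K" "z \<in> Obj2 K"
  "f \<in> Obj (Hom2 K w x)" "g \<in> Obj (Hom2 K x y)" "h \<in> Obj (Hom2 K y z)"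
 shows "hL w x z
   (inv_arr (HL x z) (PComp \<gamma> (x, y, z) (h, g))) (Ide (HL w x) (PMap1 \<gamma> w x f))
   \<cdot>[HL w z] inv_arr (HL w z) (PComp \<gamma> (w, x, z) (hcomp1 K x y z h g, f)) =
  hL w y z
   (Ide (HL y z) (PMap1 \<gamma> y z h)) (inv_arr (HL w y) (PComp \<gamma> (w, x, y) (g, f)))
   \<cdot>[HL w z] inv_arr (HL w z) (PComp \<gamma> (w, y, z) (h, hcomp1 K w x y g f))"
 using arg_cong[OF pcoh_assoc[OF assms], of "inv_arr (HL w z)"] assms
 by (simp add: inv_arr_comp L.inv_hcomp K.assoc1 L.assoc1)

end

text \<open>Essential surjectivity on objects would be too weak: 2-morphisms exist only between
  2-functors with equal object maps, so a strong equivalence has mutually inverse object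
  maps.\<close>

locale local_equivalence = two_functor K L \<gamma> for K L \<gamma> +
 assumes bij: "bij_betw (PObj \<gamma>) (Obj2 K) (Obj2 L)"
  and ff: "x \<in> Obj2 K ==> y \<in> Obj2 K ==> fully_faithful (Hom2 K x y) (HL x y) (PHom \<gamma> (x, y))"
  and es: "x \<in> Obj2 K ==> y \<in> Obj2 K ==> ess_surjective (Hom2 K x y) (HL x y) (PHom \<gamma> (x, y))"
begin

definition "p = inv_into (Obj2 K) (PObj \<gamma>)"

lemma p_simps [simp]: "x \<in> Obj2 L ==> p x \<in> Obj2 K" "x \<in> Obj2 L ==> PObj \<gamma> (p x) = x"
 "w \<in> Obj2 K ==> p (PObj \<gamma> w) = w"
 using bij by (auto simp: p_def bij_betw_def inv_into_into f_inv_into_f)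

abbreviation "Hp x y \<equiv> Hom2 K (p x) (p y)"
abbreviation "hp x y z \<equiv> hcomp2 K (p x) (p y) (p z)"
abbreviation "Cp x y z \<equiv> PComp \<gamma> (p x, p y, p z)"
abbreviation "Np x y \<equiv> PMap1 \<gamma> (p x) (p y)"
abbreviation "Mp x y \<equiv> PMap2 \<gamma> (p x) (p y)"

text \<open>The preimage of \<open>g\<close> up to isomorphism and the isomorphism are chosen as a
  pair, so that both refer to the same choice.\<close>

definition "qinv x y g = (SOME q. fst q \<in> Obj (Hp x y) \<and> iso (Hom2 L x y) (snd q) \<and>
 Dom (Hom2 L x y) (snd q) = Np x y (fst q) \<and> Cod (Hom2 L x y) (snd q) = g)"

abbreviation "Q x y g \<equiv> fst (qinv x y g)"
abbreviation "E x y g \<equiv> snd (qinv x y g)"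

lemma qinv_simps [simp]:
 assumes "x \<in> Obj2 L" "y \<in> Obj2 L" "g \<in> Obj (Hom2 L x y)"
 shows "Q x y g \<in> Obj (Hp x y)" "iso (Hom2 L x y) (E x y g)"
  "Dom (Hom2 L x y) (E x y g) = Np x y (Q x y g)" "Cod (Hom2 L x y) (E x y g) = g"
proof -
 obtain f e where "f \<in> Obj (Hp x y)" "iso (Hom2 L x y) e"
  "Dom (Hom2 L x y) e = Np x y f" "Cod (Hom2 L x y) e = g"
  using es[of "p x" "p y"] assms unfolding ess_surjective_def by auto
 then have "\<exists>q. fst q \<in> Obj (Hp x y) \<and> iso (Hom2 L x y) (snd q) \<and>
   Dom (Hom2 L x y) (snd q) = Np x y (fst q) \<and> Cod (Hom2 L x y) (snd q) = g"
  by (intro exI[of _ "(f, e)"]) simp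
 from someI_ex[OF this, folded qinv_def]
 show "Q x y g \<in> Obj (Hp x y)" "iso (Hom2 L x y) (E x y g)"
  "Dom (Hom2 L x y) (E x y g) = Np x y (Q x y g)" "Cod (Hom2 L x y) (E x y g) = g"
  by auto
qed

text \<open>The endpoints are arguments because a fully faithful functor need not be injective on
  objects, so the arrow \<open>a\<close> alone does not determine them.\<close>

definition "lift x y f f' a = (SOME k. k \<in> Arr (Hp x y) \<and> Dom (Hp x y) k = f \<and>
 Cod (Hp x y) k = f' \<and> Mp x y k = a)"

lemma lift_simps [simp]:
 assumes "x \<in> Obj2 L" "y \<in> Obj2 L" "a \<in> Arr (Hom2 L x y)"
  "f \<in> Obj (Hp x y)" "Dom (Hom2 L x y) a = Np x y f"
  "f' \<in> Obj (Hp x y)" "Cod (Hom2 L x y) a = Np x y f'"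
 shows "lift x y f f' a \<in> Arr (Hp x y)" "Dom (Hp x y) (lift x y f f' a) = f"
  "Cod (Hp x y) (lift x y f f' a) = f'" "Mp x y (lift x y f f' a) = a"
proof -
 have "\<exists>k. k \<in> Arr (Hp x y) \<and> Dom (Hp x y) k = f \<and>
  Cod (Hp x y) k = f' \<and> Mp x y k = a"
  using fully_faithfulD[OF ff[of "p x" "p y"], of f f' a] assms by auto
 from someI_ex[OF this, folded lift_def]
 show "lift x y f f' a \<in> Arr (Hp x y)" "Dom (Hp x y) (lift x y f f' a) = f"
  "Cod (Hp x y) (lift x y f f' a) = f'" "Mp x y (lift x y f f' a) = a"
  by auto
qed

lemma faith:
 assumes "x \<in> Obj2 K" "y \<in> Obj2 K" "u \<in> Arr (Hom2 K x y)" "v \<in> Arr (Hom2 K x y)"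
  "Dom (Hom2 K x y) u = Dom (Hom2 K x y) v" "Cod (Hom2 K x y) u = Cod (Hom2 K x y) v"
  "PMap2 \<gamma> x y u = PMap2 \<gamma> x y v"
 shows "u = v"
 using faithfulD[OF ff[OF assms(1,2)] phom_functor[OF assms(1,2)]] assms by blast

lemma lift_iso [simp]:
 assumes "x \<in> Obj2 L" "y \<in> Obj2 L" "iso (Hom2 L x y) a"
  "f \<in> Obj (Hp x y)" "Dom (Hom2 L x y) a = Np x y f"
  "f' \<in> Obj (Hp x y)" "Cod (Hom2 L x y) a = Np x y f'"
 shows "iso (Hp x y) (lift x y f f' a)"
 by (rule iso_reflect[OF ff phom_functor]) (use assms in simp_all)

text \<open>Every cell is the lift of what its image must be if the isomorphisms \<open>E\<close>
  are to form a 2-morphism from \<open>\<gamma>\<close> after \<open>inv2\<close> to the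
  identity.\<close>

definition "inv2 = \<lparr>PObj = \<lambda>x\<in>Obj2 L. p x,
 PHom = \<lambda>(x, y)\<in>Obj2 L \<times> Obj2 L.
  \<lparr>FObj = \<lambda>g\<in>Obj (Hom2 L x y). Q x y g,
   FArr = \<lambda>b\<in>Arr (Hom2 L x y). lift x y (Q x y (Dom (Hom2 L x y) b)) (Q x y (Cod (Hom2 L x y) b))
    (inv_arr (Hom2 L x y) (E x y (Cod (Hom2 L x y) b)) \<cdot>[Hom2 L x y] b \<cdot>[Hom2 L x y] E x y (Dom (Hom2 L x y) b))\<rparr>,
 PUnit = \<lambda>x\<in>Obj2 L. lift x x (Ide2 K (p x)) (Q x x (Ide2 L x))
  (inv_arr (Hom2 L x x) (E x x (Ide2 L x)) \<cdot>[Hom2 L x x] inv_arr (Hom2 L x x) (PUnit \<gamma> (p x))),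
 PComp = \<lambda>(x, y, z)\<in>Obj2 L \<times> Obj2 L \<times> Obj2 L. \<lambda>(h, g)\<in>Obj (Hom2 L y z) \<times> Obj (Hom2 L x y).
  lift x z (hcomp1 K (p x) (p y) (p z) (Q y z h) (Q x y g)) (Q x z (hcomp1 L x y z h g))
   (inv_arr (Hom2 L x z) (E x z (hcomp1 L x y z h g)) \<cdot>[Hom2 L x z]
    hcomp2 L x y z (E y z h) (E x y g) \<cdot>[Hom2 L x z]
    inv_arr (Hom2 L x z) (Cp x y z (Q y z h, Q x y g)))\<rparr>"

lemma PUnit_p [simp]:
 assumes "x \<in> Obj2 L"
 shows "iso (Hom2 L x x) (PUnit \<gamma> (p x))" "Dom (Hom2 L x x) (PUnit \<gamma> (p x)) = Ide2 L x"
  "Cod (Hom2 L x x) (PUnit \<gamma> (p x)) = Np x x (Ide2 K (p x))"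
 using PUnit_simps[of "p x"] assms by simp_all

lemma PComp_p [simp]:
 assumes "x \<in> Obj2 L" "y \<in> Obj2 L" "z \<in> Obj2 L" "g \<in> Obj (Hp y z)" "f \<in> Obj (Hp x y)"
 shows "iso (Hom2 L x z) (Cp x y z (g, f))"
  "Dom (Hom2 L x z) (Cp x y z (g, f)) =
   hcomp1 L x y z (Np y z g) (Np x y f)"
  "Cod (Hom2 L x z) (Cp x y z (g, f)) = Np x z (hcomp1 K (p x) (p y) (p z) g f)"
 using PComp_simps[of "p x" "p y" "p z" g f] assms by simp_all

lemma PMap_p [simp]:
 assumes "x \<in> Obj2 L" "y \<in> Obj2 L"
 shows "f \<in> Obj (Hp x y) ==> Np x y f \<in> Obj (Hom2 L x y)"
  "a \<in> Arr (Hp x y) ==> Mp x y a \<in> Arr (Hom2 L x y)"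
  "a \<in> Arr (Hp x y) ==> Dom (Hom2 L x y) (Mp x y a) = Np x y (Dom (Hp x y) a)"
  "a \<in> Arr (Hp x y) ==> Cod (Hom2 L x y) (Mp x y a) = Np x y (Cod (Hp x y) a)"
  "f \<in> Obj (Hp x y) ==> Mp x y (Ide (Hp x y) f) = Ide (Hom2 L x y) (Np x y f)"
  "a \<in> Arr (Hp x y) ==> b \<in> Arr (Hp x y) ==> Dom (Hp x y) b = Cod (Hp x y) a ==>
   Mp x y (b \<cdot>[Hp x y] a) = Mp x y b \<cdot>[Hom2 L x y] Mp x y a"
 using PMap_simps[of "p x" "p y"] assms by simp_all

lemma inv2_simps [simp]:
 "x \<in> Obj2 L ==> PObj inv2 x = p x"
 "x \<in> Obj2 L ==> y \<in> Obj2 L ==> g \<in> Obj (Hom2 L x y) ==> PMap1 inv2 x y g = Q x y g"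
 by (simp_all add: inv2_def)

lemma inv2_arr [simp]:
 assumes "x \<in> Obj2 L" "y \<in> Obj2 L" "b \<in> Arr (Hom2 L x y)"
 shows "PMap2 inv2 x y b \<in> Arr (Hp x y)"
  "Dom (Hp x y) (PMap2 inv2 x y b) = Q x y (Dom (Hom2 L x y) b)"
  "Cod (Hp x y) (PMap2 inv2 x y b) = Q x y (Cod (Hom2 L x y) b)"
  "Mp x y (PMap2 inv2 x y b) =
   inv_arr (Hom2 L x y) (E x y (Cod (Hom2 L x y) b)) \<cdot>[Hom2 L x y] b \<cdot>[Hom2 L x y] E x y (Dom (Hom2 L x y) b)"
 using assms by (simp_all add: inv2_def)

lemma inv2_unit [simp]:
 assumes "x \<in> Obj2 L"
 shows "iso (Hp x x) (PUnit inv2 x)" "Dom (Hp x x) (PUnit inv2 x) = Ide2 K (p x)"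
  "Cod (Hp x x) (PUnit inv2 x) = Q x x (Ide2 L x)"
  "Mp x x (PUnit inv2 x) =
   inv_arr (Hom2 L x x) (E x x (Ide2 L x)) \<cdot>[Hom2 L x x] inv_arr (Hom2 L x x) (PUnit \<gamma> (p x))"
 using assms by (simp_all add: inv2_def)

lemma inv2_comp [simp]:
 assumes "x \<in> Obj2 L" "y \<in> Obj2 L" "z \<in> Obj2 L" "h \<in> Obj (Hom2 L y z)" "g \<in> Obj (Hom2 L x y)"
 shows "iso (Hp x z) (PComp inv2 (x, y, z) (h, g))"
  "Dom (Hp x z) (PComp inv2 (x, y, z) (h, g)) = hcomp1 K (p x) (p y) (p z) (Q y z h) (Q x y g)"
  "Cod (Hp x z) (PComp inv2 (x, y, z) (h, g)) = Q x z (hcomp1 L x y z h g)"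
  "Mp x z (PComp inv2 (x, y, z) (h, g)) =
   inv_arr (Hom2 L x z) (E x z (hcomp1 L x y z h g)) \<cdot>[Hom2 L x z]
    hcomp2 L x y z (E y z h) (E x y g) \<cdot>[Hom2 L x z]
    inv_arr (Hom2 L x z) (Cp x y z (Q y z h, Q x y g))"
 using assms by (simp_all add: inv2_def)

lemma inv_nat_p:
 assumes "x \<in> Obj2 L" "y \<in> Obj2 L" "z \<in> Obj2 L"
  "b \<in> Arr (Hp y z)" "Dom (Hp y z) b = g" "Cod (Hp y z) b = g'"
  "a \<in> Arr (Hp x y)" "Dom (Hp x y) a = f" "Cod (Hp x y) a = f'"
 shows "inv_arr (Hom2 L x z) (Cp x y z (g', f')) \<cdot>[Hom2 L x z]
   Mp x z (hp x y z b a) =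
  hcomp2 L x y z (Mp y z b) (Mp x y a) \<cdot>[Hom2 L x z]
   inv_arr (Hom2 L x z) (Cp x y z (g, f))"
 using inv_PComp_natural[of "p x" "p y" "p z" b g g' a f f'] assms by simp

text \<open>Faithfulness of \<open>\<gamma>\<close> moves each law to \<open>L\<close>, where the
  isomorphisms \<open>E\<close> cancel and a law for the inverted composition cells of
  \<open>\<gamma>\<close> remains.\<close>

lemma inv2_two_functor: "two_functor L K inv2"
proof (rule two_functorI)
 fix x y assume xy: "x \<in> Obj2 L" "y \<in> Obj2 L"
 show "cat_functor (Hom2 L x y) (PHomCat K inv2 x y) (PHom inv2 (x, y))"
 proof (rule cat_functorI)
  fix f g assume "f \<in> Arr (Hom2 L x y)" "g \<in> Arr (Hom2 L x y)" "Dom (Hom2 L x y) g = Cod (Hom2 L x y) f"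
  then show "PMap2 inv2 x y (g \<cdot>[Hom2 L x y] f) = PMap2 inv2 x y g \<cdot>[PHomCat K inv2 x y] PMap2 inv2 x y f"
   using xy by (intro faith[of "p x" "p y"]) simp_all
 next
  fix g assume "g \<in> Obj (Hom2 L x y)"
  then show "PMap2 inv2 x y (Ide (Hom2 L x y) g) = Ide (PHomCat K inv2 x y) (PMap1 inv2 x y g)"
   using xy by (intro faith[of "p x" "p y"]) simp_all
 next
  show "FObj (PHom inv2 (x, y)) \<in> Obj (Hom2 L x y) \<rightarrow>\<^sub>E Obj (PHomCat K inv2 x y)"
   using xy by (auto simp: inv2_def)
  show "FArr (PHom inv2 (x, y)) \<in> extensional (Arr (Hom2 L x y))" using xy by (auto simp: inv2_def)
 qed (use xy in simp_all)
next
 fix x y z b a assume h: "x \<in> Obj2 L" "y \<in> Obj2 L" "z \<in> Obj2 L" "b \<in> Arr (Hom2 L y z)" "a \<in> Arr (Hom2 L x y)"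
 note n = inv_nat_p[OF h(1-3) inv2_arr(1-3)[OF h(2,3,4)] inv2_arr(1-3)[OF h(1,2,5)]]
 show "PComp inv2 (x, y, z) (Cod (Hom2 L y z) b, Cod (Hom2 L x y) a) \<cdot>[PHomCat K inv2 x z]
    hcomp2 K (PObj inv2 x) (PObj inv2 y) (PObj inv2 z) (PMap2 inv2 y z b) (PMap2 inv2 x y a) =
   PMap2 inv2 x z (hcomp2 L x y z b a) \<cdot>[PHomCat K inv2 x z]
    PComp inv2 (x, y, z) (Dom (Hom2 L y z) b, Dom (Hom2 L x y) a)"
  using h by (intro faith[of "p x" "p z"]) (simp_all add: n L.interchange_assoc)
next
 fix x y f assume h: "x \<in> Obj2 L" "y \<in> Obj2 L" "f \<in> Obj (Hom2 L x y)"
 have n: "inv_arr (Hom2 L x y) (Cp x y y (Q y y (Ide2 L y), Q x y f)) \<cdot>[Hom2 L x y]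
   Mp x y (hp x y y (PUnit inv2 y) (Ide (Hp x y) (Q x y f))) =
  hcomp2 L x y y (Mp y y (PUnit inv2 y)) (Mp x y (Ide (Hp x y) (Q x y f)))
   \<cdot>[Hom2 L x y] inv_arr (Hom2 L x y) (Cp x y y (Ide2 K (p y), Q x y f))"
  by (rule inv_nat_p) (use h in simp_all)
 show "PComp inv2 (x, y, y) (Ide2 L y, f) \<cdot>[PHomCat K inv2 x y]
    hcomp2 K (PObj inv2 x) (PObj inv2 y) (PObj inv2 y)
     (PUnit inv2 y) (Ide (PHomCat K inv2 x y) (PMap1 inv2 x y f))
   = Ide (PHomCat K inv2 x y) (PMap1 inv2 x y f)"
  using h inv_PComp_left[of "p x" "p y" "Q x y f"]
  by (intro faith[of "p x" "p y"]) (simp_all add: n L.interchange_assoc L.interchange)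
next
 fix x y f assume h: "x \<in> Obj2 L" "y \<in> Obj2 L" "f \<in> Obj (Hom2 L x y)"
 have n: "inv_arr (Hom2 L x y) (Cp x x y (Q x y f, Q x x (Ide2 L x))) \<cdot>[Hom2 L x y]
   Mp x y (hp x x y (Ide (Hp x y) (Q x y f)) (PUnit inv2 x)) =
  hcomp2 L x x y (Mp x y (Ide (Hp x y) (Q x y f))) (Mp x x (PUnit inv2 x))
   \<cdot>[Hom2 L x y] inv_arr (Hom2 L x y) (Cp x x y (Q x y f, Ide2 K (p x)))"
  by (rule inv_nat_p) (use h in simp_all)
 show "PComp inv2 (x, x, y) (f, Ide2 L x) \<cdot>[PHomCat K inv2 x y]
    hcomp2 K (PObj inv2 x) (PObj inv2 x) (PObj inv2 y)
     (Ide (PHomCat K inv2 x y) (PMap1 inv2 x y f)) (PUnit inv2 x)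
   = Ide (PHomCat K inv2 x y) (PMap1 inv2 x y f)"
  using h inv_PComp_right[of "p x" "p y" "Q x y f"]
  by (intro faith[of "p x" "p y"]) (simp_all add: n L.interchange_assoc L.interchange)
next
 fix w x y z f g h assume a: "w \<in> Obj2 L" "x \<in> Obj2 L" "y \<in> Obj2 L" "z \<in> Obj2 L"
  "f \<in> Obj (Hom2 L w x)" "g \<in> Obj (Hom2 L x y)" "h \<in> Obj (Hom2 L y z)"
 let ?F = "Q w x f" and ?G = "Q x y g" and ?H = "Q y z h"
 let ?hg = "hcomp1 L x y z h g" and ?gf = "hcomp1 L w x y g f"
 let ?IF = "Ide (Hp w x) ?F" and ?IH = "Ide (Hp y z) ?H"
 let ?C = "Hom2 L w z"
 have n1: "inv_arr ?C (Cp w x z (Q x z ?hg, ?F)) \<cdot>[?C]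
   Mp w z (hp w x z (PComp inv2 (x, y, z) (h, g)) ?IF) =
  hcomp2 L w x z (Mp x z (PComp inv2 (x, y, z) (h, g))) (Mp w x ?IF) \<cdot>[?C]
   inv_arr ?C (Cp w x z (hcomp1 K (p x) (p y) (p z) ?H ?G, ?F))"
  by (rule inv_nat_p) (use a in simp_all)
 have n2: "inv_arr ?C (Cp w y z (?H, Q w y ?gf)) \<cdot>[?C]
   Mp w z (hp w y z ?IH (PComp inv2 (w, x, y) (g, f))) =
  hcomp2 L w y z (Mp y z ?IH) (Mp w y (PComp inv2 (w, x, y) (g, f))) \<cdot>[?C]
   inv_arr ?C (Cp w y z (?H, hcomp1 K (p w) (p x) (p y) ?G ?F))"
  by (rule inv_nat_p) (use a in simp_all)
 let ?jf = "Ide (Hom2 L w x) (Np w x ?F)" and ?jh = "Ide (Hom2 L y z) (Np y z ?H)"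
 let ?ihg = "inv_arr (Hom2 L x z) (Cp x y z (?H, ?G))"
 let ?igf = "inv_arr (Hom2 L w y) (Cp w x y (?G, ?F))"
 have c: "hcomp2 L w x z ?ihg ?jf \<cdot>[?C]
   inv_arr ?C (Cp w x z (hcomp1 K (p x) (p y) (p z) ?H ?G, ?F)) =
  hcomp2 L w y z ?jh ?igf \<cdot>[?C]
   inv_arr ?C (Cp w y z (?H, hcomp1 K (p w) (p x) (p y) ?G ?F))"
  using inv_PComp_assoc[of "p w" "p x" "p y" "p z" ?F ?G ?H] a by simp
 \<comment> \<open>Associativity with the isomorphisms \<open>E\<close> attached: interchange
   separates them, leaving strict associativity in \<open>L\<close> and the inverted law
   \<open>c\<close>.\<close>
 have "hcomp2 L w x z (hcomp2 L x y z (E y z h) (E x y g) \<cdot>[Hom2 L x z] ?ihg) (E w x f) \<cdot>[?C]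
   inv_arr ?C (Cp w x z (hcomp1 K (p x) (p y) (p z) ?H ?G, ?F)) =
  hcomp2 L w x z (hcomp2 L x y z (E y z h) (E x y g)) (E w x f) \<cdot>[?C]
  hcomp2 L w x z ?ihg ?jf \<cdot>[?C]
   inv_arr ?C (Cp w x z (hcomp1 K (p x) (p y) (p z) ?H ?G, ?F))"
  using a by (simp add: L.interchange_assoc L.assoc1)
 also have "\<dots> = hcomp2 L w y z (E y z h) (hcomp2 L w x y (E x y g) (E w x f)) \<cdot>[?C]
  hcomp2 L w y z ?jh ?igf \<cdot>[?C]
   inv_arr ?C (Cp w y z (?H, hcomp1 K (p w) (p x) (p y) ?G ?F))"
  unfolding c using a by (simp add: L.assoc2)
 also have "\<dots> = hcomp2 L w y z (E y z h) (hcomp2 L w x y (E x y g) (E w x f) \<cdot>[Hom2 L w y] ?igf) \<cdot>[?C]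
   inv_arr ?C (Cp w y z (?H, hcomp1 K (p w) (p x) (p y) ?G ?F))"
  using a by (simp add: L.interchange_assoc L.assoc1 K.assoc1)
 finally have "hcomp2 L w x z (hcomp2 L x y z (E y z h) (E x y g) \<cdot>[Hom2 L x z] ?ihg) (E w x f) \<cdot>[?C]
   inv_arr ?C (Cp w x z (hcomp1 K (p x) (p y) (p z) ?H ?G, ?F)) =
  hcomp2 L w y z (E y z h) (hcomp2 L w x y (E x y g) (E w x f) \<cdot>[Hom2 L w y] ?igf) \<cdot>[?C]
   inv_arr ?C (Cp w y z (?H, hcomp1 K (p w) (p x) (p y) ?G ?F))" .
 then show "PComp inv2 (w, x, z) (hcomp1 L x y z h g, f) \<cdot>[PHomCat K inv2 w z]
    hcomp2 K (PObj inv2 w) (PObj inv2 x) (PObj inv2 z)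
     (PComp inv2 (x, y, z) (h, g)) (Ide (PHomCat K inv2 w x) (PMap1 inv2 w x f))
   = PComp inv2 (w, y, z) (h, hcomp1 L w x y g f) \<cdot>[PHomCat K inv2 w z]
    hcomp2 K (PObj inv2 w) (PObj inv2 y) (PObj inv2 z)
     (Ide (PHomCat K inv2 y z) (PMap1 inv2 y z h)) (PComp inv2 (w, x, y) (g, f))"
  using a by (intro faith[of "p w" "p z"]) (simp_all add: n1 n2 L.interchange_assoc L.assoc1 K.assoc1)
qed (auto simp: K.strict_2_category_axioms L.strict_2_category_axioms, auto simp: inv2_def)

text \<open>The counit is \<open>E\<close> by construction. The unit lifts the inverses of
  \<open>E\<close> at the images of \<open>\<gamma>\<close>, and its laws follow by
  faithfulness.\<close>

lemma strong: "strong_equivalence K L \<gamma>"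
 unfolding strong_equivalence_def
proof (intro conjI exI)
 interpret I: two_functor L K inv2 by (rule inv2_two_functor)
 show "two_functor K L \<gamma>" by (rule two_functor_axioms)
 show "two_functor L K inv2" by (rule inv2_two_functor)
 have c1: "two_functor K K (comp_two_fct K K inv2 \<gamma>)"
  by (rule comp_two_fct_two_functor[OF two_functor_axioms inv2_two_functor])
 have c2: "two_functor L L (comp_two_fct L L \<gamma> inv2)"
  by (rule comp_two_fct_two_functor[OF inv2_two_functor two_functor_axioms])
 define A where "A x y f = lift (PObj \<gamma> x) (PObj \<gamma> y) f (Q (PObj \<gamma> x) (PObj \<gamma> y) (PMap1 \<gamma> x y f))
   (inv_arr (HL x y) (E (PObj \<gamma> x) (PObj \<gamma> y) (PMap1 \<gamma> x y f)))" for x y f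
 have Q: "Q (PObj \<gamma> x) (PObj \<gamma> y) g \<in> Obj (Hom2 K x y)"
  "Dom (HL x y) (E (PObj \<gamma> x) (PObj \<gamma> y) g) = PMap1 \<gamma> x y (Q (PObj \<gamma> x) (PObj \<gamma> y) g)"
  if "x \<in> Obj2 K" "y \<in> Obj2 K" "g \<in> Obj (HL x y)" for x y g
  using qinv_simps(1,3)[of "PObj \<gamma> x" "PObj \<gamma> y" g] that by simp_all
 have A [simp]: "iso (Hom2 K x y) (A x y f)" "A x y f \<in> Arr (Hom2 K x y)" "Dom (Hom2 K x y) (A x y f) = f"
  "Cod (Hom2 K x y) (A x y f) = Q (PObj \<gamma> x) (PObj \<gamma> y) (PMap1 \<gamma> x y f)"
  "PMap2 \<gamma> x y (A x y f) = inv_arr (HL x y) (E (PObj \<gamma> x) (PObj \<gamma> y) (PMap1 \<gamma> x y f))"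
  if "x \<in> Obj2 K" "y \<in> Obj2 K" "f \<in> Obj (Hom2 K x y)" for x y f
  using that lift_iso[of "PObj \<gamma> x" "PObj \<gamma> y"] lift_simps[of "PObj \<gamma> x" "PObj \<gamma> y"] Q by (simp_all add: A_def)
 have I2: "PMap2 inv2 (PObj \<gamma> x) (PObj \<gamma> y) b \<in> Arr (Hom2 K x y)"
  "Dom (Hom2 K x y) (PMap2 inv2 (PObj \<gamma> x) (PObj \<gamma> y) b) = Q (PObj \<gamma> x) (PObj \<gamma> y) (Dom (HL x y) b)"
  "Cod (Hom2 K x y) (PMap2 inv2 (PObj \<gamma> x) (PObj \<gamma> y) b) = Q (PObj \<gamma> x) (PObj \<gamma> y) (Cod (HL x y) b)"
  "PMap2 \<gamma> x y (PMap2 inv2 (PObj \<gamma> x) (PObj \<gamma> y) b) =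
   inv_arr (HL x y) (E (PObj \<gamma> x) (PObj \<gamma> y) (Cod (HL x y) b)) \<cdot>[HL x y]
    b \<cdot>[HL x y] E (PObj \<gamma> x) (PObj \<gamma> y) (Dom (HL x y) b)"
  if "x \<in> Obj2 K" "y \<in> Obj2 K" "b \<in> Arr (HL x y)" for x y b
  using inv2_arr[of "PObj \<gamma> x" "PObj \<gamma> y" b] that by simp_all
 let ?\<alpha> = "\<lambda>(x, y)\<in>Obj2 K \<times> Obj2 K. \<lambda>f\<in>Obj (Hom2 K x y). A x y f"
 have f1: "nat_iso (Hom2 K x y) (PHomCat K (id_two_fct K) x y) (PHom (id_two_fct K) (x, y))
   (PHom (comp_two_fct K K inv2 \<gamma>) (x, y)) (?\<alpha> (x, y))" if h: "x \<in> Obj2 K" "y \<in> Obj2 K" for x y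
 proof (rule nat_isoI)
  show "cat_functor (Hom2 K x y) (PHomCat K (id_two_fct K) x y) (PHom (comp_two_fct K K inv2 \<gamma>) (x, y))"
   using two_functor.phom_functor[OF c1 h] h by simp
  fix f assume f: "f \<in> Arr (Hom2 K x y)"
  have "A x y (Cod (Hom2 K x y) f) \<cdot>[Hom2 K x y] f =
    PMap2 inv2 (PObj \<gamma> x) (PObj \<gamma> y) (PMap2 \<gamma> x y f) \<cdot>[Hom2 K x y] A x y (Dom (Hom2 K x y) f)"
   using h f by (intro faith[of x y]) (simp_all add: I2 Q)
  then show "?\<alpha> (x, y) (Cod (Hom2 K x y) f) \<cdot>[PHomCat K (id_two_fct K) x y] FArr (PHom (id_two_fct K) (x, y)) f =
    FArr (PHom (comp_two_fct K K inv2 \<gamma>) (x, y)) f \<cdot>[PHomCat K (id_two_fct K) x y] ?\<alpha> (x, y) (Dom (Hom2 K x y) f)"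
   using h f by simp
 qed (use h in simp_all)
 show "invertible_two_morphism K K (id_two_fct K) (comp_two_fct K K inv2 \<gamma>) ?\<alpha>"
  unfolding invertible_two_morphism_def
 proof (intro conjI ballI two_morphism.intro two_morphism_axioms.intro f1 c1 K.id_two_fct_two_functor)
  fix x y assume h: "x \<in> Obj2 K" "y \<in> Obj2 K"
  show "nat_trans (Hom2 K x y) (PHomCat K (id_two_fct K) x y) (PHom (id_two_fct K) (x, y))
   (PHom (comp_two_fct K K inv2 \<gamma>) (x, y)) (?\<alpha> (x, y))"
   using f1[OF h] unfolding nat_iso_def by blast
 next
  fix x y z f g assume h: "x \<in> Obj2 K" "y \<in> Obj2 K" "z \<in> Obj2 K" "f \<in> Obj (Hom2 K x y)" "g \<in> Obj (Hom2 K y z)"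
  let ?x = "PObj \<gamma> x" and ?y = "PObj \<gamma> y" and ?z = "PObj \<gamma> z"
  let ?f = "PMap1 \<gamma> x y f" and ?g = "PMap1 \<gamma> y z g"
  have n: "inv_arr (HL x z) (PComp \<gamma> (x, y, z) (Q ?y ?z ?g, Q ?x ?y ?f)) \<cdot>[HL x z]
    PMap2 \<gamma> x z (hcomp2 K x y z (A y z g) (A x y f)) =
   hcomp2 L ?x ?y ?z (PMap2 \<gamma> y z (A y z g)) (PMap2 \<gamma> x y (A x y f)) \<cdot>[HL x z]
    inv_arr (HL x z) (PComp \<gamma> (x, y, z) (g, f))"
   using h by (intro inv_PComp_natural) simp_all
  note P = inv2_comp[of ?x ?y ?z ?g ?f]
  have "(PMap2 inv2 ?x ?z (PComp \<gamma> (x, y, z) (g, f)) \<cdot>[Hom2 K x z] PComp inv2 (?x, ?y, ?z) (?g, ?f)) \<cdot>[Hom2 K x z]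
    hcomp2 K x y z (A y z g) (A x y f) = A x z (hcomp1 K x y z g f)"
   using h P by (intro faith[of x z]) (simp_all add: I2 Q n L.interchange_assoc)
  then show "?\<alpha> (x, z) (hcomp1 K x y z g f) \<cdot>[PHomCat K (id_two_fct K) x z] PComp (id_two_fct K) (x, y, z) (g, f)
   = PComp (comp_two_fct K K inv2 \<gamma>) (x, y, z) (g, f) \<cdot>[PHomCat K (id_two_fct K) x z]
    hcomp2 K (PObj (id_two_fct K) x) (PObj (id_two_fct K) y) (PObj (id_two_fct K) z) (?\<alpha> (y, z) g) (?\<alpha> (x, y) f)"
   using h by simp
 next
  fix x assume h: "x \<in> Obj2 K"
  note P = inv2_unit[of "PObj \<gamma> x"]
  have "PMap2 inv2 (PObj \<gamma> x) (PObj \<gamma> x) (PUnit \<gamma> x) \<cdot>[Hom2 K x x] PUnit inv2 (PObj \<gamma> x) = A x x (Ide2 K x)"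
   using h P by (intro faith[of x x]) (simp_all add: I2 Q)
  then show "?\<alpha> (x, x) (Ide2 K x) \<cdot>[PHomCat K (id_two_fct K) x x] PUnit (id_two_fct K) x =
    PUnit (comp_two_fct K K inv2 \<gamma>) x"
   using h by simp
 qed simp_all
 let ?\<beta> = "\<lambda>(x, y)\<in>Obj2 L \<times> Obj2 L. \<lambda>g\<in>Obj (Hom2 L x y). E x y g"
 have f2: "nat_iso (Hom2 L x y) (PHomCat L (comp_two_fct L L \<gamma> inv2) x y) (PHom (comp_two_fct L L \<gamma> inv2) (x, y))
   (PHom (id_two_fct L) (x, y)) (?\<beta> (x, y))" if h: "x \<in> Obj2 L" "y \<in> Obj2 L" for x y
 proof (rule nat_isoI)
  show "cat_functor (Hom2 L x y) (PHomCat L (comp_two_fct L L \<gamma> inv2) x y) (PHom (comp_two_fct L L \<gamma> inv2) (x, y))"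
   using two_functor.phom_functor[OF c2 h] by simp
 qed (use h in simp_all)
 show "invertible_two_morphism L L (comp_two_fct L L \<gamma> inv2) (id_two_fct L) ?\<beta>"
  unfolding invertible_two_morphism_def
 proof (intro conjI ballI two_morphism.intro two_morphism_axioms.intro f2 c2 L.id_two_fct_two_functor)
  fix x y assume h: "x \<in> Obj2 L" "y \<in> Obj2 L"
  show "nat_trans (Hom2 L x y) (PHomCat L (comp_two_fct L L \<gamma> inv2) x y) (PHom (comp_two_fct L L \<gamma> inv2) (x, y))
   (PHom (id_two_fct L) (x, y)) (?\<beta> (x, y))"
   using f2[OF h] unfolding nat_iso_def by blast
 qed simp_all
qed

end

section \<open>Simplices given by composable chains\<close>

context strict_2_category begin

fun ch :: "(nat => 'o) => (nat => 'm) => nat => nat => 'm" where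
 "ch V e i 0 = Ide2 K (V i)"
| "ch V e i (Suc d) = hcomp1 K (V i) (V (i + d)) (V (Suc (i + d))) (e (i + d)) (ch V e i d)"

definition "cM V e i j = ch V e i (j - i)"

definition "is_chain n V e \<longleftrightarrow> (\<forall>i \<le> n. V i \<in> Obj2 K) \<and> (\<forall>i < n. e i \<in> Obj (Hom2 K (V i) (V (Suc i))))"

text \<open>Strictness of \<open>K\<close> makes iterated composites associative on the nose, so a
  composable chain becomes a simplex with identity structure cells and no chosen coherence.\<close>

definition "chain n V e = mkS K n V (cM V e) (\<lambda>i. Ide (Hom2 K (V i) (V i)) (Ide2 K (V i)))
 (\<lambda>i j k. Ide (Hom2 K (V i) (V k)) (cM V e i k))"

lemma is_chainD [simp]: "is_chain n V e ==> i \<le> n ==> V i \<in> Obj2 K"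
 "is_chain n V e ==> i < n ==> e i \<in> Obj (Hom2 K (V i) (V (Suc i)))"
 by (auto simp: is_chain_def)

lemma cM_self [simp]: "cM V e i i = Ide2 K (V i)"
 by (simp add: cM_def)

lemma cM_Suc: "i \<le> j ==> cM V e i (Suc j) = hcomp1 K (V i) (V j) (V (Suc j)) (e j) (cM V e i j)"
 by (simp add: cM_def Suc_diff_le)

lemma cM_obj [simp]:
 assumes "is_chain n V e" "i \<le> j" "j \<le> n"
 shows "cM V e i j \<in> Obj (Hom2 K (V i) (V j))"
 using assms(2,3) by (induction rule: dec_induct) (use assms(1) in \<open>simp_all add: cM_Suc\<close>)

lemma cM_comp [simp]:
 assumes "is_chain n V e" "i \<le> j" "j \<le> k" "k \<le> n"
 shows "hcomp1 K (V i) (V j) (V k) (cM V e j k) (cM V e i j) = cM V e i k"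
 using assms(3,4)
proof (induction rule: dec_induct)
 case base
 then show ?case using assms by simp
next
 case (step k)
 have "hcomp1 K (V i) (V k) (V (Suc k)) (e k) (hcomp1 K (V i) (V j) (V k) (cM V e j k) (cM V e i j)) =
  hcomp1 K (V i) (V j) (V (Suc k)) (hcomp1 K (V j) (V k) (V (Suc k)) (e k) (cM V e j k)) (cM V e i j)"
  using step assms by (intro assoc1) simp_all
 then show ?case using step assms(2) by (simp add: cM_Suc)
qed

lemma cM_edge: "is_chain n V e ==> i < n ==> cM V e i (Suc i) = e i"
 by (simp add: cM_Suc)

lemma chain_simplex [simp]:
 assumes "is_chain n V e"
 shows "is_simplex K n (chain n V e)"
 unfolding chain_def
proof (rule simplex_data.mkS_two_functor, unfold_locales)
 fix i j k assume "i \<le> j" "j \<le> k" "k \<le> n"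
 then show "iso (Hom2 K (V i) (V k)) (Ide (Hom2 K (V i) (V k)) (cM V e i k))"
  "Dom (Hom2 K (V i) (V k)) (Ide (Hom2 K (V i) (V k)) (cM V e i k)) = hcomp1 K (V i) (V j) (V k) (cM V e j k) (cM V e i j)"
  "Cod (Hom2 K (V i) (V k)) (Ide (Hom2 K (V i) (V k)) (cM V e i k)) = cM V e i k"
  using cM_obj[OF assms, of i k] cM_comp[OF assms, of i j k] assms by simp_all
next
 fix i j k l assume h: "i \<le> j" "j \<le> k" "k \<le> l" "l \<le> n"
 then show "Ide (Hom2 K (V i) (V l)) (cM V e i l) \<cdot>[Hom2 K (V i) (V l)]
    hcomp2 K (V i) (V j) (V l) (Ide (Hom2 K (V j) (V l)) (cM V e j l)) (Ide (Hom2 K (V i) (V j)) (cM V e i j)) =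
    Ide (Hom2 K (V i) (V l)) (cM V e i l) \<cdot>[Hom2 K (V i) (V l)]
    hcomp2 K (V i) (V k) (V l) (Ide (Hom2 K (V k) (V l)) (cM V e k l)) (Ide (Hom2 K (V i) (V k)) (cM V e i k))"
  using cM_obj[OF assms] cM_comp[OF assms] assms by simp
qed (use assms cM_obj[OF assms] in simp_all)

lemma chain_simps [simp]:
 "i \<le> n ==> PObj (chain n V e) i = V i"
 "i \<le> n ==> PUnit (chain n V e) i = Ide (Hom2 K (V i) (V i)) (Ide2 K (V i))"
 "i \<le> j ==> j \<le> n ==> sM (chain n V e) i j = cM V e i j"
 "i \<le> j ==> j \<le> k ==> k \<le> n ==> sC (chain n V e) i j k = Ide (Hom2 K (V i) (V k)) (cM V e i k)"
 by (simp_all add: chain_def)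

text \<open>With identity structure cells the conditions on an arrow become strict multiplicativity
  and unitality of its components.\<close>

lemma chain_gc:
 assumes "is_chain m V e" "is_chain n W d" "h \<in> Arr (SR K)" "Dom (SR K) h = (m, chain m V e)"
  "Cod (SR K) h = (n, chain n W d)"
 shows "i \<le> m ==> W (app (fst h) i) = V i"
  "i \<le> m ==> gc h i i = Ide (Hom2 K (V i) (V i)) (Ide2 K (V i))"
  "i \<le> j ==> j \<le> m ==> gc h i j \<in> Arr (Hom2 K (V i) (V j))"
  "i \<le> j ==> j \<le> m ==> Dom (Hom2 K (V i) (V j)) (gc h i j) = cM V e i j"
  "i \<le> j ==> j \<le> m ==> Cod (Hom2 K (V i) (V j)) (gc h i j) = cM W d (app (fst h) i) (app (fst h) j)"
  "i \<le> j ==> j \<le> k ==> k \<le> m ==> gc h i k = hcomp2 K (V i) (V j) (V k) (gc h j k) (gc h i j)"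
proof -
 note g = SR_gc[OF assms(3-5)] and a = SR_arrD[OF assms(3-5)]
 have le: "i \<le> m ==> app (fst h) i \<le> n" for i using a by simp
 have mono: "i \<le> j ==> j \<le> m ==> app (fst h) i \<le> app (fst h) j" for i j using a by simp
 show W: "i \<le> m ==> W (app (fst h) i) = V i" for i using g(6)[of i] le[of i] by simp
 show A: "i \<le> j ==> j \<le> m ==> gc h i j \<in> Arr (Hom2 K (V i) (V j))" for i j using g(1)[of i j] by simp
 show D: "i \<le> j ==> j \<le> m ==> Dom (Hom2 K (V i) (V j)) (gc h i j) = cM V e i j" for i j using g(2)[of i j] by simp
 show C: "i \<le> j ==> j \<le> m ==> Cod (Hom2 K (V i) (V j)) (gc h i j) = cM W d (app (fst h) i) (app (fst h) j)" for i j
  using g(3)[of i j] le mono by simp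
 show "gc h i i = Ide (Hom2 K (V i) (V i)) (Ide2 K (V i))" if "i \<le> m" for i
  using g(5)[of i] that le[of i] W[of i] A[of i i] D[of i i] C[of i i] assms by simp
 show "gc h i k = hcomp2 K (V i) (V j) (V k) (gc h j k) (gc h i j)" if h: "i \<le> j" "j \<le> k" "k \<le> m" for i j k
 proof -
  have l: "app (fst h) i \<le> app (fst h) j" "app (fst h) j \<le> app (fst h) k" "app (fst h) k \<le> n"
   using mono le h by auto
  have "cM W d (app (fst h) i) (app (fst h) k) = hcomp1 K (V i) (V j) (V k)
    (cM W d (app (fst h) j) (app (fst h) k)) (cM W d (app (fst h) i) (app (fst h) j))"
   using cM_comp[OF assms(2) l] W[of i] W[of j] W[of k] h by simp
  then show ?thesis
   using g(4)[OF h] h l W[of i] W[of k] A D C assms by simp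
 qed
qed

end

definition "parr K \<phi> \<sigma> \<tau> s = (SOME h. h \<in> Arr (SR K) \<and> Dom (SR K) h = (Dom Delta \<phi>, \<sigma>) \<and>
 Cod (SR K) h = (Cod Delta \<phi>, \<tau>) \<and> fst h = \<phi> \<and> (\<forall>i < Dom Delta \<phi>. gc h i (Suc i) = s i))"

lemma parr_simps:
 assumes "\<phi> \<in> Arr Delta" "is_simplex K (Dom Delta \<phi>) \<sigma>" "is_simplex K (Cod Delta \<phi>) \<tau>"
  "\<And>i. i \<le> Dom Delta \<phi> ==> PObj \<sigma> i = PObj \<tau> (app \<phi> i)"
  "\<And>i. i < Dom Delta \<phi> ==> s i \<in> hom (PHomCat K \<sigma> i (Suc i)) (sM \<sigma> i (Suc i)) (sM \<tau> (app \<phi> i) (app \<phi> (Suc i)))"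
 shows "parr K \<phi> \<sigma> \<tau> s \<in> Arr (SR K)" "Dom (SR K) (parr K \<phi> \<sigma> \<tau> s) = (Dom Delta \<phi>, \<sigma>)"
  "Cod (SR K) (parr K \<phi> \<sigma> \<tau> s) = (Cod Delta \<phi>, \<tau>)" "fst (parr K \<phi> \<sigma> \<tau> s) = \<phi>"
  "i < Dom Delta \<phi> ==> gc (parr K \<phi> \<sigma> \<tau> s) i (Suc i) = s i"
proof -
 have "\<exists>h. h \<in> Arr (SR K) \<and> Dom (SR K) h = (Dom Delta \<phi>, \<sigma>) \<and>
  Cod (SR K) h = (Cod Delta \<phi>, \<tau>) \<and> fst h = \<phi> \<and> (\<forall>i < Dom Delta \<phi>. gc h i (Suc i) = s i)"
  by (rule SR_fill[OF assms(1) refl refl assms(2-5)]) blast+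
 from someI_ex[OF this, folded parr_def]
 show "parr K \<phi> \<sigma> \<tau> s \<in> Arr (SR K)" "Dom (SR K) (parr K \<phi> \<sigma> \<tau> s) = (Dom Delta \<phi>, \<sigma>)"
  "Cod (SR K) (parr K \<phi> \<sigma> \<tau> s) = (Cod Delta \<phi>, \<tau>)" "fst (parr K \<phi> \<sigma> \<tau> s) = \<phi>"
  "i < Dom Delta \<phi> ==> gc (parr K \<phi> \<sigma> \<tau> s) i (Suc i) = s i" by blast+
qed

text \<open>A restriction of a chain to listed vertices, realized with identity 2-cells; the faces
  and degeneracies used for the induced 2-functor all have this form.\<close>

definition (in strict_2_category) "carr m V e n W d xs = parr K (dl n xs) (chain m V e) (chain n W d)
 (\<lambda>i. Ide (Hom2 K (V i) (V (Suc i))) (e i))"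

lemma (in strict_2_category) carr_simps:
 assumes "is_chain m V e" "is_chain n W d" "sorted xs" "length xs = Suc m" "\<forall>x\<in>set xs. x \<le> n"
  "\<And>i. i \<le> m ==> V i = W (xs ! i)" "\<And>i. i < m ==> e i = cM W d (xs ! i) (xs ! Suc i)"
 shows "carr m V e n W d xs \<in> Arr (SR K)" "Dom (SR K) (carr m V e n W d xs) = (m, chain m V e)"
  "Cod (SR K) (carr m V e n W d xs) = (n, chain n W d)" "fst (carr m V e n W d xs) = dl n xs"
  "i < m ==> gc (carr m V e n W d xs) i (Suc i) = Ide (Hom2 K (V i) (V (Suc i))) (e i)"
  "cartesian (SR K) Delta (SP K) (carr m V e n W d xs)"
proof -
 have x: "xs \<noteq> []" using assms(4) by auto
 have D: "dl n xs \<in> Arr Delta" "Dom Delta (dl n xs) = m" "Cod Delta (dl n xs) = n"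
  using x assms by (simp_all add: dl_arr)
 have sm: "xs ! i \<le> xs ! Suc i" "xs ! Suc i \<le> n" if "i < m" for i
  using assms(3-5) that by (simp_all add: sorted_nth_mono)
 have sM: "sM (chain n W d) (xs ! i) (xs ! Suc i) = e i" if "i < m" for i
  using sm[OF that] assms(7)[OF that] by simp
 have PO: "PObj (chain n W d) (xs ! i) = V i" if "i \<le> m" for i
  using assms(4-6) that by simp
 have s: "Ide (Hom2 K (V i) (V (Suc i))) (e i) \<in> hom (PHomCat K (chain m V e) i (Suc i)) (sM (chain m V e) i (Suc i))
   (sM (chain n W d) (app (dl n xs) i) (app (dl n xs) (Suc i)))" if "i < Dom Delta (dl n xs)" for i
  using assms(1,4) that D(2) sM[of i] by (simp add: cM_edge)
 note p = parr_simps[OF D(1), of K "chain m V e" "chain n W d" "\<lambda>i. Ide (Hom2 K (V i) (V (Suc i))) (e i)",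
   folded carr_def, unfolded D, OF chain_simplex[OF assms(1)] chain_simplex[OF assms(2)] _ s[unfolded D]]
 show *: "carr m V e n W d xs \<in> Arr (SR K)" "Dom (SR K) (carr m V e n W d xs) = (m, chain m V e)"
  "Cod (SR K) (carr m V e n W d xs) = (n, chain n W d)" "fst (carr m V e n W d xs) = dl n xs"
  and g: "i < m ==> gc (carr m V e n W d xs) i (Suc i) = Ide (Hom2 K (V i) (V (Suc i))) (e i)" for i
  using p PO assms(4) by simp_all
 show "cartesian (SR K) Delta (SP K) (carr m V e n W d xs)"
  by (rule SR_cartesianI[OF *(1,2)]) (use assms(1) g in simp)
qed

section \<open>The 2-functor induced by an equivalence of simplicial replacements\<close>

locale replacement_equivalence = K: strict_2_category K + L: strict_2_category L
 for K :: "('p, 'm, 't) two_cat" and L :: "('q, 'n, 'u) two_cat" +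
 fixes F
 assumes F: "equivalence (SR K) (SR L) F"
  and over: "comp_fct (SR K) (SP L) F = SP K"
  and cart: "cartesian (SR K) Delta (SP K) f ==> cartesian (SR L) Delta (SP L) (FArr F f)"
begin

lemma F_functor: "cat_functor (SR K) (SR L) F" and F_ff: "fully_faithful (SR K) (SR L) F"
 and F_es: "ess_surjective (SR K) (SR L) F"
 using F by (auto simp: equivalence_iff)

lemmas F_simps = cat_functor_simps[OF F_functor]

text \<open>A functor over \<open>Delta\<close> keeps the dimension, so only the simplex component
  of its value is new.\<close>

definition "F1 m \<sigma> = snd (FObj F (m, \<sigma>))"

lemma FObj_F: "is_simplex K m \<sigma> ==> FObj F (m, \<sigma>) = (m, F1 m \<sigma>)"
 using over_simps(1)[OF over, of "(m, \<sigma>)"] F_simps(1)[of "(m, \<sigma>)"] by (cases "FObj F (m, \<sigma>)") (simp add: F1_def)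

lemma F1_simplex [simp]: "is_simplex K m \<sigma> ==> is_simplex L m (F1 m \<sigma>)"
 using F_simps(1)[of "(m, \<sigma>)"] FObj_F[of m \<sigma>] by simp

definition "c h = gc (FArr F h)"

lemma FArr_F:
 assumes "h \<in> Arr (SR K)" "Dom (SR K) h = (m, \<sigma>)" "Cod (SR K) h = (n, \<tau>)"
 shows "FArr F h \<in> Arr (SR L)" "Dom (SR L) (FArr F h) = (m, F1 m \<sigma>)" "Cod (SR L) (FArr F h) = (n, F1 n \<tau>)"
  "fst (FArr F h) = fst h"
 using F_simps(2-4)[OF assms(1)] over_simps(2)[OF over assms(1)] assms SR_gc(7,8)[OF assms]
 by (simp_all add: FObj_F)

lemma c_comp:
 assumes "h \<in> Arr (SR K)" "Dom (SR K) h = (m, \<sigma>)" "k \<in> Arr (SR K)" "Dom (SR K) k = Cod (SR K) h" "i \<le> j" "j \<le> m"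
 shows "c (k \<cdot>[SR K] h) i j = c k (app (fst h) i) (app (fst h) j) \<cdot>[PHomCat L (F1 m \<sigma>) i j] c h i j"
proof -
 obtain n \<tau> p \<upsilon> where d: "Cod (SR K) h = (n, \<tau>)" "Cod (SR K) k = (p, \<upsilon>)" by fastforce
 note H = FArr_F[OF assms(1,2) d(1)] and G = FArr_F[OF assms(3) assms(4)[unfolded d(1)] d(2)]
 show ?thesis
  unfolding c_def using F_simps(6)[OF assms(1,3,4)] gc_comp(1)[OF H(1) G(1) _ H(2) assms(5,6)] H G by simp
qed

definition "g0 x = PObj (F1 0 (K.chain 0 (\<lambda>_. x) (\<lambda>_. Ide2 K x))) 0"

abbreviation "II \<equiv> Suc (Suc 0)"
abbreviation "HG x y \<equiv> Hom2 L (g0 x) (g0 y)"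
abbreviation "hG x y z \<equiv> hcomp2 L (g0 x) (g0 y) (g0 z)"
abbreviation "s0 x \<equiv> K.chain 0 (\<lambda>_. x) (\<lambda>_. Ide2 K x)"
abbreviation "s1 x y f \<equiv> K.chain (Suc 0) ((!) [x, y]) ((!) [f])"
abbreviation "s2 x y z f g \<equiv> K.chain II ((!) [x, y, z]) ((!) [f, g])"

lemma is_chains [simp]:
 "x \<in> Obj2 K ==> K.is_chain 0 (\<lambda>_. x) e"
 "x \<in> Obj2 K ==> y \<in> Obj2 K ==> f \<in> Obj (Hom2 K x y) ==> K.is_chain (Suc 0) ((!) [x, y]) ((!) [f])"
 "x \<in> Obj2 K ==> y \<in> Obj2 K ==> z \<in> Obj2 K ==> f \<in> Obj (Hom2 K x y) ==> g \<in> Obj (Hom2 K y z) ==>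
  K.is_chain II ((!) [x, y, z]) ((!) [f, g])"
 "w \<in> Obj2 K ==> x \<in> Obj2 K ==> y \<in> Obj2 K ==> z \<in> Obj2 K ==> f \<in> Obj (Hom2 K w x) ==>
  g \<in> Obj (Hom2 K x y) ==> h \<in> Obj (Hom2 K y z) ==>
  K.is_chain (Suc II) ((!) [w, x, y, z]) ((!) [f, g, h])"
 by (auto simp: K.is_chain_def le_Suc_eq less_Suc_eq)

text \<open>The inclusion of the vertex \<open>i\<close> is an arrow out of a 0-simplex, and arrows
  of a simplicial replacement match vertices strictly; applying \<open>F\<close> shows that this
  vertex of the image depends on \<open>V i\<close> alone.\<close>

lemma F_vertex [simp]:
 assumes "K.is_chain n V e" "i \<le> n"
 shows "PObj (F1 n (K.chain n V e)) i = g0 (V i)"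
proof -
 let ?v = "K.carr 0 (\<lambda>_. V i) (\<lambda>_. Ide2 K (V i)) n V e [i]"
 have v: "?v \<in> Arr (SR K)" "Dom (SR K) ?v = (0, s0 (V i))" "Cod (SR K) ?v = (n, K.chain n V e)" "fst ?v = dl n [i]"
  using assms by (auto intro!: K.carr_simps)
 show ?thesis using SR_gc(6)[OF FArr_F(1-3)[OF v(1-3)], of 0] FArr_F(4)[OF v(1-3)] v(4) by (simp add: g0_def)
qed

lemma g0_in [simp]: "x \<in> Obj2 K ==> g0 x \<in> Obj2 L"
 using simplex_data.V_obj[OF simplex_data_simplex[OF F1_simplex[of 0 "s0 x"]], of 0] by simp

lemma F_data: "K.is_chain n V e ==> simplex_data L n (\<lambda>i. g0 (V i)) (sM (F1 n (K.chain n V e)))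
  (PUnit (F1 n (K.chain n V e))) (sC (F1 n (K.chain n V e)))"
 by (rule simplex_data_cong[of _ "PObj (F1 n (K.chain n V e))"]) (simp_all add: simplex_data_simplex)

lemmas F_data_simps [simp] = simplex_data.M_obj[OF F_data] simplex_data.U_iso[OF F_data]
 simplex_data.U_dom[OF F_data] simplex_data.U_cod[OF F_data] simplex_data.P_iso[OF F_data]
 simplex_data.P_dom[OF F_data] simplex_data.P_cod[OF F_data]

lemma c_simps:
 assumes "K.is_chain m V e" "h \<in> Arr (SR K)" "Dom (SR K) h = (m, K.chain m V e)" "Cod (SR K) h = (n, \<tau>)"
 shows "i \<le> j ==> j \<le> m ==> c h i j \<in> Arr (HG (V i) (V j))"
  "i \<le> j ==> j \<le> m ==> Dom (HG (V i) (V j)) (c h i j) = sM (F1 m (K.chain m V e)) i j"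
  "i \<le> j ==> j \<le> m ==> Cod (HG (V i) (V j)) (c h i j) = sM (F1 n \<tau>) (app (fst h) i) (app (fst h) j)"
  "i \<le> j ==> j \<le> k ==> k \<le> m ==> c h i k \<cdot>[HG (V i) (V k)] sC (F1 m (K.chain m V e)) i j k =
   sC (F1 n \<tau>) (app (fst h) i) (app (fst h) j) (app (fst h) k) \<cdot>[HG (V i) (V k)]
    hG (V i) (V j) (V k) (c h j k) (c h i j)"
  "i \<le> m ==> c h i i \<cdot>[HG (V i) (V i)] PUnit (F1 m (K.chain m V e)) i = PUnit (F1 n \<tau>) (app (fst h) i)"
  "i \<le> j ==> j \<le> m ==> cartesian (SR K) Delta (SP K) h ==> iso (HG (V i) (V j)) (c h i j)"
proof -
 note f = FArr_F[OF assms(2-4)]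
 show "i \<le> j ==> j \<le> m ==> c h i j \<in> Arr (HG (V i) (V j))"
  "i \<le> j ==> j \<le> m ==> Dom (HG (V i) (V j)) (c h i j) = sM (F1 m (K.chain m V e)) i j"
  "i \<le> j ==> j \<le> m ==> Cod (HG (V i) (V j)) (c h i j) = sM (F1 n \<tau>) (app (fst h) i) (app (fst h) j)"
  "i \<le> j ==> j \<le> k ==> k \<le> m ==> c h i k \<cdot>[HG (V i) (V k)] sC (F1 m (K.chain m V e)) i j k =
   sC (F1 n \<tau>) (app (fst h) i) (app (fst h) j) (app (fst h) k) \<cdot>[HG (V i) (V k)]
    hG (V i) (V j) (V k) (c h j k) (c h i j)"
  "i \<le> m ==> c h i i \<cdot>[HG (V i) (V i)] PUnit (F1 m (K.chain m V e)) i = PUnit (F1 n \<tau>) (app (fst h) i)"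
  using SR_gc(1-5)[OF f(1-3)] assms(1) f(4) by (simp_all add: c_def)
 show "i \<le> j ==> j \<le> m ==> cartesian (SR K) Delta (SP K) h ==> iso (HG (V i) (V j)) (c h i j)"
  using SR_cartesianD[OF cart f(2), of i j] assms(1) by (simp add: c_def)
qed

end

lemma SR_fst_comp:
 assumes "h \<in> Arr (SR K)" "k \<in> Arr (SR K)" "Dom (SR K) k = Cod (SR K) h"
 shows "fst (k \<cdot>[SR K] h) = fst k \<cdot>[Delta] fst h"
 using gc_comp(2)[OF assms, of "fst (Dom (SR K) h)" "snd (Dom (SR K) h)" 0 0] by simp

context strict_2_category begin

lemma carr_gc:
 assumes "is_chain m V e" "is_chain n W d" "sorted xs" "length xs = Suc m" "\<forall>x\<in>set xs. x \<le> n"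
  "\<And>i. i \<le> m ==> V i = W (xs ! i)" "\<And>i. i < m ==> e i = cM W d (xs ! i) (xs ! Suc i)" "i \<le> j" "j \<le> m"
 shows "gc (carr m V e n W d xs) i j = Ide (Hom2 K (V i) (V j)) (cM V e i j)"
 using assms(8,9)
proof (induction rule: dec_induct)
 case base
 then show ?case using chain_gc(2)[OF assms(1,2) carr_simps(1-3)[OF assms(1-7)]] by simp
next
 case (step j)
 then have "gc (carr m V e n W d xs) i (Suc j) = hcomp2 K (V i) (V j) (V (Suc j))
   (gc (carr m V e n W d xs) j (Suc j)) (gc (carr m V e n W d xs) i j)"
  by (intro chain_gc(6)[OF assms(1,2) carr_simps(1-3)[OF assms(1-7)]]) simp_all
 then show ?case using step assms(1) carr_simps(5)[OF assms(1-7), of j] by (simp add: cM_Suc)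
qed

text \<open>Both sides have identity 2-cells on consecutive edges, so the comparison reduces to the
  underlying maps of ordinals.\<close>

lemma carr_comp:
 assumes "is_chain m V e" "is_chain n W d" "is_chain l X u"
  "sorted xs" "length xs = Suc m" "\<forall>x\<in>set xs. x \<le> n" "sorted ys" "length ys = Suc n" "\<forall>y\<in>set ys. y \<le> l"
  "\<And>i. i \<le> m ==> V i = W (xs ! i)" "\<And>i. i < m ==> e i = cM W d (xs ! i) (xs ! Suc i)"
  "\<And>i. i \<le> n ==> W i = X (ys ! i)" "\<And>i. i < n ==> d i = cM X u (ys ! i) (ys ! Suc i)"
  "\<And>i. i < m ==> e i = cM X u (ys ! (xs ! i)) (ys ! (xs ! Suc i))"
 shows "carr n W d l X u ys \<cdot>[SR K] carr m V e n W d xs = carr m V e l X u (map ((!) ys) xs)"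
proof (rule SR_spine_unique[of _ _ _ m "chain m V e"])
 note h = carr_simps[OF assms(1,2,4-6,10,11)] and k = carr_simps[OF assms(2,3,7-9,12,13)]
 have x: "xs ! i \<le> n" if "i \<le> m" for i using assms(5,6) that by simp
 have s: "xs ! i \<le> xs ! Suc i" if "i < m" for i using assms(4,5) that by (simp add: sorted_nth_mono)
 have sm: "sorted (map ((!) ys) xs)"
  unfolding sorted_map using assms(6,8) by (intro sorted_wrt_mono_rel[OF _ assms(4)]) (auto intro!: sorted_nth_mono[OF assms(7)])
 have le: "\<forall>x\<in>set (map ((!) ys) xs). x \<le> l" using assms(6,8,9) by (auto simp: less_Suc_eq_le)
 have ln: "length (map ((!) ys) xs) = Suc m" using assms(5) by simp
 have cV: "V i = X (map ((!) ys) xs ! i)" if "i \<le> m" for i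
  using that assms(5,10,12) x[OF that] by simp
 have ce: "e i = cM X u (map ((!) ys) xs ! i) (map ((!) ys) xs ! Suc i)" if "i < m" for i
  using that assms(5,14) by simp
 note g' = carr_simps[OF assms(1,3) sm ln le cV ce]
 show "carr m V e l X u (map ((!) ys) xs) \<in> Arr (SR K)" by (rule g'(1))
 show "Dom (SR K) (carr m V e l X u (map ((!) ys) xs)) = (m, chain m V e)" by (rule g'(2))
 show "carr n W d l X u ys \<cdot>[SR K] carr m V e n W d xs \<in> Arr (SR K)"
  "Dom (SR K) (carr n W d l X u ys \<cdot>[SR K] carr m V e n W d xs) = (m, chain m V e)"
  "Cod (SR K) (carr n W d l X u ys \<cdot>[SR K] carr m V e n W d xs) = Cod (SR K) (carr m V e l X u (map ((!) ys) xs))"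
  using h k g' by simp_all
 show "fst (carr n W d l X u ys \<cdot>[SR K] carr m V e n W d xs) = fst (carr m V e l X u (map ((!) ys) xs))"
 proof -
  have y: "ys \<noteq> []" "xs \<noteq> []" using assms(5,8) by auto
  have me: "map (app (dl l ys)) xs = map ((!) ys) xs"
   using assms(6,8) by (auto simp: less_Suc_eq_le)
  have "dl l ys \<cdot>[Delta] dl n xs = dl l (map (app (dl l ys)) xs)"
   using dl_comp[of "dl l ys" n xs] y assms(4,6-9) by simp
  then have "dl l ys \<cdot>[Delta] dl n xs = dl l (map ((!) ys) xs)" unfolding me .
  then show ?thesis
   using h(1-4) k(1-4) g'(4) by (simp add: SR_fst_comp)
 qed
 show "gc (carr n W d l X u ys \<cdot>[SR K] carr m V e n W d xs) i (Suc i) = gc (carr m V e l X u (map ((!) ys) xs)) i (Suc i)"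
  if i: "i < m" for i
 proof -
  have "gc (carr n W d l X u ys) (xs ! i) (xs ! Suc i) = Ide (Hom2 K (V i) (V (Suc i))) (e i)"
   using carr_gc[OF assms(2,3,7-9,12,13) s[OF i] x[of "Suc i"]] i by (simp add: assms(10,11))
  then show ?thesis
   using gc_comp(1)[OF h(1) k(1) _ h(2), of i "Suc i"] h k g' i assms(1,5) by simp
 qed
qed

end

section \<open>The induced cells on objects, edges and triangles\<close>

context replacement_equivalence begin

definition "g1 x y f = sM (F1 (Suc 0) (s1 x y f)) 0 (Suc 0)"

text \<open>A 2-cell becomes a vertical arrow between 1-simplices, which is how \<open>F\<close>
  acts on it.\<close>

definition "ar x y a = parr K (Ide Delta (Suc 0)) (s1 x y (Dom (Hom2 K x y) a)) (s1 x y (Cod (Hom2 K x y) a)) (\<lambda>_. a)"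

definition "g2 x y a = c (ar x y a) 0 (Suc 0)"

abbreviation "ea n V e i j \<equiv> K.carr (Suc 0) ((!) [V i, V j]) ((!) [K.cM V e i j]) n V e [i, j]"

text \<open>\<open>F\<close> need not commute strictly with passing to an edge; cartesianness of the
  edge inclusion provides this isomorphism instead.\<close>

definition "ee n V e i j = c (ea n V e i j) 0 (Suc 0)"

abbreviation "deg x \<equiv> K.carr (Suc 0) ((!) [x, x]) ((!) [Ide2 K x]) 0 (\<lambda>_. x) (\<lambda>_. Ide2 K x) [0, 0]"

text \<open>The degeneracy onto the point relates the image of the identity edge to the degenerate
  edge of the image of a 0-simplex, where the unit cell lives.\<close>

definition "gU x = inv_arr (HG x x) (c (deg x) 0 (Suc 0)) \<cdot>[HG x x] PUnit (F1 0 (s0 x)) 0"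

abbreviation "e2 x y z f g \<equiv> ee II ((!) [x, y, z]) ((!) [f, g])"

text \<open>The composition cell of the image of the 2-simplex with edges \<open>f, g\<close>,
  conjugated so that its three edges become the standard ones given by \<open>g1\<close>.\<close>

definition "gP x y z g f = inv_arr (HG x z) (e2 x y z f g 0 II) \<cdot>[HG x z]
 sC (F1 II (s2 x y z f g)) 0 (Suc 0) II \<cdot>[HG x z]
 hG x y z (e2 x y z f g (Suc 0) II) (e2 x y z f g 0 (Suc 0))"

lemma ea_simps:
 assumes "K.is_chain n V e" "i \<le> j" "j \<le> n"
 shows "ea n V e i j \<in> Arr (SR K)" "Dom (SR K) (ea n V e i j) = (Suc 0, s1 (V i) (V j) (K.cM V e i j))"
  "Cod (SR K) (ea n V e i j) = (n, K.chain n V e)" "fst (ea n V e i j) = dl n [i, j]"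
  "gc (ea n V e i j) 0 (Suc 0) = Ide (Hom2 K (V i) (V j)) (K.cM V e i j)"
  "cartesian (SR K) Delta (SP K) (ea n V e i j)"
proof -
 have ch: "K.is_chain (Suc 0) ((!) [V i, V j]) ((!) [K.cM V e i j])" using assms by simp
 have V: "[V i, V j] ! a = V ([i, j] ! a)" if "a \<le> Suc 0" for a using that by (auto simp: le_Suc_eq)
 have e: "[K.cM V e i j] ! a = K.cM V e ([i, j] ! a) ([i, j] ! Suc a)" if "a < Suc 0" for a using that by simp
 show "ea n V e i j \<in> Arr (SR K)" "Dom (SR K) (ea n V e i j) = (Suc 0, s1 (V i) (V j) (K.cM V e i j))"
  "Cod (SR K) (ea n V e i j) = (n, K.chain n V e)" "fst (ea n V e i j) = dl n [i, j]"
  "cartesian (SR K) Delta (SP K) (ea n V e i j)"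
  by (rule K.carr_simps[OF ch assms(1) _ _ _ V e]; use assms in simp)+
 show "gc (ea n V e i j) 0 (Suc 0) = Ide (Hom2 K (V i) (V j)) (K.cM V e i j)"
  using K.carr_simps(5)[OF ch assms(1) _ _ _ V e, of 0] assms by simp
qed

lemma g1_in [simp]: "x \<in> Obj2 K ==> y \<in> Obj2 K ==> f \<in> Obj (Hom2 K x y) ==> g1 x y f \<in> Obj (HG x y)"
 using simplex_data.M_obj[OF F_data[of "Suc 0" "(!) [x, y]" "(!) [f]"], of 0 "Suc 0"] by (simp add: g1_def)

lemma ee_simps [simp]:
 assumes "K.is_chain n V e" "i \<le> j" "j \<le> n"
 shows "iso (HG (V i) (V j)) (ee n V e i j)"
  "Dom (HG (V i) (V j)) (ee n V e i j) = g1 (V i) (V j) (K.cM V e i j)"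
  "Cod (HG (V i) (V j)) (ee n V e i j) = sM (F1 n (K.chain n V e)) i j"
proof -
 have ch: "K.is_chain (Suc 0) ((!) [V i, V j]) ((!) [K.cM V e i j])" using assms by simp
 note a = ea_simps[OF assms]
 show "iso (HG (V i) (V j)) (ee n V e i j)"
  "Dom (HG (V i) (V j)) (ee n V e i j) = g1 (V i) (V j) (K.cM V e i j)"
  "Cod (HG (V i) (V j)) (ee n V e i j) = sM (F1 n (K.chain n V e)) i j"
  using c_simps(2,3,6)[OF ch a(1-3), of 0 "Suc 0"] a(4,6) by (simp_all add: ee_def g1_def)
qed

lemma deg_simps:
 assumes "x \<in> Obj2 K"
 shows "deg x \<in> Arr (SR K)" "Dom (SR K) (deg x) = (Suc 0, s1 x x (Ide2 K x))"
  "Cod (SR K) (deg x) = (0, s0 x)" "fst (deg x) = dl 0 [0, 0]" "cartesian (SR K) Delta (SP K) (deg x)"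
proof -
 have V: "[x, x] ! a = x" if "a \<le> Suc 0" for a using that by (auto simp: le_Suc_eq)
 have e: "[Ide2 K x] ! a = K.cM (\<lambda>_. x) (\<lambda>_. Ide2 K x) ([0, 0] ! a) ([0, 0] ! Suc a)" if "a < Suc 0" for a using that by simp
 show "deg x \<in> Arr (SR K)" "Dom (SR K) (deg x) = (Suc 0, s1 x x (Ide2 K x))"
  "Cod (SR K) (deg x) = (0, s0 x)" "fst (deg x) = dl 0 [0, 0]" "cartesian (SR K) Delta (SP K) (deg x)"
  by (rule K.carr_simps[OF _ _ _ _ _ V e]; use assms in simp)+
qed

lemma c_deg [simp]:
 assumes "x \<in> Obj2 K"
 shows "iso (HG x x) (c (deg x) 0 (Suc 0))"
  "Dom (HG x x) (c (deg x) 0 (Suc 0)) = g1 x x (Ide2 K x)"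
  "Cod (HG x x) (c (deg x) 0 (Suc 0)) = sM (F1 0 (s0 x)) 0 0"
 using c_simps(2,3,6)[OF is_chains(2)[OF assms assms] deg_simps(1-3)[OF assms], of 0 "Suc 0"] deg_simps(4,5)[OF assms]
 by (simp_all add: g1_def assms)

lemma U0 [simp]:
 assumes "x \<in> Obj2 K"
 shows "iso (HG x x) (PUnit (F1 0 (s0 x)) 0)"
  "Dom (HG x x) (PUnit (F1 0 (s0 x)) 0) = Ide2 L (g0 x)"
  "Cod (HG x x) (PUnit (F1 0 (s0 x)) 0) = sM (F1 0 (s0 x)) 0 0"
 using simplex_data.U_iso[OF F_data[OF is_chains(1)[OF assms]], of 0]
  simplex_data.U_dom[OF F_data[OF is_chains(1)[OF assms]], of 0]
  simplex_data.U_cod[OF F_data[OF is_chains(1)[OF assms]], of 0] by simp_all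

lemma gU_simps [simp]:
 assumes "x \<in> Obj2 K"
 shows "iso (HG x x) (gU x)" "Dom (HG x x) (gU x) = Ide2 L (g0 x)"
  "Cod (HG x x) (gU x) = g1 x x (Ide2 K x)"
 using assms by (simp_all add: gU_def)

lemma e2_simps [simp]:
 assumes "x \<in> Obj2 K" "y \<in> Obj2 K" "z \<in> Obj2 K" "f \<in> Obj (Hom2 K x y)" "g \<in> Obj (Hom2 K y z)"
 shows "iso (HG x y) (e2 x y z f g 0 (Suc 0))"
  "Dom (HG x y) (e2 x y z f g 0 (Suc 0)) = g1 x y f"
  "Cod (HG x y) (e2 x y z f g 0 (Suc 0)) = sM (F1 II (s2 x y z f g)) 0 (Suc 0)"
  "iso (HG y z) (e2 x y z f g (Suc 0) II)"
  "Dom (HG y z) (e2 x y z f g (Suc 0) II) = g1 y z g"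
  "Cod (HG y z) (e2 x y z f g (Suc 0) II) = sM (F1 II (s2 x y z f g)) (Suc 0) II"
  "iso (HG x z) (e2 x y z f g 0 II)"
  "Dom (HG x z) (e2 x y z f g 0 II) = g1 x z (hcomp1 K x y z g f)"
  "Cod (HG x z) (e2 x y z f g 0 II) = sM (F1 II (s2 x y z f g)) 0 II"
  "iso (HG x z) (sC (F1 II (s2 x y z f g)) 0 (Suc 0) II)"
  "Dom (HG x z) (sC (F1 II (s2 x y z f g)) 0 (Suc 0) II) =
   hcomp1 L (g0 x) (g0 y) (g0 z) (sM (F1 II (s2 x y z f g)) (Suc 0) II) (sM (F1 II (s2 x y z f g)) 0 (Suc 0))"
  "Cod (HG x z) (sC (F1 II (s2 x y z f g)) 0 (Suc 0) II) = sM (F1 II (s2 x y z f g)) 0 II"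
proof -
 have ch: "K.is_chain II ((!) [x, y, z]) ((!) [f, g])" using assms by simp
 note E = ee_simps[OF ch]
 note D = simplex_data.P_iso[OF F_data[OF ch], of 0 "Suc 0" "Suc (Suc 0)"] simplex_data.P_dom[OF F_data[OF ch], of 0 "Suc 0" "Suc (Suc 0)"]
  simplex_data.P_cod[OF F_data[OF ch], of 0 "Suc 0" "Suc (Suc 0)"]
 show "iso (HG x y) (e2 x y z f g 0 (Suc 0))"
  "Dom (HG x y) (e2 x y z f g 0 (Suc 0)) = g1 x y f"
  "Cod (HG x y) (e2 x y z f g 0 (Suc 0)) = sM (F1 II (s2 x y z f g)) 0 (Suc 0)"
  "iso (HG y z) (e2 x y z f g (Suc 0) II)"
  "Dom (HG y z) (e2 x y z f g (Suc 0) II) = g1 y z g"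
  "Cod (HG y z) (e2 x y z f g (Suc 0) II) = sM (F1 II (s2 x y z f g)) (Suc 0) II"
  "iso (HG x z) (e2 x y z f g 0 II)"
  "Dom (HG x z) (e2 x y z f g 0 II) = g1 x z (hcomp1 K x y z g f)"
  "Cod (HG x z) (e2 x y z f g 0 II) = sM (F1 II (s2 x y z f g)) 0 II"
  "iso (HG x z) (sC (F1 II (s2 x y z f g)) 0 (Suc 0) II)"
  "Dom (HG x z) (sC (F1 II (s2 x y z f g)) 0 (Suc 0) II) =
   hcomp1 L (g0 x) (g0 y) (g0 z) (sM (F1 II (s2 x y z f g)) (Suc 0) II) (sM (F1 II (s2 x y z f g)) 0 (Suc 0))"
  "Cod (HG x z) (sC (F1 II (s2 x y z f g)) 0 (Suc 0) II) = sM (F1 II (s2 x y z f g)) 0 II"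
  using E[of 0 "Suc 0"] E[of "Suc 0" "Suc (Suc 0)"] E[of 0 "Suc (Suc 0)"] D assms by (simp_all add: K.cM_Suc)
qed

lemma gP_simps [simp]:
 assumes "x \<in> Obj2 K" "y \<in> Obj2 K" "z \<in> Obj2 K" "f \<in> Obj (Hom2 K x y)" "g \<in> Obj (Hom2 K y z)"
 shows "iso (HG x z) (gP x y z g f)"
  "Dom (HG x z) (gP x y z g f) = hcomp1 L (g0 x) (g0 y) (g0 z) (g1 y z g) (g1 x y f)"
  "Cod (HG x z) (gP x y z g f) = g1 x z (hcomp1 K x y z g f)"
 using assms by (simp_all add: gP_def)

lemma e2_gP:
 assumes "x \<in> Obj2 K" "y \<in> Obj2 K" "z \<in> Obj2 K" "f \<in> Obj (Hom2 K x y)" "g \<in> Obj (Hom2 K y z)"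
 shows "e2 x y z f g 0 II \<cdot>[HG x z] gP x y z g f =
  sC (F1 II (s2 x y z f g)) 0 (Suc 0) II \<cdot>[HG x z]
  hG x y z (e2 x y z f g (Suc 0) II) (e2 x y z f g 0 (Suc 0))"
 using assms by (simp add: gP_def)

text \<open>The triangle \<open>i, j, k\<close> is reached from a 2-simplex by the restriction arrow
  \<open>?H\<close>, and compatibility of the image of \<open>?H\<close> with composition cells
  transports the definition of \<open>gP\<close>. The unit and associativity laws come from suitable
  triples of one chain.\<close>

lemma gP_face:
 assumes ch: "K.is_chain n V e" and ijk: "i \<le> j" "j \<le> k" "k \<le> n"
 shows "ee n V e i k \<cdot>[HG (V i) (V k)] gP (V i) (V j) (V k) (K.cM V e j k) (K.cM V e i j) =
  sC (F1 n (K.chain n V e)) i j k \<cdot>[HG (V i) (V k)]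
  hG (V i) (V j) (V k) (ee n V e j k) (ee n V e i j)"
proof -
 let ?V = "(!) [V i, V j, V k]" and ?e = "(!) [K.cM V e i j, K.cM V e j k]"
 let ?x = "V i" and ?y = "V j" and ?z = "V k" and ?f = "K.cM V e i j" and ?g = "K.cM V e j k"
 have o: "V i \<in> Obj2 K" "V j \<in> Obj2 K" "V k \<in> Obj2 K" "?f \<in> Obj (Hom2 K ?x ?y)" "?g \<in> Obj (Hom2 K ?y ?z)"
  using ch ijk by simp_all
 have ch2: "K.is_chain II ?V ?e" using o by simp
 let ?H = "K.carr II ?V ?e n V e [i, j, k]"
 have vH: "?V a = V ([i, j, k] ! a)" if "a \<le> Suc (Suc 0)" for a using that by (auto simp: le_Suc_eq)
 have eH: "?e a = K.cM V e ([i, j, k] ! a) ([i, j, k] ! Suc a)" if "a < Suc (Suc 0)" for a using that by (auto simp: less_Suc_eq)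
 have H: "?H \<in> Arr (SR K)" "Dom (SR K) ?H = (Suc (Suc 0), K.chain II ?V ?e)"
  "Cod (SR K) ?H = (n, K.chain n V e)" "fst ?H = dl n [i, j, k]"
  by (rule K.carr_simps[OF ch2 ch _ _ _ vH eH]; use ijk in simp)+
 \<comment> \<open>An edge of the 2-simplex followed by \<open>?H\<close> is the corresponding edge
   inclusion of the long chain, so the edge isomorphisms compose accordingly.\<close>
 have *: "c ?H a b \<cdot>[HG (?V a) (?V b)] ee II ?V ?e a b = ee n V e ([i, j, k] ! a) ([i, j, k] ! b)"
  if ab: "a \<le> b" "b \<le> Suc (Suc 0)" for a b
 proof -
  have abl: "a \<le> Suc (Suc 0)" using ab by simp
  let ?a = "[i, j, k] ! a" and ?b = "[i, j, k] ! b"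
  have cM: "K.cM ?V ?e a b = K.cM V e ?a ?b"
   using ab o K.cM_comp[OF ch ijk] by (auto simp: le_Suc_eq K.cM_Suc)
  have ch1: "K.is_chain (Suc 0) ((!) [?V a, ?V b]) ((!) [K.cM ?V ?e a b])"
   by (rule is_chains(2)) (use ch2 ab abl in \<open>simp_all del: is_chains\<close>)
  have "?H \<cdot>[SR K] ea II ?V ?e a b = K.carr (Suc 0) ((!) [?V a, ?V b]) ((!) [K.cM ?V ?e a b]) n V e (map ((!) [i, j, k]) [a, b])"
   by (rule K.carr_comp[OF ch1 ch2 ch _ _ _ _ _ _ _ _ vH eH]) (use ab abl ijk vH[of a] vH[of b] cM in \<open>auto simp: le_Suc_eq\<close>)
  also have "\<dots> = ea n V e ?a ?b" using vH[of a] vH[of b] ab cM by simp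
  finally have eq: "?H \<cdot>[SR K] ea II ?V ?e a b = ea n V e ?a ?b" .
  note E = ea_simps[OF ch2 ab]
  have "c (?H \<cdot>[SR K] ea II ?V ?e a b) 0 (Suc 0) = c ?H (app (dl II [a, b]) 0) (app (dl II [a, b]) (Suc 0))
    \<cdot>[PHomCat L (F1 (Suc 0) (s1 (?V a) (?V b) (K.cM ?V ?e a b))) 0 (Suc 0)] ee II ?V ?e a b"
   using c_comp[OF E(1,2) H(1), of 0 "Suc 0"] E H by (simp add: ee_def)
  then show ?thesis unfolding eq using ch1 by (simp add: ee_def)
 qed
 note cH = c_simps[OF ch2 H(1-3)]
 let ?C = "HG ?x ?z"
 have "ee n V e i k \<cdot>[?C] gP ?x ?y ?z ?g ?f = c ?H 0 II \<cdot>[?C] e2 ?x ?y ?z ?f ?g 0 II \<cdot>[?C] gP ?x ?y ?z ?g ?f"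
  using *[of 0 "Suc (Suc 0)", symmetric] o cH(1,2)[of 0 "Suc (Suc 0)"] by simp
 also have "\<dots> = (c ?H 0 II \<cdot>[?C] sC (F1 II (s2 ?x ?y ?z ?f ?g)) 0 (Suc 0) II) \<cdot>[?C]
  hG ?x ?y ?z (e2 ?x ?y ?z ?f ?g (Suc 0) II) (e2 ?x ?y ?z ?f ?g 0 (Suc 0))"
  unfolding e2_gP[OF o] using o cH(1,2)[of 0 "Suc (Suc 0)"] by simp
 also have "c ?H 0 II \<cdot>[?C] sC (F1 II (s2 ?x ?y ?z ?f ?g)) 0 (Suc 0) II =
  sC (F1 n (K.chain n V e)) i j k \<cdot>[?C] hG ?x ?y ?z (c ?H (Suc 0) II) (c ?H 0 (Suc 0))"
  using cH(4)[of 0 "Suc 0" "Suc (Suc 0)"] H(4) by simp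
 also have "(sC (F1 n (K.chain n V e)) i j k \<cdot>[?C] hG ?x ?y ?z (c ?H (Suc 0) II) (c ?H 0 (Suc 0))) \<cdot>[?C]
  hG ?x ?y ?z (e2 ?x ?y ?z ?f ?g (Suc 0) II) (e2 ?x ?y ?z ?f ?g 0 (Suc 0)) =
  sC (F1 n (K.chain n V e)) i j k \<cdot>[?C] hG ?x ?y ?z
   (c ?H (Suc 0) II \<cdot>[HG ?y ?z] e2 ?x ?y ?z ?f ?g (Suc 0) II)
   (c ?H 0 (Suc 0) \<cdot>[HG ?x ?y] e2 ?x ?y ?z ?f ?g 0 (Suc 0))"
  using o cH(1-3)[of "Suc 0" "Suc (Suc 0)"] cH(1-3)[of 0 "Suc 0"] H(4) ch ijk
   simplex_data.P_iso[OF F_data[OF ch] ijk] simplex_data.P_dom[OF F_data[OF ch] ijk] by (simp add: L.interchange)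
 also have "\<dots> = sC (F1 n (K.chain n V e)) i j k \<cdot>[?C] hG ?x ?y ?z (ee n V e j k) (ee n V e i j)"
  using *[of 0 "Suc 0"] *[of "Suc 0" "Suc (Suc 0)"] by simp
 finally show ?thesis .
qed

end

section \<open>Functoriality and coherence of the induced cells\<close>

context replacement_equivalence begin

lemma c_Ide: "is_simplex K m \<sigma> ==> i \<le> j ==> j \<le> m ==>
  c (Ide (SR K) (m, \<sigma>)) i j = Ide (PHomCat L (F1 m \<sigma>) i j) (sM (F1 m \<sigma>) i j)"
 using F_simps(5)[of "(m, \<sigma>)"] by (simp add: c_def FObj_F gc_Ide)

lemma ar_simps:
 assumes "x \<in> Obj2 K" "y \<in> Obj2 K" "a \<in> Arr (Hom2 K x y)"
 shows "ar x y a \<in> Arr (SR K)" "Dom (SR K) (ar x y a) = (Suc 0, s1 x y (Dom (Hom2 K x y) a))"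
  "Cod (SR K) (ar x y a) = (Suc 0, s1 x y (Cod (Hom2 K x y) a))" "fst (ar x y a) = Ide Delta (Suc 0)"
  "gc (ar x y a) 0 (Suc 0) = a"
proof -
 have ch: "K.is_chain (Suc 0) ((!) [x, y]) ((!) [Dom (Hom2 K x y) a])"
  "K.is_chain (Suc 0) ((!) [x, y]) ((!) [Cod (Hom2 K x y) a])" using assms by simp_all
 note p = parr_simps[of "Ide Delta (Suc 0)" K "s1 x y (Dom (Hom2 K x y) a)" "s1 x y (Cod (Hom2 K x y) a)" "\<lambda>_. a", folded ar_def]
 show "ar x y a \<in> Arr (SR K)" "Dom (SR K) (ar x y a) = (Suc 0, s1 x y (Dom (Hom2 K x y) a))"
  "Cod (SR K) (ar x y a) = (Suc 0, s1 x y (Cod (Hom2 K x y) a))" "fst (ar x y a) = Ide Delta (Suc 0)"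
  "gc (ar x y a) 0 (Suc 0) = a"
  using p(1-4) p(5)[of 0] assms ch by (simp_all add: K.cM_Suc)
qed

lemma ar_unique:
 assumes "x \<in> Obj2 K" "y \<in> Obj2 K" "f \<in> Obj (Hom2 K x y)" "f' \<in> Obj (Hom2 K x y)"
  "h \<in> Arr (SR K)" "Dom (SR K) h = (Suc 0, s1 x y f)"
  "Cod (SR K) h = (Suc 0, s1 x y f')" "fst h = Ide Delta (Suc 0)"
 shows "gc h 0 (Suc 0) \<in> Arr (Hom2 K x y)" "Dom (Hom2 K x y) (gc h 0 (Suc 0)) = f"
  "Cod (Hom2 K x y) (gc h 0 (Suc 0)) = f'" "h = ar x y (gc h 0 (Suc 0))"
proof -
 have ch: "K.is_chain (Suc 0) ((!) [x, y]) ((!) [f])" "K.is_chain (Suc 0) ((!) [x, y]) ((!) [f'])"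
  using assms by simp_all
 show a: "gc h 0 (Suc 0) \<in> Arr (Hom2 K x y)" "Dom (Hom2 K x y) (gc h 0 (Suc 0)) = f"
  "Cod (Hom2 K x y) (gc h 0 (Suc 0)) = f'"
  using K.chain_gc(3-5)[OF ch assms(5-7), of 0 "Suc 0"] assms by (simp_all add: K.cM_Suc)
 note r = ar_simps[OF assms(1,2) a(1)]
 show "h = ar x y (gc h 0 (Suc 0))"
  by (rule SR_spine_unique[OF assms(5) r(1) assms(6)]) (use r a assms in simp_all)
qed

lemma g2_simps [simp]:
 assumes "x \<in> Obj2 K" "y \<in> Obj2 K" "a \<in> Arr (Hom2 K x y)"
 shows "g2 x y a \<in> Arr (HG x y)"
  "Dom (HG x y) (g2 x y a) = g1 x y (Dom (Hom2 K x y) a)"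
  "Cod (HG x y) (g2 x y a) = g1 x y (Cod (Hom2 K x y) a)"
proof -
 have ch: "K.is_chain (Suc 0) ((!) [x, y]) ((!) [Dom (Hom2 K x y) a])" using assms by simp
 note r = ar_simps[OF assms]
 show "g2 x y a \<in> Arr (HG x y)"
  "Dom (HG x y) (g2 x y a) = g1 x y (Dom (Hom2 K x y) a)"
  "Cod (HG x y) (g2 x y a) = g1 x y (Cod (Hom2 K x y) a)"
  using c_simps(1-3)[OF ch r(1-3), of 0 "Suc 0"] r(4) by (simp_all add: g2_def g1_def)
qed

lemma g2_Ide [simp]:
 assumes "x \<in> Obj2 K" "y \<in> Obj2 K" "f \<in> Obj (Hom2 K x y)"
 shows "g2 x y (Ide (Hom2 K x y) f) = Ide (HG x y) (g1 x y f)"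
proof -
 have ch: "is_simplex K (Suc 0) (s1 x y f)" using assms by simp
 have "Ide (SR K) (Suc 0, s1 x y f) = ar x y (gc (Ide (SR K) (Suc 0, s1 x y f)) 0 (Suc 0))"
  by (rule ar_unique[OF assms assms(3)]) (use ch in simp_all)
 then have "Ide (SR K) (Suc 0, s1 x y f) = ar x y (Ide (Hom2 K x y) f)"
  using assms ch by (simp add: gc_Ide K.cM_Suc)
 then show ?thesis using c_Ide[OF ch, of 0 "Suc 0"] assms by (simp add: g2_def g1_def)
qed

lemma g2_comp [simp]:
 assumes "x \<in> Obj2 K" "y \<in> Obj2 K" "a \<in> Arr (Hom2 K x y)" "b \<in> Arr (Hom2 K x y)"
  "Dom (Hom2 K x y) b = Cod (Hom2 K x y) a"
 shows "g2 x y (b \<cdot>[Hom2 K x y] a) = g2 x y b \<cdot>[HG x y] g2 x y a"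
proof -
 note A = ar_simps[OF assms(1-3)] and B = ar_simps[OF assms(1,2,4)]
 have ch: "K.is_chain (Suc 0) ((!) [x, y]) ((!) [Dom (Hom2 K x y) a])" using assms by simp
 have d: "Dom (SR K) (ar x y b) = Cod (SR K) (ar x y a)" using A B assms by simp
 have "ar x y b \<cdot>[SR K] ar x y a = ar x y (gc (ar x y b \<cdot>[SR K] ar x y a) 0 (Suc 0))"
  by (rule ar_unique[of x y "Dom (Hom2 K x y) a" "Cod (Hom2 K x y) b"]) (use assms A B d in \<open>simp_all add: SR_fst_comp\<close>)
 also have "gc (ar x y b \<cdot>[SR K] ar x y a) 0 (Suc 0) = b \<cdot>[Hom2 K x y] a"
  using gc_comp(1)[OF A(1) B(1) d A(2), of 0 "Suc 0"] A(4,5) B(5) assms ch by simp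
 finally show ?thesis
  using c_comp[OF A(1,2) B(1) d, of 0 "Suc 0"] A(4) ch by (simp add: g2_def)
qed

text \<open>The list \<open>[0, Suc 0]\<close> is the identity map of \<open>[1]\<close>, so the
  inclusion of this edge is the vertical arrow of an identity 2-cell.\<close>

lemma ee_self:
 assumes "x \<in> Obj2 K" "y \<in> Obj2 K" "f \<in> Obj (Hom2 K x y)"
 shows "ee (Suc 0) ((!) [x, y]) ((!) [f]) 0 (Suc 0) = Ide (HG x y) (g1 x y f)"
proof -
 have ch: "K.is_chain (Suc 0) ((!) [x, y]) ((!) [f])" using assms by simp
 note e = ea_simps[OF ch, of 0 "Suc 0", simplified]
 have cM: "K.cM ((!) [x, y]) ((!) [f]) 0 (Suc 0) = f" using assms by (simp add: K.cM_Suc)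
 have "dl (Suc 0) [0, Suc 0] = Ide Delta (Suc 0)" using dl_Ide[of "Suc 0"] by simp
 then have "ea (Suc 0) ((!) [x, y]) ((!) [f]) 0 (Suc 0) = ar x y (gc (ea (Suc 0) ((!) [x, y]) ((!) [f]) 0 (Suc 0)) 0 (Suc 0))"
  by (intro ar_unique[OF assms assms(3)]) (use e cM in simp_all)
 then have "ea (Suc 0) ((!) [x, y]) ((!) [f]) 0 (Suc 0) = ar x y (Ide (Hom2 K x y) f)" using e(5) cM by simp
 then have "ee (Suc 0) ((!) [x, y]) ((!) [f]) 0 (Suc 0) = g2 x y (Ide (Hom2 K x y) f)" unfolding ee_def g2_def by simp
 then show ?thesis using assms by simp
qed

text \<open>The degenerate edge \<open>i, i\<close> factors as the degeneracy onto the point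
  followed by the inclusion of the vertex \<open>i\<close>.\<close>

lemma gU_face:
 assumes ch: "K.is_chain n V e" and i: "i \<le> n"
 shows "ee n V e i i \<cdot>[HG (V i) (V i)] gU (V i) = PUnit (F1 n (K.chain n V e)) i"
proof -
 let ?x = "V i"
 have x: "?x \<in> Obj2 K" using ch i by simp
 have ch0: "K.is_chain 0 (\<lambda>_. ?x) (\<lambda>_. Ide2 K ?x)" using x by simp
 have ch1: "K.is_chain (Suc 0) ((!) [?x, ?x]) ((!) [Ide2 K ?x])" using x by simp
 let ?v = "K.carr 0 (\<lambda>_. ?x) (\<lambda>_. Ide2 K ?x) n V e [i]"
 have v: "?v \<in> Arr (SR K)" "Dom (SR K) ?v = (0, s0 ?x)" "Cod (SR K) ?v = (n, K.chain n V e)" "fst ?v = dl n [i]"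
  using assms x by (auto intro!: K.carr_simps)
 note d = deg_simps[OF x]
 have "?v \<cdot>[SR K] deg ?x = K.carr (Suc 0) ((!) [?x, ?x]) ((!) [Ide2 K ?x]) n V e (map ((!) [i]) [0, 0])"
  by (rule K.carr_comp[OF ch1 ch0 ch]) (use i in \<open>auto simp: le_Suc_eq\<close>)
 then have "?v \<cdot>[SR K] deg ?x = ea n V e i i" by simp
 then have "ee n V e i i = c ?v 0 0 \<cdot>[HG ?x ?x] c (deg ?x) 0 (Suc 0)"
  using c_comp[OF d(1,2) v(1), of 0 "Suc 0"] d(3,4) v(2) ch1 by (simp add: ee_def)
 then show ?thesis
  using c_simps(1,2,5)[OF ch0 v(1-3), of 0] c_simps(1,2)[OF ch0 v(1-3), of 0 0] v(4) x by (simp add: gU_def)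
qed

text \<open>Edge inclusions commute with \<open>A\<close> and with its component at that edge, as
  arrows of the simplicial replacement; \<open>F\<close> preserves this square.\<close>

lemma g2_face:
 assumes ch: "K.is_chain n V e" "K.is_chain n V e'" and ij: "i \<le> j" "j \<le> n"
  and A: "A \<in> Arr (SR K)" "Dom (SR K) A = (n, K.chain n V e)" "Cod (SR K) A = (n, K.chain n V e')" "fst A = Ide Delta n"
 shows "c A i j \<cdot>[HG (V i) (V j)] ee n V e i j =
  ee n V e' i j \<cdot>[HG (V i) (V j)] g2 (V i) (V j) (gc A i j)"
proof -
 note E = ea_simps[OF ch(1) ij] and E' = ea_simps[OF ch(2) ij]
 have gA: "gc A i j \<in> Arr (Hom2 K (V i) (V j))" "Dom (Hom2 K (V i) (V j)) (gc A i j) = K.cM V e i j"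
  "Cod (Hom2 K (V i) (V j)) (gc A i j) = K.cM V e' i j"
  using K.chain_gc(3-5)[OF ch A(1-3) ij] A(4) ij by simp_all
 have o: "V i \<in> Obj2 K" "V j \<in> Obj2 K" using ch ij by simp_all
 have ch1: "K.is_chain (Suc 0) ((!) [V i, V j]) ((!) [K.cM V e i j])" using o ch ij by simp
 note r = ar_simps[OF o gA(1), unfolded gA]
 have "A \<cdot>[SR K] ea n V e i j = ea n V e' i j \<cdot>[SR K] ar (V i) (V j) (gc A i j)"
 proof (rule SR_spine_unique[of _ K _ "Suc 0" "s1 (V i) (V j) (K.cM V e i j)"])
  have "gc (A \<cdot>[SR K] ea n V e i j) 0 (Suc 0) = gc A i j"
   using gc_comp(1)[OF E(1) A(1) _ E(2), of 0 "Suc 0"] E(3-5) A(2) gA o ch1 by simp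
  moreover have "gc (ea n V e' i j \<cdot>[SR K] ar (V i) (V j) (gc A i j)) 0 (Suc 0) = gc A i j"
   using gc_comp(1)[OF r(1) E'(1) _ r(2), of 0 "Suc 0"] r(3-5) E'(2,5) gA o ch1 by simp
  ultimately show "gc (A \<cdot>[SR K] ea n V e i j) k (Suc k) = gc (ea n V e' i j \<cdot>[SR K] ar (V i) (V j) (gc A i j)) k (Suc k)"
   if "k < Suc 0" for k using that by simp
 qed (use E E' A r ij in \<open>simp_all add: SR_fst_comp\<close>)
 then have "c (A \<cdot>[SR K] ea n V e i j) 0 (Suc 0) = c (ea n V e' i j \<cdot>[SR K] ar (V i) (V j) (gc A i j)) 0 (Suc 0)" by simp
 then show ?thesis
  using c_comp[OF E(1,2) A(1), of 0 "Suc 0"] c_comp[OF r(1,2) E'(1), of 0 "Suc 0"] E(3,4) A(2) r(3,4) E'(2) ch1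
  by (simp add: ee_def g2_def)
qed

definition "induced = \<lparr>PObj = \<lambda>x\<in>Obj2 K. g0 x,
 PHom = \<lambda>(x, y)\<in>Obj2 K \<times> Obj2 K.
  \<lparr>FObj = \<lambda>f\<in>Obj (Hom2 K x y). g1 x y f, FArr = \<lambda>a\<in>Arr (Hom2 K x y). g2 x y a\<rparr>,
 PUnit = \<lambda>x\<in>Obj2 K. gU x,
 PComp = \<lambda>(x, y, z)\<in>Obj2 K \<times> Obj2 K \<times> Obj2 K. \<lambda>(g, f)\<in>Obj (Hom2 K y z) \<times> Obj (Hom2 K x y). gP x y z g f\<rparr>"

lemma induced_simps [simp]:
 "x \<in> Obj2 K ==> PObj induced x = g0 x"
 "x \<in> Obj2 K ==> y \<in> Obj2 K ==> f \<in> Obj (Hom2 K x y) ==> PMap1 induced x y f = g1 x y f"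
 "x \<in> Obj2 K ==> y \<in> Obj2 K ==> a \<in> Arr (Hom2 K x y) ==> PMap2 induced x y a = g2 x y a"
 "x \<in> Obj2 K ==> PUnit induced x = gU x"
 "x \<in> Obj2 K ==> y \<in> Obj2 K ==> z \<in> Obj2 K ==> g \<in> Obj (Hom2 K y z) ==> f \<in> Obj (Hom2 K x y) ==>
  PComp induced (x, y, z) (g, f) = gP x y z g f"
 by (simp_all add: induced_def)

text \<open>The pair \<open>a, b\<close> extends to an arrow \<open>A\<close> of 2-simplices whose
  long component is the horizontal composite. The image of \<open>A\<close> respects composition
  cells, and \<open>g2_face\<close> translates its three components.\<close>

lemma gP_natural:
 assumes o: "x \<in> Obj2 K" "y \<in> Obj2 K" "z \<in> Obj2 K" and b: "b \<in> Arr (Hom2 K y z)" and a: "a \<in> Arr (Hom2 K x y)"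
 shows "gP x y z (Cod (Hom2 K y z) b) (Cod (Hom2 K x y) a) \<cdot>[HG x z]
   hG x y z (g2 y z b) (g2 x y a) =
  g2 x z (hcomp2 K x y z b a) \<cdot>[HG x z] gP x y z (Dom (Hom2 K y z) b) (Dom (Hom2 K x y) a)"
proof -
 let ?f = "Dom (Hom2 K x y) a" and ?f' = "Cod (Hom2 K x y) a" and ?g = "Dom (Hom2 K y z) b" and ?g' = "Cod (Hom2 K y z) b"
 let ?n = "Suc (Suc 0)" and ?V = "(!) [x, y, z]" and ?e = "(!) [?f, ?g]" and ?e' = "(!) [?f', ?g']"
 have fg: "?f \<in> Obj (Hom2 K x y)" "?g \<in> Obj (Hom2 K y z)" "?f' \<in> Obj (Hom2 K x y)" "?g' \<in> Obj (Hom2 K y z)"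
  using o a b by simp_all
 have ch: "K.is_chain ?n ?V ?e" "K.is_chain ?n ?V ?e'" using o fg by simp_all
 define A where "A = parr K (Ide Delta ?n) (s2 x y z ?f ?g) (s2 x y z ?f' ?g') ((!) [a, b])"
 have s: "[a, b] ! i \<in> hom (PHomCat K (s2 x y z ?f ?g) i (Suc i)) (sM (s2 x y z ?f ?g) i (Suc i))
   (sM (s2 x y z ?f' ?g') (app (Ide Delta ?n) i) (app (Ide Delta ?n) (Suc i)))" if "i < Dom Delta (Ide Delta ?n)" for i
  using that o a b by (auto simp: less_Suc_eq K.cM_Suc)
 have PO: "PObj (s2 x y z ?f ?g) i = PObj (s2 x y z ?f' ?g') (app (Ide Delta ?n) i)" if "i \<le> Dom Delta (Ide Delta ?n)" for i
  using that by simp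
 note p = parr_simps[OF _ _ _ PO s, folded A_def]
 have A: "A \<in> Arr (SR K)" "Dom (SR K) A = (?n, s2 x y z ?f ?g)" "Cod (SR K) A = (?n, s2 x y z ?f' ?g')" "fst A = Ide Delta ?n"
  "gc A 0 (Suc 0) = a" "gc A (Suc 0) ?n = b"
  using p(1-4) p(5)[of 0] p(5)[of "Suc 0"] ch by simp_all
 have A02: "gc A 0 ?n = hcomp2 K x y z b a"
  using K.chain_gc(6)[OF ch A(1-3), of 0 "Suc 0" ?n] A(5,6) by simp
 note cA = c_simps[OF ch(1) A(1-3)]
 note n01 = g2_face[OF ch, of 0 "Suc 0", OF _ _ A(1-4)] and n12 = g2_face[OF ch, of "Suc 0" ?n, OF _ _ A(1-4)]
  and n02 = g2_face[OF ch, of 0 ?n, OF _ _ A(1-4)]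
 let ?C = "HG x z"
 let ?E = "e2 x y z ?f ?g" and ?E' = "e2 x y z ?f' ?g'"
 let ?S = "sC (F1 ?n (s2 x y z ?f ?g)) 0 (Suc 0) ?n" and ?S' = "sC (F1 ?n (s2 x y z ?f' ?g')) 0 (Suc 0) ?n"
 show ?thesis
 proof (rule iso_cancel_left[of ?C "?E' 0 ?n"])
  have "?E' 0 ?n \<cdot>[?C] gP x y z ?g' ?f' \<cdot>[?C] hG x y z (g2 y z b) (g2 x y a) =
   (?E' 0 ?n \<cdot>[?C] gP x y z ?g' ?f') \<cdot>[?C] hG x y z (g2 y z b) (g2 x y a)"
   using o fg a b by simp
  also have "\<dots> = ?S' \<cdot>[?C] hG x y z (?E' (Suc 0) ?n \<cdot>[HG y z] g2 y z b)
    (?E' 0 (Suc 0) \<cdot>[HG x y] g2 x y a)"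
   unfolding e2_gP[OF o fg(3,4)] using o fg a b by (simp add: L.interchange)
  also have "\<dots> = ?S' \<cdot>[?C] hG x y z (c A (Suc 0) ?n \<cdot>[HG y z] ?E (Suc 0) ?n)
    (c A 0 (Suc 0) \<cdot>[HG x y] ?E 0 (Suc 0))"
   using n01 n12 A(5,6) by simp
  also have "\<dots> = (?S' \<cdot>[?C] hG x y z (c A (Suc 0) ?n) (c A 0 (Suc 0))) \<cdot>[?C]
    hG x y z (?E (Suc 0) ?n) (?E 0 (Suc 0))"
   using o fg cA(1-3)[of 0 "Suc 0"] cA(1-3)[of "Suc 0" ?n] A(4) by (simp add: L.interchange)
  also have "?S' \<cdot>[?C] hG x y z (c A (Suc 0) ?n) (c A 0 (Suc 0)) = c A 0 ?n \<cdot>[?C] ?S"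
   using cA(4)[of 0 "Suc 0" ?n] A(4) by simp
  also have "(c A 0 ?n \<cdot>[?C] ?S) \<cdot>[?C] hG x y z (?E (Suc 0) ?n) (?E 0 (Suc 0)) =
    (c A 0 ?n \<cdot>[?C] ?E 0 ?n) \<cdot>[?C] gP x y z ?g ?f"
   using o fg cA(1-3)[of 0 ?n] e2_gP[OF o fg(1,2)] by simp
  also have "\<dots> = ?E' 0 ?n \<cdot>[?C] g2 x z (hcomp2 K x y z b a) \<cdot>[?C] gP x y z ?g ?f"
   using n02 A02 o fg a b by simp
  finally show "?E' 0 ?n \<cdot>[?C] gP x y z ?g' ?f' \<cdot>[?C] hG x y z (g2 y z b) (g2 x y a) =
   ?E' 0 ?n \<cdot>[?C] g2 x z (hcomp2 K x y z b a) \<cdot>[?C] gP x y z ?g ?f" .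
 qed (use o fg a b in simp_all)
qed

text \<open>The degenerate triple \<open>0, 1, 1\<close> of a 1-simplex reduces this to the left
  unit law of its image.\<close>

lemma gP_left:
 assumes "x \<in> Obj2 K" "y \<in> Obj2 K" "f \<in> Obj (Hom2 K x y)"
 shows "gP x y y (Ide2 K y) f \<cdot>[HG x y]
  hG x y y (gU y) (Ide (HG x y) (g1 x y f)) = Ide (HG x y) (g1 x y f)"
proof -
 let ?V = "(!) [x, y]" and ?e = "(!) [f]"
 let ?C = "HG x y" and ?T = "F1 (Suc 0) (s1 x y f)"
 have ch: "K.is_chain (Suc 0) ?V ?e" using assms by simp
 interpret D: simplex_data L "Suc 0" "\<lambda>i. g0 ([x, y] ! i)" "sM ?T" "PUnit ?T" "sC ?T" by (rule F_data[OF ch])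
 have [simp]: "iso ?C (sC ?T 0 (Suc 0) (Suc 0))"
  "Dom ?C (sC ?T 0 (Suc 0) (Suc 0)) = hcomp1 L (g0 x) (g0 y) (g0 y) (sM ?T (Suc 0) (Suc 0)) (g1 x y f)"
  "iso (HG y y) (PUnit ?T (Suc 0))" "Dom (HG y y) (PUnit ?T (Suc 0)) = Ide2 L (g0 y)"
  "Cod (HG y y) (PUnit ?T (Suc 0)) = sM ?T (Suc 0) (Suc 0)"
  "iso (HG y y) (ee (Suc 0) ?V ?e (Suc 0) (Suc 0))"
  "Dom (HG y y) (ee (Suc 0) ?V ?e (Suc 0) (Suc 0)) = g1 y y (Ide2 K y)"
  "Cod (HG y y) (ee (Suc 0) ?V ?e (Suc 0) (Suc 0)) = sM ?T (Suc 0) (Suc 0)"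
  using D.P_iso[of 0 "Suc 0" "Suc 0"] D.P_dom[of 0 "Suc 0" "Suc 0"] D.U_iso[of "Suc 0"] D.U_dom[of "Suc 0"] D.U_cod[of "Suc 0"]
   ee_simps[OF ch, of "Suc 0" "Suc 0"] by (simp_all add: g1_def)
 have "gP x y y (Ide2 K y) f = sC ?T 0 (Suc 0) (Suc 0) \<cdot>[?C]
   hG x y y (ee (Suc 0) ?V ?e (Suc 0) (Suc 0)) (Ide ?C (g1 x y f))"
  using gP_face[OF ch, of 0 "Suc 0" "Suc 0"] assms by (simp add: ee_self K.cM_Suc)
 then have "gP x y y (Ide2 K y) f \<cdot>[?C] hG x y y (gU y) (Ide ?C (g1 x y f)) =
  sC ?T 0 (Suc 0) (Suc 0) \<cdot>[?C] hG x y y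
   (ee (Suc 0) ?V ?e (Suc 0) (Suc 0) \<cdot>[HG y y] gU y) (Ide ?C (g1 x y f))"
  using assms by (simp add: L.interchange)
 also have "\<dots> = Ide ?C (g1 x y f)"
  using gU_face[OF ch, of "Suc 0"] D.P_left[of 0 "Suc 0"] by (simp add: g1_def)
 finally show ?thesis .
qed

text \<open>The degenerate triple \<open>0, 0, 1\<close> plays the role that \<open>0, 1, 1\<close>
  has for the left unit.\<close>

lemma gP_right:
 assumes "x \<in> Obj2 K" "y \<in> Obj2 K" "f \<in> Obj (Hom2 K x y)"
 shows "gP x x y f (Ide2 K x) \<cdot>[HG x y]
  hG x x y (Ide (HG x y) (g1 x y f)) (gU x) = Ide (HG x y) (g1 x y f)"
proof -
 let ?V = "(!) [x, y]" and ?e = "(!) [f]"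
 let ?C = "HG x y" and ?T = "F1 (Suc 0) (s1 x y f)"
 have ch: "K.is_chain (Suc 0) ?V ?e" using assms by simp
 interpret D: simplex_data L "Suc 0" "\<lambda>i. g0 ([x, y] ! i)" "sM ?T" "PUnit ?T" "sC ?T" by (rule F_data[OF ch])
 have [simp]: "iso ?C (sC ?T 0 0 (Suc 0))"
  "Dom ?C (sC ?T 0 0 (Suc 0)) = hcomp1 L (g0 x) (g0 x) (g0 y) (g1 x y f) (sM ?T 0 0)"
  "iso (HG x x) (PUnit ?T 0)" "Dom (HG x x) (PUnit ?T 0) = Ide2 L (g0 x)"
  "Cod (HG x x) (PUnit ?T 0) = sM ?T 0 0"
  "iso (HG x x) (ee (Suc 0) ?V ?e 0 0)"
  "Dom (HG x x) (ee (Suc 0) ?V ?e 0 0) = g1 x x (Ide2 K x)"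
  "Cod (HG x x) (ee (Suc 0) ?V ?e 0 0) = sM ?T 0 0"
  using D.P_iso[of 0 0 "Suc 0"] D.P_dom[of 0 0 "Suc 0"] D.U_iso[of 0] D.U_dom[of 0] D.U_cod[of 0]
   ee_simps[OF ch, of 0 0] by (simp_all add: g1_def)
 have "gP x x y f (Ide2 K x) = sC ?T 0 0 (Suc 0) \<cdot>[?C]
   hG x x y (Ide ?C (g1 x y f)) (ee (Suc 0) ?V ?e 0 0)"
  using gP_face[OF ch, of 0 0 "Suc 0"] assms by (simp add: ee_self K.cM_Suc)
 then have "gP x x y f (Ide2 K x) \<cdot>[?C] hG x x y (Ide ?C (g1 x y f)) (gU x) =
  sC ?T 0 0 (Suc 0) \<cdot>[?C] hG x x y (Ide ?C (g1 x y f))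
   (ee (Suc 0) ?V ?e 0 0 \<cdot>[HG x x] gU x)"
  using assms by (simp add: L.interchange)
 also have "\<dots> = Ide ?C (g1 x y f)"
  using gU_face[OF ch, of 0] D.P_right[of 0 "Suc 0"] by (simp add: g1_def)
 finally show ?thesis .
qed

text \<open>After composition with the edge isomorphism from \<open>i\<close> to \<open>l\<close>,
  four uses of \<open>gP_face\<close> turn the claim into associativity of the composition cells in
  the image of the chain.\<close>

lemma gP_assoc_chain:
 assumes ch: "K.is_chain n V e" and ijkl: "i \<le> j" "j \<le> k" "k \<le> l" "l \<le> n"
 shows "gP (V i) (V j) (V l) (K.cM V e j l) (K.cM V e i j) \<cdot>[HG (V i) (V l)]
   hG (V i) (V j) (V l) (gP (V j) (V k) (V l) (K.cM V e k l) (K.cM V e j k))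
    (Ide (HG (V i) (V j)) (g1 (V i) (V j) (K.cM V e i j))) =
  gP (V i) (V k) (V l) (K.cM V e k l) (K.cM V e i k) \<cdot>[HG (V i) (V l)]
   hG (V i) (V k) (V l) (Ide (HG (V k) (V l)) (g1 (V k) (V l) (K.cM V e k l)))
    (gP (V i) (V j) (V k) (K.cM V e j k) (K.cM V e i j))"
proof -
 let ?T = "F1 n (K.chain n V e)"
 interpret D: simplex_data L n "\<lambda>i. g0 (V i)" "sM ?T" "PUnit ?T" "sC ?T" by (rule F_data[OF ch])
 have jk: "i \<le> k" "j \<le> l" "i \<le> l" "i \<le> n" "j \<le> n" "k \<le> n" using ijkl by auto
 have o [simp]: "V i \<in> Obj2 K" "V j \<in> Obj2 K" "V k \<in> Obj2 K" "V l \<in> Obj2 K"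
  "K.cM V e i j \<in> Obj (Hom2 K (V i) (V j))" "K.cM V e j k \<in> Obj (Hom2 K (V j) (V k))"
  "K.cM V e k l \<in> Obj (Hom2 K (V k) (V l))" "K.cM V e i k \<in> Obj (Hom2 K (V i) (V k))"
  "K.cM V e j l \<in> Obj (Hom2 K (V j) (V l))" "K.cM V e i l \<in> Obj (Hom2 K (V i) (V l))"
  using ch ijkl jk by simp_all
 have m [simp]: "hcomp1 K (V i) (V j) (V k) (K.cM V e j k) (K.cM V e i j) = K.cM V e i k"
  "hcomp1 K (V j) (V k) (V l) (K.cM V e k l) (K.cM V e j k) = K.cM V e j l"
  "hcomp1 K (V i) (V j) (V l) (K.cM V e j l) (K.cM V e i j) = K.cM V e i l"
  "hcomp1 K (V i) (V k) (V l) (K.cM V e k l) (K.cM V e i k) = K.cM V e i l"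
  using ch ijkl jk by simp_all
 note E [simp] = ee_simps[OF ch ijkl(1) jk(5)] ee_simps[OF ch ijkl(2) jk(6)] ee_simps[OF ch ijkl(3,4)]
  ee_simps[OF ch jk(1,6)] ee_simps[OF ch jk(2) ijkl(4)] ee_simps[OF ch jk(3) ijkl(4)]
 note S [simp] = D.P_iso[OF ijkl(1) jk(2) ijkl(4)] D.P_dom[OF ijkl(1) jk(2) ijkl(4)] D.P_cod[OF ijkl(1) jk(2) ijkl(4)]
  D.P_iso[OF ijkl(2-4)] D.P_dom[OF ijkl(2-4)] D.P_cod[OF ijkl(2-4)]
  D.P_iso[OF ijkl(1,2) jk(6)] D.P_dom[OF ijkl(1,2) jk(6)] D.P_cod[OF ijkl(1,2) jk(6)]
  D.P_iso[OF jk(1) ijkl(3,4)] D.P_dom[OF jk(1) ijkl(3,4)] D.P_cod[OF jk(1) ijkl(3,4)]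
 have mo [simp]: "sM ?T i j \<in> Obj (HG (V i) (V j))" "sM ?T j k \<in> Obj (HG (V j) (V k))"
  "sM ?T k l \<in> Obj (HG (V k) (V l))"
  using ijkl jk by simp_all
 let ?C = "HG (V i) (V l)" and ?E = "ee n V e"
 let ?h = "hG (V i) (V j) (V l)" and ?k = "hG (V i) (V k) (V l)"
 let ?If = "Ide (HG (V i) (V j)) (g1 (V i) (V j) (K.cM V e i j))"
 let ?Ih = "Ide (HG (V k) (V l)) (g1 (V k) (V l) (K.cM V e k l))"
 let ?P1 = "gP (V i) (V j) (V l) (K.cM V e j l) (K.cM V e i j)" and ?P2 = "gP (V j) (V k) (V l) (K.cM V e k l) (K.cM V e j k)"
 let ?P3 = "gP (V i) (V k) (V l) (K.cM V e k l) (K.cM V e i k)" and ?P4 = "gP (V i) (V j) (V k) (K.cM V e j k) (K.cM V e i j)"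
 show ?thesis
 proof (rule iso_cancel_left[of ?C "?E i l"])
  have "?E i l \<cdot>[?C] ?P1 \<cdot>[?C] ?h ?P2 ?If = (?E i l \<cdot>[?C] ?P1) \<cdot>[?C] ?h ?P2 ?If"
   by simp
  also have "\<dots> = sC ?T i j l \<cdot>[?C] ?h (?E j l \<cdot>[HG (V j) (V l)] ?P2) (?E i j)"
   unfolding gP_face[OF ch ijkl(1) jk(2) ijkl(4)] by (simp add: L.interchange)
  also have "\<dots> = (sC ?T i j l \<cdot>[?C] ?h (sC ?T j k l) (Ide (HG (V i) (V j)) (sM ?T i j))) \<cdot>[?C]
    ?h (hG (V j) (V k) (V l) (?E k l) (?E j k)) (?E i j)"
   unfolding gP_face[OF ch ijkl(2-4)] by (simp add: L.interchange L.assoc1)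
  also have "\<dots> = (sC ?T i k l \<cdot>[?C] ?k (Ide (HG (V k) (V l)) (sM ?T k l)) (sC ?T i j k)) \<cdot>[?C]
    ?k (?E k l) (hG (V i) (V j) (V k) (?E j k) (?E i j))"
   unfolding D.P_assoc[OF ijkl] by (simp add: L.assoc2)
  also have "\<dots> = sC ?T i k l \<cdot>[?C] ?k (?E k l) (?E i k \<cdot>[HG (V i) (V k)] ?P4)"
   unfolding gP_face[OF ch ijkl(1,2) jk(6)] by (simp add: L.interchange L.assoc1)
  also have "\<dots> = (?E i l \<cdot>[?C] ?P3) \<cdot>[?C] ?k ?Ih ?P4"
   unfolding gP_face[OF ch jk(1) ijkl(3,4)] by (simp add: L.interchange)
  also have "\<dots> = ?E i l \<cdot>[?C] ?P3 \<cdot>[?C] ?k ?Ih ?P4" by simp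
  finally show "?E i l \<cdot>[?C] ?P1 \<cdot>[?C] ?h ?P2 ?If = ?E i l \<cdot>[?C] ?P3 \<cdot>[?C] ?k ?Ih ?P4" .
 qed (simp_all add: L.assoc1)
qed

lemma induced_two_functor: "two_functor K L induced"
proof (rule two_functorI)
 fix x y assume xy: "x \<in> Obj2 K" "y \<in> Obj2 K"
 show "cat_functor (Hom2 K x y) (PHomCat L induced x y) (PHom induced (x, y))"
 proof (rule cat_functorI)
  show "FObj (PHom induced (x, y)) \<in> Obj (Hom2 K x y) \<rightarrow>\<^sub>E Obj (PHomCat L induced x y)"
   using xy by (auto simp: induced_def)
  show "FArr (PHom induced (x, y)) \<in> extensional (Arr (Hom2 K x y))" using xy by (auto simp: induced_def)
 qed (use xy in simp_all)
next
 fix w x y z f g h assume a: "w \<in> Obj2 K" "x \<in> Obj2 K" "y \<in> Obj2 K" "z \<in> Obj2 K"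
  "f \<in> Obj (Hom2 K w x)" "g \<in> Obj (Hom2 K x y)" "h \<in> Obj (Hom2 K y z)"
 let ?n = "Suc II"
 have ch: "K.is_chain ?n ((!) [w, x, y, z]) ((!) [f, g, h])" using a by simp
 show "PComp induced (w, x, z) (hcomp1 K x y z h g, f) \<cdot>[PHomCat L induced w z]
    hcomp2 L (PObj induced w) (PObj induced x) (PObj induced z)
     (PComp induced (x, y, z) (h, g)) (Ide (PHomCat L induced w x) (PMap1 induced w x f))
   = PComp induced (w, y, z) (h, hcomp1 K w x y g f) \<cdot>[PHomCat L induced w z]
    hcomp2 L (PObj induced w) (PObj induced y) (PObj induced z)
     (Ide (PHomCat L induced y z) (PMap1 induced y z h)) (PComp induced (w, x, y) (g, f))"
  using gP_assoc_chain[OF ch, of 0 "Suc 0" "Suc (Suc 0)" ?n] a by (simp add: K.cM_Suc)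
qed (auto simp: K.strict_2_category_axioms L.strict_2_category_axioms gP_natural gP_left gP_right, auto simp: induced_def)

text \<open>Equal vertices permit an arrow between the images; fullness lifts it, and an arrow of
  0-simplices already forces equal vertices.\<close>

lemma g0_inj:
 assumes "x \<in> Obj2 K" "y \<in> Obj2 K" "g0 x = g0 y"
 shows "x = y"
proof -
 have s: "is_simplex K 0 (s0 x)" "is_simplex K 0 (s0 y)" using assms by simp_all
 obtain k where k: "k \<in> Arr (SR L)" "Dom (SR L) k = (0, F1 0 (s0 x))" "Cod (SR L) k = (0, F1 0 (s0 y))"
  by (rule SR_fill[of "Ide Delta 0" 0 0 L "F1 0 (s0 x)" "F1 0 (s0 y)"]) (use s assms in simp_all)
 obtain h where h: "h \<in> Arr (SR K)" "Dom (SR K) h = (0, s0 x)" "Cod (SR K) h = (0, s0 y)"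
  using fully_faithfulD[OF F_ff, of "(0, s0 x)" "(0, s0 y)" k] s k by (auto simp: FObj_F)
 have "app (fst h) 0 = 0" using SR_arrD(1-3)[OF h] app_le[of "fst h" 0] by simp
 then show ?thesis using SR_gc(6)[OF h, of 0] by simp
qed

text \<open>Essential surjectivity with control of the dimension, since isomorphisms lie over
  identities of \<open>Delta\<close>.\<close>

lemma F_surj:
 assumes "is_simplex L n \<tau>"
 obtains \<sigma> e where "is_simplex K n \<sigma>" "iso (SR L) e" "Dom (SR L) e = (n, F1 n \<sigma>)" "Cod (SR L) e = (n, \<tau>)" "fst e = Ide Delta n"
proof -
 have "\<exists>X \<in> Obj (SR K). \<exists>e. iso (SR L) e \<and> Dom (SR L) e = FObj F X \<and> Cod (SR L) e = (n, \<tau>)"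
  using F_es assms unfolding ess_surjective_def by (metis SR_Obj)
 then obtain m \<sigma> e where e: "is_simplex K m \<sigma>" "iso (SR L) e" "Dom (SR L) e = (m, F1 m \<sigma>)" "Cod (SR L) e = (n, \<tau>)"
  using FObj_F by auto
 have "fst e = Ide Delta m" "n = m"
  using iso_over_Delta[OF SP_functor e(2)] e assms by simp_all
 then show ?thesis using that e by blast
qed

text \<open>The properties of \<open>F\<close> are read on 0-simplices for objects and on
  1-simplices for categories of morphisms, where a vertical arrow amounts to one 2-cell.\<close>

lemma induced_local_equivalence: "local_equivalence K L induced"
proof (intro local_equivalence.intro induced_two_functor local_equivalence_axioms.intro)
 have "\<exists>x \<in> Obj2 K. g0 x = y" if y: "y \<in> Obj2 L" for y
 proof -
  have "L.is_chain 0 (\<lambda>_. y) (\<lambda>_. Ide2 L y)" using y by (simp add: L.is_chain_def)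
  then have t: "is_simplex L 0 (L.chain 0 (\<lambda>_. y) (\<lambda>_. Ide2 L y))" by simp
  obtain \<sigma> e where e: "is_simplex K 0 \<sigma>" "iso (SR L) e" "Dom (SR L) e = (0, F1 0 \<sigma>)"
   "Cod (SR L) e = (0, L.chain 0 (\<lambda>_. y) (\<lambda>_. Ide2 L y))" "fst e = Ide Delta 0" by (rule F_surj[OF t])
  interpret S: simplex_data K 0 "PObj \<sigma>" "sM \<sigma>" "PUnit \<sigma>" "sC \<sigma>" by (rule simplex_data_simplex[OF e(1)])
  let ?x = "PObj \<sigma> 0"
  have x: "?x \<in> Obj2 K" by simp
  \<comment> \<open>A 0-simplex still carries a 1-cell isomorphic to the identity. The comparison
    with the standard 0-simplex on the same object has no consecutive edges and is therefore filled
    without further data.\<close>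
  obtain h where h: "h \<in> Arr (SR K)" "Dom (SR K) h = (0, s0 ?x)" "Cod (SR K) h = (0, \<sigma>)" "fst h = Ide Delta 0"
   by (rule SR_fill[of "Ide Delta 0" 0 0 K "s0 ?x" \<sigma>]) (use e x in simp_all)
  have "PObj (F1 0 \<sigma>) 0 = g0 ?x" using SR_gc(6)[OF FArr_F(1-3)[OF h(1-3)], of 0] FArr_F(4)[OF h(1-3)] h(4) x by simp
  moreover have "y = PObj (F1 0 \<sigma>) 0" using SR_gc(6)[OF iso_arr[OF e(2)] e(3,4), of 0] e(5) by simp
  ultimately show ?thesis using x by auto
 qed
 then show "bij_betw (PObj induced) (Obj2 K) (Obj2 L)"
  using g0_inj by (force simp: bij_betw_def inj_on_def image_iff)
next
 fix x y assume xy: "x \<in> Obj2 K" "y \<in> Obj2 K"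
 show "fully_faithful (Hom2 K x y) (PHomCat L induced x y) (PHom induced (x, y))"
 proof (rule fully_faithfulI)
  fix f f' g assume g: "f \<in> Obj (Hom2 K x y)" "f' \<in> Obj (Hom2 K x y)" "g \<in> Arr (PHomCat L induced x y)"
   "Dom (PHomCat L induced x y) g = PMap1 induced x y f" "Cod (PHomCat L induced x y) g = PMap1 induced x y f'"
  have s: "is_simplex K (Suc 0) (s1 x y f)" "is_simplex K (Suc 0) (s1 x y f')" using xy g by simp_all
  have ch: "K.is_chain (Suc 0) ((!) [x, y]) ((!) [f])" "K.is_chain (Suc 0) ((!) [x, y]) ((!) [f'])" using xy g by simp_all
  obtain k where k: "k \<in> Arr (SR L)" "Dom (SR L) k = (Suc 0, F1 (Suc 0) (s1 x y f))"
   "Cod (SR L) k = (Suc 0, F1 (Suc 0) (s1 x y f'))" "fst k = Ide Delta (Suc 0)" "\<And>i. i < Suc 0 ==> gc k i (Suc i) = g"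
   by (rule SR_fill[of "Ide Delta (Suc 0)" "Suc 0" "Suc 0" L "F1 (Suc 0) (s1 x y f)" "F1 (Suc 0) (s1 x y f')" "\<lambda>_. g"])
    (use s g xy ch in \<open>simp_all add: g1_def\<close>)
  obtain h where h: "h \<in> Arr (SR K)" "Dom (SR K) h = (Suc 0, s1 x y f)" "Cod (SR K) h = (Suc 0, s1 x y f')" "FArr F h = k"
   using fully_faithfulD[OF F_ff, of "(Suc 0, s1 x y f)" "(Suc 0, s1 x y f')" k] s k by (auto simp: FObj_F)
  have "fst h = Ide Delta (Suc 0)" using FArr_F(4)[OF h(1-3)] h(4) k(4) by simp
  note r = ar_unique[OF xy g(1,2) h(1-3) this]
  have "g2 x y (gc h 0 (Suc 0)) = g" using r(4) h(4) k(5)[of 0] by (simp add: g2_def c_def)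
  then show "\<exists>a \<in> Arr (Hom2 K x y). Dom (Hom2 K x y) a = f \<and> Cod (Hom2 K x y) a = f' \<and> PMap2 induced x y a = g"
   using r(1-3) xy by auto
 next
  fix a a' assume a: "a \<in> Arr (Hom2 K x y)" "a' \<in> Arr (Hom2 K x y)" "Dom (Hom2 K x y) a = Dom (Hom2 K x y) a'"
   "Cod (Hom2 K x y) a = Cod (Hom2 K x y) a'" "PMap2 induced x y a = PMap2 induced x y a'"
  note r = ar_simps[OF xy a(1)] and r' = ar_simps[OF xy a(2)]
  have "FArr F (ar x y a) = FArr F (ar x y a')"
   by (rule SR_spine_unique[OF FArr_F(1)[OF r(1-3)] FArr_F(1)[OF r'(1-3)] FArr_F(2)[OF r(1-3)]])
    (use FArr_F[OF r(1-3)] FArr_F[OF r'(1-3)] r r' a xy in \<open>simp_all add: g2_def c_def\<close>)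
  then have "ar x y a = ar x y a'"
   by (intro faithfulD[OF F_ff F_functor r(1) r'(1)]) (simp_all only: r(2,3) r'(2,3) a(3,4))
  then show "a = a'" using r(5) r'(5) by metis
 qed
 show "ess_surjective (Hom2 K x y) (PHomCat L induced x y) (PHom induced (x, y))"
  unfolding ess_surjective_def
 proof
  fix g assume "g \<in> Obj (PHomCat L induced x y)"
  then have g: "g \<in> Obj (HG x y)" using xy by simp
  let ?\<tau> = "L.chain (Suc 0) ((!) [g0 x, g0 y]) ((!) [g])"
  have chL: "L.is_chain (Suc 0) ((!) [g0 x, g0 y]) ((!) [g])"
   using g xy by (auto simp: L.is_chain_def le_Suc_eq less_Suc_eq)
  then have t: "is_simplex L (Suc 0) ?\<tau>" by simp
  obtain \<sigma> e where e: "is_simplex K (Suc 0) \<sigma>" "iso (SR L) e" "Dom (SR L) e = (Suc 0, F1 (Suc 0) \<sigma>)"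
   "Cod (SR L) e = (Suc 0, ?\<tau>)" "fst e = Ide Delta (Suc 0)" by (rule F_surj[OF t])
  interpret S: simplex_data K "Suc 0" "PObj \<sigma>" "sM \<sigma>" "PUnit \<sigma>" "sC \<sigma>" by (rule simplex_data_simplex[OF e(1)])
  let ?x = "PObj \<sigma> 0" and ?y = "PObj \<sigma> (Suc 0)" and ?f = "sM \<sigma> 0 (Suc 0)"
  have o: "?x \<in> Obj2 K" "?y \<in> Obj2 K" "?f \<in> Obj (Hom2 K ?x ?y)" by simp_all
  have ch: "K.is_chain (Suc 0) ((!) [?x, ?y]) ((!) [?f])" using o by simp
  \<comment> \<open>The preimage \<open>\<sigma>\<close> need not be a chain; the identity of its
    edge compares it with the chain on that edge, and this comparison is cartesian.\<close>
  obtain h where h: "h \<in> Arr (SR K)" "Dom (SR K) h = (Suc 0, s1 ?x ?y ?f)" "Cod (SR K) h = (Suc 0, \<sigma>)"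
   "fst h = Ide Delta (Suc 0)" "\<And>i. i < Suc 0 ==> gc h i (Suc i) = Ide (Hom2 K ?x ?y) ?f"
   by (rule SR_fill[of "Ide Delta (Suc 0)" "Suc 0" "Suc 0" K "s1 ?x ?y ?f" \<sigma> "\<lambda>_. Ide (Hom2 K ?x ?y) ?f"])
    (use e o ch in \<open>simp_all add: le_Suc_eq K.cM_Suc, auto\<close>)
  have "cartesian (SR K) Delta (SP K) h"
   by (rule SR_cartesianI[OF h(1,2)]) (use h(5) o ch in simp)
  then have i1: "iso (HG ?x ?y) (c h 0 (Suc 0))"
   using c_simps(6)[OF ch h(1-3), of 0 "Suc 0"] by simp
  note H = FArr_F[OF h(1-3)] and Eg = SR_gc[OF iso_arr[OF e(2)] e(3,4)]
  have PF: "PObj (F1 (Suc 0) \<sigma>) 0 = g0 ?x" "PObj (F1 (Suc 0) \<sigma>) (Suc 0) = g0 ?y"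
   using SR_gc(6)[OF H(1-3), of 0] SR_gc(6)[OF H(1-3), of "Suc 0"] H(4) h(4) ch by simp_all
  have "g0 x = g0 ?x" "g0 y = g0 ?y"
   using Eg(6)[of 0] Eg(6)[of "Suc 0"] e(5) PF by simp_all
  \<comment> \<open>Injectivity on objects turns the equality of vertices in \<open>L\<close> into
    one in \<open>K\<close>, so the preimage has the prescribed endpoints.\<close>
  then have xe: "?x = x" "?y = y" using g0_inj[OF xy(1) o(1)] g0_inj[OF xy(2) o(2)] by simp_all
  have i2: "iso (HG x y) (gc e 0 (Suc 0))"
   using SR_iso_gc[OF e(2,3), of 0 "Suc 0"] PF xe by simp
  have d: "Dom (HG x y) (gc e 0 (Suc 0)) = sM (F1 (Suc 0) \<sigma>) 0 (Suc 0)"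
   "Cod (HG x y) (gc e 0 (Suc 0)) = g"
   using Eg(2,3)[of 0 "Suc 0"] PF e(5) xe chL g xy by (simp_all add: L.cM_Suc)
  have c: "Dom (HG x y) (c h 0 (Suc 0)) = g1 x y ?f"
   "Cod (HG x y) (c h 0 (Suc 0)) = sM (F1 (Suc 0) \<sigma>) 0 (Suc 0)"
   using c_simps(2,3)[OF ch h(1-3), of 0 "Suc 0"] h(4) xe by (simp_all add: g1_def)
  have o': "?f \<in> Obj (Hom2 K x y)" and i1': "iso (HG x y) (c h 0 (Suc 0))"
   using o(3) i1 unfolding xe by simp_all
  show "\<exists>f \<in> Obj (Hom2 K x y). \<exists>e. iso (PHomCat L induced x y) e \<and>
    Dom (PHomCat L induced x y) e = PMap1 induced x y f \<and> Cod (PHomCat L induced x y) e = g"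
   using xy o' i1' i2 d c
   by (intro bexI[of _ ?f] exI[of _ "gc e 0 (Suc 0) \<cdot>[HG x y] c h 0 (Suc 0)"]) simp_all
 qed
qed

end

lemma replacement_unique:
 assumes "strict_2_category K" "equivalence_over Delta C \<pi> (SR K) (SP K) E"
  "strict_2_category L" "equivalence_over Delta C \<pi> (SR L) (SP L) E'"
 shows "\<exists>\<gamma>. strong_equivalence K L \<gamma>"
proof -
 obtain F where F: "equivalence (SR K) (SR L) F" "comp_fct (SR K) (SP L) F = SP K"
  "\<And>f. cartesian (SR K) Delta (SP K) f ==> cartesian (SR L) Delta (SP L) (FArr F f)"
  by (rule equivalence_over_span[OF assms(2,4)]) blast
 interpret replacement_equivalence K L F
  by (intro replacement_equivalence.intro replacement_equivalence_axioms.intro assms F)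
 show ?thesis using local_equivalence.strong[OF induced_local_equivalence] by blast
qed

section \<open>Segal-style 2-categories\<close>

text \<open>The vertex list of an initial segment, a constant of its own so that
  \<open>upt_Suc\<close> does not unroll it.\<close>

definition ini :: "nat => nat list" where "ini n = [0..<Suc n]"

lemma ini_simps [simp]: "length (ini n) = Suc n" "ini n \<noteq> []" "sorted (ini n)" "x \<in> set (ini n) \<longleftrightarrow> x \<le> n"
 "i \<le> n ==> ini n ! i = i"
 by (auto simp: ini_def simp del: upt_Suc)

abbreviation valid :: "nat => nat list => bool" where
 "valid n xs \<equiv> xs \<noteq> [] \<and> sorted xs \<and> (\<forall>x\<in>set xs. x \<le> n)"

locale segal =
 fixes C :: "('o, 'a) cat" and \<pi> :: "('o, 'a, nat, delta_arr) fct"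
 assumes segal: "segal_2_category C \<pi>"
begin

abbreviation cmp (infixr "**" 70) where "g ** f \<equiv> g \<cdot>[C] f"
abbreviation "dim c \<equiv> FObj \<pi> c"
abbreviation "base h \<equiv> FArr \<pi> h"

lemma fib: "fibration C Delta \<pi>" and disc: "discrete (fiber C Delta \<pi> 0)"
 and seg: "l \<le> n ==> equivalence (fiber C Delta \<pi> n) (segal_target C \<pi> n l) (segal_fct C \<pi> n l)"
 using segal by (auto simp: segal_2_category_def)

lemma pi_functor: "cat_functor C Delta \<pi>"
 using fib by (simp add: fibration_def)

lemma C_category [simp]: "category C"
 using pi_functor by (rule cat_functor_cat)

lemmas pi_simps [simp] = cat_functor_simps[OF pi_functor]

text \<open>An object \<open>c\<close> over \<open>[n]\<close> is treated as an \<open>n\<close>-simplex: \<open>ed c xs\<close> is its face with vertices \<open>xs\<close>, the source of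
 the chosen cartesian lift \<open>lf c xs\<close>. The arrow \<open>rs h xs\<close> below is the restriction of \<open>h\<close> to that face.\<close>

definition "lf c xs = cart_lift C Delta \<pi> (dl (dim c) xs) c"
definition "ed c xs = Dom C (lf c xs)"

lemma lf_simps [simp]:
 assumes "c \<in> Obj C" "valid (dim c) xs"
 shows "lf c xs \<in> Arr C" "Cod C (lf c xs) = c" "Dom C (lf c xs) = ed c xs" "base (lf c xs) = dl (dim c) xs"
  "cartesian C Delta \<pi> (lf c xs)" "ed c xs \<in> Obj C" "dim (ed c xs) = length xs - 1"
proof -
 have "\<exists>f. cartesian C Delta \<pi> f \<and> Cod C f = c \<and> base f = dl (dim c) xs"
  using fib assms unfolding fibration_def by (metis dl_arr dl_simps(2))
 from someI_ex[OF this, folded cart_lift_def, folded lf_def]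
 have l: "cartesian C Delta \<pi> (lf c xs)" "Cod C (lf c xs) = c" "base (lf c xs) = dl (dim c) xs" by auto
 show *: "lf c xs \<in> Arr C" "Cod C (lf c xs) = c" "Dom C (lf c xs) = ed c xs" "base (lf c xs) = dl (dim c) xs"
  "cartesian C Delta \<pi> (lf c xs)" using l cartesian_arr by (auto simp: ed_def)
 show "ed c xs \<in> Obj C" using category_simps(1)[OF C_category *(1)] by (simp add: ed_def)
 show "dim (ed c xs) = length xs - 1" using pi_simps(3)[OF *(1)] *(4) by (simp add: ed_def)
qed

lemma valid_map [simp]:
 assumes "h \<in> Arr C" "valid (dim (Dom C h)) xs"
 shows "sorted (map (app (base h)) xs)" "\<forall>x\<in>set xs. app (base h) x \<le> dim (Cod C h)"
 using assms pi_simps(2-4)[OF assms(1)]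
 unfolding sorted_map by (auto intro!: sorted_wrt_mono_rel[of xs "(\<le>)"] simp: app_mono)

definition "rs h xs = (SOME r. r \<in> Arr C \<and> Dom C r = ed (Dom C h) xs \<and>
 Cod C r = ed (Cod C h) (map (app (base h)) xs) \<and> base r = Ide Delta (length xs - 1) \<and>
 lf (Cod C h) (map (app (base h)) xs) ** r = h ** lf (Dom C h) xs)"

lemma rs_simps [simp]:
 assumes "h \<in> Arr C" "valid (dim (Dom C h)) xs"
 shows "rs h xs \<in> Arr C" "Dom C (rs h xs) = ed (Dom C h) xs"
  "Cod C (rs h xs) = ed (Cod C h) (map (app (base h)) xs)" "base (rs h xs) = Ide Delta (length xs - 1)"
  and lf_rs: "lf (Cod C h) (map (app (base h)) xs) ** rs h xs = h ** lf (Dom C h) xs"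
proof -
 have v: "valid (dim (Cod C h)) (map (app (base h)) xs)" using assms valid_map[OF assms] by simp
 obtain r where "r \<in> Arr C" "Dom C r = ed (Dom C h) xs" "Cod C r = ed (Cod C h) (map (app (base h)) xs)"
  "base r = Ide Delta (length xs - 1)" "lf (Cod C h) (map (app (base h)) xs) ** r = h ** lf (Dom C h) xs"
 proof (rule cartesianD[OF lf_simps(5)[OF _ v], of "h ** lf (Dom C h) xs"])
  show "base (h ** lf (Dom C h) xs) = base (lf (Cod C h) (map (app (base h)) xs))"
   using assms v by simp
 qed (use assms v in simp_all)
 then have "\<exists>r. r \<in> Arr C \<and> Dom C r = ed (Dom C h) xs \<and>
  Cod C r = ed (Cod C h) (map (app (base h)) xs) \<and> base r = Ide Delta (length xs - 1) \<and>
  lf (Cod C h) (map (app (base h)) xs) ** r = h ** lf (Dom C h) xs" by blast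
 from someI_ex[OF this, folded rs_def]
 show "rs h xs \<in> Arr C" "Dom C (rs h xs) = ed (Dom C h) xs"
  "Cod C (rs h xs) = ed (Cod C h) (map (app (base h)) xs)" "base (rs h xs) = Ide Delta (length xs - 1)"
  "lf (Cod C h) (map (app (base h)) xs) ** rs h xs = h ** lf (Dom C h) xs" by auto
qed

lemma lf_cancel:
 assumes "c \<in> Obj C" "valid (dim c) xs" "u \<in> Arr C" "v \<in> Arr C" "Dom C u = Dom C v" "Cod C u = ed c xs" "Cod C v = ed c xs"
  "base u = Ide Delta (length xs - 1)" "base v = Ide Delta (length xs - 1)" "lf c xs ** u = lf c xs ** v"
 shows "u = v"
 using cartesian_cancel[OF pi_functor lf_simps(5)[OF assms(1,2)] assms(3-5)] assms by simp

lemma rs_unique: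
 assumes "h \<in> Arr C" "valid (dim (Dom C h)) xs" "r \<in> Arr C" "Dom C r = ed (Dom C h) xs"
  "Cod C r = ed (Cod C h) (map (app (base h)) xs)" "base r = Ide Delta (length xs - 1)"
  "lf (Cod C h) (map (app (base h)) xs) ** r = h ** lf (Dom C h) xs"
 shows "rs h xs = r"
 by (rule lf_cancel[of "Cod C h" "map (app (base h)) xs"]) (use assms lf_rs[OF assms(1,2)] in simp_all)

text \<open>Although the lifts are arbitrary choices, restriction is strictly functorial: both sides
  are the unique factorization of one arrow through the same lift.\<close>

lemma rs_comp:
 assumes "h \<in> Arr C" "k \<in> Arr C" "Dom C k = Cod C h" "valid (dim (Dom C h)) xs"
 shows "rs (k ** h) xs = rs k (map (app (base h)) xs) ** rs h xs"
proof -
 have v: "valid (dim (Dom C k)) (map (app (base h)) xs)" using assms valid_map[OF assms(1,4)] by simp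
 have m: "map (app (base k \<cdot>[Delta] base h)) xs = map (app (base k)) (map (app (base h)) xs)"
  using assms by simp
 have l: "lf (Cod C k) (map (app (base k)) (map (app (base h)) xs)) \<in> Arr C"
  "Dom C (lf (Cod C k) (map (app (base k)) (map (app (base h)) xs))) = ed (Cod C k) (map (app (base k)) (map (app (base h)) xs))"
  using v valid_map[OF assms(2) v] assms(2) lf_simps[of "Cod C k" "map (app (base k)) (map (app (base h)) xs)"] by simp_all
 have "lf (Cod C k) (map (app (base k)) (map (app (base h)) xs)) ** rs k (map (app (base h)) xs) ** rs h xs =
  (lf (Cod C k) (map (app (base k)) (map (app (base h)) xs)) ** rs k (map (app (base h)) xs)) ** rs h xs"
  by (rule category_simps(11)[OF C_category, symmetric])
   (use assms v l rs_simps[OF assms(2) v] in simp_all)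
 also have "\<dots> = k ** lf (Dom C k) (map (app (base h)) xs) ** rs h xs"
  unfolding lf_rs[OF assms(2) v] using assms v by simp
 also have "\<dots> = (k ** h) ** lf (Dom C h) xs"
  unfolding assms(3) lf_rs[OF assms(1,4)] using assms by simp
 finally show ?thesis
  using assms v rs_simps[OF assms(2) v] by (intro rs_unique) (simp_all add: m del: map_map)
qed

lemma map_app_Ide [simp]: "valid n xs ==> map (app (Ide Delta n)) xs = xs"
 by (simp add: map_idI)

lemma rs_Ide [simp]:
 assumes "c \<in> Obj C" "valid (dim c) xs"
 shows "rs (Ide C c) xs = Ide C (ed c xs)"
 by (rule rs_unique) (use assms in simp_all)

text \<open>The lift at the target, and \<open>h\<close> after the lift at the source, are cartesian
  over the same map; they differ by an isomorphism, which must be \<open>rs h xs\<close>.\<close>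

lemma rs_iso:
 assumes "cartesian C Delta \<pi> h" "valid (dim (Dom C h)) xs"
 shows "iso C (rs h xs)"
proof -
 have h [simp]: "h \<in> Arr C" by (rule cartesian_arr[OF assms(1)])
 have v: "valid (dim (Cod C h)) (map (app (base h)) xs)" using valid_map[OF h assms(2)] assms(2) by simp
 have c: "cartesian C Delta \<pi> (h ** lf (Dom C h) xs)"
  using fib assms unfolding fibration_def by simp
 obtain w where w: "iso C w" "Dom C w = Dom C (h ** lf (Dom C h) xs)"
  "Cod C w = Dom C (lf (Cod C h) (map (app (base h)) xs))"
  "base w = Ide Delta (dim (Dom C (lf (Cod C h) (map (app (base h)) xs))))"
  "lf (Cod C h) (map (app (base h)) xs) ** w = h ** lf (Dom C h) xs"
  by (rule cartesian_compare[OF pi_functor lf_simps(5)[OF _ v] c]) (use assms v in simp_all)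
 have "rs h xs = w" by (rule rs_unique) (use w assms v in simp_all)
 then show ?thesis using w(1) by simp
qed

lemma iso_base:
 assumes "iso C h"
 shows "base h = Ide Delta (dim (Dom C h))" "dim (Cod C h) = dim (Dom C h)"
  "base (inv_arr C h) = Ide Delta (dim (Dom C h))"
 using iso_over_Delta[OF pi_functor assms] vertical_iso_inv[OF pi_functor assms] by simp_all

lemma rs_iso_iso:
 assumes "iso C h" "valid (dim (Dom C h)) xs"
 shows "iso C (rs h xs)" "inv_arr C (rs h xs) = rs (inv_arr C h) xs"
proof -
 note b = iso_base[OF assms(1)]
 have m: "map (app (base h)) xs = xs" "map (app (base (inv_arr C h))) xs = xs"
  unfolding b(1,3) using assms(2) by simp_all
 have v: "valid (dim (Dom C (inv_arr C h))) xs" using assms b by simp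
 note r = rs_simps[OF iso_arr[OF assms(1)] assms(2), unfolded m]
  and r' = rs_simps[OF inv_arr_simps(1)[OF assms(1)] v, unfolded m]
 have 1: "rs (inv_arr C h) xs ** rs h xs = Ide C (Dom C (rs h xs))"
  using rs_comp[of h "inv_arr C h" xs] assms r(2) m by simp
 have 2: "rs h xs ** rs (inv_arr C h) xs = Ide C (Cod C (rs h xs))"
  using rs_comp[of "inv_arr C h" h xs] assms r(3) m v by simp
 show i: "iso C (rs h xs)"
  by (rule isoI[of _ _ "rs (inv_arr C h) xs"]) (use r r' 1 2 assms(1) in simp_all)
 show "inv_arr C (rs h xs) = rs (inv_arr C h) xs"
  by (rule inv_arr_unique[OF C_category i]) (use r r' 1 assms(1) in simp_all)
qed

lemma discrete0:
 assumes "f \<in> Arr C" "base f = Ide Delta 0"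
 shows "f = Ide C (Dom C f)" "Cod C f = Dom C f"
proof -
 show "f = Ide C (Dom C f)"
  using disc assms unfolding discrete_def by (simp add: fiber_def)
 then have "Cod C f = Cod C (Ide C (Dom C f))" by simp
 then show "Cod C f = Dom C f" using assms(1) by simp
qed

text \<open>The restriction to one vertex is vertical over \<open>[0]\<close>, hence an identity by
  discreteness. Thus every arrow preserves vertices strictly.\<close>

lemma ed_vertex:
 assumes "h \<in> Arr C" "i \<le> dim (Dom C h)"
 shows "ed (Cod C h) [app (base h) i] = ed (Dom C h) [i]" "rs h [i] = Ide C (ed (Dom C h) [i])"
 using discrete0[of "rs h [i]"] assms rs_simps[of h "[i]"] by simp_all

lemma ed_0 [simp]: "c \<in> Obj C ==> dim c = 0 ==> ed c [0] = c"
 using discrete0(2)[of "lf c [0]"] dl_Ide[of 0] by simp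

lemma ed_ed [simp]: "c \<in> Obj C ==> valid (dim c) xs ==> i < length xs ==> ed (ed c xs) [i] = ed c [xs ! i]"
 using ed_vertex(1)[of "lf c xs" i] by simp

text \<open>The comparison with the chosen lift lies in the discrete fiber, so that lift is the only
  arrow from a 0-dimensional object over the given vertex.\<close>

lemma vertex_arr:
 assumes "h \<in> Arr C" "dim (Dom C h) = 0" "base h = dl (dim (Cod C h)) [i]" "i \<le> dim (Cod C h)"
 shows "h = lf (Cod C h) [i]"
proof -
 have c: "Cod C h \<in> Obj C" using assms by simp
 obtain v where v: "v \<in> Arr C" "Dom C v = Dom C h" "Cod C v = Dom C (lf (Cod C h) [i])"
  "base v = Ide Delta (dim (Dom C (lf (Cod C h) [i])))" "lf (Cod C h) [i] ** v = h"
  by (rule cartesianD[OF lf_simps(5)[OF c, of "[i]"], of h]) (use assms c in simp_all)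
 have "v = Ide C (Dom C v)" "Cod C v = Dom C v" using discrete0[of v] v assms c by simp_all
 then have "v = Ide C (ed (Cod C h) [i])" using v(3) c assms(4) by simp
 then show ?thesis using v(5) c assms(4) by simp
qed

lemma transition_obj:
 assumes "c \<in> Obj C" "dim c = n" "valid n xs"
 shows "FObj (transition C Delta \<pi> (dl n xs)) c = ed c xs"
 using assms by (simp add: transition_def fiber_def lf_def ed_def)

text \<open>The transition functor and \<open>rs\<close> solve the same factorization problem, so
  the Segal condition can be read in terms of faces.\<close>

lemma transition_arr:
 assumes "g \<in> Arr C" "base g = Ide Delta n" "valid n xs"
 shows "FArr (transition C Delta \<pi> (dl n xs)) g = rs g xs"
proof -
 have d: "dim (Dom C g) = n" "dim (Cod C g) = n"
  using pi_simps(3,4)[OF assms(1), symmetric] assms(2) by simp_all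
 have v: "valid (dim (Dom C g)) xs" using assms(3) d by simp
 have m: "map (app (base g)) xs = xs" using assms(2,3) by simp
 note r = rs_simps[OF assms(1) v, unfolded m] lf_rs[OF assms(1) v, unfolded m]
 have "(THE h. h \<in> hom (fiber C Delta \<pi> (Dom Delta (dl n xs)))
      (Dom C (cart_lift C Delta \<pi> (dl n xs) (Dom C g))) (Dom C (cart_lift C Delta \<pi> (dl n xs) (Cod C g))) \<and>
     cart_lift C Delta \<pi> (dl n xs) (Cod C g) ** h = g ** cart_lift C Delta \<pi> (dl n xs) (Dom C g)) =
  (THE h. h \<in> Arr C \<and> base h = Ide Delta (length xs - 1) \<and> Dom C h = ed (Dom C g) xs \<and> Cod C h = ed (Cod C g) xs \<and>
    lf (Cod C g) xs ** h = g ** lf (Dom C g) xs)"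
  by (simp add: fiber_def ed_def lf_def d conj_assoc)
 also have "\<dots> = rs g xs"
 proof (rule the_equality)
  fix h assume h: "h \<in> Arr C \<and> base h = Ide Delta (length xs - 1) \<and> Dom C h = ed (Dom C g) xs \<and> Cod C h = ed (Cod C g) xs \<and>
    lf (Cod C g) xs ** h = g ** lf (Dom C g) xs"
  then show "h = rs g xs" using rs_unique[OF assms(1) v, of h] m by simp
 qed (use r in simp)
 finally show ?thesis using assms by (simp add: transition_def fiber_def)
qed

lemma fiber_simps [simp]: "c \<in> Obj (fiber C Delta \<pi> n) \<longleftrightarrow> c \<in> Obj C \<and> dim c = n"
 "f \<in> Arr (fiber C Delta \<pi> n) \<longleftrightarrow> f \<in> Arr C \<and> base f = Ide Delta n"
 "Dom (fiber C Delta \<pi> n) = Dom C" "Cod (fiber C Delta \<pi> n) = Cod C" "Ide (fiber C Delta \<pi> n) = Ide C"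
 "Comp (fiber C Delta \<pi> n) = Comp C"
 by (auto simp: fiber_def)

lemma vertical_dim: "f \<in> Arr C ==> base f = Ide Delta n ==> dim (Dom C f) = n \<and> dim (Cod C f) = n"
 using pi_simps(3,4)[of f] by (metis Delta_Dom_comp(3,4))

lemma segal_tail: "Suc n - n = Suc 0" "Suc n - Suc 0 = n" by simp_all

text \<open>Essential surjectivity of the Segal functor that splits off the last edge:
  \<open>e\<close> is glued onto the last vertex of \<open>c\<close>, and an isomorphism of the
  fiber product is unpacked into its two components.\<close>

lemma segal_lift:
 assumes c: "c \<in> Obj C" "dim c = n" and e: "e \<in> Obj C" "dim e = Suc 0" "ed e [0] = ed c [n]"
 obtains d u v where "d \<in> Obj C" "dim d = Suc n"
  "iso C u" "base u = Ide Delta n" "Dom C u = ed d (ini n)" "Cod C u = c"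
  "iso C v" "base v = Ide Delta (Suc 0)" "Dom C v = ed d [n, Suc n]" "Cod C v = e"
proof -
 let ?T = "segal_target C \<pi> (Suc n) n" and ?F = "segal_fct C \<pi> (Suc n) n"
 have eq: "equivalence (fiber C Delta \<pi> (Suc n)) ?T ?F" by (rule seg) simp
 have sg: "term_seg 0 n = dl n [n]" "init_seg 0 (Suc 0) = dl (Suc 0) [0]" "init_seg n (Suc n) = dl (Suc n) (ini n)"
  "term_seg (Suc 0) (Suc n) = dl (Suc n) [n, Suc n]"
  using term_seg_dl[of 0 n] init_seg_dl[of 0 "Suc 0"] init_seg_dl[of n "Suc n"] term_seg_dl[of "Suc 0" "Suc n"]
  by (simp_all add: ini_def upt_rec)
 have "(c, e) \<in> Obj ?T"
  using c e by (simp add: segal_target_def fiber_product_def segal_tail sg transition_obj)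
 then obtain d w where d: "d \<in> Obj C" "dim d = Suc n" and w: "iso ?T w" "Dom ?T w = FObj ?F d" "Cod ?T w = (c, e)"
  using eq unfolding equivalence_iff ess_surjective_def by (metis fiber_simps(1))
 obtain u v where uv: "w = (u, v)" by (cases w)
 have F: "FObj ?F d = (ed d (ini n), ed d [n, Suc n])"
  using d by (simp add: segal_fct_def pair_fct_def segal_tail sg transition_obj)
 obtain w' where w': "w' \<in> hom ?T (Cod ?T w) (Dom ?T w)" "w' \<cdot>[?T] w = Ide ?T (Dom ?T w)" "w \<cdot>[?T] w' = Ide ?T (Cod ?T w)"
  using w(1) unfolding iso_def by blast
 obtain u' v' where uv': "w' = (u', v')" by (cases w')
 have wa: "w \<in> Arr ?T" using w(1) by simp
 have u: "u \<in> Arr C" "base u = Ide Delta n" "v \<in> Arr C" "base v = Ide Delta (Suc 0)"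
  "Dom C u = ed d (ini n)" "Cod C u = c" "Dom C v = ed d [n, Suc n]" "Cod C v = e"
  using wa w(2,3) F unfolding uv by (simp_all add: segal_target_def fiber_product_def segal_tail)
 have i: "u' \<in> Arr C" "v' \<in> Arr C" "Dom C u' = c" "Cod C u' = Dom C u" "Dom C v' = e" "Cod C v' = Dom C v"
  "u' ** u = Ide C (Dom C u)" "u ** u' = Ide C (Cod C u)" "v' ** v = Ide C (Dom C v)" "v ** v' = Ide C (Cod C v)"
  using w' u(6,8) unfolding uv uv' by (simp_all add: segal_target_def fiber_product_def segal_tail)
 have "iso C u" by (rule isoI[of _ _ u']) (use i u in simp_all)
 moreover have "iso C v" by (rule isoI[of _ _ v']) (use i u in simp_all)
 ultimately show ?thesis using that d u by blast
qed

text \<open>Over the shared vertex both restrictions are identities, by discreteness, so any pair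
  \<open>a, b\<close> with the right endpoints is an arrow of the fiber product.\<close>

lemma segal_ff:
 assumes d: "d \<in> Obj C" "dim d = Suc n" "d' \<in> Obj C" "dim d' = Suc n"
 shows "a \<in> Arr C ==> base a = Ide Delta n ==> Dom C a = ed d (ini n) ==> Cod C a = ed d' (ini n) ==>
   b \<in> Arr C ==> base b = Ide Delta (Suc 0) ==> Dom C b = ed d [n, Suc n] ==> Cod C b = ed d' [n, Suc n] ==>
   \<exists>h \<in> Arr C. base h = Ide Delta (Suc n) \<and> Dom C h = d \<and> Cod C h = d' \<and> rs h (ini n) = a \<and> rs h [n, Suc n] = b"
  and "h \<in> Arr C ==> h' \<in> Arr C ==> base h = Ide Delta (Suc n) ==> base h' = Ide Delta (Suc n) ==>
   Dom C h = d ==> Dom C h' = d ==> Cod C h = d' ==> Cod C h' = d' ==>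
   rs h (ini n) = rs h' (ini n) ==> rs h [n, Suc n] = rs h' [n, Suc n] ==> h = h'"
proof -
 let ?T = "segal_target C \<pi> (Suc n) n" and ?F = "segal_fct C \<pi> (Suc n) n"
 have eq: "equivalence (fiber C Delta \<pi> (Suc n)) ?T ?F" by (rule seg) simp
 then have ff: "fully_faithful (fiber C Delta \<pi> (Suc n)) ?T ?F" by (simp add: equivalence_iff)
 have sg: "term_seg 0 n = dl n [n]" "init_seg 0 (Suc 0) = dl (Suc 0) [0]" "init_seg n (Suc n) = dl (Suc n) (ini n)"
  "term_seg (Suc 0) (Suc n) = dl (Suc n) [n, Suc n]"
  using term_seg_dl[of 0 n] init_seg_dl[of 0 "Suc 0"] init_seg_dl[of n "Suc n"] term_seg_dl[of "Suc 0" "Suc n"]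
  by (simp_all add: ini_def upt_rec)
 have F: "FObj ?F d = (ed d (ini n), ed d [n, Suc n])" if "d \<in> Obj C" "dim d = Suc n" for d
  using that by (simp add: segal_fct_def pair_fct_def segal_tail sg transition_obj)
 have FA: "FArr ?F h = (rs h (ini n), rs h [n, Suc n])" if "h \<in> Arr C" "base h = Ide Delta (Suc n)" for h
  using that by (simp add: segal_fct_def pair_fct_def segal_tail sg transition_arr)
 show "\<exists>h \<in> Arr C. base h = Ide Delta (Suc n) \<and> Dom C h = d \<and> Cod C h = d' \<and> rs h (ini n) = a \<and> rs h [n, Suc n] = b"
  if a: "a \<in> Arr C" "base a = Ide Delta n" "Dom C a = ed d (ini n)" "Cod C a = ed d' (ini n)"
   "b \<in> Arr C" "base b = Ide Delta (Suc 0)" "Dom C b = ed d [n, Suc n]" "Cod C b = ed d' [n, Suc n]"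
 proof -
  have dima: "dim (Dom C a) = n" "dim (Dom C b) = Suc 0" using vertical_dim a by blast+
  have "rs a [n] = Ide C (ed (Dom C a) [n])" "rs b [0] = Ide C (ed (Dom C b) [0])"
   using ed_vertex(2)[OF a(1), of n] ed_vertex(2)[OF a(5), of 0] dima by simp_all
  moreover have "ed (Dom C a) [n] = ed (Dom C b) [0]" unfolding a(3,7) using d by simp
  ultimately have "rs a [n] = rs b [0]" by simp
  then have ab: "(a, b) \<in> Arr ?T" "Dom ?T (a, b) = FObj ?F d" "Cod ?T (a, b) = FObj ?F d'"
   using a d by (simp_all add: F) (simp_all add: segal_target_def fiber_product_def segal_tail sg transition_arr)
  obtain h where "h \<in> Arr (fiber C Delta \<pi> (Suc n))" "Dom C h = d" "Cod C h = d'" "FArr ?F h = (a, b)"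
   using fully_faithfulD[OF ff _ _ ab] d by auto
  then show ?thesis using FA[of h] by auto
 qed
 show "h = h'" if "h \<in> Arr C" "h' \<in> Arr C" "base h = Ide Delta (Suc n)" "base h' = Ide Delta (Suc n)"
   "Dom C h = d" "Dom C h' = d" "Cod C h = d'" "Cod C h' = d'"
   "rs h (ini n) = rs h' (ini n)" "rs h [n, Suc n] = rs h' [n, Suc n]"
  by (rule equivalence_faithful[OF eq]) (use that FA in simp_all)
qed

end

text \<open>Factorizations are given by the inverse, which is again vertical.\<close>

lemma iso_cartesian:
 assumes "cat_functor C I \<pi>" "iso C v" "FArr \<pi> v = Ide I (FObj \<pi> (Dom C v))" "FObj \<pi> (Cod C v) = FObj \<pi> (Dom C v)"
 shows "cartesian C I \<pi> v"
 unfolding cartesian_def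
proof (intro conjI ballI impI)
 have [simp]: "category C" "category I" using assms(1) by (auto dest: cat_functor_cat)
 note [simp] = cat_functor_simps[OF assms(1)] assms(2)
 show "v \<in> Arr C" by simp
 fix f' assume f': "f' \<in> Arr C" "Cod C f' = Cod C v \<and> FArr \<pi> f' = FArr \<pi> v"
 have iv: "FArr \<pi> (inv_arr C v) = Ide I (FObj \<pi> (Dom C v))" by (rule vertical_iso_inv[OF assms(1-3)]) simp
 show "\<exists>!f0. f0 \<in> hom C (Dom C f') (Dom C v) \<and> FArr \<pi> f0 = Ide I (FObj \<pi> (Dom C v)) \<and> v \<cdot>[C] f0 = f'"
 proof (rule ex1I[of _ "inv_arr C v \<cdot>[C] f'"])
  show "inv_arr C v \<cdot>[C] f' \<in> hom C (Dom C f') (Dom C v) \<and>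
    FArr \<pi> (inv_arr C v \<cdot>[C] f') = Ide I (FObj \<pi> (Dom C v)) \<and> v \<cdot>[C] (inv_arr C v \<cdot>[C] f') = f'"
   using f' iv assms(3) by simp
  fix g assume "g \<in> hom C (Dom C f') (Dom C v) \<and> FArr \<pi> g = Ide I (FObj \<pi> (Dom C v)) \<and> v \<cdot>[C] g = f'"
  then show "g = inv_arr C v \<cdot>[C] f'" using inv_arr_cancel(1)[of C v g] by auto
 qed
qed

lemma dl_ini: "dl n (ini n) = Ide Delta n"
 using dl_Ide[of n] by (simp add: ini_def del: upt_Suc)

lemma Delta_dl:
 assumes "\<phi> \<in> Arr Delta"
 shows "dl (Cod Delta \<phi>) (map (app \<phi>) (ini (Dom Delta \<phi>))) = \<phi>" "sorted (map (app \<phi>) (ini (Dom Delta \<phi>)))"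
 using dl_comp[of \<phi> "Dom Delta \<phi>" "ini (Dom Delta \<phi>)"] assms
 by (simp_all add: dl_ini sorted_iff_nth_mono)

section \<open>Arrows prescribed on consecutive edges in a Segal-style 2-category\<close>

context segal begin

definition "vhom c d = {a \<in> Arr C. base a = Ide Delta (dim c) \<and> Dom C a = c \<and> Cod C a = d}"

lemma vhom_iff [simp]: "a \<in> vhom c d \<longleftrightarrow> a \<in> Arr C \<and> base a = Ide Delta (dim c) \<and> Dom C a = c \<and> Cod C a = d"
 by (simp add: vhom_def)

lemma rs_lf_iso [simp]: "c \<in> Obj C ==> valid (dim c) xs ==> valid (length xs - 1) ys ==> iso C (rs (lf c xs) ys)"
 by (rule rs_iso) simp_all

lemma rs_lf [simp]:
 assumes "c \<in> Obj C" "valid (dim c) xs" "valid (length xs - 1) ys"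
 shows "rs (lf c xs) ys \<in> Arr C" "Dom C (rs (lf c xs) ys) = ed (ed c xs) ys"
  "Cod C (rs (lf c xs) ys) = ed c (map ((!) xs) ys)" "base (rs (lf c xs) ys) = Ide Delta (length ys - 1)"
proof -
 have "y < length xs" if "y \<in> set ys" for y
  using assms(2,3) that by (metis One_nat_def Suc_pred leD length_greater_0_conv not_less_eq)
 then have m: "map (app (base (lf c xs))) ys = map ((!) xs) ys" using assms by simp
 show "rs (lf c xs) ys \<in> Arr C" "Dom C (rs (lf c xs) ys) = ed (ed c xs) ys"
  "Cod C (rs (lf c xs) ys) = ed c (map ((!) xs) ys)" "base (rs (lf c xs) ys) = Ide Delta (length ys - 1)"
  using rs_simps[of "lf c xs" ys, unfolded m] assms by simp_all
qed

lemma rs_vertical: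
 assumes "h \<in> vhom c d" "valid (dim c) xs"
 shows "rs h xs \<in> vhom (ed c xs) (ed d xs)"
 using rs_simps[of h xs] assms lf_simps[of c xs] by auto

lemma vhom_dim: "h \<in> vhom c d ==> c \<in> Obj C \<and> d \<in> Obj C \<and> dim d = dim c"
 using vertical_dim[of h] by auto

lemma rs_vcomp:
 assumes "h \<in> vhom c d" "k \<in> Arr C" "Dom C k = d" "valid (dim c) xs"
 shows "rs (k ** h) xs = rs k xs ** rs h xs"
 using rs_comp[of h k xs] assms by simp

text \<open>The edges of the face \<open>ini n\<close> and those of the whole object are only
  canonically isomorphic; this square lets an induction on dimension pass between them.\<close>

lemma rs_ini:
 assumes "h \<in> vhom c d" "dim c = Suc n" "i < n"
 shows "rs (lf d (ini n)) [i, Suc i] ** rs (rs h (ini n)) [i, Suc i] = rs h [i, Suc i] ** rs (lf c (ini n)) [i, Suc i]"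
proof -
 have c: "c \<in> Obj C" "d \<in> Obj C" "dim d = Suc n" using vhom_dim[OF assms(1)] assms(2) by auto
 have v: "valid (dim c) (ini n)" using assms by simp
 have r: "rs h (ini n) \<in> vhom (ed c (ini n)) (ed d (ini n))" by (rule rs_vertical[OF assms(1) v])
 have e: "lf d (ini n) ** rs h (ini n) = h ** lf c (ini n)"
 proof -
  have m: "map (app (base h)) (ini n) = ini n" using assms by simp
  show ?thesis using lf_rs[of h "ini n", unfolded m] assms v by simp
 qed
 have "rs (lf d (ini n) ** rs h (ini n)) [i, Suc i] = rs (lf d (ini n)) [i, Suc i] ** rs (rs h (ini n)) [i, Suc i]"
  by (rule rs_vcomp[OF r]) (use c assms in simp_all)
 moreover have "rs (h ** lf c (ini n)) [i, Suc i] = rs h [i, Suc i] ** rs (lf c (ini n)) [i, Suc i]"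
  using rs_comp[of "lf c (ini n)" h "[i, Suc i]"] c assms by simp
 ultimately show ?thesis using e by simp
qed

text \<open>By induction on the dimension the restrictions to the initial segment agree; the last
  edges agree by hypothesis, and the Segal functor is faithful.\<close>

lemma spine_unique:
 "h \<in> vhom c d ==> h' \<in> vhom c d ==> (\<And>i. i < dim c ==> rs h [i, Suc i] = rs h' [i, Suc i]) ==> h = h'"
proof (induction "dim c" arbitrary: c d h h')
 case 0
 then show ?case using discrete0(1)[of h] discrete0(1)[of h'] by simp
next
 case (Suc n)
 have c: "c \<in> Obj C" "d \<in> Obj C" "dim c = Suc n" "dim d = Suc n" using vhom_dim[OF Suc.prems(1)] Suc.hyps(2) by auto
 have v: "valid (dim c) (ini n)" using c by simp
 have "rs h (ini n) = rs h' (ini n)"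
 proof (rule Suc.hyps(1))
  show "n = dim (ed c (ini n))" using c by simp
  show r: "rs h (ini n) \<in> vhom (ed c (ini n)) (ed d (ini n))" "rs h' (ini n) \<in> vhom (ed c (ini n)) (ed d (ini n))"
   using rs_vertical[OF Suc.prems(1) v] rs_vertical[OF Suc.prems(2) v] by auto
  fix i assume "i < dim (ed c (ini n))"
  then have i: "i < n" using c by simp
  have vi: "valid (dim (ed c (ini n))) [i, Suc i]" using c i by simp
  show "rs (rs h (ini n)) [i, Suc i] = rs (rs h' (ini n)) [i, Suc i]"
  proof (rule iso_cancel_left[of C "rs (lf d (ini n)) [i, Suc i]"])
   show "rs (lf d (ini n)) [i, Suc i] ** rs (rs h (ini n)) [i, Suc i] =
     rs (lf d (ini n)) [i, Suc i] ** rs (rs h' (ini n)) [i, Suc i]"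
    unfolding rs_ini[OF Suc.prems(1) c(3) i] rs_ini[OF Suc.prems(2) c(3) i] using Suc.prems(3)[of i] i c by simp
  qed (use rs_vertical[OF r(1) vi] rs_vertical[OF r(2) vi] c i in simp_all)
 qed
 moreover have "rs h [n, Suc n] = rs h' [n, Suc n]" using Suc.prems(3)[of n] c by simp
 ultimately show ?case
  using segal_ff(2)[of c n d h h'] Suc.prems(1,2) c by simp
qed

text \<open>The same induction with fullness of the Segal functor. Agreement of vertices is a
  separate hypothesis because in dimension 0 no edge implies it.\<close>

lemma spine_exists:
 "c \<in> Obj C ==> d \<in> Obj C ==> dim d = dim c ==> (\<And>i. i \<le> dim c ==> ed c [i] = ed d [i]) ==>
  (\<And>i. i < dim c ==> a i \<in> vhom (ed c [i, Suc i]) (ed d [i, Suc i])) ==>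
  \<exists>h \<in> vhom c d. \<forall>i < dim c. rs h [i, Suc i] = a i"
proof (induction "dim c" arbitrary: c d a)
 case 0
 then have "d = c" using ed_0[of c] ed_0[of d] by simp
 then show ?case using 0 by (intro bexI[of _ "Ide C c"]) simp_all
next
 case (Suc n)
 have c: "c \<in> Obj C" "d \<in> Obj C" "dim c = Suc n" "dim d = Suc n" using Suc by auto
 let ?c = "ed c (ini n)" and ?d = "ed d (ini n)"
 \<comment> \<open>The prescribed arrows, transported to the edges of the face \<open>ini n\<close>,
   to which the induction hypothesis applies.\<close>
 define b where "b i = inv_arr C (rs (lf d (ini n)) [i, Suc i]) ** a i ** rs (lf c (ini n)) [i, Suc i]" for i
 have a [simp]: "a i \<in> Arr C" "base (a i) = Ide Delta (Suc 0)" "Dom C (a i) = ed c [i, Suc i]" "Cod C (a i) = ed d [i, Suc i]"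
  if "i \<le> n" for i using Suc.prems(5)[of i] that c by simp_all
 have b: "b i \<in> vhom (ed ?c [i, Suc i]) (ed ?d [i, Suc i])" if "i < n" for i
 proof -
  have "base (inv_arr C (rs (lf d (ini n)) [i, Suc i])) = Ide Delta (Suc 0)"
   using vertical_iso_inv[OF pi_functor, of "rs (lf d (ini n)) [i, Suc i]" "Suc 0"] c that by simp
  then show ?thesis using that c by (simp add: b_def)
 qed
 obtain g where g: "g \<in> vhom ?c ?d" "\<And>i. i < n ==> rs g [i, Suc i] = b i"
  using Suc.hyps(1)[of ?c ?d b] b c Suc.prems(4) by auto
 obtain h where h: "h \<in> Arr C" "base h = Ide Delta (Suc n)" "Dom C h = c" "Cod C h = d" "rs h (ini n) = g" "rs h [n, Suc n] = a n"
  using segal_ff(1)[of c n d g "a n"] c g a[of n] by auto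
 have hv: "h \<in> vhom c d" using h c by simp
 have "rs h [i, Suc i] = a i" if "i < dim c" for i
 proof (cases "i = n")
  case False
  then have i: "i < n" using that c by simp
  have hi: "rs h [i, Suc i] \<in> vhom (ed c [i, Suc i]) (ed d [i, Suc i])"
   using rs_vertical[OF hv, of "[i, Suc i]"] c i by simp
  show ?thesis
  proof (rule iso_cancel_right[of C "rs (lf c (ini n)) [i, Suc i]"])
   show "rs h [i, Suc i] ** rs (lf c (ini n)) [i, Suc i] = a i ** rs (lf c (ini n)) [i, Suc i]"
    unfolding rs_ini[OF hv c(3) i, symmetric] h(5) g(2)[OF i] b_def using c i by simp
  qed (use hi c i in simp_all)
 qed (use h in simp)
 then show ?case using hv by blast
qed

text \<open>Prescribe the inverse by the inverses on consecutive edges; both composites are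
  identities by uniqueness.\<close>

lemma spine_iso:
 assumes h: "h \<in> vhom c d" and i: "\<And>i. i < dim c ==> iso C (rs h [i, Suc i])"
 shows "iso C h"
proof -
 have c: "c \<in> Obj C" "d \<in> Obj C" "dim d = dim c" using vhom_dim[OF h] by auto
 have r: "rs h [i, Suc i] \<in> vhom (ed c [i, Suc i]) (ed d [i, Suc i])" if "i < dim c" for i
  using rs_vertical[OF h] that by simp
 have s: "ed c [i] = ed d [i]" if "i \<le> dim c" for i using ed_vertex(1)[of h i] that h by simp
 have "\<exists>k \<in> vhom d c. \<forall>i < dim d. rs k [i, Suc i] = inv_arr C (rs h [i, Suc i])"
 proof (rule spine_exists)
  fix j assume "j < dim d"
  then have j: "j < dim c" using c by simp
  show "inv_arr C (rs h [j, Suc j]) \<in> vhom (ed d [j, Suc j]) (ed c [j, Suc j])"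
   using vertical_iso_inv[OF pi_functor i[OF j], of "Suc 0"] r[OF j] i[OF j] c j by simp
 qed (use c s in simp_all)
 then obtain k where k: "k \<in> vhom d c" "\<And>i. i < dim d ==> rs k [i, Suc i] = inv_arr C (rs h [i, Suc i])" by blast
 have "k ** h = Ide C c"
 proof (rule spine_unique[of _ c c])
  show "k ** h \<in> vhom c c" using h k c by simp
  show "rs (k ** h) [j, Suc j] = rs (Ide C c) [j, Suc j]" if j: "j < dim c" for j
   using rs_vcomp[OF h, of k "[j, Suc j]"] k h c j i[OF j] r[OF j] by simp
 qed (use c in simp)
 moreover have "h ** k = Ide C d"
 proof (rule spine_unique[of _ d d])
  show "h ** k \<in> vhom d d" using h k c by simp
  show "rs (h ** k) [j, Suc j] = rs (Ide C d) [j, Suc j]" if "j < dim d" for j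
   using rs_vcomp[OF k(1), of h "[j, Suc j]"] k h c that i[of j] r[of j] by simp
 qed (use c in simp)
 ultimately show ?thesis using h k by (intro isoI[of h C k]) simp_all
qed

text \<open>Factoring through the chosen cartesian lift of \<open>\<phi>\<close> reduces the problem
  to a vertical arrow. If all prescribed edges are invertible, so is the vertical factor, and the
  composite is cartesian.\<close>

lemma arrow_exists:
 assumes c: "c \<in> Obj C" "d \<in> Obj C" and \<phi>: "\<phi> \<in> Arr Delta" "Dom Delta \<phi> = dim c" "Cod Delta \<phi> = dim d"
  and v: "\<And>i. i \<le> dim c ==> ed c [i] = ed d [app \<phi> i]"
  and a: "\<And>i. i < dim c ==> a i \<in> vhom (ed c [i, Suc i]) (ed d [app \<phi> i, app \<phi> (Suc i)])"
 obtains h where "h \<in> Arr C" "Dom C h = c" "Cod C h = d" "base h = \<phi>" "\<And>i. i < dim c ==> rs h [i, Suc i] = a i"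
  "(\<forall>i < dim c. iso C (a i)) \<longrightarrow> cartesian C Delta \<pi> h"
proof -
 define xs where "xs = map (app \<phi>) (ini (dim c))"
 have xs: "valid (dim d) xs" "length xs = Suc (dim c)" "\<And>i. i \<le> dim c ==> xs ! i = app \<phi> i" "dl (dim d) xs = \<phi>"
  using \<phi> Delta_dl[OF \<phi>(1)] by (simp_all add: xs_def)
 let ?d = "ed d xs" and ?p = "lf d xs"
 have p: "?p \<in> Arr C" "Dom C ?p = ?d" "Cod C ?p = d" "base ?p = \<phi>" "cartesian C Delta \<pi> ?p" "?d \<in> Obj C" "dim ?d = dim c"
  using c xs by simp_all
 have pi: "iso C (rs ?p [i, Suc i])" "Dom C (rs ?p [i, Suc i]) = ed ?d [i, Suc i]"
  "Cod C (rs ?p [i, Suc i]) = ed d [app \<phi> i, app \<phi> (Suc i)]" "base (rs ?p [i, Suc i]) = Ide Delta (Suc 0)"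
  "dim (ed d [app \<phi> i, app \<phi> (Suc i)]) = Suc 0" if "i < dim c" for i
  using that c xs(1,2) xs(3)[of i] xs(3)[of "Suc i"] lf_simps(7)[of d "[app \<phi> i, app \<phi> (Suc i)]"] \<phi> by simp_all
 define b where "b i = inv_arr C (rs ?p [i, Suc i]) ** a i" for i
 have b: "b i \<in> vhom (ed c [i, Suc i]) (ed ?d [i, Suc i])" if "i < dim c" for i
  using pi[OF that] a[OF that] vertical_iso_inv[OF pi_functor pi(1)[OF that] pi(4)[OF that]] c that by (simp add: b_def)
 obtain w where w: "w \<in> vhom c ?d" "\<And>i. i < dim c ==> rs w [i, Suc i] = b i"
 proof -
  have "ed c [i] = ed ?d [i]" if "i \<le> dim c" for i using that v[OF that] xs c by simp
  then show thesis using spine_exists[OF c(1) p(6,7) _ b] that by blast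
 qed
 show ?thesis
 proof (rule that[of "?p ** w"])
  show "rs (?p ** w) [i, Suc i] = a i" if i: "i < dim c" for i
   using rs_vcomp[OF w(1) p(1,2), of "[i, Suc i]"] w(2)[OF i] i a[OF i] pi[OF i] by (simp add: b_def)
  show "(\<forall>i < dim c. iso C (a i)) \<longrightarrow> cartesian C Delta \<pi> (?p ** w)"
  proof
   assume i: "\<forall>i < dim c. iso C (a i)"
   have "iso C w"
   proof (rule spine_iso[OF w(1)])
    show "iso C (rs w [j, Suc j])" if "j < dim c" for j
     using that i w(2)[OF that] pi[OF that] a[OF that] by (simp add: b_def)
   qed
   then have "cartesian C Delta \<pi> w" using w p by (intro iso_cartesian[OF pi_functor]) simp_all
   then show "cartesian C Delta \<pi> (?p ** w)" using fib p w unfolding fibration_def by simp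
  qed
 qed (use p w \<phi> in simp_all)
qed

text \<open>Both arrows factor through one lift, which reduces the claim to their vertical
  factors.\<close>

lemma arrow_unique:
 assumes h: "h \<in> Arr C" "h' \<in> Arr C" "Dom C h = Dom C h'" "Cod C h = Cod C h'" "base h = base h'"
  "\<And>i. i < dim (Dom C h) ==> rs h [i, Suc i] = rs h' [i, Suc i]"
 shows "h = h'"
proof -
 let ?c = "Dom C h" and ?d = "Cod C h" and ?\<phi> = "base h"
 define xs where "xs = map (app ?\<phi>) (ini (dim ?c))"
 have c: "?c \<in> Obj C" "?d \<in> Obj C" and \<phi>: "?\<phi> \<in> Arr Delta" "Dom Delta ?\<phi> = dim ?c" "Cod Delta ?\<phi> = dim ?d" using h by simp_all
 have xs: "valid (dim ?d) xs" "length xs = Suc (dim ?c)" "dl (dim ?d) xs = ?\<phi>"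
  using \<phi> Delta_dl[OF \<phi>(1)] by (simp_all add: xs_def)
 let ?p = "lf ?d xs"
 have p: "?p \<in> Arr C" "Cod C ?p = ?d" "base ?p = ?\<phi>" "cartesian C Delta \<pi> ?p" "Dom C ?p \<in> Obj C" "dim (Dom C ?p) = dim ?c"
  using c xs by simp_all
 obtain w where w: "w \<in> Arr C" "Dom C w = ?c" "Cod C w = Dom C ?p" "base w = Ide Delta (dim ?c)" "?p ** w = h"
  by (rule cartesianD[OF p(4) h(1)]) (use p in simp_all)
 obtain w' where w': "w' \<in> Arr C" "Dom C w' = ?c" "Cod C w' = Dom C ?p" "base w' = Ide Delta (dim ?c)" "?p ** w' = h'"
  by (rule cartesianD[OF p(4) h(2)]) (use p h in simp_all)
 have wv: "w \<in> vhom ?c (Dom C ?p)" "w' \<in> vhom ?c (Dom C ?p)" using w w' by simp_all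
 have "w = w'"
 proof (rule spine_unique[OF wv])
  fix i assume i: "i < dim ?c"
  have v: "valid (dim ?c) [i, Suc i]" "valid (dim (Dom C ?p)) [i, Suc i]" using i p by simp_all
  show "rs w [i, Suc i] = rs w' [i, Suc i]"
  proof (rule iso_cancel_left[of C "rs ?p [i, Suc i]"])
   show "rs ?p [i, Suc i] ** rs w [i, Suc i] = rs ?p [i, Suc i] ** rs w' [i, Suc i]"
    using rs_vcomp[OF wv(1) p(1) refl v(1)] rs_vcomp[OF wv(2) p(1) refl v(1)] h(6)[OF i] w(5) w'(5) by simp
  qed (use rs_iso[OF p(4) v(2)] rs_vertical[OF wv(1) v(1)] rs_vertical[OF wv(2) v(1)] rs_simps[OF p(1) v(2)] in simp_all)
 qed
 then show ?thesis using w w' by simp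
qed

section \<open>Horizontal composition of arrows between edges\<close>

text \<open>An arrow between the edges \<open>ij\<close> and an arrow between the edges \<open>jk\<close> of two objects compose to
 an arrow between the edges \<open>ik\<close>, by extension along the Segal equivalence in dimension \<open>2\<close>.\<close>

definition "star c i j k d i' j' k' a b = (SOME e. e \<in> vhom (ed c [i, k]) (ed d [i', k']) \<and>
 (\<exists>h \<in> Arr C. Dom C h = ed c [i, j, k] \<and> Cod C h = d \<and> base h = dl (dim d) [i', j', k'] \<and>
   rs h [0, Suc 0] = a ** rs (lf c [i, j, k]) [0, Suc 0] \<and>
   rs h [Suc 0, Suc (Suc 0)] = b ** rs (lf c [i, j, k]) [Suc 0, Suc (Suc 0)] \<and>
   rs h [0, Suc (Suc 0)] = e ** rs (lf c [i, j, k]) [0, Suc (Suc 0)]))"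

lemma edge_vertices:
 assumes "c \<in> Obj C" "d \<in> Obj C" "i \<le> j" "j \<le> dim c" "i' \<le> j'" "j' \<le> dim d" "a \<in> vhom (ed c [i, j]) (ed d [i', j'])"
 shows "ed c [i] = ed d [i']" "ed c [j] = ed d [j']"
 using ed_vertex(1)[of a 0] ed_vertex(1)[of a "Suc 0"] assms by simp_all

text \<open>The pair \<open>a, b\<close> fills to an arrow out of the triangle
  \<open>i, j, k\<close>. The long edge of that triangle is canonically isomorphic to the edge
  \<open>i, k\<close> of \<open>c\<close>, and removing this isomorphism from the restriction of the
  filler leaves the composite.\<close>

lemma star_arrow:
 assumes c: "c \<in> Obj C" "d \<in> Obj C" "i \<le> j" "j \<le> k" "k \<le> dim c" "i' \<le> j'" "j' \<le> k'" "k' \<le> dim d"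
  "a \<in> vhom (ed c [i, j]) (ed d [i', j'])" "b \<in> vhom (ed c [j, k]) (ed d [j', k'])"
 shows "star c i j k d i' j' k' a b \<in> vhom (ed c [i, k]) (ed d [i', k'])"
  "\<exists>h \<in> Arr C. Dom C h = ed c [i, j, k] \<and> Cod C h = d \<and> base h = dl (dim d) [i', j', k'] \<and>
   rs h [0, Suc 0] = a ** rs (lf c [i, j, k]) [0, Suc 0] \<and>
   rs h [Suc 0, Suc (Suc 0)] = b ** rs (lf c [i, j, k]) [Suc 0, Suc (Suc 0)] \<and>
   rs h [0, Suc (Suc 0)] = star c i j k d i' j' k' a b ** rs (lf c [i, j, k]) [0, Suc (Suc 0)]"
proof -
 let ?X = "ed c [i, j, k]" and ?l = "lf c [i, j, k]" and ?n = "Suc (Suc 0)"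
 have X: "?X \<in> Obj C" "dim ?X = ?n" using c by simp_all
 have va: "ed c [i] = ed d [i']" "ed c [j] = ed d [j']" "ed c [k] = ed d [k']"
  using edge_vertices[OF c(1,2,3) _ c(6) _ c(9)] edge_vertices[OF c(1,2,4,5,7,8,10)] c by simp_all
 have D: "dim (ed c [i, j]) = Suc 0" "dim (ed c [j, k]) = Suc 0" using c by simp_all
 obtain h where h: "h \<in> Arr C" "Dom C h = ?X" "Cod C h = d" "base h = dl (dim d) [i', j', k']"
  "\<And>x. x < dim ?X ==> rs h [x, Suc x] = [a ** rs ?l [0, Suc 0], b ** rs ?l [Suc 0, ?n]] ! x"
 proof (rule arrow_exists[OF X(1) c(2), of "dl (dim d) [i', j', k']"])
  show "ed ?X [x] = ed d [app (dl (dim d) [i', j', k']) x]" if "x \<le> dim ?X" for x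
   using that X c va by (auto simp: le_Suc_eq)
  show "[a ** rs ?l [0, Suc 0], b ** rs ?l [Suc 0, ?n]] ! x \<in>
    vhom (ed ?X [x, Suc x]) (ed d [app (dl (dim d) [i', j', k']) x, app (dl (dim d) [i', j', k']) (Suc x)])"
   if "x < dim ?X" for x
   using that X c D by (auto simp: less_Suc_eq)
 qed (use c X in auto)
 define e where "e = rs h [0, ?n] ** inv_arr C (rs ?l [0, ?n])"
 have h02: "rs h [0, ?n] \<in> Arr C" "Dom C (rs h [0, ?n]) = ed ?X [0, ?n]" "Cod C (rs h [0, ?n]) = ed d [i', k']" "base (rs h [0, ?n]) = Ide Delta (Suc 0)"
  using rs_simps[OF h(1), of "[0, ?n]"] h X by simp_all
 have l02: "iso C (rs ?l [0, ?n])" "Dom C (rs ?l [0, ?n]) = ed ?X [0, ?n]" "Cod C (rs ?l [0, ?n]) = ed c [i, k]" "base (rs ?l [0, ?n]) = Ide Delta (Suc 0)"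
  using c by simp_all
 have "e \<in> vhom (ed c [i, k]) (ed d [i', k'])"
  using h02 l02 vertical_iso_inv[OF pi_functor l02(1,4)] c by (simp add: e_def)
 moreover have "rs h [0, ?n] = e ** rs ?l [0, ?n]" using h02 l02 by (simp add: e_def)
 ultimately have "\<exists>e. e \<in> vhom (ed c [i, k]) (ed d [i', k']) \<and>
  (\<exists>h \<in> Arr C. Dom C h = ?X \<and> Cod C h = d \<and> base h = dl (dim d) [i', j', k'] \<and>
   rs h [0, Suc 0] = a ** rs ?l [0, Suc 0] \<and> rs h [Suc 0, ?n] = b ** rs ?l [Suc 0, ?n] \<and>
   rs h [0, ?n] = e ** rs ?l [0, ?n])"
  using h h(5)[of 0] h(5)[of "Suc 0"] X by (intro exI[of _ e] conjI bexI[of _ h]) simp_all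
 from someI_ex[OF this, folded star_def]
 show "star c i j k d i' j' k' a b \<in> vhom (ed c [i, k]) (ed d [i', k'])"
  "\<exists>h \<in> Arr C. Dom C h = ?X \<and> Cod C h = d \<and> base h = dl (dim d) [i', j', k'] \<and>
   rs h [0, Suc 0] = a ** rs ?l [0, Suc 0] \<and> rs h [Suc 0, ?n] = b ** rs ?l [Suc 0, ?n] \<and>
   rs h [0, ?n] = star c i j k d i' j' k' a b ** rs ?l [0, ?n]" by blast+
qed

text \<open>The defining filler lives on one chosen triangle. Comparison with it over the triangle
  \<open>x, y, z\<close> shows that any \<open>h\<close> extending \<open>a\<close> and
  \<open>b\<close> along any \<open>p\<close> into \<open>c\<close> computes the same composite; the
  laws below come from suitable choices of \<open>p\<close> and \<open>h\<close>.\<close>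

lemma star_char:
 assumes c: "c \<in> Obj C" "d \<in> Obj C" "i \<le> j" "j \<le> k" "k \<le> dim c" "i' \<le> j'" "j' \<le> k'" "k' \<le> dim d"
  "a \<in> vhom (ed c [i, j]) (ed d [i', j'])" "b \<in> vhom (ed c [j, k]) (ed d [j', k'])"
  and p: "p \<in> Arr C" "Cod C p = c" and h: "h \<in> Arr C" "Dom C h = Dom C p" "Cod C h = d"
  and xyz: "x \<le> y" "y \<le> z" "z \<le> dim (Dom C p)" "map (app (base p)) [x, y, z] = [i, j, k]" "map (app (base h)) [x, y, z] = [i', j', k']"
  and e: "rs h [x, y] = a ** rs p [x, y]" "rs h [y, z] = b ** rs p [y, z]"
 shows "rs h [x, z] = star c i j k d i' j' k' a b ** rs p [x, z]"
proof -
 let ?X = "Dom C p" and ?n = "Suc (Suc 0)"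
 let ?q = "lf ?X [x, y, z]" and ?l = "lf c [i, j, k]" and ?s = "star c i j k d i' j' k' a b"
 have X: "?X \<in> Obj C" and v: "valid (dim ?X) [x, y, z]" "valid (dim (Dom C h)) [x, y, z]" using p xyz h by simp_all
 have vv: "valid (dim ?X) [x, y]" "valid (dim ?X) [y, z]" "valid (dim ?X) [x, z]" using v by auto
 let ?r = "rs p [x, y, z]"
 have m: "app (base p) x = i" "app (base p) y = j" "app (base p) z = k"
  "app (base h) x = i'" "app (base h) y = j'" "app (base h) z = k'" using xyz by simp_all
 have r: "?r \<in> Arr C" "Dom C ?r = ed ?X [x, y, z]" "Cod C ?r = ed c [i, j, k]" "base ?r = Ide Delta ?n" "?l ** ?r = p ** ?q"
  using rs_simps[OF p(1) v(1)] lf_rs[OF p(1) v(1)] m p by simp_all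
 have q: "?q \<in> Arr C" "Dom C ?q = ed ?X [x, y, z]" "Cod C ?q = ?X" "base ?q = dl (dim ?X) [x, y, z]" "dim (ed ?X [x, y, z]) = ?n"
  using X v by simp_all
 have l: "?l \<in> Arr C" "Dom C ?l = ed c [i, j, k]" "Cod C ?l = c" "base ?l = dl (dim c) [i, j, k]" using c by simp_all
 have rv: "?r \<in> vhom (ed ?X [x, y, z]) (ed c [i, j, k])" using r q by simp
 obtain h0 where h0: "h0 \<in> Arr C" "Dom C h0 = ed c [i, j, k]" "Cod C h0 = d" "base h0 = dl (dim d) [i', j', k']"
   "rs h0 [0, Suc 0] = a ** rs ?l [0, Suc 0]" "rs h0 [Suc 0, ?n] = b ** rs ?l [Suc 0, ?n]"
   "rs h0 [0, ?n] = ?s ** rs ?l [0, ?n]"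
  using star_arrow(2)[OF c] by blast
 have st: "?s \<in> vhom (ed c [i, k]) (ed d [i', k'])" by (rule star_arrow(1)[OF c])
 have pq: "rs (p ** ?q) [s, t] = rs p [[x, y, z] ! s, [x, y, z] ! t] ** rs ?q [s, t]"
  and hq: "rs (h ** ?q) [s, t] = rs h [[x, y, z] ! s, [x, y, z] ! t] ** rs ?q [s, t]"
  and lr: "rs (p ** ?q) [s, t] = rs ?l [s, t] ** rs ?r [s, t]"
  and hr: "rs (h0 ** ?r) [s, t] = rs h0 [s, t] ** rs ?r [s, t]" if "s \<le> t" "t \<le> ?n" for s t
  using rs_comp[of ?q p "[s, t]"] rs_comp[of ?q h "[s, t]"] rs_vcomp[OF rv l(1), of "[s, t]"] rs_vcomp[OF rv h0(1), of "[s, t]"]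
   that q p h r(5) l h0 by simp_all
 have rp: "rs p [x, y] \<in> Arr C" "Cod C (rs p [x, y]) = ed c [i, j]" "Dom C (rs p [x, y]) = ed ?X [x, y]"
  "rs p [y, z] \<in> Arr C" "Cod C (rs p [y, z]) = ed c [j, k]" "Dom C (rs p [y, z]) = ed ?X [y, z]"
  "rs p [x, z] \<in> Arr C" "Cod C (rs p [x, z]) = ed c [i, k]" "Dom C (rs p [x, z]) = ed ?X [x, z]"
  using rs_simps(1-3)[OF p(1) vv(1)] rs_simps(1-3)[OF p(1) vv(2)] rs_simps(1-3)[OF p(1) vv(3)] m p by simp_all
 have rr: "rs ?r [s, t] \<in> Arr C" "Dom C (rs ?r [s, t]) = ed (ed ?X [x, y, z]) [s, t]"
  "Cod C (rs ?r [s, t]) = ed (ed c [i, j, k]) [s, t]" if "s \<le> t" "t \<le> ?n" for s t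
  using rs_vertical[OF rv, of "[s, t]"] that q(5) by simp_all
 \<comment> \<open>Both arrows agree on the two consecutive edges of the triangle, hence everywhere;
   restriction to the long edge then gives the claim.\<close>
 have "h ** ?q = h0 ** ?r"
 proof (rule arrow_unique)
  show "base (h ** ?q) = base (h0 ** ?r)"
   using h q h0 r v c m by simp
  fix s assume "s < dim (Dom C (h ** ?q))"
  then have s: "s = 0 \<or> s = Suc 0" using h q by auto
  have "rs (h ** ?q) [0, Suc 0] = a ** rs (p ** ?q) [0, Suc 0]"
   unfolding hq[of 0 "Suc 0", simplified] pq[of 0 "Suc 0", simplified] e using rp c X v by simp
  also have "\<dots> = rs (h0 ** ?r) [0, Suc 0]"
   unfolding lr[of 0 "Suc 0", simplified] hr[of 0 "Suc 0", simplified] h0(5) using rr[of 0 "Suc 0"] c by simp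
  finally have 1: "rs (h ** ?q) [0, Suc 0] = rs (h0 ** ?r) [0, Suc 0]" .
  have "rs (h ** ?q) [Suc 0, ?n] = b ** rs (p ** ?q) [Suc 0, ?n]"
   unfolding hq[of "Suc 0" ?n, simplified] pq[of "Suc 0" ?n, simplified] e using rp c X v by simp
  also have "\<dots> = rs (h0 ** ?r) [Suc 0, ?n]"
   unfolding lr[of "Suc 0" ?n, simplified] hr[of "Suc 0" ?n, simplified] h0(6) using rr[of "Suc 0" ?n] c by simp
  finally show "rs (h ** ?q) [s, Suc s] = rs (h0 ** ?r) [s, Suc s]" using s 1 by auto
 qed (use h q h0 r in simp_all)
 then have "rs h [x, z] ** rs ?q [0, ?n] = rs (h0 ** ?r) [0, ?n]" using hq[of 0 ?n] by simp
 also have "\<dots> = ?s ** rs (p ** ?q) [0, ?n]"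
  unfolding lr[of 0 ?n, simplified] hr[of 0 ?n, simplified] h0(7) using rr[of 0 ?n] c st by simp
 also have "\<dots> = (?s ** rs p [x, z]) ** rs ?q [0, ?n]"
  unfolding pq[of 0 ?n, simplified] using rp st X v by simp
 finally have *: "rs h [x, z] ** rs ?q [0, ?n] = (?s ** rs p [x, z]) ** rs ?q [0, ?n]" .
 show ?thesis
  by (rule iso_cancel_right[OF C_category _ *])
   (use X v vv rp st h rs_simps(1,2)[OF h(1), of "[x, z]"] in simp_all)
qed

end

section \<open>Laws of horizontal composition\<close>

context segal begin

text \<open>With the identity for \<open>p\<close>, the arrow \<open>h\<close> is its own
  filler.\<close>

lemma star_edges:
 assumes h: "h \<in> Arr C" and "i \<le> j" "j \<le> k" "k \<le> dim (Dom C h)"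
 shows "star (Dom C h) i j k (Cod C h) (app (base h) i) (app (base h) j) (app (base h) k) (rs h [i, j]) (rs h [j, k]) = rs h [i, k]"
proof -
 let ?c = "Dom C h" and ?d = "Cod C h"
 have c: "?c \<in> Obj C" "?d \<in> Obj C" using h by simp_all
 have m: "app (base h) i \<le> app (base h) j" "app (base h) j \<le> app (base h) k" "app (base h) k \<le> dim ?d" using assms by simp_all
 have v: "rs h [i, j] \<in> vhom (ed ?c [i, j]) (ed ?d [app (base h) i, app (base h) j])"
  "rs h [j, k] \<in> vhom (ed ?c [j, k]) (ed ?d [app (base h) j, app (base h) k])" using assms by simp_all
 have s: "star ?c i j k ?d (app (base h) i) (app (base h) j) (app (base h) k) (rs h [i, j]) (rs h [j, k]) \<in>
   vhom (ed ?c [i, k]) (ed ?d [app (base h) i, app (base h) k])"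
  by (rule star_arrow(1)[OF c assms(2-4) m v])
 have I: "rs (Ide C ?c) [i, j] = Ide C (ed ?c [i, j])" "rs (Ide C ?c) [j, k] = Ide C (ed ?c [j, k])"
  "rs (Ide C ?c) [i, k] = Ide C (ed ?c [i, k])"
  using rs_Ide[OF c(1), of "[i, j]"] rs_Ide[OF c(1), of "[j, k]"] rs_Ide[OF c(1), of "[i, k]"] assms(2-4) by auto
 have "rs h [i, k] = star ?c i j k ?d (app (base h) i) (app (base h) j) (app (base h) k) (rs h [i, j]) (rs h [j, k]) ** rs (Ide C ?c) [i, k]"
 proof (rule star_char[OF c assms(2-4) m v, of "Ide C ?c" h i j k])
  show "rs h [i, j] = rs h [i, j] ** rs (Ide C ?c) [i, j]" "rs h [j, k] = rs h [j, k] ** rs (Ide C ?c) [j, k]"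
   unfolding I using v by simp_all
 qed (use assms c in simp_all)
 then show ?thesis using s c assms unfolding I by simp
qed

lemma star_Ide:
 assumes "c \<in> Obj C" "i \<le> j" "j \<le> k" "k \<le> dim c"
 shows "star c i j k c i j k (Ide C (ed c [i, j])) (Ide C (ed c [j, k])) = Ide C (ed c [i, k])"
 using star_edges[of "Ide C c" i j k] assms by simp

text \<open>Take for \<open>p\<close> the filler of \<open>a, b\<close>; a filler of the vertical
  composites then extends \<open>a', b'\<close> along it.\<close>

lemma star_comp:
 assumes c: "c \<in> Obj C" "d \<in> Obj C" "e \<in> Obj C" "i \<le> j" "j \<le> k" "k \<le> dim c" "i' \<le> j'" "j' \<le> k'" "k' \<le> dim d"
  "i'' \<le> j''" "j'' \<le> k''" "k'' \<le> dim e"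
  and a: "a \<in> vhom (ed c [i, j]) (ed d [i', j'])" "b \<in> vhom (ed c [j, k]) (ed d [j', k'])"
   "a' \<in> vhom (ed d [i', j']) (ed e [i'', j''])" "b' \<in> vhom (ed d [j', k']) (ed e [j'', k''])"
 shows "star c i j k e i'' j'' k'' (a' ** a) (b' ** b) =
  star d i' j' k' e i'' j'' k'' a' b' ** star c i j k d i' j' k' a b"
proof -
 let ?n = "Suc (Suc 0)" and ?l = "lf c [i, j, k]"
 have D: "dim (ed d [i', j']) = Suc 0" "dim (ed d [j', k']) = Suc 0" "dim (ed c [i, j]) = Suc 0" "dim (ed c [j, k]) = Suc 0"
  using c by simp_all
 have ab: "a' ** a \<in> vhom (ed c [i, j]) (ed e [i'', j''])" "b' ** b \<in> vhom (ed c [j, k]) (ed e [j'', k''])"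
  using a D by simp_all
 note c1 = c(1,2,4-9) and c2 = c(2,3,7-12) and c3 = c(1,3,4-6,10-12)
 let ?s = "star c i j k d i' j' k' a b" and ?s' = "star d i' j' k' e i'' j'' k'' a' b'" and ?s'' = "star c i j k e i'' j'' k'' (a' ** a) (b' ** b)"
 have s: "?s \<in> vhom (ed c [i, k]) (ed d [i', k'])" "?s' \<in> vhom (ed d [i', k']) (ed e [i'', k''])" "?s'' \<in> vhom (ed c [i, k]) (ed e [i'', k''])"
  using star_arrow(1)[OF c1 a(1,2)] star_arrow(1)[OF c2 a(3,4)] star_arrow(1)[OF c3 ab] by auto
 obtain h where h: "h \<in> Arr C" "Dom C h = ed c [i, j, k]" "Cod C h = d" "base h = dl (dim d) [i', j', k']"
   "rs h [0, Suc 0] = a ** rs ?l [0, Suc 0]" "rs h [Suc 0, ?n] = b ** rs ?l [Suc 0, ?n]" "rs h [0, ?n] = ?s ** rs ?l [0, ?n]"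
  using star_arrow(2)[OF c1 a(1,2)] by blast
 obtain g where g: "g \<in> Arr C" "Dom C g = ed c [i, j, k]" "Cod C g = e" "base g = dl (dim e) [i'', j'', k'']"
   "rs g [0, Suc 0] = (a' ** a) ** rs ?l [0, Suc 0]" "rs g [Suc 0, ?n] = (b' ** b) ** rs ?l [Suc 0, ?n]"
   "rs g [0, ?n] = ?s'' ** rs ?l [0, ?n]"
  using star_arrow(2)[OF c3 ab] by blast
 have "rs g [0, ?n] = ?s' ** rs h [0, ?n]"
  by (rule star_char[OF c2 a(3,4) h(1,3) g(1) _ g(3), of 0 "Suc 0" ?n]) (use h g c a in simp_all)
 then have "?s'' ** rs ?l [0, ?n] = (?s' ** ?s) ** rs ?l [0, ?n]"
  unfolding g(7) h(7) using s c by simp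
 then show ?thesis
  by (rule iso_cancel_right[rotated 2]) (use s c in simp_all)
qed

text \<open>One filler over the four vertices \<open>i, j, k, l\<close> extends all three arrows,
  and both bracketings are read off its longest edge.\<close>

lemma star_assoc:
 assumes c: "c \<in> Obj C" "d \<in> Obj C" "i \<le> j" "j \<le> k" "k \<le> l" "l \<le> dim c" "i' \<le> j'" "j' \<le> k'" "k' \<le> l'" "l' \<le> dim d"
  and a: "a \<in> vhom (ed c [i, j]) (ed d [i', j'])" "b \<in> vhom (ed c [j, k]) (ed d [j', k'])" "e \<in> vhom (ed c [k, l]) (ed d [k', l'])"
 shows "star c i k l d i' k' l' (star c i j k d i' j' k' a b) e = star c i j l d i' j' l' a (star c j k l d j' k' l' b e)"
proof -
 let ?p = "lf c [i, j, k, l]" and ?X = "ed c [i, j, k, l]"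
 have X: "?X \<in> Obj C" "dim ?X = Suc (Suc (Suc 0))" using c by simp_all
 have o: "i \<le> k" "j \<le> l" "i \<le> l" "i' \<le> k'" "j' \<le> l'" "k \<le> dim c" "k' \<le> dim d" "j \<le> dim c" "j' \<le> dim d" using c by auto
 have va: "ed c [i] = ed d [i']" "ed c [j] = ed d [j']" "ed c [k] = ed d [k']" "ed c [l] = ed d [l']"
  using edge_vertices[OF c(1,2,3) _ c(7) _ a(1)] edge_vertices[OF c(1,2,4) _ c(8) _ a(2)]
   edge_vertices[OF c(1,2,5,6,9,10) a(3)] o by simp_all
 have D: "dim (ed c [i, j]) = Suc 0" "dim (ed c [j, k]) = Suc 0" "dim (ed c [k, l]) = Suc 0" using c by simp_all
 obtain h where h: "h \<in> Arr C" "Dom C h = ?X" "Cod C h = d" "base h = dl (dim d) [i', j', k', l']"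
  "\<And>x. x < dim ?X ==> rs h [x, Suc x] = [a ** rs ?p [0, Suc 0], b ** rs ?p [Suc 0, Suc (Suc 0)],
   e ** rs ?p [Suc (Suc 0), Suc (Suc (Suc 0))]] ! x"
 proof (rule arrow_exists[OF X(1) c(2), of "dl (dim d) [i', j', k', l']"])
  show "ed ?X [x] = ed d [app (dl (dim d) [i', j', k', l']) x]" if "x \<le> dim ?X" for x
   using that X c va by (auto simp: le_Suc_eq)
  show "[a ** rs ?p [0, Suc 0], b ** rs ?p [Suc 0, Suc (Suc 0)], e ** rs ?p [Suc (Suc 0), Suc (Suc (Suc 0))]] ! x \<in>
    vhom (ed ?X [x, Suc x]) (ed d [app (dl (dim d) [i', j', k', l']) x, app (dl (dim d) [i', j', k', l']) (Suc x)])"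
   if "x < dim ?X" for x
   using that X c a D by (auto simp: less_Suc_eq)
 qed (use c X in auto)
 have e: "rs h [0, Suc 0] = a ** rs ?p [0, Suc 0]" "rs h [Suc 0, Suc (Suc 0)] = b ** rs ?p [Suc 0, Suc (Suc 0)]"
  "rs h [Suc (Suc 0), Suc (Suc (Suc 0))] = e ** rs ?p [Suc (Suc 0), Suc (Suc (Suc 0))]"
  using h(5)[of 0] h(5)[of "Suc 0"] h(5)[of "Suc (Suc 0)"] X by simp_all
 have p: "?p \<in> Arr C" "Cod C ?p = c" "Dom C ?p = ?X" "base ?p = dl (dim c) [i, j, k, l]" using c by simp_all
 let ?ab = "star c i j k d i' j' k' a b" and ?be = "star c j k l d j' k' l' b e"
 have s1: "?ab \<in> vhom (ed c [i, k]) (ed d [i', k'])" by (rule star_arrow(1)[OF c(1-4) _ c(7,8) _ a(1,2)]) (use o in auto)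
 have s2: "?be \<in> vhom (ed c [j, l]) (ed d [j', l'])" by (rule star_arrow(1)[OF c(1,2,4-6,8-10) a(2,3)])
 have 1: "rs h [0, Suc (Suc 0)] = ?ab ** rs ?p [0, Suc (Suc 0)]"
  by (rule star_char[OF c(1-4) _ c(7,8) _ a(1,2) p(1,2) h(1) _ h(3), of 0 "Suc 0" "Suc (Suc 0)"]) (use o p h c e in simp_all)
 have 2: "rs h [Suc 0, Suc (Suc (Suc 0))] = ?be ** rs ?p [Suc 0, Suc (Suc (Suc 0))]"
  by (rule star_char[OF c(1,2,4-6,8-10) a(2,3) p(1,2) h(1) _ h(3), of "Suc 0" "Suc (Suc 0)"]) (use o p h c e in simp_all)
 let ?L = "star c i k l d i' k' l' ?ab e" and ?R = "star c i j l d i' j' l' a ?be"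
 have sL: "?L \<in> vhom (ed c [i, l]) (ed d [i', l'])" by (rule star_arrow(1)[OF c(1,2) o(1) c(5,6) o(4) c(9,10) s1 a(3)])
 have sR: "?R \<in> vhom (ed c [i, l]) (ed d [i', l'])" by (rule star_arrow(1)[OF c(1-3) o(2) c(6,7) o(5) c(10) a(1) s2])
 have 3: "rs h [0, Suc (Suc (Suc 0))] = ?L ** rs ?p [0, Suc (Suc (Suc 0))]"
  by (rule star_char[OF c(1,2) o(1) c(5,6) o(4) c(9,10) s1 a(3) p(1,2) h(1) _ h(3), of 0 "Suc (Suc 0)"]) (use o p h c e 1 in simp_all)
 have 4: "rs h [0, Suc (Suc (Suc 0))] = ?R ** rs ?p [0, Suc (Suc (Suc 0))]"
  by (rule star_char[OF c(1-3) o(2) c(6,7) o(5) c(10) a(1) s2 p(1,2) h(1) _ h(3), of 0 "Suc 0"]) (use o p h c e 2 in simp_all)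
 have "?L ** rs ?p [0, Suc (Suc (Suc 0))] = ?R ** rs ?p [0, Suc (Suc (Suc 0))]" using 3 4 by simp
 then show ?thesis by (rule iso_cancel_right[rotated 2]) (use c sL sR in simp_all)
qed

text \<open>The edge \<open>ii\<close> is degenerate; two such edges over the same vertex are canonically isomorphic.\<close>

definition "degen c i d j = rs (lf d [j]) [0, 0] ** inv_arr C (rs (lf c [i]) [0, 0])"

text \<open>Following the inclusion of a vertex by \<open>h\<close> gives the inclusion of its
  image, by uniqueness over a vertex; restrict both to the degenerate edge.\<close>

lemma rs_degen:
 assumes "h \<in> Arr C" "i \<le> dim (Dom C h)"
 shows "rs h [i, i] ** rs (lf (Dom C h) [i]) [0, 0] = rs (lf (Cod C h) [app (base h) i]) [0, 0]"
proof -
 have "h ** lf (Dom C h) [i] = lf (Cod C h) [app (base h) i]"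
  using vertex_arr[of "h ** lf (Dom C h) [i]" "app (base h) i"] assms by simp
 then show ?thesis using rs_comp[of "lf (Dom C h) [i]" h "[0, 0]"] assms by simp
qed

text \<open>The arrow \<open>a\<close> followed by the inclusion of its target edge restricts to
  \<open>a\<close> on the edge and to the degenerate comparisons at its ends, so it is a filler for
  the triples \<open>0, 0, 1\<close> and \<open>0, 1, 1\<close>.\<close>

lemma star_degen:
 assumes c: "c \<in> Obj C" "d \<in> Obj C" "i \<le> j" "j \<le> dim c" "i' \<le> j'" "j' \<le> dim d" and a: "a \<in> vhom (ed c [i, j]) (ed d [i', j'])"
 shows "star c i i j d i' i' j' (degen c i d i') a = a"
  and "star c i j j d i' j' j' a (degen c j d j') = a"
proof -
 let ?X = "ed c [i, j]" and ?p = "lf c [i, j]" and ?h = "lf d [i', j'] ** a"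
 have va: "ed c [i] = ed d [i']" "ed c [j] = ed d [j']" using edge_vertices[OF c a] .
 have X: "?X \<in> Obj C" "dim ?X = Suc 0" "dim (ed d [i', j']) = Suc 0" using c by simp_all
 have p: "?p \<in> Arr C" "Cod C ?p = c" "Dom C ?p = ?X" "base ?p = dl (dim c) [i, j]" using c by simp_all
 have q: "lf d [i', j'] \<in> Arr C" "Cod C (lf d [i', j']) = d" "Dom C (lf d [i', j']) = ed d [i', j']" "base (lf d [i', j']) = dl (dim d) [i', j']"
  using c by simp_all
 have h: "?h \<in> Arr C" "Dom C ?h = ?X" "Cod C ?h = d" "base ?h = dl (dim d) [i', j']" using q a X c by simp_all
 have I: "dl (Suc 0) [0, Suc 0] = Ide Delta (Suc 0)" using dl_Ide[of "Suc 0"] by simp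
 have P: "rs ?p [0, Suc 0] = lf ?X [0, Suc 0]"
  by (rule rs_unique) (use p X I c in simp_all)
 have H: "rs ?h [0, Suc 0] = a ** lf ?X [0, Suc 0]"
  by (rule rs_unique) (use h q X I c a in simp_all)
 have k: "degen c x d x' \<in> vhom (ed c [x, x]) (ed d [x', x'])" if "x \<le> dim c" "x' \<le> dim d" "ed c [x] = ed d [x']" for x x'
  using that c vertical_iso_inv[OF pi_functor, of "rs (lf c [x]) [0, 0]" "Suc 0"] by (simp add: degen_def)
 \<comment> \<open>The index \<open>z\<close> treats both ends at once; a degenerate edge comes from
   its vertex, where \<open>rs_degen\<close> computes both restrictions.\<close>
 have D: "rs ?h [z, z] = degen c ([i, j] ! z) d ([i', j'] ! z) ** rs ?p [z, z]" if z: "z \<le> Suc 0" for z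
 proof (rule iso_cancel_right[of C "rs (lf ?X [z]) [0, 0]"])
  have zz: "[i, j] ! z \<le> dim c" "[i', j'] ! z \<le> dim d" "ed c [[i, j] ! z] = ed d [[i', j'] ! z]" using z c va by (auto simp: le_Suc_eq)
  have 1: "rs ?h [z, z] ** rs (lf ?X [z]) [0, 0] = rs (lf d [[i', j'] ! z]) [0, 0]"
   using rs_degen[OF h(1), of z] h z X by simp
  have 2: "rs ?p [z, z] ** rs (lf ?X [z]) [0, 0] = rs (lf c [[i, j] ! z]) [0, 0]"
   using rs_degen[OF p(1), of z] p z X by simp
  have 3: "(degen c ([i, j] ! z) d ([i', j'] ! z) ** rs ?p [z, z]) ** rs (lf ?X [z]) [0, 0] =
   degen c ([i, j] ! z) d ([i', j'] ! z) ** rs ?p [z, z] ** rs (lf ?X [z]) [0, 0]"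
   by (rule category_simps(11)) (use k[OF zz] z X c zz rs_simps[OF p(1), of "[z, z]"] p in simp_all)
  show "rs ?h [z, z] ** rs (lf ?X [z]) [0, 0] = (degen c ([i, j] ! z) d ([i', j'] ! z) ** rs ?p [z, z]) ** rs (lf ?X [z]) [0, 0]"
   unfolding 3 1 2 unfolding degen_def using c zz by simp
  show "degen c ([i, j] ! z) d ([i', j'] ! z) ** rs ?p [z, z] \<in> Arr C"
   "Dom C (degen c ([i, j] ! z) d ([i', j'] ! z) ** rs ?p [z, z]) = Cod C (rs (lf ?X [z]) [0, 0])"
   using k[OF zz] z X c zz rs_simps[OF p(1), of "[z, z]"] p by simp_all
  show "rs ?h [z, z] \<in> Arr C" "Dom C (rs ?h [z, z]) = Cod C (rs (lf ?X [z]) [0, 0])"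
   using rs_simps[OF h(1), of "[z, z]"] h z X by simp_all
 qed (use X z in simp_all)
 have o: "i \<le> dim c" "i' \<le> dim d" using c by auto
 have ki: "degen c i d i' \<in> vhom (ed c [i, i]) (ed d [i', i'])" and kj: "degen c j d j' \<in> vhom (ed c [j, j]) (ed d [j', j'])"
  using k[of i i'] k[of j j'] c va o by auto
 have e: "rs ?h [0, Suc 0] = a ** rs ?p [0, Suc 0]" unfolding P H ..
 let ?s = "star c i i j d i' i' j' (degen c i d i') a" and ?t = "star c i j j d i' j' j' a (degen c j d j')"
 have "rs ?h [0, Suc 0] = ?s ** rs ?p [0, Suc 0]"
  by (rule star_char[OF c(1,2) order_refl c(3,4) order_refl c(5,6) ki a p(1,2) h(1) _ h(3), of 0 0])
   (use h p c X D[of 0] e in simp_all)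
 then have 1: "?s ** rs ?p [0, Suc 0] = a ** rs ?p [0, Suc 0]" using e by simp
 have "rs ?h [0, Suc 0] = ?t ** rs ?p [0, Suc 0]"
  by (rule star_char[OF c(1,2,3) order_refl c(4,5) order_refl c(6) a kj p(1,2) h(1) _ h(3), of 0 "Suc 0"])
   (use h p c X D[of "Suc 0"] e in simp_all)
 then have 2: "?t ** rs ?p [0, Suc 0] = a ** rs ?p [0, Suc 0]" using e by simp
 have i: "iso C (rs ?p [0, Suc 0])" "Cod C (rs ?p [0, Suc 0]) = ed c [i, j]" using c by simp_all
 have s: "?s \<in> vhom (ed c [i, j]) (ed d [i', j'])" "?t \<in> vhom (ed c [i, j]) (ed d [i', j'])"
  using star_arrow(1)[OF c(1,2) order_refl c(3,4) order_refl c(5,6) ki a]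
   star_arrow(1)[OF c(1,2,3) order_refl c(4,5) order_refl c(6) a kj] by auto
 show "?s = a" by (rule iso_cancel_right[OF C_category i(1) 1]) (use i s a in simp_all)
 show "?t = a" by (rule iso_cancel_right[OF C_category i(1) 2]) (use i s a in simp_all)
qed

text \<open>The restrictions of \<open>p\<close> and of \<open>q\<close> compose horizontally by
  \<open>star_edges\<close>, and \<open>star_comp\<close> moves them outside. Only \<open>p\<close>
  is required to be cartesian, as only its restrictions are inverted.\<close>

lemma star_transport:
 assumes p: "p \<in> Arr C" "Dom C p = c" "Cod C p = c'" "cartesian C Delta \<pi> p" and q: "q \<in> Arr C" "Dom C q = d" "Cod C q = d'"
  and ijk: "i \<le> j" "j \<le> k" "k \<le> dim c" "i' \<le> j'" "j' \<le> k'" "k' \<le> dim d"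
  and a: "a \<in> vhom (ed c [i, j]) (ed d [i', j'])" "b \<in> vhom (ed c [j, k]) (ed d [j', k'])"
 shows "star c' (app (base p) i) (app (base p) j) (app (base p) k) d' (app (base q) i') (app (base q) j') (app (base q) k')
   (rs q [i', j'] ** a ** inv_arr C (rs p [i, j])) (rs q [j', k'] ** b ** inv_arr C (rs p [j, k])) =
  rs q [i', k'] ** star c i j k d i' j' k' a b ** inv_arr C (rs p [i, k])"
proof -
 have o: "c \<in> Obj C" "c' \<in> Obj C" "d \<in> Obj C" "d' \<in> Obj C" using p q by auto
 have ik: "i \<le> k" "i' \<le> k'" "j \<le> dim c" "j' \<le> dim d" using ijk by auto
 let ?p = "app (base p)" and ?q = "app (base q)"
 have m: "?p i \<le> ?p j" "?p j \<le> ?p k" "?p k \<le> dim c'" "?q i' \<le> ?q j'" "?q j' \<le> ?q k'" "?q k' \<le> dim d'"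
  using p q ijk by simp_all
 have pi: "iso C (rs p [x, y])" "rs p [x, y] \<in> vhom (ed c [x, y]) (ed c' [?p x, ?p y])" if "x \<le> y" "y \<le> dim c" for x y
  using rs_iso[OF p(4), of "[x, y]"] rs_simps[OF p(1), of "[x, y]"] that p o by simp_all
 have qv: "rs q [x, y] \<in> vhom (ed d [x, y]) (ed d' [?q x, ?q y])" if "x \<le> y" "y \<le> dim d" for x y
  using rs_simps[OF q(1), of "[x, y]"] that q o by simp
 note pij = pi[OF ijk(1) ik(3)] and pjk = pi[OF ijk(2,3)] and pik = pi[OF ik(1) ijk(3)]
  and qij = qv[OF ijk(4) ik(4)] and qjk = qv[OF ijk(5,6)] and qik = qv[OF ik(2) ijk(6)]
 have d1: "dim (ed c [i, j]) = Suc 0" "dim (ed c [j, k]) = Suc 0" "dim (ed d [i', j']) = Suc 0" "dim (ed d [j', k']) = Suc 0"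
  "dim (ed c' [?p i, ?p j]) = Suc 0" "dim (ed c' [?p j, ?p k]) = Suc 0" "dim (ed c [i, k]) = Suc 0" "dim (ed d [i', k']) = Suc 0"
  using ijk ik m o by simp_all
 let ?A = "rs q [i', j'] ** a ** inv_arr C (rs p [i, j])" and ?B = "rs q [j', k'] ** b ** inv_arr C (rs p [j, k])"
 have iv: "base (inv_arr C (rs p [i, j])) = Ide Delta (Suc 0)" "base (inv_arr C (rs p [j, k])) = Ide Delta (Suc 0)"
  using iso_base(3)[OF pij(1)] iso_base(3)[OF pjk(1)] pij pjk d1 by simp_all
 have A: "?A \<in> vhom (ed c' [?p i, ?p j]) (ed d' [?q i', ?q j'])" "?B \<in> vhom (ed c' [?p j, ?p k]) (ed d' [?q j', ?q k'])"
  using a pij pjk qij qjk iv d1 by simp_all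
 let ?s = "star c i j k d i' j' k' a b" and ?S = "star c' (?p i) (?p j) (?p k) d' (?q i') (?q j') (?q k') ?A ?B"
 have s: "?s \<in> vhom (ed c [i, k]) (ed d [i', k'])" by (rule star_arrow(1)[OF o(1,3) ijk a])
 have S: "?S \<in> vhom (ed c' [?p i, ?p k]) (ed d' [?q i', ?q k'])" by (rule star_arrow(1)[OF o(2,4) m A])
 have "?S ** rs p [i, k] = ?S ** star c i j k c' (?p i) (?p j) (?p k) (rs p [i, j]) (rs p [j, k])"
  using star_edges[OF p(1), of i j k] p ijk by simp
 also have "\<dots> = star c i j k d' (?q i') (?q j') (?q k') (?A ** rs p [i, j]) (?B ** rs p [j, k])"
  by (rule star_comp[OF o(1,2,4) ijk(1-3) m pij(2) pjk(2) A, symmetric])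
 also have "\<dots> = star c i j k d' (?q i') (?q j') (?q k') (rs q [i', j'] ** a) (rs q [j', k'] ** b)"
  using a pij pjk qij qjk by simp
 also have "\<dots> = star d i' j' k' d' (?q i') (?q j') (?q k') (rs q [i', j']) (rs q [j', k']) ** ?s"
  by (rule star_comp[OF o(1,3,4) ijk m(4-6) a qij qjk])
 also have "\<dots> = rs q [i', k'] ** ?s"
  using star_edges[OF q(1), of i' j' k'] q ijk by simp
 finally have *: "?S ** rs p [i, k] = rs q [i', k'] ** ?s" .
 have "?S = (?S ** rs p [i, k]) ** inv_arr C (rs p [i, k])" using S pik by simp
 then show ?thesis unfolding * using s pik qik by simp
qed

section \<open>Paths and their realizations\<close>

text \<open>An empty list carries no vertex, so both endpoints are arguments.\<close>

fun path :: "'o => 'o list => 'o => bool" where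
 "path x [] y \<longleftrightarrow> x = y \<and> x \<in> Obj C \<and> dim x = 0"
| "path x (c # L) y \<longleftrightarrow> c \<in> Obj C \<and> dim c = Suc 0 \<and> ed c [0] = x \<and> path (ed c [Suc 0]) L y"

lemma path_source: "path x L y ==> x \<in> Obj C \<and> dim x = 0"
 by (cases L) auto

lemma path_target: "path x L y ==> y \<in> Obj C \<and> dim y = 0"
 by (induction L arbitrary: x) auto

lemma path_append: "path x (L @ M) z \<longleftrightarrow> (\<exists>y. path x L y \<and> path y M z)"
 by (induction L arbitrary: x) (auto dest: path_source)

lemma path_unique: "path x L y ==> path x L y' ==> y = y'"
 by (induction L arbitrary: x) auto

text \<open>The initial vertex is stated separately because the conditions on edges say nothing for
  the empty path.\<close>

definition "real_spec x L t u \<longleftrightarrow> t \<in> Obj C \<and> dim t = length L \<and> ed t [0] = x \<and>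
 (\<forall>i < length L. iso C (u i) \<and> u i \<in> vhom (ed t [i, Suc i]) (L ! i))"

text \<open>The isomorphisms onto the edges preserve vertices strictly, so the vertices of a
  realization are those met along the path.\<close>

lemma real_vertex:
 assumes "path x L y" "real_spec x L t u" "i \<le> length L"
 shows "path x (take i L) (ed t [i])"
 using assms(3)
proof (induction i)
 case 0
 then show ?case using assms path_source by (simp add: real_spec_def)
next
 case (Suc i)
 let ?c = "L ! i"
 have t: "t \<in> Obj C" "dim t = length L" "u i \<in> vhom (ed t [i, Suc i]) ?c" using assms(2) Suc by (auto simp: real_spec_def)
 have v: "ed ?c [0] = ed t [i]" "ed ?c [Suc 0] = ed t [Suc i]"
  using ed_vertex(1)[of "u i" 0] ed_vertex(1)[of "u i" "Suc 0"] t Suc.prems by simp_all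
 have c: "?c \<in> Obj C" "dim ?c = Suc 0" using vhom_dim[OF t(3)] t Suc.prems by simp_all
 have "path x (take i L) (ed t [i])" using Suc by simp
 moreover have "path (ed t [i]) [?c] (ed t [Suc i])" using c v t Suc.prems by simp
 ultimately have "path x (take i L @ [?c]) (ed t [Suc i])" unfolding path_append by blast
 then show ?case using Suc.prems by (simp add: take_Suc_conv_app_nth)
qed

text \<open>The last edge is glued onto a realization of the rest by the Segal condition; strictly
  equal vertices make this possible.\<close>

lemma real_exists: "path x L y ==> \<exists>t u. real_spec x L t u"
proof (induction L arbitrary: y rule: rev_induct)
 case Nil
 then show ?case by (intro exI[of _ x]) (auto simp: real_spec_def)
next
 case (snoc c L)
 then obtain y' where y': "path x L y'" "c \<in> Obj C" "dim c = Suc 0" "ed c [0] = y'" by (auto simp: path_append)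
 obtain t u where tu: "real_spec x L t u" using snoc.IH[OF y'(1)] by blast
 let ?n = "length L"
 have t: "t \<in> Obj C" "dim t = ?n" "ed t [0] = x" using tu by (auto simp: real_spec_def)
 have "path x L (ed t [?n])" using real_vertex[OF y'(1) tu, of ?n] by simp
 then have "ed c [0] = ed t [?n]" using path_unique y' by blast
 then obtain d w v where d: "d \<in> Obj C" "dim d = Suc ?n"
  and w: "iso C w" "base w = Ide Delta ?n" "Dom C w = ed d (ini ?n)" "Cod C w = t"
  and v: "iso C v" "base v = Ide Delta (Suc 0)" "Dom C v = ed d [?n, Suc ?n]" "Cod C v = c"
  using segal_lift[OF t(1,2) y'(2,3)] by metis
 \<comment> \<open>Earlier edges are reached through the face \<open>ini\<close> of the new object
   and the isomorphism \<open>w\<close>; the last edge is reached by \<open>v\<close>.\<close>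
 define u' where "u' i = (if i < ?n then u i ** rs w [i, Suc i] ** inv_arr C (rs (lf d (ini ?n)) [i, Suc i]) else v)" for i
 have di: "ed d (ini ?n) \<in> Obj C" "dim (ed d (ini ?n)) = ?n" using d by simp_all
 have "real_spec x (L @ [c]) d u'"
  unfolding real_spec_def
 proof (intro conjI allI impI)
  show "ed d [0] = x"
   using ed_vertex(1)[of w 0] w di d t by simp
 next
  fix i assume i: "i < length (L @ [c])"
  have "iso C (u' i) \<and> u' i \<in> vhom (ed d [i, Suc i]) ((L @ [c]) ! i)"
  proof (cases "i < ?n")
   case True
   have ui: "iso C (u i)" "u i \<in> vhom (ed t [i, Suc i]) (L ! i)" using tu True by (auto simp: real_spec_def)
   have wi: "iso C (rs w [i, Suc i])" "rs w [i, Suc i] \<in> vhom (ed (ed d (ini ?n)) [i, Suc i]) (ed t [i, Suc i])"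
    using rs_iso_iso(1)[OF w(1), of "[i, Suc i]"] rs_vertical[of w "ed d (ini ?n)" t "[i, Suc i]"] w di True by simp_all
   have li: "iso C (rs (lf d (ini ?n)) [i, Suc i])" "Dom C (rs (lf d (ini ?n)) [i, Suc i]) = ed (ed d (ini ?n)) [i, Suc i]"
    "Cod C (rs (lf d (ini ?n)) [i, Suc i]) = ed d [i, Suc i]" using d True by simp_all
   have dd: "dim (ed d [i, Suc i]) = Suc 0" "dim (ed t [i, Suc i]) = Suc 0" "dim (ed (ed d (ini ?n)) [i, Suc i]) = Suc 0"
    using d t di True by simp_all
   have "base (inv_arr C (rs (lf d (ini ?n)) [i, Suc i])) = Ide Delta (Suc 0)"
    using iso_base(3)[OF li(1)] li(2) dd by simp
   then show ?thesis using True ui wi li dd by (simp add: u'_def nth_append)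
  next
   case False
   then have "i = ?n" using i by simp
   then show ?thesis using v d by (simp add: u'_def)
  qed
  then show "iso C (u' i)" "u' i \<in> vhom (ed d [i, Suc i]) ((L @ [c]) ! i)" by auto
 qed (use d in simp_all)
 then show ?case by blast
qed

text \<open>\<open>T x L\<close> is a simplex with consecutive edges \<open>L\<close>, up to the isomorphisms \<open>u x L\<close>; \<open>amb\<close> maps such a simplex
 to an arbitrary object by prescribing the images of the consecutive edges.\<close>

definition "RT x L = (SOME tu. real_spec x L (fst tu) (snd tu))"
definition "T x L = fst (RT x L)"
definition "u x L = snd (RT x L)"

lemma T_spec: "path x L y ==> real_spec x L (T x L) (u x L)"
proof -
 assume "path x L y"
 then have "\<exists>tu. real_spec x L (fst tu) (snd tu)" using real_exists by fastforce
 from someI_ex[OF this, folded RT_def] show ?thesis by (simp add: T_def u_def)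
qed

lemma T_simps:
 assumes "path x L y"
 shows "T x L \<in> Obj C" "dim (T x L) = length L" "ed (T x L) [0] = x"
  "i < length L ==> iso C (u x L i)" "i < length L ==> u x L i \<in> vhom (ed (T x L) [i, Suc i]) (L ! i)"
 using T_spec[OF assms] by (auto simp: real_spec_def)

lemma T_vertex:
 assumes "path x (A @ B) z" "path x A y"
 shows "ed (T x (A @ B)) [length A] = y"
 using real_vertex[OF assms(1) T_spec[OF assms(1)], of "length A"] path_unique[OF assms(2)] by simp

lemma path_edge:
 assumes "path x L y" "i < length L"
 shows "L ! i \<in> Obj C" "dim (L ! i) = Suc 0"
 using vhom_dim[OF T_simps(5)[OF assms]] T_simps(1,2)[OF assms(1)] assms(2) by simp_all

definition "amb x L c ps w = (SOME h. h \<in> Arr C \<and> Dom C h = T x L \<and> Cod C h = c \<and> base h = dl (dim c) ps \<and>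
 (\<forall>i < length L. rs h [i, Suc i] = w i ** u x L i) \<and> ((\<forall>i < length L. iso C (w i)) \<longrightarrow> cartesian C Delta \<pi> h))"

lemma amb_simps:
 assumes L: "path x L y" and c: "c \<in> Obj C" "valid (dim c) ps" "length ps = Suc (length L)" "ed c [ps ! 0] = x"
  and w: "\<And>i. i < length L ==> w i \<in> vhom (L ! i) (ed c [ps ! i, ps ! Suc i])"
 shows "amb x L c ps w \<in> Arr C" "Dom C (amb x L c ps w) = T x L" "Cod C (amb x L c ps w) = c" "base (amb x L c ps w) = dl (dim c) ps"
  "i < length L ==> rs (amb x L c ps w) [i, Suc i] = w i ** u x L i"
  "(\<And>i. i < length L ==> iso C (w i)) ==> cartesian C Delta \<pi> (amb x L c ps w)"
proof -
 note T = T_simps[OF L]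
 have wu: "w i ** u x L i \<in> vhom (ed (T x L) [i, Suc i]) (ed c [ps ! i, ps ! Suc i])" if "i < length L" for i
  using T(1,2) T(4,5)[OF that] w[OF that] path_edge[OF L that] that by simp
 have ps: "ps ! i \<le> ps ! Suc i" "ps ! Suc i \<le> dim c" if "i < length L" for i
  using c(2,3) that by (simp_all add: sorted_nth_mono)
 \<comment> \<open>A vertex other than the first ends an edge, so the arrow prescribed on that edge
   already matches it.\<close>
 have vx: "ed (T x L) [i] = ed c [ps ! i]" if "i \<le> length L" for i
 proof (cases i)
  case 0
  then show ?thesis using T(3) c(4) by simp
 next
  case (Suc j)
  have "ed (T x L) [Suc j] = ed c [ps ! Suc j]"
   by (rule edge_vertices(2)[OF T(1) c(1) _ _ ps wu]) (use that Suc T(2) in auto)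
  then show ?thesis using Suc by simp
 qed
 obtain h where "h \<in> Arr C" "Dom C h = T x L" "Cod C h = c" "base h = dl (dim c) ps"
  "\<And>i. i < dim (T x L) ==> rs h [i, Suc i] = w i ** u x L i"
  "(\<forall>i < dim (T x L). iso C (w i ** u x L i)) \<longrightarrow> cartesian C Delta \<pi> h"
 proof (rule arrow_exists[OF T(1) c(1), of "dl (dim c) ps" "\<lambda>i. w i ** u x L i"])
  show "ed (T x L) [i] = ed c [app (dl (dim c) ps) i]" if "i \<le> dim (T x L)" for i using vx[of i] that T(2) c(3) by simp
  show "w i ** u x L i \<in> vhom (ed (T x L) [i, Suc i]) (ed c [app (dl (dim c) ps) i, app (dl (dim c) ps) (Suc i)])"
   if "i < dim (T x L)" for i using wu[of i] that T(2) c(3) by simp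
 qed (use c T in simp_all)
 moreover have "iso C (w i ** u x L i)" if "i < length L" "iso C (w i)" for i
  using T(4,5)[OF that(1)] w[OF that(1)] that by simp
 ultimately have "\<exists>h. h \<in> Arr C \<and> Dom C h = T x L \<and> Cod C h = c \<and> base h = dl (dim c) ps \<and>
  (\<forall>i < length L. rs h [i, Suc i] = w i ** u x L i) \<and> ((\<forall>i < length L. iso C (w i)) \<longrightarrow> cartesian C Delta \<pi> h)"
  using T(2) by (intro exI[of _ h]) auto
 from someI_ex[OF this, folded amb_def]
 show "amb x L c ps w \<in> Arr C" "Dom C (amb x L c ps w) = T x L" "Cod C (amb x L c ps w) = c" "base (amb x L c ps w) = dl (dim c) ps"
  "i < length L ==> rs (amb x L c ps w) [i, Suc i] = w i ** u x L i"
  "(\<And>i. i < length L ==> iso C (w i)) ==> cartesian C Delta \<pi> (amb x L c ps w)" by blast+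
qed

end

section \<open>Segments of paths and their long edges\<close>

context segal begin

definition "sh p l = map ((+) p) (ini l)"

lemma sh_simps [simp]: "length (sh p l) = Suc l" "sh p l \<noteq> []" "sorted (sh p l)" "p + l \<le> n ==> \<forall>x\<in>set (sh p l). x \<le> n"
 "i \<le> l ==> sh p l ! i = p + i" "sh p 0 = [p]"
 by (auto simp: sh_def sorted_iff_nth_mono simp del: upt_Suc) (simp add: ini_def)

text \<open>Position and initial vertex are parameters because a segment as a list does not
  determine where in the path it occurs; this matters most for the empty segment.\<close>

definition "sub x N p y L \<longleftrightarrow> (\<exists>A B z. N = A @ L @ B \<and> length A = p \<and> path x A y \<and> path x N z)"

text \<open>The long edge \<open>lg x L\<close> of \<open>T x L\<close> plays the role of the composite of \<open>L\<close>. If \<open>L\<close> is the segment of \<open>N\<close> that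
 starts at the position \<open>p\<close> and the vertex \<open>y\<close>, then \<open>J\<close> embeds \<open>T y L\<close> into \<open>T x N\<close>, \<open>cj\<close> compares the long edge with
 the corresponding edge of \<open>T x N\<close>, and \<open>tr\<close> conjugates by these comparisons.\<close>

definition "lg x L = ed (T x L) [0, length L]"

definition "J x N p y L = amb y L (T x N) (sh p (length L)) (\<lambda>i. inv_arr C (u x N (p + i)))"

definition "cj x N p y L = rs (J x N p y L) [0, length L]"

lemma subI: "path x A y ==> path y L w ==> path w B z ==> p = length A ==> N = A @ L @ B ==> sub x N p y L"
 unfolding sub_def by (auto simp: path_append)

lemma sub_self: "path x L y ==> sub x L 0 x L"
 using subI[of x "[]" x L y "[]" y] path_source path_target by fastforce

lemma subD:
 assumes "sub x N p y L"
 shows "\<exists>z. path x N z" "\<exists>w. path y L w" "p + length L \<le> length N" "i < length L ==> N ! (p + i) = L ! i"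
  "T x N \<in> Obj C" "dim (T x N) = length N" "ed (T x N) [p] = y"
proof -
 obtain A B z where A: "N = A @ L @ B" "length A = p" "path x A y" "path x N z" using assms by (auto simp: sub_def)
 show "\<exists>z. path x N z" using A by blast
 show "\<exists>w. path y L w" using A path_unique by (metis path_append)
 show "p + length L \<le> length N" "i < length L ==> N ! (p + i) = L ! i" using A by (auto simp: nth_append)
 show "T x N \<in> Obj C" "dim (T x N) = length N" using T_simps[OF A(4)] by auto
 show "ed (T x N) [p] = y" using T_vertex[of x A "L @ B" z y] A by simp
qed

lemma sub_trans:
 assumes "sub x N p y L" "sub y L q z M"
 shows "sub x N (p + q) z M"
proof -
 obtain A B w where A: "N = A @ L @ B" "length A = p" "path x A y" "path x N w" using assms by (auto simp: sub_def)
 obtain A' B' w' where B: "L = A' @ M @ B'" "length A' = q" "path y A' z" "path y L w'" using assms by (auto simp: sub_def)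
 have "path x (A @ A') z" using A B by (auto simp: path_append)
 then show ?thesis unfolding sub_def using A B by (intro exI[of _ "A @ A'"] exI[of _ "B' @ B"] exI[of _ w]) simp
qed

text \<open>Inverting the isomorphisms \<open>u\<close> of the long path identifies each edge of the
  segment with an edge of \<open>T x N\<close>; as all prescribed arrows are invertible, the
  embedding is cartesian.\<close>

lemma J_simps:
 assumes s: "sub x N p y L"
 shows "J x N p y L \<in> Arr C" "Dom C (J x N p y L) = T y L" "Cod C (J x N p y L) = T x N"
  "base (J x N p y L) = dl (length N) (sh p (length L))" "cartesian C Delta \<pi> (J x N p y L)"
  "i < length L ==> rs (J x N p y L) [i, Suc i] = inv_arr C (u x N (p + i)) ** u y L i"
  "i \<le> length L ==> app (base (J x N p y L)) i = p + i"
proof -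
 note d = subD[OF s]
 obtain z w where z: "path x N z" "path y L w" using d by blast
 note t = T_simps[OF z(1)]
 have v: "valid (dim (T x N)) (sh p (length L))" using d by simp
 have iv: "iso C (inv_arr C (u x N (p + i)))" "inv_arr C (u x N (p + i)) \<in> vhom (L ! i) (ed (T x N) [p + i, Suc (p + i)])"
  if "i < length L" for i
 proof -
  have i: "p + i < length N" using that d(3) by simp
  have e: "iso C (u x N (p + i))" "u x N (p + i) \<in> vhom (ed (T x N) [p + i, Suc (p + i)]) (L ! i)"
   using t(4,5)[OF i] d(4)[OF that] by simp_all
  have "dim (ed (T x N) [p + i, Suc (p + i)]) = Suc 0" "dim (L ! i) = Suc 0" using t i path_edge[OF z(2) that] by simp_all
  then show "iso C (inv_arr C (u x N (p + i)))" "inv_arr C (u x N (p + i)) \<in> vhom (L ! i) (ed (T x N) [p + i, Suc (p + i)])"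
   using e iso_base(3)[OF e(1)] by simp_all
 qed
 have iv': "inv_arr C (u x N (p + i)) \<in> vhom (L ! i) (ed (T x N) [sh p (length L) ! i, sh p (length L) ! Suc i])"
  if "i < length L" for i using iv(2)[OF that] that by simp
 have v0: "ed (T x N) [sh p (length L) ! 0] = y" using d(7) by simp
 note a = amb_simps[OF z(2) t(1) v sh_simps(1) v0 iv', folded J_def]
 show *: "J x N p y L \<in> Arr C" "Dom C (J x N p y L) = T y L" "Cod C (J x N p y L) = T x N"
  "base (J x N p y L) = dl (length N) (sh p (length L))" using a(1-4) t(2) by simp_all
 show "cartesian C Delta \<pi> (J x N p y L)" by (rule a(6)) (use iv in simp_all)
 show "i < length L ==> rs (J x N p y L) [i, Suc i] = inv_arr C (u x N (p + i)) ** u y L i" using a(5) by simp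
 show "i \<le> length L ==> app (base (J x N p y L)) i = p + i" using * d(3) by simp
qed

lemma J_unique:
 assumes s: "sub x N p y L" and h: "h \<in> Arr C" "Dom C h = T y L" "Cod C h = T x N" "base h = dl (length N) (sh p (length L))"
  "\<And>i. i < length L ==> rs h [i, Suc i] = inv_arr C (u x N (p + i)) ** u y L i"
 shows "h = J x N p y L"
proof (rule arrow_unique)
 fix i assume "i < dim (Dom C h)"
 then have "i < length L" using h(2) subD(2)[OF s] T_simps(2) by auto
 then show "rs h [i, Suc i] = rs (J x N p y L) [i, Suc i]" using h(5) J_simps(6)[OF s] by simp
qed (use h J_simps[OF s] in simp_all)

lemma u_simps:
 assumes "sub x N p y L" "i < length L"
 shows "iso C (u y L i)" "u y L i \<in> vhom (ed (T y L) [i, Suc i]) (L ! i)"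
  "iso C (u x N (p + i))" "u x N (p + i) \<in> vhom (ed (T x N) [p + i, Suc (p + i)]) (L ! i)"
proof -
 note d = subD[OF assms(1)]
 obtain z w where z: "path x N z" "path y L w" using d by blast
 have "p + i < length N" using d(3) assms(2) by simp
 then show "iso C (u y L i)" "u y L i \<in> vhom (ed (T y L) [i, Suc i]) (L ! i)"
  "iso C (u x N (p + i))" "u x N (p + i) \<in> vhom (ed (T x N) [p + i, Suc (p + i)]) (L ! i)"
  using T_simps(4,5)[OF z(1), of "p + i"] T_simps(4,5)[OF z(2) assms(2)] d(4)[OF assms(2)] by simp_all
qed

text \<open>On every edge the isomorphisms of the intermediate realization cancel, and arrows are
  determined on edges.\<close>

lemma J_comp:
 assumes s: "sub x N p y L" "sub y L q z M"
 shows "J x N p y L ** J y L q z M = J x N (p + q) z M"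
proof (rule J_unique[OF sub_trans[OF s]])
 note j = J_simps[OF s(1)] and k = J_simps[OF s(2)] and d = subD[OF s(1)] and e = subD[OF s(2)]
 have mm: "map (app (dl (length N) (sh p (length L)))) (sh q (length M)) = sh (p + q) (length M)"
  by (rule nth_equalityI) (use d(3) e(3) in simp_all)
 show "base (J x N p y L ** J y L q z M) = dl (length N) (sh (p + q) (length M))"
  using j k d e mm by (simp add: dl_comp)
 fix i assume i: "i < length M"
 have M: "dim (T z M) = length M" using e(2) T_simps(2) by auto
 have qi: "q + i < length L" using e(3) i by simp
 note u = u_simps[OF s(1) qi] u_simps[OF s(2) i]
 have "rs (J x N p y L ** J y L q z M) [i, Suc i] = rs (J x N p y L) [q + i, Suc (q + i)] ** rs (J y L q z M) [i, Suc i]"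
  using rs_comp[of "J y L q z M" "J x N p y L" "[i, Suc i]"] j k d e i M by simp
 also have "\<dots> = (inv_arr C (u x N (p + (q + i))) ** u y L (q + i)) ** inv_arr C (u y L (q + i)) ** u z M i"
  using j(6)[OF qi] k(6)[OF i] by simp
 also have "\<dots> = inv_arr C (u x N (p + (q + i))) ** u z M i"
  using u e(4)[OF i] by simp
 finally show "rs (J x N p y L ** J y L q z M) [i, Suc i] = inv_arr C (u x N (p + q + i)) ** u z M i"
  by (simp add: add.assoc)
qed (use J_simps[OF s(1)] J_simps[OF s(2)] in simp_all)

lemma J_full:
 assumes "path x L y"
 shows "J x L 0 x L = Ide C (T x L)"
proof (rule J_unique[OF sub_self[OF assms], symmetric])
 note t = T_simps[OF assms]
 have "sh 0 (length L) = ini (length L)" by (rule nth_equalityI) simp_all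
 then show "base (Ide C (T x L)) = dl (length L) (sh 0 (length L))" using t by (simp add: dl_ini)
 fix i assume "i < length L"
 then show "rs (Ide C (T x L)) [i, Suc i] = inv_arr C (u x L (0 + i)) ** u x L i" using t by simp
qed (use T_simps[OF assms] in simp_all)

lemma T_Nil: "y \<in> Obj C ==> dim y = 0 ==> T y [] = y"
 using T_simps[of y "[]" y] ed_0[of "T y []"] by simp

lemma J_Nil:
 assumes "sub x N p y []"
 shows "J x N p y [] = lf (T x N) [p]"
proof -
 have "y \<in> Obj C" "dim y = 0" using subD(2)[OF assms] by auto
 then show ?thesis using vertex_arr[of "J x N p y []" p] J_simps[OF assms] subD[OF assms] T_Nil by simp
qed

lemma lg_simps:
 assumes "path x L y"
 shows "lg x L \<in> Obj C" "dim (lg x L) = Suc 0" "ed (lg x L) [0] = x" "ed (lg x L) [Suc 0] = y"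
 using T_simps[OF assms] T_vertex[of x L "[]" y y] assms by (simp_all add: lg_def)

lemma cj_simps:
 assumes s: "sub x N p y L"
 shows "iso C (cj x N p y L)" "cj x N p y L \<in> vhom (lg y L) (ed (T x N) [p, p + length L])"
  "inv_arr C (cj x N p y L) \<in> vhom (ed (T x N) [p, p + length L]) (lg y L)" "dim (ed (T x N) [p, p + length L]) = Suc 0"
proof -
 note j = J_simps[OF s] and d = subD[OF s]
 obtain w where w: "path y L w" using d by blast
 have t: "T y L \<in> Obj C" "dim (T y L) = length L" using T_simps[OF w] by auto
 show 1: "iso C (cj x N p y L)" unfolding cj_def by (rule rs_iso) (use j t in simp_all)
 show 2: "cj x N p y L \<in> vhom (lg y L) (ed (T x N) [p, p + length L])"
  using rs_simps[OF j(1), of "[0, length L]"] j t d lg_simps[OF w] by (simp add: cj_def lg_def)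
 show "dim (ed (T x N) [p, p + length L]) = Suc 0" using d by simp
 then show "inv_arr C (cj x N p y L) \<in> vhom (ed (T x N) [p, p + length L]) (lg y L)"
  using iso_base(3)[OF 1] 1 2 lg_simps[OF w] by simp
qed

lemma cj_trans:
 assumes s: "sub x N p y L" "sub y L q z M"
 shows "rs (J x N p y L) [q, q + length M] ** cj y L q z M = cj x N (p + q) z M"
proof -
 have "dim (T z M) = length M" using subD(2)[OF s(2)] T_simps(2) by auto
 then show ?thesis unfolding cj_def J_comp[OF s, symmetric]
  using rs_comp[of "J y L q z M" "J x N p y L" "[0, length M]"] J_simps[OF s(1)] J_simps[OF s(2)] by simp
qed

lemma cj_full: "path x L y ==> cj x L 0 x L = Ide C (lg x L)"
 using T_simps[of x L y] by (simp add: cj_def J_full lg_def)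

definition "tr x N p L N' p' y M a = cj x N' p' y M ** a ** inv_arr C (cj x N p y L)"

lemma tr_vhom:
 assumes s: "sub x N p y L" "sub x N' p' y M" and a: "a \<in> vhom (lg y L) (lg y M)"
 shows "tr x N p L N' p' y M a \<in> vhom (ed (T x N) [p, p + length L]) (ed (T x N') [p', p' + length M])"
proof -
 obtain w where w: "path y L w" using subD(2)[OF s(1)] by blast
 obtain v where v: "path y M v" using subD(2)[OF s(2)] by blast
 show ?thesis unfolding tr_def using a cj_simps[OF s(1)] cj_simps[OF s(2)] lg_simps[OF w] lg_simps[OF v] by simp
qed

lemma tr_Ide: "sub x N p y L ==> tr x N p L N p y L (Ide C (lg y L)) = Ide C (ed (T x N) [p, p + length L])"
 using cj_simps[of x N p y L] by (simp add: tr_def)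

lemma tr_comp:
 assumes s: "sub x N p y L" "sub x N' p' y M" "sub x N'' p'' y M'" and a: "a \<in> vhom (lg y L) (lg y M)" "b \<in> vhom (lg y M) (lg y M')"
 shows "tr x N p L N'' p'' y M' (b ** a) = tr x N' p' M N'' p'' y M' b ** tr x N p L N' p' y M a"
 using a cj_simps[OF s(1)] cj_simps[OF s(2)] cj_simps[OF s(3)] by (simp add: tr_def)

lemma tr_full: "path x L y ==> path x M y ==> a \<in> vhom (lg x L) (lg x M) ==> tr x L 0 L M 0 x M a = a"
 using lg_simps[of x L y] lg_simps[of x M y] by (simp add: tr_def cj_full)

lemma cj_Nil: "sub x N p y [] ==> cj x N p y [] = rs (lf (T x N) [p]) [0, 0]"
 by (simp add: cj_def J_Nil)

lemma tr_Nil: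
 assumes "sub x N p y []" "sub x N' p' y []"
 shows "tr x N p [] N' p' y [] (Ide C (lg y [])) = degen (T x N) p (T x N') p'"
 using cj_simps[OF assms(1)] by (simp add: tr_def degen_def flip: cj_Nil[OF assms(1)] cj_Nil[OF assms(2)])

text \<open>Since the comparisons of long edges compose, conjugating in stages through intermediate
  realizations gives the same arrow.\<close>

lemma tr_trans:
 assumes s: "sub x N p y L" "sub y L q z M" and s': "sub x N' p' y L'" "sub y L' q' z M'" and a: "a \<in> vhom (lg z M) (lg z M')"
 shows "rs (J x N' p' y L') [q', q' + length M'] ** tr y L q M L' q' z M' a ** inv_arr C (rs (J x N p y L) [q, q + length M]) =
  tr x N (p + q) M N' (p' + q') z M' a"
proof -
 let ?j = "rs (J x N p y L) [q, q + length M]" and ?k = "rs (J x N' p' y L') [q', q' + length M']"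
 have j: "iso C ?j" "Dom C ?j = ed (T y L) [q, q + length M]" "?k \<in> Arr C" "Dom C ?k = ed (T y L') [q', q' + length M']"
  using rs_iso[OF J_simps(5)[OF s(1)], of "[q, q + length M]"] rs_simps[OF J_simps(1)[OF s(1)], of "[q, q + length M]"]
   rs_simps[OF J_simps(1)[OF s'(1)], of "[q', q' + length M']"] J_simps(2)[OF s(1)] J_simps(2)[OF s'(1)] subD[OF s(2)] subD[OF s'(2)] by simp_all
 have "inv_arr C (cj x N (p + q) z M) = inv_arr C (cj y L q z M) ** inv_arr C ?j"
  unfolding cj_trans[OF s, symmetric] by (rule inv_arr_comp) (use j cj_simps[OF s(2)] in simp_all)
 then show ?thesis unfolding tr_def cj_trans[OF s', symmetric]
  using j a cj_simps[OF s(2)] cj_simps[OF s'(2)] by simp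
qed

text \<open>The two arrows are moved to adjacent edges of the realizations of the concatenated
  paths, where \<open>star\<close> can compose them.\<close>

definition "hc x L y L' M M' a b = star (T x (L @ L')) 0 (length L) (length L + length L') (T x (M @ M')) 0 (length M) (length M + length M')
 (tr x (L @ L') 0 L (M @ M') 0 x M a) (tr x (L @ L') (length L) L' (M @ M') (length M) y M' b)"

lemma sub_app: "path x L y ==> path y L' z ==> sub x (L @ L') 0 x L \<and> sub x (L @ L') (length L) y L'"
 using subI[of x "[]" x L y L' z] subI[of x L y L' z "[]" z] path_source[of x L y] path_target[of y L' z] by simp

text \<open>Independence of the ambient realization: composing in the realization of the two paths
  and then moving to a longer one agrees with composing there directly. This reduces associativity
  to a single ambient object.\<close>

lemma hc_tr:
 assumes p: "path x L y" "path x M y" "path y L' z" "path y M' z" and a: "a \<in> vhom (lg x L) (lg x M)" "b \<in> vhom (lg y L') (lg y M')"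
  and s: "sub w N p x (L @ L')" "sub w N' p' x (M @ M')"
 shows "tr w N p (L @ L') N' p' x (M @ M') (hc x L y L' M M' a b) =
   star (T w N) p (p + length L) (p + length L + length L') (T w N') p' (p' + length M) (p' + length M + length M')
    (tr w N p L N' p' x M a) (tr w N (p + length L) L' N' (p' + length M) y M' b)"
proof -
 note sl = conjunct1[OF sub_app[OF p(1,3)]] conjunct2[OF sub_app[OF p(1,3)]]
  and sm = conjunct1[OF sub_app[OF p(2,4)]] conjunct2[OF sub_app[OF p(2,4)]]
 note j = J_simps[OF s(1)] and k = J_simps[OF s(2)]
 note d = subD[OF sl(1)] and e = subD[OF sm(1)]
 note ta = tr_vhom[OF sl(1) sm(1) a(1)] and tb = tr_vhom[OF sl(2) sm(2) a(2)]
 note st = star_transport[OF j(1,2,3,5) k(1,2,3), of 0 "length L" "length L + length L'" 0 "length M" "length M + length M'",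
   OF _ _ _ _ _ _ ta[unfolded add_0] tb]
 have "rs (J w N' p' x (M @ M')) [0, length M + length M'] ** hc x L y L' M M' a b ** inv_arr C (rs (J w N p x (L @ L')) [0, length L + length L']) =
  star (T w N) p (p + length L) (p + (length L + length L')) (T w N') p' (p' + length M) (p' + (length M + length M'))
    (tr w N p L N' p' x M a) (tr w N (p + length L) L' N' (p' + length M) y M' b)"
  unfolding hc_def using st d e j(7) k(7) tr_trans[OF s(1) sl(1) s(2) sm(1) a(1)] tr_trans[OF s(1) sl(2) s(2) sm(2) a(2)]
  by simp
 then show ?thesis by (simp add: tr_def cj_def add.assoc)
qed

lemma hc_vhom:
 assumes p: "path x L y" "path x M y" "path y L' z" "path y M' z" and a: "a \<in> vhom (lg x L) (lg x M)" "b \<in> vhom (lg y L') (lg y M')"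
 shows "hc x L y L' M M' a b \<in> vhom (lg x (L @ L')) (lg x (M @ M'))"
proof -
 note sl = conjunct1[OF sub_app[OF p(1,3)]] conjunct2[OF sub_app[OF p(1,3)]]
  and sm = conjunct1[OF sub_app[OF p(2,4)]] conjunct2[OF sub_app[OF p(2,4)]]
 note d = subD[OF sl(1)] and e = subD[OF sm(1)]
 show ?thesis unfolding hc_def lg_def length_append
  by (rule star_arrow(1)) (use d e tr_vhom[OF sl(1) sm(1) a(1)] tr_vhom[OF sl(2) sm(2) a(2)] in simp_all)
qed

lemma hc_Ide:
 assumes p: "path x L y" "path y L' z"
 shows "hc x L y L' L L' (Ide C (lg x L)) (Ide C (lg y L')) = Ide C (lg x (L @ L'))"
proof -
 note sl = conjunct1[OF sub_app[OF p]] conjunct2[OF sub_app[OF p]]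
 show ?thesis using star_Ide[of "T x (L @ L')" 0 "length L" "length L + length L'"] subD[OF sl(1)]
   tr_Ide[OF sl(1)] tr_Ide[OF sl(2)] by (simp add: hc_def lg_def)
qed

lemma hc_comp:
 assumes p: "path x L y" "path x M y" "path x N y" "path y L' z" "path y M' z" "path y N' z"
  and a: "a \<in> vhom (lg x L) (lg x M)" "b \<in> vhom (lg y L') (lg y M')" "a' \<in> vhom (lg x M) (lg x N)" "b' \<in> vhom (lg y M') (lg y N')"
 shows "hc x L y L' N N' (a' ** a) (b' ** b) = hc x M y M' N N' a' b' ** hc x L y L' M M' a b"
proof -
 note sl = conjunct1[OF sub_app[OF p(1,4)]] conjunct2[OF sub_app[OF p(1,4)]]
  and sm = conjunct1[OF sub_app[OF p(2,5)]] conjunct2[OF sub_app[OF p(2,5)]]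
  and sn = conjunct1[OF sub_app[OF p(3,6)]] conjunct2[OF sub_app[OF p(3,6)]]
 show ?thesis unfolding hc_def tr_comp[OF sl(1) sm(1) sn(1) a(1,3)] tr_comp[OF sl(2) sm(2) sn(2) a(2,4)]
  by (rule star_comp) (use subD[OF sl(1)] subD[OF sm(1)] subD[OF sn(1)] tr_vhom[OF sl(1) sm(1) a(1)] tr_vhom[OF sl(2) sm(2) a(2)]
   tr_vhom[OF sm(1) sn(1) a(3)] tr_vhom[OF sm(2) sn(2) a(4)] in simp_all)
qed

text \<open>For the empty path the transported identity is the comparison of degenerate edges, which
  is neutral for \<open>star\<close>.\<close>

lemma hc_unit:
 assumes p: "path x L y" "path x M y" and a: "a \<in> vhom (lg x L) (lg x M)"
 shows "hc x L y [] M [] a (Ide C (lg y [])) = a" "hc x [] x L [] M (Ide C (lg x [])) a = a"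
proof -
 have e: "path x [] x" "path y [] y" using path_source[OF p(1)] path_target[OF p(1)] by simp_all
 note s = sub_app[OF p(1) e(2)] sub_app[OF p(2) e(2)] sub_app[OF e(1) p(1)] sub_app[OF e(1) p(2)]
 note t = T_simps[OF p(1)] T_simps[OF p(2)]
 have aa: "a \<in> vhom (ed (T x L) [0, length L]) (ed (T x M) [0, length M])" using a by (simp add: lg_def)
 show "hc x L y [] M [] a (Ide C (lg y [])) = a"
  using s star_degen(2)[OF t(1,6) _ _ _ _ aa] t by (simp add: hc_def tr_full[OF p a] tr_Nil)
 show "hc x [] x L [] M (Ide C (lg x [])) a = a"
  using s star_degen(1)[OF t(1,6) _ _ _ _ aa] t by (simp add: hc_def tr_full[OF p a] tr_Nil)
qed

text \<open>By \<open>hc_tr\<close> both sides are computed in the realizations of the threefold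
  concatenations, where \<open>star_assoc\<close> applies.\<close>

lemma hc_assoc:
 assumes p: "path x L y" "path x M y" "path y L' z" "path y M' z" "path z L'' w" "path z M'' w"
  and a: "a \<in> vhom (lg x L) (lg x M)" "b \<in> vhom (lg y L') (lg y M')" "c \<in> vhom (lg z L'') (lg z M'')"
 shows "hc x (L @ L') z L'' (M @ M') M'' (hc x L y L' M M' a b) c = hc x L y (L' @ L'') M (M' @ M'') a (hc y L' z L'' M' M'' b c)"
proof -
 have e: "path x [] x" "path w [] w" using path_source[OF p(1)] path_target[OF p(5)] by simp_all
 let ?N = "L @ L' @ L''" and ?N' = "M @ M' @ M''"
 have pl: "path x (L @ L') z" "path y (L' @ L'') w" "path x (M @ M') z" "path y (M' @ M'') w" using p by (auto simp: path_append)
 have s: "sub x ?N 0 x L" "sub x ?N (length L) y L'" "sub x ?N (length L + length L') z L''"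
   "sub x ?N 0 x (L @ L')" "sub x ?N (length L) y (L' @ L'')"
  using subI[OF e(1) p(1) pl(2)] subI[OF p(1,3,5)] subI[OF pl(1) p(5) e(2)] subI[OF e(1) pl(1) p(5)] subI[OF p(1) pl(2) e(2)] by simp_all
 have s': "sub x ?N' 0 x M" "sub x ?N' (length M) y M'" "sub x ?N' (length M + length M') z M''"
   "sub x ?N' 0 x (M @ M')" "sub x ?N' (length M) y (M' @ M'')"
  using subI[OF e(1) p(2) pl(4)] subI[OF p(2,4,6)] subI[OF pl(3) p(6) e(2)] subI[OF e(1) pl(3) p(6)] subI[OF p(2) pl(4) e(2)] by simp_all
 note A = tr_vhom[OF s(1) s'(1) a(1)] tr_vhom[OF s(2) s'(2) a(2)] tr_vhom[OF s(3) s'(3) a(3)]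
 have "star (T x ?N) 0 (length L + length L') (length L + length L' + length L'') (T x ?N') 0 (length M + length M') (length M + length M' + length M'')
   (star (T x ?N) 0 (length L) (length L + length L') (T x ?N') 0 (length M) (length M + length M')
    (tr x ?N 0 L ?N' 0 x M a) (tr x ?N (length L) L' ?N' (length M) y M' b)) (tr x ?N (length L + length L') L'' ?N' (length M + length M') z M'' c) =
  star (T x ?N) 0 (length L) (length L + length L' + length L'') (T x ?N') 0 (length M) (length M + length M' + length M'')
   (tr x ?N 0 L ?N' 0 x M a) (star (T x ?N) (length L) (length L + length L') (length L + length L' + length L'')
     (T x ?N') (length M) (length M + length M') (length M + length M' + length M'')
     (tr x ?N (length L) L' ?N' (length M) y M' b) (tr x ?N (length L + length L') L'' ?N' (length M + length M') z M'' c))"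
  by (rule star_assoc) (use subD[OF s(1)] subD[OF s'(1)] A in simp_all)
 then show ?thesis
  using hc_tr[OF p(1-4) a(1,2) s(4) s'(4)] hc_tr[OF p(3-6) a(2,3) s(5) s'(5)]
  by (simp add: hc_def add.assoc)
qed

end

section \<open>The strict 2-category of paths\<close>

context segal begin

text \<open>Source and target paths are stored with the arrow because different paths may have the
  same long edge.\<close>

definition "RH x y = \<lparr>Obj = {L. path x L y}, Arr = {(L, a, M). path x L y \<and> path x M y \<and> a \<in> vhom (lg x L) (lg x M)},
 Dom = (\<lambda>(L, a, M). L), Cod = (\<lambda>(L, a, M). M), Ide = (\<lambda>L. (L, Ide C (lg x L), L)),
 Comp = (\<lambda>(M', b, N) (L, a, M). (L, b ** a, N))\<rparr>"

text \<open>Paths are written in the order of traversal, so \<open>g\<close> after \<open>f\<close>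
  is \<open>f @ g\<close>.\<close>

definition "RR = \<lparr>Obj2 = {x \<in> Obj C. dim x = 0}, Hom2 = RH, Ide2 = (\<lambda>x. []),
 Comp2 = (\<lambda>x y z. \<lparr>FObj = (\<lambda>(g, f) \<in> Obj (RH y z) \<times> Obj (RH x y). f @ g),
  FArr = (\<lambda>((L', b, M'), (L, a, M)) \<in> Arr (RH y z) \<times> Arr (RH x y). (L @ L', hc x L y L' M M' a b, M @ M'))\<rparr>)\<rparr>"

lemma RR_simps [simp]: "x \<in> Obj2 RR \<longleftrightarrow> x \<in> Obj C \<and> dim x = 0" "Ide2 RR x = []"
 "L \<in> Obj (Hom2 RR x y) \<longleftrightarrow> path x L y"
 "(L, a, M) \<in> Arr (Hom2 RR x y) \<longleftrightarrow> path x L y \<and> path x M y \<and> a \<in> vhom (lg x L) (lg x M)"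
 "Dom (Hom2 RR x y) (L, a, M) = L" "Cod (Hom2 RR x y) (L, a, M) = M" "Ide (Hom2 RR x y) L = (L, Ide C (lg x L), L)"
 "(M', b, N) \<cdot>[Hom2 RR x y] (L, a, M) = (L, b ** a, N)"
 "path y g z ==> path x f y ==> hcomp1 RR x y z g f = f @ g"
 "path x L y ==> path x M y ==> path y L' z ==> path y M' z ==> a \<in> vhom (lg x L) (lg x M) ==> b \<in> vhom (lg y L') (lg y M') ==>
  hcomp2 RR x y z (L', b, M') (L, a, M) = (L @ L', hc x L y L' M M' a b, M @ M')"
 by (simp_all add: RR_def RH_def)

lemma RR_arr: "f \<in> Arr (Hom2 RR x y) \<longleftrightarrow>
  (\<exists>L a M. f = (L, a, M) \<and> path x L y \<and> path x M y \<and> a \<in> vhom (lg x L) (lg x M))"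
 by (auto simp: RR_def RH_def)

lemma RR_hom_category [simp]: "category (Hom2 RR x y)"
proof (rule categoryI)
 fix f g assume "f \<in> Arr (Hom2 RR x y)" "g \<in> Arr (Hom2 RR x y)" "Dom (Hom2 RR x y) g = Cod (Hom2 RR x y) f"
 then obtain L a M b N where "f = (L, a, M)" "g = (M, b, N)" "path x L y" "path x M y" "path x N y"
   "a \<in> vhom (lg x L) (lg x M)" "b \<in> vhom (lg x M) (lg x N)" by (auto simp: RR_arr)
 then show "g \<cdot>[Hom2 RR x y] f \<in> Arr (Hom2 RR x y) \<and> Dom (Hom2 RR x y) (g \<cdot>[Hom2 RR x y] f) = Dom (Hom2 RR x y) f \<and>
   Cod (Hom2 RR x y) (g \<cdot>[Hom2 RR x y] f) = Cod (Hom2 RR x y) g"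
  using lg_simps[of x L y] lg_simps[of x M y] by simp
qed (auto simp: RR_arr lg_simps)

lemma RR_strict: "strict_2_category RR"
proof (rule strict_2_category.intro)
 fix w x y z :: 'o
 show "category (Hom2 RR x y)" by (rule RR_hom_category)
 assume x: "x \<in> Obj2 RR" and y: "y \<in> Obj2 RR"
 show "Ide2 RR x \<in> Obj (Hom2 RR x x)" using x by simp
 show "hcomp1 RR x y y (Ide2 RR y) f = f" "hcomp1 RR x x y f (Ide2 RR x) = f" if "f \<in> Obj (Hom2 RR x y)" for f
  using x y that by simp_all
 show "hcomp2 RR x y y (Ide (Hom2 RR y y) (Ide2 RR y)) a = a" "hcomp2 RR x x y a (Ide (Hom2 RR x x) (Ide2 RR x)) = a"
  if t: "a \<in> Arr (Hom2 RR x y)" for a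
 proof -
  obtain L b M where a: "a = (L, b, M)" "path x L y" "path x M y" "b \<in> vhom (lg x L) (lg x M)" using t unfolding RR_arr by blast
  have e: "path x [] x" "path y [] y" using x y by simp_all
  have i: "Ide C (lg x []) \<in> vhom (lg x []) (lg x [])" "Ide C (lg y []) \<in> vhom (lg y []) (lg y [])"
   using lg_simps[OF e(1)] lg_simps[OF e(2)] by simp_all
  show "hcomp2 RR x y y (Ide (Hom2 RR y y) (Ide2 RR y)) a = a"
   unfolding a(1) RR_simps(2,7) RR_simps(10)[OF a(2,3) e(2) e(2) a(4) i(2)] hc_unit(1)[OF a(2-4)] by simp
  show "hcomp2 RR x x y a (Ide (Hom2 RR x x) (Ide2 RR x)) = a"
   unfolding a(1) RR_simps(2,7) RR_simps(10)[OF e(1) e(1) a(2,3) i(1) a(4)] hc_unit(2)[OF a(2-4)] by simp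
 qed
 assume z: "z \<in> Obj2 RR"
 show "cat_functor (prod_cat (Hom2 RR y z) (Hom2 RR x y)) (Hom2 RR x z) (Comp2 RR x y z)" (is "cat_functor ?P ?H ?F")
 proof (rule cat_functorI)
  show "category ?P" "category ?H" by (simp_all add: RR_hom_category)
  show "FObj ?F \<in> Obj ?P \<rightarrow>\<^sub>E Obj ?H" by (auto simp: RR_def RH_def path_append)
  show "FArr ?F \<in> extensional (Arr ?P)" by (simp add: RR_def)
 next
  fix f assume "f \<in> Arr ?P"
  then obtain L' b M' L a M where f: "f = ((L', b, M'), (L, a, M))" "path x L y" "path x M y" "path y L' z" "path y M' z"
   "a \<in> vhom (lg x L) (lg x M)" "b \<in> vhom (lg y L') (lg y M')" by (auto simp: RR_arr)
  have "path x (L @ L') z" "path x (M @ M') z" using f by (auto simp: path_append)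
  then show "FArr ?F f \<in> Arr ?H \<and> Dom ?H (FArr ?F f) = FObj ?F (Dom ?P f) \<and> Cod ?H (FArr ?F f) = FObj ?F (Cod ?P f)"
   unfolding f(1) RR_simps(10)[OF f(2-)] RR_simps prod_cat_simps RR_simps(9)[OF f(4,2)] RR_simps(9)[OF f(5,3)]
   using hc_vhom[OF f(2-)] by blast
 next
  fix v assume "v \<in> Obj ?P"
  then obtain L' L where v: "v = (L', L)" "path x L y" "path y L' z" by auto
  have i: "Ide C (lg x L) \<in> vhom (lg x L) (lg x L)" "Ide C (lg y L') \<in> vhom (lg y L') (lg y L')"
   using lg_simps[OF v(2)] lg_simps[OF v(3)] by simp_all
  show "FArr ?F (Ide ?P v) = Ide ?H (FObj ?F v)"
   unfolding v(1) prod_cat_simps RR_simps(7) RR_simps(9)[OF v(3,2)] RR_simps(10)[OF v(2,2,3,3) i] hc_Ide[OF v(2,3)] ..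
 next
  fix f g assume "f \<in> Arr ?P" "g \<in> Arr ?P" and "Dom ?P g = Cod ?P f"
  then obtain L' b M' L a M N' b' N a' where f: "f = ((L', b, M'), (L, a, M))" "g = ((M', b', N'), (M, a', N))"
   and p: "path x L y" "path x M y" "path x N y" "path y L' z" "path y M' z" "path y N' z"
   and a: "a \<in> vhom (lg x L) (lg x M)" "b \<in> vhom (lg y L') (lg y M')" "a' \<in> vhom (lg x M) (lg x N)" "b' \<in> vhom (lg y M') (lg y N')"
   by (auto simp: RR_arr)
  have c: "a' ** a \<in> vhom (lg x L) (lg x N)" "b' ** b \<in> vhom (lg y L') (lg y N')"
   using a lg_simps[OF p(1)] lg_simps[OF p(2)] lg_simps[OF p(4)] lg_simps[OF p(5)] by simp_all
  show "FArr ?F (g \<cdot>[?P] f) = FArr ?F g \<cdot>[?H] FArr ?F f"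
   unfolding f prod_cat_simps RR_simps(8) RR_simps(10)[OF p(1,2,4,5) a(1,2)] RR_simps(10)[OF p(2,3,5,6) a(3,4)]
    RR_simps(10)[OF p(1,3,4,6) c] hc_comp[OF p a] ..
 qed
 assume w: "w \<in> Obj2 RR"
 show "hcomp1 RR w y z h (hcomp1 RR w x y g f) = hcomp1 RR w x z (hcomp1 RR x y z h g) f"
  if "f \<in> Obj (Hom2 RR w x)" "g \<in> Obj (Hom2 RR x y)" "h \<in> Obj (Hom2 RR y z)" for f g h
 proof -
  have "path w (f @ g) y" "path x (g @ h) z" using that by (auto simp: path_append)
  then show ?thesis using that by simp
 qed
 show "hcomp2 RR w y z c (hcomp2 RR w x y b a) = hcomp2 RR w x z (hcomp2 RR x y z c b) a"
  if abc: "a \<in> Arr (Hom2 RR w x)" "b \<in> Arr (Hom2 RR x y)" "c \<in> Arr (Hom2 RR y z)" for a b c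
 proof -
  obtain L a' M where a: "a = (L, a', M)" "path w L x" "path w M x" "a' \<in> vhom (lg w L) (lg w M)" using abc(1) by (auto simp: RR_arr)
  obtain L' b' M' where b: "b = (L', b', M')" "path x L' y" "path x M' y" "b' \<in> vhom (lg x L') (lg x M')" using abc(2) by (auto simp: RR_arr)
  obtain L'' c' M'' where c: "c = (L'', c', M'')" "path y L'' z" "path y M'' z" "c' \<in> vhom (lg y L'') (lg y M'')" using abc(3) by (auto simp: RR_arr)
  have p: "path w (L @ L') y" "path w (M @ M') y" "path x (L' @ L'') z" "path x (M' @ M'') z" using a b c by (auto simp: path_append)
  note h = hc_vhom[OF a(2,3) b(2,3) a(4) b(4)] hc_vhom[OF b(2,3) c(2,3) b(4) c(4)]
  show ?thesis
   unfolding a(1) b(1) c(1) RR_simps(10)[OF a(2,3) b(2,3) a(4) b(4)] RR_simps(10)[OF b(2,3) c(2,3) b(4) c(4)]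
    RR_simps(10)[OF p(1,2) c(2,3) h(1) c(4)] RR_simps(10)[OF a(2,3) p(3,4) a(4) h(2)]
   using hc_assoc[OF a(2,3) b(2,3) c(2,3) a(4) b(4) c(4)] by simp
 qed
qed

lemma RR_iso:
 assumes "path x L y" "path x M y" "a \<in> vhom (lg x L) (lg x M)" "iso C a"
 shows "iso (Hom2 RR x y) (L, a, M)"
proof (rule isoI[of _ _ "(M, inv_arr C a, L)"])
 have "base (inv_arr C a) = Ide Delta (Suc 0)" using iso_base(3)[OF assms(4)] assms lg_simps[OF assms(1)] by simp
 then show "(M, inv_arr C a, L) \<in> Arr (Hom2 RR x y)" using assms lg_simps[OF assms(2)] by simp
qed (use assms in simp_all)

end

section \<open>Charts of a Segal-style 2-category\<close>

context segal begin

text \<open>A repeated vertex contributes a degenerate edge rather than nothing, so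
  \<open>[i]\<close> and \<open>[i, i]\<close> give different paths; the comparison between them
  will be the unit cell.\<close>

fun es :: "'o => nat list => 'o list" where
 "es c (i # j # qs) = ed c [i, j] # es c (j # qs)"
| "es c [i] = []"
| "es c [] = []"

lemma es_length [simp]: "length (es c qs) = length qs - Suc 0"
 by (induction c qs rule: es.induct) auto

lemma es_nth: "Suc k < length qs ==> es c qs ! k = ed c [qs ! k, qs ! Suc k]"
proof (induction c qs arbitrary: k rule: es.induct)
 case (1 c i j qs)
 then show ?case by (cases k) simp_all
qed simp_all

text \<open>\<open>tl\<close> drops the shared vertex, so that gluing vertex lists corresponds to
  concatenating paths.\<close>

lemma es_append: "qs \<noteq> [] ==> ks \<noteq> [] ==> last qs = hd ks ==> es c (qs @ tl ks) = es c qs @ es c ks"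
proof (induction c qs rule: es.induct)
 case (2 c i)
 then show ?case by (cases ks) auto
qed simp_all

lemma es_path: "c \<in> Obj C ==> valid (dim c) qs ==> path (ed c [hd qs]) (es c qs) (ed c [last qs])"
 by (induction c qs rule: es.induct) auto

text \<open>\<open>H c qs\<close> maps the realization of the path \<open>es c qs\<close> of edges of \<open>c\<close> back to \<open>c\<close>; on long edges this is the
 isomorphism \<open>q c qs\<close>. An arrow \<open>h\<close> of \<open>C\<close> thus acts between long edges by \<open>A h qs ks\<close>; the cases with \<open>h\<close> an
 identity are the structure isomorphisms of the simplex \<open>ES c\<close>, and all coherence laws are instances of
 the compatibility of \<open>A\<close> with vertical and horizontal composition.\<close>

definition "H c qs = amb (ed c [hd qs]) (es c qs) c qs (\<lambda>k. Ide C (es c qs ! k))"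

definition "q c qs = rs (H c qs) [0, length qs - 1]"

lemma H_simps:
 assumes c: "c \<in> Obj C" "valid (dim c) qs"
 shows "H c qs \<in> Arr C" "Dom C (H c qs) = T (ed c [hd qs]) (es c qs)" "Cod C (H c qs) = c" "base (H c qs) = dl (dim c) qs"
  "Suc k < length qs ==> rs (H c qs) [k, Suc k] = u (ed c [hd qs]) (es c qs) k"
  "cartesian C Delta \<pi> (H c qs)" "k < length qs ==> app (base (H c qs)) k = qs ! k"
  "dim (T (ed c [hd qs]) (es c qs)) = length qs - Suc 0" "T (ed c [hd qs]) (es c qs) \<in> Obj C"
proof -
 note p = es_path[OF c]
 have l: "length qs = Suc (length (es c qs))" using c by simp
 have x: "ed c [qs ! 0] = ed c [hd qs]" using c by (simp add: hd_conv_nth)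
 have w: "Ide C (es c qs ! i) \<in> vhom (es c qs ! i) (ed c [qs ! i, qs ! Suc i])" if "i < length (es c qs)" for i
  using path_edge[OF p that] es_nth[of i qs c] that by simp
 note a = amb_simps[OF p c l x w, folded H_def]
 show *: "H c qs \<in> Arr C" "Dom C (H c qs) = T (ed c [hd qs]) (es c qs)" "Cod C (H c qs) = c" "base (H c qs) = dl (dim c) qs"
  using a(1-4) by simp_all
 show "cartesian C Delta \<pi> (H c qs)"
 proof (rule a(6))
  fix i assume "i < length (es c qs)"
  then show "iso C (Ide C (es c qs ! i))" by (intro iso_Ide path_edge(1)[OF p]) simp_all
 qed
 show "Suc k < length qs ==> rs (H c qs) [k, Suc k] = u (ed c [hd qs]) (es c qs) k"
  using a(5)[of k] T_simps(4,5)[OF p, of k] T_simps(1,2)[OF p] path_edge[OF p, of k] by simp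
 show "k < length qs ==> app (base (H c qs)) k = qs ! k" using * by simp
 show "dim (T (ed c [hd qs]) (es c qs)) = length qs - Suc 0" "T (ed c [hd qs]) (es c qs) \<in> Obj C" using T_simps(1,2)[OF p] by simp_all
qed

lemma q_simps:
 assumes c: "c \<in> Obj C" "valid (dim c) qs"
 shows "iso C (q c qs)" "q c qs \<in> vhom (lg (ed c [hd qs]) (es c qs)) (ed c [hd qs, last qs])"
  "inv_arr C (q c qs) \<in> vhom (ed c [hd qs, last qs]) (lg (ed c [hd qs]) (es c qs))" "dim (ed c [hd qs, last qs]) = Suc 0"
  "dim (lg (ed c [hd qs]) (es c qs)) = Suc 0" "hd qs \<le> last qs" "last qs \<le> dim c"
proof -
 note h = H_simps[OF c]
 note l = lg_simps[OF es_path[OF c]]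
 have e: "qs ! 0 = hd qs" "qs ! (length qs - Suc 0) = last qs" using c by (simp_all add: hd_conv_nth last_conv_nth)
 show o: "hd qs \<le> last qs" "last qs \<le> dim c"
  using sorted_nth_mono[of qs 0 "length qs - Suc 0"] c by (simp_all add: flip: e)
 have v0: "valid (dim (Dom C (H c qs))) [0, length qs - Suc 0]" unfolding h(2,8) by simp
 have m: "map (app (base (H c qs))) [0, length qs - Suc 0] = [hd qs, last qs]"
  using h(7)[of 0] h(7)[of "length qs - Suc 0"] c(2) e by simp
 show i: "iso C (q c qs)" unfolding q_def by (rule rs_iso) (use h in simp_all)
 show v: "q c qs \<in> vhom (lg (ed c [hd qs]) (es c qs)) (ed c [hd qs, last qs])"
  using rs_simps(1-4)[OF h(1) v0, unfolded h(2,3) m] l(2) by (simp add: lg_def q_def)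
 show d: "dim (ed c [hd qs, last qs]) = Suc 0" using o c by simp
 show "dim (lg (ed c [hd qs]) (es c qs)) = Suc 0" by (rule l(2))
 show "inv_arr C (q c qs) \<in> vhom (ed c [hd qs, last qs]) (lg (ed c [hd qs]) (es c qs))"
  using i v d l iso_base(3)[OF i] by simp
qed

text \<open>Both arrows out of the realization of \<open>es c ks\<close> have the same restrictions
  to consecutive edges, since the isomorphisms \<open>u\<close> of the longer path cancel.\<close>

lemma H_J:
 assumes c: "c \<in> Obj C" "valid (dim c) qs" "valid (dim c) ks"
  and s: "sub (ed c [hd qs]) (es c qs) p (ed c [hd ks]) (es c ks)" and n: "\<And>k. k < length ks ==> ks ! k = qs ! (p + k)"
 shows "H c qs ** J (ed c [hd qs]) (es c qs) p (ed c [hd ks]) (es c ks) = H c ks" (is "_ ** ?J = _")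
  and "rs (H c qs) [p, p + (length ks - Suc 0)] ** cj (ed c [hd qs]) (es c qs) p (ed c [hd ks]) (es c ks) = q c ks"
proof -
 note h = H_simps[OF c(1,2)] and h' = H_simps[OF c(1,3)] and j = J_simps[OF s] and d = subD[OF s]
 have l: "0 < length qs" "0 < length ks" using c by simp_all
 have pl: "p + length ks \<le> length qs" using d(3) l unfolding es_length by arith
 have m: "map (app (dl (dim c) qs)) (sh p (length ks - Suc 0)) = ks"
  by (rule nth_equalityI) (use l pl n in simp_all)
 show *: "H c qs ** ?J = H c ks"
 proof (rule arrow_unique)
  have "p + (length ks - Suc 0) \<le> length qs - Suc 0" using pl l by linarith
  then have v: "valid (length qs - Suc 0) (sh p (length ks - Suc 0))" by simp
  have "base (H c qs ** ?J) = base (H c qs) \<cdot>[Delta] base ?J" using h(1,2) j(1,3) by simp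
  also have "\<dots> = dl (dim c) (map (app (dl (dim c) qs)) (sh p (length ks - Suc 0)))"
   unfolding h(4) j(4) es_length by (subst dl_comp) (use c v in simp_all)
  finally show "base (H c qs ** ?J) = base (H c ks)" unfolding m h'(4) .
  fix k assume "k < dim (Dom C (H c qs ** ?J))"
  then have k: "Suc k < length ks" using h j h' by simp
  have pk: "Suc (p + k) < length qs" "k < length (es c ks)" using pl k by simp_all
  have "rs (H c qs ** ?J) [k, Suc k] = rs (H c qs) [p + k, Suc (p + k)] ** rs ?J [k, Suc k]"
  proof -
   have v2: "valid (dim (Dom C ?J)) [k, Suc k]" unfolding j(2) h'(8) using k by (simp, linarith)
   have d: "Dom C (H c qs) = Cod C ?J" unfolding h(2) j(3) ..
   have "map (app (base ?J)) [k, Suc k] = [p + k, Suc (p + k)]" using j(7)[of k] j(7)[of "Suc k"] k by simp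
   then show ?thesis using rs_comp[OF j(1) h(1) d v2] by simp
  qed
  also have "\<dots> = u (ed c [hd qs]) (es c qs) (p + k) ** inv_arr C (u (ed c [hd qs]) (es c qs) (p + k)) ** u (ed c [hd ks]) (es c ks) k"
   using h(5)[OF pk(1)] j(6)[OF pk(2)] by simp
  also have "\<dots> = u (ed c [hd ks]) (es c ks) k" using u_simps[OF s pk(2)] by simp
  finally show "rs (H c qs ** ?J) [k, Suc k] = rs (H c ks) [k, Suc k]" using h'(5)[OF k] by simp
 qed (use h(1-3) h'(1-3) j(1-3) in simp_all)
 have v3: "valid (dim (Dom C ?J)) [0, length ks - Suc 0]" unfolding j(2) h'(8) by simp
 have d: "Dom C (H c qs) = Cod C ?J" unfolding h(2) j(3) ..
 have "map (app (base ?J)) [0, length ks - Suc 0] = [p, p + (length ks - Suc 0)]"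
  using j(7)[of 0] j(7)[of "length ks - Suc 0"] by simp
 then show "rs (H c qs) [p, p + (length ks - Suc 0)] ** cj (ed c [hd qs]) (es c qs) p (ed c [hd ks]) (es c ks) = q c ks"
  unfolding q_def *[symmetric] cj_def using rs_comp[OF j(1) h(1) d v3] by simp
qed

definition "A h qs ks = inv_arr C (q (Cod C h) ks) ** rs h [hd qs, last qs] ** q (Dom C h) qs"

text \<open>Only the end vertices have to correspond under \<open>h\<close>; the lists may differ in
  length and in intermediate vertices. This freedom lets one definition produce the action on edges
  as well as the unit and composition cells.\<close>

definition "adm h qs ks \<longleftrightarrow> h \<in> Arr C \<and> valid (dim (Dom C h)) qs \<and> valid (dim (Cod C h)) ks \<and>
 app (base h) (hd qs) = hd ks \<and> app (base h) (last qs) = last ks"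

lemma adm_simps:
 assumes "adm h qs ks"
 shows "h \<in> Arr C" "Dom C h \<in> Obj C" "Cod C h \<in> Obj C" "valid (dim (Dom C h)) qs" "valid (dim (Cod C h)) ks"
  "ed (Cod C h) [hd ks] = ed (Dom C h) [hd qs]" "ed (Cod C h) [last ks] = ed (Dom C h) [last qs]"
  "rs h [hd qs, last qs] \<in> vhom (ed (Dom C h) [hd qs, last qs]) (ed (Cod C h) [hd ks, last ks])"
  "path (ed (Dom C h) [hd qs]) (es (Dom C h) qs) (ed (Dom C h) [last qs])"
  "path (ed (Dom C h) [hd qs]) (es (Cod C h) ks) (ed (Dom C h) [last qs])"
proof -
 show *: "h \<in> Arr C" "Dom C h \<in> Obj C" "Cod C h \<in> Obj C" "valid (dim (Dom C h)) qs" "valid (dim (Cod C h)) ks"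
  using assms by (auto simp: adm_def)
 note q = q_simps[OF *(2,4)]
 show v: "ed (Cod C h) [hd ks] = ed (Dom C h) [hd qs]" "ed (Cod C h) [last ks] = ed (Dom C h) [last qs]"
  using ed_vertex(1)[OF *(1), of "hd qs"] ed_vertex(1)[OF *(1), of "last qs"] assms q(6,7) by (auto simp: adm_def)
 show "rs h [hd qs, last qs] \<in> vhom (ed (Dom C h) [hd qs, last qs]) (ed (Cod C h) [hd ks, last ks])"
  using rs_simps[OF *(1), of "[hd qs, last qs]"] q assms by (simp add: adm_def)
 show "path (ed (Dom C h) [hd qs]) (es (Dom C h) qs) (ed (Dom C h) [last qs])"
  "path (ed (Dom C h) [hd qs]) (es (Cod C h) ks) (ed (Dom C h) [last qs])"
  using es_path[OF *(2,4)] es_path[OF *(3,5)] v by simp_all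
qed

lemma A_vhom:
 assumes "adm h qs ks"
 shows "A h qs ks \<in> vhom (lg (ed (Dom C h) [hd qs]) (es (Dom C h) qs)) (lg (ed (Dom C h) [hd qs]) (es (Cod C h) ks))"
proof -
 note a = adm_simps[OF assms]
 show ?thesis unfolding A_def
  using q_simps[OF a(2,4)] q_simps[OF a(3,5)] a(6,8) by simp
qed

lemma A_Ide:
 assumes "c \<in> Obj C" "valid (dim c) qs"
 shows "A (Ide C c) qs qs = Ide C (lg (ed c [hd qs]) (es c qs))"
 using assms q_simps[OF assms] by (simp add: A_def)

lemma cancel_middle:
 assumes "iso C s" "g' \<in> Arr C" "g \<in> Arr C" "f \<in> Arr C" "f' \<in> Arr C"
  "Dom C g' = Cod C g" "Dom C g = Cod C s" "Cod C f = Cod C s" "Dom C f = Cod C f'"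
 shows "(g' ** g ** s) ** (inv_arr C s ** f ** f') = g' ** (g ** f) ** f'"
 using assms by simp

lemma cancel_outer:
 assumes "iso C s" "iso C t" "f \<in> Arr C"
 shows "Cod C f = Dom C t ==> Dom C f = Dom C s ==> inv_arr C t ** (t ** f ** inv_arr C s) ** s = f"
  "Cod C f = Cod C t ==> Dom C f = Cod C s ==> t ** (inv_arr C t ** f ** s) ** inv_arr C s = f"
 using assms by simp_all

text \<open>The inner pair of \<open>q\<close> isomorphisms cancels and restriction is
  functorial.\<close>

lemma A_comp:
 assumes "adm h qs ks" "adm k ks ls" "Dom C k = Cod C h"
 shows "A k ks ls ** A h qs ks = A (k ** h) qs ls" "adm (k ** h) qs ls"
proof -
 note a = adm_simps[OF assms(1)] and b = adm_simps[OF assms(2)]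
 have o: "hd qs \<le> last qs" "last qs \<le> dim (Dom C h)" "hd qs \<le> dim (Dom C h)" using q_simps(6,7)[OF a(2,4)] by simp_all
 then have v: "valid (dim (Dom C h)) [hd qs, last qs]" by simp
 have "rs (k ** h) [hd qs, last qs] = rs k [hd ks, last ks] ** rs h [hd qs, last qs]"
  using rs_comp[OF a(1) b(1) assms(3) v] assms(1) by (simp add: adm_def)
 moreover have "(inv_arr C (q (Cod C k) ls) ** rs k [hd ks, last ks] ** q (Cod C h) ks) **
   (inv_arr C (q (Cod C h) ks) ** rs h [hd qs, last qs] ** q (Dom C h) qs) =
  inv_arr C (q (Cod C k) ls) ** (rs k [hd ks, last ks] ** rs h [hd qs, last qs]) ** q (Dom C h) qs"
  by (rule cancel_middle) (use a(8) b(8) assms(3) q_simps(1-3)[OF a(2,4)] q_simps(1-3)[OF a(3,5)] q_simps(1-3)[OF b(3,5)] in simp_all)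
 ultimately show "A k ks ls ** A h qs ks = A (k ** h) qs ls"
  unfolding A_def assms(3) using a(1) b(1) assms(3) by simp
 show "adm (k ** h) qs ls"
  using assms o by (simp add: adm_def)
qed

lemma valid_pair: "i \<le> j ==> j \<le> n ==> valid n [i, j]"
 by simp

lemma glue_simps:
 assumes "qs \<noteq> []" "ks \<noteq> []" "last qs = hd ks"
 shows "hd (qs @ tl ks) = hd qs" "last (qs @ tl ks) = last ks"
  "length (qs @ tl ks) - Suc 0 = (length qs - Suc 0) + (length ks - Suc 0)"
  "k < length qs ==> (qs @ tl ks) ! k = qs ! k" "k < length ks ==> (qs @ tl ks) ! (length qs - Suc 0 + k) = ks ! k"
proof -
 obtain b ks' where k: "ks = b # ks'" using assms(2) by (cases ks) auto
 then obtain qs' where q: "qs = qs' @ [b]" using assms by (cases qs rule: rev_cases) auto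
 show "hd (qs @ tl ks) = hd qs" using assms(1) by simp
 show "last (qs @ tl ks) = last ks"
  "length (qs @ tl ks) - Suc 0 = (length qs - Suc 0) + (length ks - Suc 0)"
  "k < length qs ==> (qs @ tl ks) ! k = qs ! k"
  using assms(1) by (simp_all add: k q nth_append)
 show "k < length ks ==> (qs @ tl ks) ! (length qs - Suc 0 + k) = ks ! k"
  using nth_append_length_plus[of qs' ks k] by (simp add: k q)
qed

lemma valid_append: "valid n qs ==> valid n ks ==> last qs = hd ks ==> valid n (qs @ tl ks)"
 by (cases ks; cases qs rule: rev_cases) (auto simp: sorted_append intro: order_trans)

lemma H_glue:
 assumes c: "c \<in> Obj C" "valid (dim c) qs" "valid (dim c) ks" "last qs = hd ks"
 shows "app (base (H c (qs @ tl ks))) 0 = hd qs" "app (base (H c (qs @ tl ks))) (length qs - Suc 0) = last qs"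
  "app (base (H c (qs @ tl ks))) (length qs - Suc 0 + (length ks - Suc 0)) = last ks"
proof -
 note n = conjunct1[OF c(2)] conjunct1[OF c(3)]
 note h = H_simps(7)[OF c(1) valid_append[OF c(2-4)]] and g = glue_simps[OF n c(4)]
 have l: "length qs - Suc 0 < length qs" "0 < length qs" "length ks - Suc 0 < length ks" using n by simp_all
 have L: "length qs - Suc 0 < length (qs @ tl ks)" "0 < length (qs @ tl ks)"
  "length qs - Suc 0 + (length ks - Suc 0) < length (qs @ tl ks)"
  using l unfolding length_append length_tl One_nat_def by linarith+
 show "app (base (H c (qs @ tl ks))) 0 = hd qs" unfolding h[OF L(2)] g(4)[OF l(2)] hd_conv_nth[OF n(1)] ..
 show "app (base (H c (qs @ tl ks))) (length qs - Suc 0) = last qs" unfolding h[OF L(1)] g(4)[OF l(1)] using last_conv_nth[OF n(1)] by simp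
 show "app (base (H c (qs @ tl ks))) (length qs - Suc 0 + (length ks - Suc 0)) = last ks"
  unfolding h[OF L(3)] g(5)[OF l(3)] using last_conv_nth[OF n(2)] by simp
qed

text \<open>Transport along \<open>H\<close>, from realizations to the source and target of
  \<open>h\<close>, turns the two factors into restrictions of \<open>h\<close> to the inner edges.
  There \<open>star_edges\<close> composes them to the restriction to the outer edge, and
  transporting back gives the action on the glued lists.\<close>

lemma A_hc:
 assumes h: "adm h qs ks" "adm h qs' ks'" "last qs = hd qs'" "last ks = hd ks'"
 shows "hc (ed (Dom C h) [hd qs]) (es (Dom C h) qs) (ed (Dom C h) [hd qs']) (es (Dom C h) qs') (es (Cod C h) ks) (es (Cod C h) ks')
   (A h qs ks) (A h qs' ks') = A h (qs @ tl qs') (ks @ tl ks')" (is "?hc = _")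
  and "adm h (qs @ tl qs') (ks @ tl ks')"
proof -
 let ?c = "Dom C h" and ?d = "Cod C h" and ?Q = "qs @ tl qs'" and ?K = "ks @ tl ks'"
 note a = adm_simps[OF h(1)] and b = adm_simps[OF h(2)]
 note v = valid_append[OF a(4) b(4) h(3)] and w = valid_append[OF a(5) b(5) h(4)]
 note gq = glue_simps[OF conjunct1[OF a(4)] conjunct1[OF b(4)] h(3)] and gk = glue_simps[OF conjunct1[OF a(5)] conjunct1[OF b(5)] h(4)]
 note e = gq(1,2) gk(1,2)
 show adm: "adm h ?Q ?K" using h v w e by (simp add: adm_def)
 let ?l = "length qs - Suc 0" and ?l' = "length qs' - Suc 0" and ?m = "length ks - Suc 0" and ?m' = "length ks' - Suc 0"
 let ?x = "ed ?c [hd qs]" and ?y = "ed ?c [hd qs']" and ?N = "es ?c ?Q" and ?M = "es ?d ?K"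
 have N: "?N = es ?c qs @ es ?c qs'" "?M = es ?d ks @ es ?d ks'"
  using es_append[OF conjunct1[OF a(4)] conjunct1[OF b(4)] h(3)] es_append[OF conjunct1[OF a(5)] conjunct1[OF b(5)] h(4)] by blast+
 have y: "ed ?c [last qs] = ?y" using h(3) by simp
 note p = a(9,10)[unfolded y] b(9,10)
 have s: "sub ?x ?N 0 ?x (es ?c qs)" "sub ?x ?N ?l ?y (es ?c qs')" "sub ?x ?M 0 ?x (es ?d ks)" "sub ?x ?M ?m ?y (es ?d ks')"
  unfolding N using sub_app[OF p(1,3)] sub_app[OF p(2,4)] by simp_all
 note HQ = H_simps[OF a(2) v, unfolded e] and HK = H_simps[OF a(3) w, unfolded e a(6)]
 note qQ = q_simps[OF a(2) v, unfolded e] and qK = q_simps[OF a(3) w, unfolded e a(6)]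
 note q1 = q_simps[OF a(2,4)] and q2 = q_simps[OF b(2,4)]
 have hQ: "rs (H ?c ?Q) [0, ?l] ** cj ?x ?N 0 ?x (es ?c qs) = q ?c qs" "rs (H ?c ?Q) [?l, ?l + ?l'] ** cj ?x ?N ?l ?y (es ?c qs') = q ?c qs'"
  using H_J(2)[OF a(2) v a(4), of 0, unfolded e, OF s(1)] gq(4)
   H_J(2)[OF a(2) v b(4), of ?l, unfolded e, OF s(2)] gq(5) by simp_all
 have hK: "rs (H ?d ?K) [0, ?m] ** cj ?x ?M 0 ?x (es ?d ks) = q ?d ks" "rs (H ?d ?K) [?m, ?m + ?m'] ** cj ?x ?M ?m ?y (es ?d ks') = q ?d ks'"
  using H_J(2)[OF a(3) w a(5), of 0, unfolded e a(6), OF s(3)] gk(4)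
   H_J(2)[OF a(3) w b(5), of ?m, unfolded e a(6) b(6), OF s(4)] gk(5) by simp_all
 note t = tr_vhom[OF s(1,3) A_vhom[OF h(1)]] tr_vhom[OF s(2,4) A_vhom[OF h(2)]]
 note cc = cj_simps[OF s(1)] cj_simps[OF s(2)] and dd = cj_simps[OF s(3)] cj_simps[OF s(4)]
 \<comment> \<open>Common form of the two factors: the comparison \<open>cj\<close> followed by a
   restriction of \<open>H\<close> is \<open>q\<close>, so both conjugations collapse against the
   one built into \<open>A\<close>.\<close>
 have conj: "F ** tr X Nn i L' M' i' Y L'' (A h zs zs') ** inv_arr C G = rs h [hd zs, last zs]"
  if z: "F ** cj X M' i' Y L'' = q ?d zs'" "G ** cj X Nn i Y L' = q ?c zs" and G: "iso C G" "iso C F"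
   and D: "Dom C F = Cod C (cj X M' i' Y L'')" "Dom C G = Cod C (cj X Nn i Y L')" "iso C (cj X M' i' Y L'')" "iso C (cj X Nn i Y L')"
   and ad: "adm h zs zs'" for F G X Nn i L' M' i' Y L'' zs zs'
 proof -
  note a = adm_simps[OF ad]
  note q = q_simps[OF a(2,4)] q_simps[OF a(3,5)]
  have "F ** tr X Nn i L' M' i' Y L'' (A h zs zs') ** inv_arr C G = (F ** cj X M' i' Y L'') ** A h zs zs' ** inv_arr C (G ** cj X Nn i Y L')"
  proof -
   have "inv_arr C (G ** cj X Nn i Y L') = inv_arr C (cj X Nn i Y L') ** inv_arr C G" by (rule inv_arr_comp) (use G D in simp_all)
   moreover have "Dom C (A h zs zs') = Dom C (cj X Nn i Y L')" "Cod C (A h zs zs') = Dom C (cj X M' i' Y L'')" "A h zs zs' \<in> Arr C"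
   proof -
    have "Dom C (cj X Nn i Y L') = Dom C (q ?c zs)" "Dom C (cj X M' i' Y L'') = Dom C (q ?d zs')"
     unfolding z[symmetric] using G D by simp_all
    then show "Dom C (A h zs zs') = Dom C (cj X Nn i Y L')" "Cod C (A h zs zs') = Dom C (cj X M' i' Y L'')" "A h zs zs' \<in> Arr C"
     using A_vhom[OF ad] q(2,9) a(6) by simp_all
   qed
   ultimately show ?thesis unfolding tr_def using G D by simp
  qed
  then show ?thesis unfolding z A_def using cancel_outer(2)[OF q(1,8), of "rs h [hd zs, last zs]"] a(8) q(2,9) by simp
 qed
 have nQ: "?l + ?l' \<le> dim (T ?x ?N)" unfolding HQ(8) gq(3) ..
 have nK: "?m + ?m' \<le> dim (T ?x ?M)" unfolding HK(8) gk(3) ..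
 have rQ: "iso C (rs (H ?c ?Q) [i, j])" "Dom C (rs (H ?c ?Q) [i, j]) = ed (T ?x ?N) [i, j]" if "i \<le> j" "j \<le> ?l + ?l'" for i j
 proof -
  have v: "valid (dim (Dom C (H ?c ?Q))) [i, j]" unfolding HQ(2) by (rule valid_pair[OF that(1) order_trans[OF that(2) nQ]])
  show "iso C (rs (H ?c ?Q) [i, j])" "Dom C (rs (H ?c ?Q) [i, j]) = ed (T ?x ?N) [i, j]"
   using rs_iso[OF HQ(6) v] rs_simps(2)[OF HQ(1) v] unfolding HQ(2) by blast+
 qed
 have rK: "iso C (rs (H ?d ?K) [i, j])" "Dom C (rs (H ?d ?K) [i, j]) = ed (T ?x ?M) [i, j]" if "i \<le> j" "j \<le> ?m + ?m'" for i j
 proof -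
  have v: "valid (dim (Dom C (H ?d ?K))) [i, j]" unfolding HK(2) by (rule valid_pair[OF that(1) order_trans[OF that(2) nK]])
  show "iso C (rs (H ?d ?K) [i, j])" "Dom C (rs (H ?d ?K) [i, j]) = ed (T ?x ?M) [i, j]"
   using rs_iso[OF HK(6) v] rs_simps(2)[OF HK(1) v] unfolding HK(2) by blast+
 qed
 have C: "Cod C (cj ?x ?N 0 ?x (es ?c qs)) = ed (T ?x ?N) [0, ?l]" "Cod C (cj ?x ?N ?l ?y (es ?c qs')) = ed (T ?x ?N) [?l, ?l + ?l']"
  "Cod C (cj ?x ?M 0 ?x (es ?d ks)) = ed (T ?x ?M) [0, ?m]" "Cod C (cj ?x ?M ?m ?y (es ?d ks')) = ed (T ?x ?M) [?m, ?m + ?m']"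
  using cc(2,6) dd(2,6) unfolding vhom_iff add_0 es_length by blast+
 note r1 = rQ[OF le0 le_add1] rK[OF le0 le_add1] and r2 = rQ[OF le_add1 order_refl] rK[OF le_add1 order_refl]
 have c1: "rs (H ?d ?K) [0, ?m] ** tr ?x ?N 0 (es ?c qs) ?M 0 ?x (es ?d ks) (A h qs ks) ** inv_arr C (rs (H ?c ?Q) [0, ?l]) = rs h [hd qs, last qs]"
  by (rule conj[OF hK(1) hQ(1) r1(1,3) _ _ dd(1) cc(1) h(1)]) (simp_all only: r1(2,4) C)
 have c2: "rs (H ?d ?K) [?m, ?m + ?m'] ** tr ?x ?N ?l (es ?c qs') ?M ?m ?y (es ?d ks') (A h qs' ks') ** inv_arr C (rs (H ?c ?Q) [?l, ?l + ?l'])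
   = rs h [hd qs', last qs']"
  by (rule conj[OF hK(2) hQ(2) r2(1,3) _ _ dd(5) cc(5) h(2)]) (simp_all only: r2(2,4) C)
 have ap: "app (base (H ?c ?Q)) 0 = hd qs" "app (base (H ?c ?Q)) ?l = last qs" "app (base (H ?c ?Q)) (?l + ?l') = last qs'"
  "app (base (H ?d ?K)) 0 = hd ks" "app (base (H ?d ?K)) ?m = last ks" "app (base (H ?d ?K)) (?m + ?m') = last ks'"
  by (rule H_glue[OF a(2,4) b(4) h(3)] H_glue[OF a(3,5) b(5) h(4)])+
 have hc: "?hc = star (T ?x ?N) 0 ?l (?l + ?l') (T ?x ?M) 0 ?m (?m + ?m')
   (tr ?x ?N 0 (es ?c qs) ?M 0 ?x (es ?d ks) (A h qs ks)) (tr ?x ?N ?l (es ?c qs') ?M ?m ?y (es ?d ks') (A h qs' ks'))"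
  unfolding hc_def N by simp
 note st = star_transport[OF HQ(1,2,3,6) HK(1,2,3) le0 le_add1 nQ le0 le_add1 nK t[unfolded add_0 es_length], unfolded ap c1 c2]
 have "star ?c (hd qs) (last qs) (last qs') ?d (hd ks) (last ks) (last ks') (rs h [hd qs, last qs]) (rs h [hd qs', last qs']) = rs h [hd qs, last qs']"
  using star_edges[OF a(1), of "hd qs" "last qs" "last qs'"] h q1(6) q2(6,7) by (simp add: adm_def)
 from trans[OF this[symmetric] st] have "rs h [hd qs, last qs'] = q ?d ?K ** ?hc ** inv_arr C (q ?c ?Q)"
  unfolding q_def hc One_nat_def gq(3) gk(3) .
 then have "inv_arr C (q ?d ?K) ** rs h [hd qs, last qs'] ** q ?c ?Q =
   inv_arr C (q ?d ?K) ** (q ?d ?K ** ?hc ** inv_arr C (q ?c ?Q)) ** q ?c ?Q" by (rule arg_cong)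
 moreover have "?hc \<in> vhom (lg ?x ?N) (lg ?x ?M)"
  unfolding N by (rule hc_vhom[OF p A_vhom[OF h(1)] A_vhom[OF h(2)]])
 ultimately show "?hc = A h ?Q ?K"
  unfolding A_def[of h ?Q ?K] e using cancel_outer(1)[OF qQ(1) qK(1), of ?hc] qQ(2) qK(2) by simp
qed

end

section \<open>The equivalence with the simplicial replacement\<close>

context segal begin

definition "AR h qs ks = (es (Dom C h) qs, A h qs ks, es (Cod C h) ks)"

lemma AR_simps:
 assumes "adm h qs ks" "x = ed (Dom C h) [hd qs]" "y = ed (Dom C h) [last qs]"
 shows "AR h qs ks \<in> Arr (Hom2 RR x y)" "Dom (Hom2 RR x y) (AR h qs ks) = es (Dom C h) qs"
  "Cod (Hom2 RR x y) (AR h qs ks) = es (Cod C h) ks"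
 unfolding AR_def assms(2,3) RR_simps using adm_simps(9,10)[OF assms(1)] A_vhom[OF assms(1)] by blast+

lemma AR_iso:
 assumes "adm h qs ks" "x = ed (Dom C h) [hd qs]" "y = ed (Dom C h) [last qs]" "cartesian C Delta \<pi> h"
 shows "iso (Hom2 RR x y) (AR h qs ks)"
proof -
 note a = adm_simps[OF assms(1)]
 note q = q_simps[OF a(2,4)] and k = q_simps[OF a(3,5)]
 have "iso C (rs h [hd qs, last qs])" by (rule rs_iso[OF assms(4)]) (use q(6,7) in simp)
 then have "iso C (A h qs ks)" unfolding A_def using a(8) q(1,2) k(1,2) by simp
 then show ?thesis unfolding AR_def assms(2,3) by (rule RR_iso[OF a(9,10) A_vhom[OF assms(1)]])
qed

lemma AR_comp:
 assumes "adm h qs ks" "adm k ks ls" "Dom C k = Cod C h"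
 shows "AR k ks ls \<cdot>[Hom2 RR x y] AR h qs ks = AR (k ** h) qs ls"
 unfolding AR_def RR_simps A_comp(1)[OF assms] using adm_simps(1)[OF assms(1)] adm_simps(1)[OF assms(2)] assms(3) by simp

lemma AR_Ide:
 assumes "c \<in> Obj C" "valid (dim c) qs" "x = ed c [hd qs]"
 shows "AR (Ide C c) qs qs = Ide (Hom2 RR x y) (es c qs)"
 unfolding AR_def RR_simps A_Ide[OF assms(1,2)] assms(3) using assms(1) by simp

lemma AR_hc:
 assumes h: "adm h qs ks" "adm h qs' ks'" "last qs = hd qs'" "last ks = hd ks'"
  and v: "x = ed (Dom C h) [hd qs]" "y = ed (Dom C h) [hd qs']" "z = ed (Dom C h) [last qs']"
 shows "hcomp2 RR x y z (AR h qs' ks') (AR h qs ks) = AR h (qs @ tl qs') (ks @ tl ks')"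
proof -
 note a = adm_simps[OF h(1)] and b = adm_simps[OF h(2)]
 have y: "ed (Dom C h) [last qs] = ed (Dom C h) [hd qs']" using h(3) by simp
 show ?thesis
  unfolding AR_def v RR_simps(10)[OF a(9,10)[unfolded y] b(9,10) A_vhom[OF h(1)] A_vhom[OF h(2)]] A_hc(1)[OF h]
  using es_append[OF conjunct1[OF a(4)] conjunct1[OF b(4)] h(3)] es_append[OF conjunct1[OF a(5)] conjunct1[OF b(5)] h(4)] by simp
qed

lemma admI: "h \<in> Arr C ==> valid (dim (Dom C h)) qs ==> valid (dim (Cod C h)) ks ==>
  app (base h) (hd qs) = hd ks ==> app (base h) (last qs) = last ks ==> adm h qs ks"
 by (simp add: adm_def)

lemma adm_Ide: "c \<in> Obj C ==> valid (dim c) qs ==> valid (dim c) ks ==> hd qs = hd ks ==> last qs = last ks ==> adm (Ide C c) qs ks"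
 using q_simps(6,7)[of c ks] by (intro admI) simp_all

text \<open>The action of an identity arrow is the canonical cell between two paths in one object
  with common ends; such cells compose vertically and horizontally to cells of the same
  kind.\<close>

definition "W c qs ks = AR (Ide C c) qs ks"

definition "par c qs ks \<longleftrightarrow> c \<in> Obj C \<and> valid (dim c) qs \<and> valid (dim c) ks \<and> hd qs = hd ks \<and> last qs = last ks"

lemma par_adm: "par c qs ks ==> adm (Ide C c) qs ks"
 unfolding par_def using adm_Ide by blast

lemma Ide_simps: "c \<in> Obj C ==> Dom C (Ide C c) = c \<and> Cod C (Ide C c) = c \<and> Ide C c ** Ide C c = Ide C c"
 by simp

lemma W_simps:
 assumes "par c qs ks" "x = ed c [hd qs]" "y = ed c [last qs]"
 shows "Dom (Hom2 RR x y) (W c qs ks) = es c qs" "Cod (Hom2 RR x y) (W c qs ks) = es c ks" "iso (Hom2 RR x y) (W c qs ks)"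
proof -
 have c: "c \<in> Obj C" using assms(1) by (simp add: par_def)
 note d = Ide_simps[OF c]
 have I: "cartesian C Delta \<pi> (Ide C c)" by (rule iso_cartesian[OF pi_functor]) (use c in simp_all)
 have xy: "x = ed (Dom C (Ide C c)) [hd qs]" "y = ed (Dom C (Ide C c)) [last qs]" unfolding assms(2,3) using d by simp_all
 show "Dom (Hom2 RR x y) (W c qs ks) = es c qs" "Cod (Hom2 RR x y) (W c qs ks) = es c ks" "iso (Hom2 RR x y) (W c qs ks)"
  unfolding W_def using AR_simps(2,3)[OF par_adm[OF assms(1)] xy] AR_iso[OF par_adm[OF assms(1)] xy I] d by presburger+
qed

lemma W_comp:
 assumes "par c qs ks" "par c ks ls"
 shows "W c ks ls \<cdot>[Hom2 RR x y] W c qs ks = W c qs ls"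
proof -
 have "c \<in> Obj C" using assms(1) by (simp add: par_def)
 note d = Ide_simps[OF this]
 then show ?thesis unfolding W_def using AR_comp[OF par_adm[OF assms(1)] par_adm[OF assms(2)]] by presburger
qed

lemma W_Ide: "par c qs qs ==> x = ed c [hd qs] ==> Ide (Hom2 RR x y) (es c qs) = W c qs qs"
 unfolding W_def par_def using AR_Ide by simp

lemma W_hc:
 assumes "par c qs ks" "par c qs' ks'" "last qs = hd qs'"
  and "x = ed c [hd qs]" "y = ed c [hd qs']" "z = ed c [last qs']"
 shows "hcomp2 RR x y z (W c qs' ks') (W c qs ks) = W c (qs @ tl qs') (ks @ tl ks')"
proof -
 have "c \<in> Obj C" using assms(1) by (simp add: par_def)
 note d = Ide_simps[OF this]
 have l: "last ks = hd ks'" using assms(1-3) unfolding par_def by simp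
 show ?thesis unfolding W_def by (rule AR_hc[OF par_adm[OF assms(1)] par_adm[OF assms(2)] assms(3) l]) (use d assms in presburger)+
qed

definition "ES c = mkS RR (dim c) (\<lambda>i. ed c [i]) (\<lambda>i j. es c [i, j]) (\<lambda>i. W c [i] [i, i]) (\<lambda>i j k. W c [i, j, k] [i, k])"

text \<open>Each unit or associativity law equates composites of the canonical cells
  \<open>W\<close>. Such composites are again canonical cells and depend only on the outer vertex
  lists, so the two sides coincide.\<close>

lemma ES_data:
 assumes c: "c \<in> Obj C"
 shows "simplex_data RR (dim c) (\<lambda>i. ed c [i]) (\<lambda>i j. es c [i, j]) (\<lambda>i. W c [i] [i, i]) (\<lambda>i j k. W c [i, j, k] [i, k])"
proof (intro simplex_data.intro simplex_data_axioms.intro RR_strict)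
 have path2: "path (ed c [i]) (es c [i, j]) (ed c [j])" if "i \<le> j" "j \<le> dim c" for i j
  using es_path[OF c, of "[i, j]"] that by (simp del: es.simps)
 {
  fix i assume i: "i \<le> dim c"
  have a: "par c [i] [i, i]" using c i by (simp add: par_def)
  have e: "ed c [i] = ed c [hd [i]]" "ed c [i] = ed c [last [i]]" by simp_all
  show "ed c [i] \<in> Obj2 RR" using c i by simp
  show "iso (Hom2 RR (ed c [i]) (ed c [i])) (W c [i] [i, i])" by (rule W_simps(3)[OF a e])
  show "Dom (Hom2 RR (ed c [i]) (ed c [i])) (W c [i] [i, i]) = Ide2 RR (ed c [i])"
   unfolding W_simps(1)[OF a e] by simp
  show "Cod (Hom2 RR (ed c [i]) (ed c [i])) (W c [i] [i, i]) = es c [i, i]" by (rule W_simps(2)[OF a e])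
 next
  fix i j assume ij: "i \<le> j" "j \<le> dim c"
  have i: "i \<le> dim c" using ij by simp
  have a: "par c [i] [i, i]" "par c [j] [j, j]" "par c [i, j] [i, j]" "par c [i, j] [i, j, j]" "par c [i, j, j] [i, j]"
   "par c [i, j] [i, i, j]" "par c [i, i, j] [i, j]" using c ij i by (simp_all add: par_def)
  show "es c [i, j] \<in> Obj (Hom2 RR (ed c [i]) (ed c [j]))" unfolding RR_simps by (rule path2[OF ij])
  have D: "Ide (Hom2 RR (ed c [i]) (ed c [j])) (es c [i, j]) = W c [i, j] [i, j]"
   by (rule W_Ide[OF a(3)]) simp
  have h: "hcomp2 RR (ed c [i]) (ed c [j]) (ed c [j]) (W c [j] [j, j]) (W c [i, j] [i, j]) = W c [i, j] [i, j, j]"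
   "hcomp2 RR (ed c [i]) (ed c [i]) (ed c [j]) (W c [i, j] [i, j]) (W c [i] [i, i]) = W c [i, j] [i, i, j]"
   using W_hc[OF a(3,2) _ refl refl refl] W_hc[OF a(1,3) _ refl refl refl] by (simp_all del: es.simps RR_simps)
  show "W c [i, j, j] [i, j] \<cdot>[Hom2 RR (ed c [i]) (ed c [j])]
    hcomp2 RR (ed c [i]) (ed c [j]) (ed c [j]) (W c [j] [j, j]) (Ide (Hom2 RR (ed c [i]) (ed c [j])) (es c [i, j])) =
   Ide (Hom2 RR (ed c [i]) (ed c [j])) (es c [i, j])" unfolding D h by (rule W_comp[OF a(4,5)])
  show "W c [i, i, j] [i, j] \<cdot>[Hom2 RR (ed c [i]) (ed c [j])]
    hcomp2 RR (ed c [i]) (ed c [i]) (ed c [j]) (Ide (Hom2 RR (ed c [i]) (ed c [j])) (es c [i, j])) (W c [i] [i, i]) =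
   Ide (Hom2 RR (ed c [i]) (ed c [j])) (es c [i, j])" unfolding D h by (rule W_comp[OF a(6,7)])
 next
  fix i j k assume ijk: "i \<le> j" "j \<le> k" "k \<le> dim c"
  have o: "i \<le> k" "j \<le> dim c" "i \<le> dim c" using ijk by auto
  have a: "par c [i, j, k] [i, k]" using c ijk o by (simp add: par_def)
  have e: "ed c [i] = ed c [hd [i, j, k]]" "ed c [k] = ed c [last [i, j, k]]" by simp_all
  show "iso (Hom2 RR (ed c [i]) (ed c [k])) (W c [i, j, k] [i, k])" by (rule W_simps(3)[OF a e])
  show "Dom (Hom2 RR (ed c [i]) (ed c [k])) (W c [i, j, k] [i, k]) = hcomp1 RR (ed c [i]) (ed c [j]) (ed c [k]) (es c [j, k]) (es c [i, j])"
   unfolding W_simps(1)[OF a e] RR_simps(9)[OF path2[OF ijk(2,3)] path2[OF ijk(1) o(2)]] by simp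
  show "Cod (Hom2 RR (ed c [i]) (ed c [k])) (W c [i, j, k] [i, k]) = es c [i, k]" by (rule W_simps(2)[OF a e])
 next
  fix i j k l assume ijkl: "i \<le> j" "j \<le> k" "k \<le> l" "l \<le> dim c"
  have o: "i \<le> k" "j \<le> l" "i \<le> l" "j \<le> dim c" "i \<le> dim c" "k \<le> dim c" using ijkl by auto
  have a: "par c [i, j] [i, j]" "par c [j, k, l] [j, l]" "par c [i, j, k] [i, k]" "par c [k, l] [k, l]"
   "par c [i, j, k, l] [i, j, l]" "par c [i, j, k, l] [i, k, l]" "par c [i, j, l] [i, l]" "par c [i, k, l] [i, l]"
   using c ijkl o by (simp_all add: par_def)
  have D: "Ide (Hom2 RR (ed c [i]) (ed c [j])) (es c [i, j]) = W c [i, j] [i, j]"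
   "Ide (Hom2 RR (ed c [k]) (ed c [l])) (es c [k, l]) = W c [k, l] [k, l]"
   by (rule W_Ide[OF a(1)] W_Ide[OF a(4)]; simp)+
  have e: "hcomp2 RR (ed c [i]) (ed c [j]) (ed c [l]) (W c [j, k, l] [j, l]) (W c [i, j] [i, j]) = W c [i, j, k, l] [i, j, l]"
   "hcomp2 RR (ed c [i]) (ed c [k]) (ed c [l]) (W c [k, l] [k, l]) (W c [i, j, k] [i, k]) = W c [i, j, k, l] [i, k, l]"
   using W_hc[OF a(1,2) _ refl refl refl] W_hc[OF a(3,4) _ refl refl refl] by (simp_all del: es.simps RR_simps)
  show "W c [i, j, l] [i, l] \<cdot>[Hom2 RR (ed c [i]) (ed c [l])]
    hcomp2 RR (ed c [i]) (ed c [j]) (ed c [l]) (W c [j, k, l] [j, l]) (Ide (Hom2 RR (ed c [i]) (ed c [j])) (es c [i, j])) =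
   W c [i, k, l] [i, l] \<cdot>[Hom2 RR (ed c [i]) (ed c [l])]
    hcomp2 RR (ed c [i]) (ed c [k]) (ed c [l]) (Ide (Hom2 RR (ed c [k]) (ed c [l])) (es c [k, l])) (W c [i, j, k] [i, k])"
   unfolding D e W_comp[OF a(5,7)] W_comp[OF a(6,8)] ..
 }
qed

lemma ES_simps [simp]:
 "i \<le> dim c ==> PObj (ES c) i = ed c [i]" "i \<le> dim c ==> PUnit (ES c) i = W c [i] [i, i]"
 "i \<le> j ==> j \<le> dim c ==> sM (ES c) i j = es c [i, j]"
 "i \<le> j ==> j \<le> k ==> k \<le> dim c ==> sC (ES c) i j k = W c [i, j, k] [i, k]"
 by (simp_all add: ES_def)

lemma ES_simplex [simp]: "c \<in> Obj C ==> is_simplex RR (dim c) (ES c)"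
 unfolding ES_def by (rule simplex_data.mkS_two_functor) (rule ES_data)

definition "ea h i j = AR h [i, j] [app (base h) i, app (base h) j]"

definition "EA h = garr RR (base h) (ES (Dom C h)) (ea h) (ES (Cod C h))"

lemma q_vertex:
 assumes "c \<in> Obj C" "i \<le> dim c"
 shows "q c [i] = rs (lf c [i]) [0, 0]"
proof -
 have v: "valid (dim c) [i]" using assms by simp
 note h = H_simps[OF assms(1) v]
 have "H c [i] = lf c [i]" using vertex_arr[of "H c [i]" i] h assms by simp
 then show ?thesis by (simp add: q_def)
qed

text \<open>On a single vertex \<open>h\<close> acts only through the chosen vertex inclusions, by
  \<open>rs_degen\<close>, so it may be replaced by the identity of its target. This is the unit
  condition for the induced arrow.\<close>

lemma A_vertex:
 assumes "h \<in> Arr C" "i \<le> dim (Dom C h)"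
 shows "A h [i] [app (base h) i, app (base h) i] = A (Ide C (Cod C h)) [app (base h) i] [app (base h) i, app (base h) i]"
proof -
 let ?j = "app (base h) i"
 have o: "Dom C h \<in> Obj C" "Cod C h \<in> Obj C" "?j \<le> dim (Cod C h)" using assms by simp_all
 have "rs h [i, i] ** q (Dom C h) [i] = q (Cod C h) [?j]" unfolding q_vertex[OF o(1) assms(2)] q_vertex[OF o(2,3)] by (rule rs_degen[OF assms])
 then show ?thesis
  using o q_simps(2)[OF o(2), of "[?j]"] by (simp add: A_def)
qed

lemma ea_adm: "h \<in> Arr C ==> i \<le> j ==> j \<le> dim (Dom C h) ==> adm h [i, j] [app (base h) i, app (base h) j]"
 by (rule admI) simp_all

text \<open>Compatibility with composition cells is the composition of \<open>h\<close> with
  identities on either side: both ways give the action of \<open>h\<close> from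
  \<open>[i, j, k]\<close> to the images of \<open>i\<close> and \<open>k\<close>.\<close>

lemma EA_data:
 assumes h: "h \<in> Arr C"
 shows "arr_data RR (base h) (ES (Dom C h)) (ES (Cod C h)) (ea h)"
proof -
 let ?c = "Dom C h" and ?d = "Cod C h" and ?f = "app (base h)"
 have o: "?c \<in> Obj C" "?d \<in> Obj C" "Dom Delta (base h) = dim ?c" "Cod Delta (base h) = dim ?d" using h by simp_all
 have f: "?f i \<le> dim ?d" if "i \<le> dim ?c" for i using that h by simp
 have fm: "?f i \<le> ?f j" if "i \<le> j" "j \<le> dim ?c" for i j using that h by simp
 have v: "ed ?d [?f i] = ed ?c [i]" if "i \<le> dim ?c" for i using ed_vertex(1)[OF h that] .
 have I: "Dom C (Ide C ?c) = ?c" "Cod C (Ide C ?c) = ?c" "Dom C (Ide C ?d) = ?d" "Cod C (Ide C ?d) = ?d" "Ide C ?d ** h = h" "h ** Ide C ?c = h"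
  using o h by simp_all
 have "smor RR (dim ?c) (\<lambda>i. PObj (ES ?d) (?f i)) (sM (ES ?c)) (PUnit (ES ?c)) (sC (ES ?c))
   (\<lambda>i j. sM (ES ?d) (?f i) (?f j)) (\<lambda>i. PUnit (ES ?d) (?f i)) (\<lambda>i j k. sC (ES ?d) (?f i) (?f j) (?f k)) (ea h)"
 proof (rule smorI)
  fix i j assume ij: "i \<le> j" "j \<le> dim ?c"
  then show "ea h i j \<in> hom (Hom2 RR (PObj (ES ?d) (?f i)) (PObj (ES ?d) (?f j))) (sM (ES ?c) i j) (sM (ES ?d) (?f i) (?f j))"
   using AR_simps[OF ea_adm[OF h ij], of "ed ?c [i]" "ed ?c [j]"] f[of i] f[of j] fm[of i j] v[of i] v[of j] by (simp add: ea_def)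
 next
  fix i j k assume ijk: "i \<le> j" "j \<le> k" "k \<le> dim ?c"
  have le: "i \<le> k" "i \<le> dim ?c" "j \<le> dim ?c" using ijk by auto
  have a: "adm (Ide C ?c) [i, j, k] [i, k]" "adm (Ide C ?d) [?f i, ?f j, ?f k] [?f i, ?f k]"
   using adm_Ide[OF o(1), of "[i, j, k]" "[i, k]"] adm_Ide[OF o(2), of "[?f i, ?f j, ?f k]" "[?f i, ?f k]"] ijk le f fm by simp_all
  have s: "sC (ES ?c) i j k = AR (Ide C ?c) [i, j, k] [i, k]" "sC (ES ?d) (?f i) (?f j) (?f k) = AR (Ide C ?d) [?f i, ?f j, ?f k] [?f i, ?f k]"
   "PObj (ES ?d) (?f i) = ed ?c [i]" "PObj (ES ?d) (?f j) = ed ?c [j]" "PObj (ES ?d) (?f k) = ed ?c [k]"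
   using ijk le f fm v by (simp_all add: W_def)
  have hc: "hcomp2 RR (ed ?c [i]) (ed ?c [j]) (ed ?c [k]) (ea h j k) (ea h i j) = AR h [i, j, k] [?f i, ?f j, ?f k]"
   unfolding ea_def using AR_hc[OF ea_adm[OF h ijk(1) le(3)] ea_adm[OF h ijk(2,3)], of "ed ?c [i]" "ed ?c [j]" "ed ?c [k]"] by simp
  have ah: "adm h [i, j, k] [?f i, ?f j, ?f k]"
   using A_hc(2)[OF ea_adm[OF h ijk(1) le(3)] ea_adm[OF h ijk(2,3)]] by simp
  show "ea h i k \<cdot>[Hom2 RR (PObj (ES ?d) (?f i)) (PObj (ES ?d) (?f k))] sC (ES ?c) i j k =
    sC (ES ?d) (?f i) (?f j) (?f k) \<cdot>[Hom2 RR (PObj (ES ?d) (?f i)) (PObj (ES ?d) (?f k))]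
    hcomp2 RR (PObj (ES ?d) (?f i)) (PObj (ES ?d) (?f j)) (PObj (ES ?d) (?f k)) (ea h j k) (ea h i j)"
   unfolding s hc unfolding ea_def AR_comp[OF a(1) ea_adm[OF h le(1) ijk(3)] I(2)[symmetric]] AR_comp[OF ah a(2) I(3)] I ..
 next
  fix i assume i: "i \<le> dim ?c"
  have a: "adm (Ide C ?c) [i] [i, i]" by (rule adm_Ide[OF o(1)]) (use i in simp_all)
  have s: "PUnit (ES ?c) i = AR (Ide C ?c) [i] [i, i]" "PUnit (ES ?d) (?f i) = AR (Ide C ?d) [?f i] [?f i, ?f i]"
   using i f by (simp_all add: W_def)
  show "ea h i i \<cdot>[Hom2 RR (PObj (ES ?d) (?f i)) (PObj (ES ?d) (?f i))] PUnit (ES ?c) i = PUnit (ES ?d) (?f i)"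
   unfolding s ea_def AR_comp[OF a ea_adm[OF h order_refl i] I(2)[symmetric]] I
   unfolding AR_def A_vertex[OF h i] I by simp
 qed
 then show ?thesis unfolding arr_data_def o(3,4) using h o f v by simp
qed

lemma EA_simps [simp]:
 assumes "h \<in> Arr C"
 shows "EA h \<in> Arr (SR RR)" "Dom (SR RR) (EA h) = (dim (Dom C h), ES (Dom C h))" "Cod (SR RR) (EA h) = (dim (Cod C h), ES (Cod C h))"
  "fst (EA h) = base h" "i \<le> j ==> j \<le> dim (Dom C h) ==> gc (EA h) i j = ea h i j"
 using SR_garr[OF EA_data[OF assms]] assms by (simp_all add: EA_def)

definition "E = \<lparr>FObj = \<lambda>c\<in>Obj C. (dim c, ES c), FArr = \<lambda>h\<in>Arr C. EA h\<rparr>"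

lemma E_simps [simp]: "c \<in> Obj C ==> FObj E c = (dim c, ES c)" "h \<in> Arr C ==> FArr E h = EA h"
 by (simp_all add: E_def)

lemma E_functor: "cat_functor C (SR RR) E"
proof (rule cat_functorI)
 show "FObj E \<in> Obj C \<rightarrow>\<^sub>E Obj (SR RR)" by (auto simp: E_def)
 show "FArr E \<in> extensional (Arr C)" by (simp add: E_def)
 show "FArr E f \<in> Arr (SR RR) \<and> Dom (SR RR) (FArr E f) = FObj E (Dom C f) \<and> Cod (SR RR) (FArr E f) = FObj E (Cod C f)"
  if "f \<in> Arr C" for f using that by simp
next
 fix c assume c: "c \<in> Obj C"
 have "EA (Ide C c) = Ide (SR RR) (dim c, ES c)"
 proof (rule SR_eqI)
  fix i j assume "i \<le> j" "j \<le> fst (Dom (SR RR) (EA (Ide C c)))"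
  then have ij: "i \<le> j" "j \<le> dim c" "i \<le> dim c" using c by simp_all
  have "gc (EA (Ide C c)) i j = AR (Ide C c) [i, j] [i, j]" using ij c by (simp add: ea_def)
  also have "\<dots> = Ide (Hom2 RR (ed c [i]) (ed c [j])) (es c [i, j])" by (rule AR_Ide) (use c ij in simp_all)
  finally show "gc (EA (Ide C c)) i j = gc (Ide (SR RR) (dim c, ES c)) i j" unfolding gc_Ide[OF ES_simplex[OF c] ij(1,2)] using ij by simp
 qed (use c in simp_all)
 then show "FArr E (Ide C c) = Ide (SR RR) (FObj E c)" using c by simp
next
 fix f g assume f: "f \<in> Arr C" "g \<in> Arr C" "Dom C g = Cod C f"
 have e: "Dom (SR RR) (EA g) = Cod (SR RR) (EA f)" using f by simp
 have gf: "g ** f \<in> Arr C" "Dom C (g ** f) = Dom C f" "base (g ** f) = base g \<cdot>[Delta] base f" using f by simp_all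
 have "EA (g ** f) = EA g \<cdot>[SR RR] EA f"
 proof (rule SR_eqI)
  have d0: "0 \<le> dim (Dom C f)" by simp
  show "fst (EA (g ** f)) = fst (EA g \<cdot>[SR RR] EA f)"
   unfolding gc_comp(2)[OF EA_simps(1)[OF f(1)] EA_simps(1)[OF f(2)] e EA_simps(2)[OF f(1)] order_refl d0] using f by simp
  fix i j assume "i \<le> j" "j \<le> fst (Dom (SR RR) (EA (g ** f)))"
  then have ij: "i \<le> j" "j \<le> dim (Dom C f)" using f by simp_all
  let ?f = "app (base f)"
  have fi: "?f i \<le> ?f j" "?f j \<le> dim (Dom C g)" using f ij by simp_all
  have b: "app (base g \<cdot>[Delta] base f) i = app (base g) (?f i)" "app (base g \<cdot>[Delta] base f) j = app (base g) (?f j)"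
   using ij f by simp_all
  have "gc (EA (g ** f)) i j = ea (g ** f) i j" using ij gf by simp
  also have "\<dots> = ea g (?f i) (?f j) \<cdot>[PHomCat RR (ES (Dom C f)) i j] ea f i j"
   unfolding ea_def gf(3) b AR_comp[OF ea_adm[OF f(1) ij] ea_adm[OF f(2) fi] f(3)] ..
  finally show "gc (EA (g ** f)) i j = gc (EA g \<cdot>[SR RR] EA f) i j"
   unfolding gc_comp(1)[OF EA_simps(1)[OF f(1)] EA_simps(1)[OF f(2)] e EA_simps(2)[OF f(1)] ij] using f ij fi by simp
 qed (use f in simp_all)
 then show "FArr E (g ** f) = FArr E g \<cdot>[SR RR] FArr E f" using f by simp
qed simp_all

text \<open>The 2-cells of \<open>g\<close> on consecutive edges, conjugated by \<open>q\<close>,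
  are arrows of \<open>C\<close> that extend by \<open>arrow_exists\<close>; consecutive edges then
  decide equality in the simplicial replacement.\<close>

lemma E_full:
 assumes c: "c \<in> Obj C" "d \<in> Obj C" and g: "g \<in> Arr (SR RR)" "Dom (SR RR) g = (dim c, ES c)" "Cod (SR RR) g = (dim d, ES d)"
 shows "\<exists>h \<in> Arr C. Dom C h = c \<and> Cod C h = d \<and> EA h = g"
proof -
 let ?\<phi> = "fst g" and ?f = "app (fst g)"
 note G = SR_gc[OF g] and D = SR_arrD(1-3)[OF g]
 have f: "?f i \<le> dim d" if "i \<le> dim c" for i using that D by simp
 have fm: "?f i \<le> ?f j" if "i \<le> j" "j \<le> dim c" for i j using that D by simp
 have v: "ed c [i] = ed d [?f i]" if "i \<le> dim c" for i using G(6)[of i] that f[of i] by simp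
 define b where "b i = fst (snd (gc g i (Suc i)))" for i
 have b: "gc g i (Suc i) = (es c [i, Suc i], b i, es d [?f i, ?f (Suc i)])" "b i \<in> vhom (lg (ed c [i]) (es c [i, Suc i])) (lg (ed c [i]) (es d [?f i, ?f (Suc i)]))"
  if "i < dim c" for i
 proof -
  have o: "i \<le> Suc i" "Suc i \<le> dim c" "i \<le> dim c" using that by auto
  note k = G(1-3)[OF o(1,2)]
  obtain L a M where L: "gc g i (Suc i) = (L, a, M)" by (metis prod_cases3)
  have k': "(L, a, M) \<in> Arr (Hom2 RR (ed c [i]) (ed c [Suc i]))" "L = es c [i, Suc i]" "M = es d [?f i, ?f (Suc i)]"
   using k o f[of i] f[of "Suc i"] fm[of i "Suc i"] unfolding L by (simp_all del: es.simps)
  show "gc g i (Suc i) = (es c [i, Suc i], b i, es d [?f i, ?f (Suc i)])" "b i \<in> vhom (lg (ed c [i]) (es c [i, Suc i])) (lg (ed c [i]) (es d [?f i, ?f (Suc i)]))"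
   using k' L unfolding RR_simps b_def by simp_all
 qed
 have qc: "iso C (q c [i, Suc i])" "q c [i, Suc i] \<in> vhom (lg (ed c [i]) (es c [i, Suc i])) (ed c [i, Suc i])"
  "inv_arr C (q c [i, Suc i]) \<in> vhom (ed c [i, Suc i]) (lg (ed c [i]) (es c [i, Suc i]))" "dim (lg (ed c [i]) (es c [i, Suc i])) = Suc 0"
  "dim (ed c [i, Suc i]) = Suc 0" if "i < dim c" for i
  using q_simps(1-5)[OF c(1), of "[i, Suc i]"] that by (simp_all del: es.simps)
 have qd: "iso C (q d [?f i, ?f (Suc i)])" "q d [?f i, ?f (Suc i)] \<in> vhom (lg (ed c [i]) (es d [?f i, ?f (Suc i)])) (ed d [?f i, ?f (Suc i)])"
  "dim (lg (ed c [i]) (es d [?f i, ?f (Suc i)])) = Suc 0" if "i < dim c" for i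
  using q_simps(1,2,5)[OF c(2), of "[?f i, ?f (Suc i)]"] f[of i] f[of "Suc i"] fm[of i "Suc i"] that v[of i] by (simp_all del: es.simps)
 \<comment> \<open>Solves the definition of \<open>A\<close> for the restriction of \<open>h\<close>
   to a consecutive edge.\<close>
 define a where "a i = q d [?f i, ?f (Suc i)] ** b i ** inv_arr C (q c [i, Suc i])" for i
 have a: "a i \<in> vhom (ed c [i, Suc i]) (ed d [?f i, ?f (Suc i)])" if "i < dim c" for i
  using b(2)[OF that] qc[OF that] qd[OF that] by (simp add: a_def del: es.simps)
 obtain h where h: "h \<in> Arr C" "Dom C h = c" "Cod C h = d" "base h = ?\<phi>" "\<And>i. i < dim c ==> rs h [i, Suc i] = a i"
  using arrow_exists[OF c D(1-3) v a] by blast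
 have "EA h = g"
 proof (rule SR_spine_unique[of _ RR _ "dim c" "ES c"])
  fix i assume i: "i < dim c"
  have "A h [i, Suc i] [?f i, ?f (Suc i)] = inv_arr C (q d [?f i, ?f (Suc i)]) ** a i ** q c [i, Suc i]"
   using h i by (simp add: A_def del: es.simps)
  also have "\<dots> = b i"
   unfolding a_def by (rule cancel_outer(1)) (use qc[OF i] qd[OF i] b(2)[OF i] in \<open>simp_all del: es.simps\<close>)
  finally show "gc (EA h) i (Suc i) = gc g i (Suc i)"
   unfolding b(1)[OF i] using h i by (simp add: ea_def AR_def del: es.simps)
 qed (use h g in simp_all)
 then show ?thesis using h by blast
qed

text \<open>The isomorphisms \<open>q\<close> can be cancelled, which recovers the restrictions to
  consecutive edges.\<close>

lemma E_faithful:
 assumes h: "h \<in> Arr C" "h' \<in> Arr C" "Dom C h = Dom C h'" "Cod C h = Cod C h'" "EA h = EA h'"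
 shows "h = h'"
proof (rule arrow_unique[OF h(1-4)])
 show b: "base h = base h'" using EA_simps(4)[OF h(1)] EA_simps(4)[OF h(2)] h(5) by simp
 fix i assume i: "i < dim (Dom C h)"
 let ?f = "app (base h)" and ?c = "Dom C h" and ?d = "Cod C h"
 have o: "?c \<in> Obj C" "?d \<in> Obj C" "?f i \<le> ?f (Suc i)" "?f (Suc i) \<le> dim ?d" "?f i \<le> dim ?d" using h i by simp_all
 note ad = ea_adm[OF h(1), of i "Suc i"] ea_adm[OF h(2), of i "Suc i"]
 have r: "rs h [i, Suc i] \<in> vhom (ed ?c [i, Suc i]) (ed ?d [?f i, ?f (Suc i)])" "rs h' [i, Suc i] \<in> vhom (ed ?c [i, Suc i]) (ed ?d [?f i, ?f (Suc i)])"
  using adm_simps(8)[OF ad(1)] adm_simps(8)[OF ad(2)] i h(3,4) b by simp_all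
 have q: "iso C (q ?c [i, Suc i])" "q ?c [i, Suc i] \<in> vhom (lg (ed ?c [i]) (es ?c [i, Suc i])) (ed ?c [i, Suc i])"
  "iso C (q ?d [?f i, ?f (Suc i)])" "q ?d [?f i, ?f (Suc i)] \<in> vhom (lg (ed ?d [?f i]) (es ?d [?f i, ?f (Suc i)])) (ed ?d [?f i, ?f (Suc i)])"
  using q_simps(1,2)[OF o(1), of "[i, Suc i]"] q_simps(1,2)[OF o(2), of "[?f i, ?f (Suc i)]"] i o by (simp_all del: es.simps)
 have "ea h i (Suc i) = ea h' i (Suc i)"
  using EA_simps(5)[OF h(1), of i "Suc i"] EA_simps(5)[OF h(2), of i "Suc i"] i h(3,5) by simp
 then have "A h [i, Suc i] [?f i, ?f (Suc i)] = A h' [i, Suc i] [?f i, ?f (Suc i)]" using b by (simp add: ea_def AR_def)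
 then have e: "inv_arr C (q ?d [?f i, ?f (Suc i)]) ** rs h [i, Suc i] ** q ?c [i, Suc i] = inv_arr C (q ?d [?f i, ?f (Suc i)]) ** rs h' [i, Suc i] ** q ?c [i, Suc i]"
  using h(3,4) by (simp add: A_def)
 have x: "q ?d [?f i, ?f (Suc i)] ** (inv_arr C (q ?d [?f i, ?f (Suc i)]) ** r ** q ?c [i, Suc i]) ** inv_arr C (q ?c [i, Suc i]) = r"
  if "r \<in> vhom (ed ?c [i, Suc i]) (ed ?d [?f i, ?f (Suc i)])" for r
  by (rule cancel_outer(2)) (use q that in \<open>simp_all del: es.simps\<close>)
 show "rs h [i, Suc i] = rs h' [i, Suc i]" using x[OF r(1)] x[OF r(2)] e by metis
qed

text \<open>The edges of \<open>\<sigma>\<close> are paths rather than edges of \<open>C\<close>.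
  Replacing each by its long edge gives a path in \<open>C\<close>, whose realization has the right
  consecutive edges up to isomorphism; these isomorphisms extend to the whole simplex.\<close>

lemma E_ess_surjective:
 assumes \<sigma>: "is_simplex RR n \<sigma>"
 shows "\<exists>c \<in> Obj C. \<exists>e. iso (SR RR) e \<and> Dom (SR RR) e = (dim c, ES c) \<and> Cod (SR RR) e = (n, \<sigma>)"
proof -
 interpret S: simplex_data RR n "PObj \<sigma>" "sM \<sigma>" "PUnit \<sigma>" "sC \<sigma>" by (rule simplex_data_simplex[OF \<sigma>])
 define x where "x = PObj \<sigma>"
 define L where "L i = sM \<sigma> i (Suc i)" for i
 define N where "N = map (\<lambda>i. lg (x i) (L i)) [0..<n]"
 have L: "path (x i) (L i) (x (Suc i))" if "i < n" for i
  using S.M_obj[of i "Suc i"] that unfolding RR_simps x_def L_def by simp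
 have x: "x i \<in> Obj C" "dim (x i) = 0" if "i \<le> n" for i using S.V_obj[OF that] by (simp_all add: x_def)
 have N: "length N = n" "\<And>i. i < n ==> N ! i = lg (x i) (L i)" by (simp_all add: N_def)
 have pN: "path (x 0) (take i N) (x i)" if "i \<le> n" for i using that
 proof (induction i)
  case 0
  then show ?case using x[of 0] by simp
 next
  case (Suc i)
  have "path (x i) [N ! i] (x (Suc i))"
   using lg_simps[OF L[of i]] x[of "Suc i"] N(2)[of i] Suc.prems by simp
  then have "path (x 0) (take i N @ [N ! i]) (x (Suc i))" unfolding path_append using Suc by auto
  then show ?case using Suc.prems N(1) by (simp add: take_Suc_conv_app_nth)
 qed
 have pn: "path (x 0) N (x n)" using pN[of n] N(1) by simp
 define c where "c = T (x 0) N"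
 note t = T_simps[OF pn, folded c_def, unfolded N(1)]
 have v: "ed c [i] = x i" if "i \<le> n" for i
  using T_vertex[of "x 0" "take i N" "drop i N" "x n" "x i"] pN[OF that] pn that N(1) by (simp add: c_def)
 \<comment> \<open>\<open>q\<close> leads from the long edge of the one-edge path to that edge of
   \<open>c\<close>, and \<open>u\<close> from there to the long edge of \<open>L i\<close>; as a
   2-morphism its target is the path \<open>L i\<close> itself.\<close>
 define s where "s i = (es c [i, Suc i], u (x 0) N i ** q c [i, Suc i], L i)" for i
 have s: "s i \<in> hom (Hom2 RR (x i) (x (Suc i))) (es c [i, Suc i]) (L i)" "iso (Hom2 RR (x i) (x (Suc i))) (s i)" if i: "i < n" for i
 proof -
  have q: "iso C (q c [i, Suc i])" "q c [i, Suc i] \<in> vhom (lg (x i) (es c [i, Suc i])) (ed c [i, Suc i])"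
    "dim (lg (x i) (es c [i, Suc i])) = Suc 0" "dim (ed c [i, Suc i]) = Suc 0"
   using q_simps(1,2,4,5)[OF t(1), of "[i, Suc i]"] t(2) v[of i] i by (simp_all del: es.simps)
  have uu: "iso C (u (x 0) N i)" "u (x 0) N i \<in> vhom (ed c [i, Suc i]) (lg (x i) (L i))" using t(4,5)[OF i] N(2)[OF i] by simp_all
  have w: "u (x 0) N i ** q c [i, Suc i] \<in> vhom (lg (x i) (es c [i, Suc i])) (lg (x i) (L i))" "iso C (u (x 0) N i ** q c [i, Suc i])"
   using q uu by (simp_all del: es.simps)
  have p: "path (x i) (es c [i, Suc i]) (x (Suc i))" using es_path[OF t(1), of "[i, Suc i]"] t(2) v[of i] v[of "Suc i"] i by (simp del: es.simps)
  show "s i \<in> hom (Hom2 RR (x i) (x (Suc i))) (es c [i, Suc i]) (L i)"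
   unfolding hom_iff s_def RR_simps using p L[OF i] w(1) by blast
  show "iso (Hom2 RR (x i) (x (Suc i))) (s i)" unfolding s_def by (rule RR_iso[OF p L[OF i] w])
 qed
 have I: "Ide Delta n \<in> Arr Delta" "Dom Delta (Ide Delta n) = n" "Cod Delta (Ide Delta n) = n" by simp_all
 have sc: "is_simplex RR n (ES c)" using ES_simplex[OF t(1)] t(2) by simp
 have vx: "PObj (ES c) i = x i" if "i \<le> n" for i using v that t(2) by simp
 obtain h where h: "h \<in> Arr (SR RR)" "Dom (SR RR) h = (n, ES c)" "Cod (SR RR) h = (n, \<sigma>)" "fst h = Ide Delta n"
  "\<And>i. i < n ==> gc h i (Suc i) = s i"
 proof (rule SR_fill[OF I sc \<sigma>, of s])
  show "PObj (ES c) i = PObj \<sigma> (app (Ide Delta n) i)" if "i \<le> n" for i using vx[OF that] that by (simp add: x_def)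
  show "s i \<in> hom (PHomCat RR (ES c) i (Suc i)) (sM (ES c) i (Suc i)) (sM \<sigma> (app (Ide Delta n) i) (app (Ide Delta n) (Suc i)))"
   if "i < n" for i using s(1)[OF that] vx[of i] vx[of "Suc i"] that t(2) by (simp add: L_def del: es.simps hom_iff)
 qed blast
 have "cartesian (SR RR) Delta (SP RR) h"
  by (rule SR_cartesianI[OF h(1,2)]) (use s(2) vx h(5) in simp)
 then have "iso (SR RR) h" by (rule vertical_cartesian_iso[OF SP_functor]) (use h \<sigma> in simp)
 then show ?thesis using h t(1,2) by metis
qed

text \<open>Preservation of cartesian arrows is not verified on formulas; it holds for any
  equivalence over \<open>Delta\<close>.\<close>

theorem E_equivalence_over: "equivalence_over Delta C \<pi> (SR RR) (SP RR) E"
proof -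
 have "fully_faithful C (SR RR) E"
  by (rule fully_faithfulI) (use E_full E_faithful in simp_all)
 moreover have "ess_surjective C (SR RR) E"
  unfolding ess_surjective_def
 proof
  fix X assume "X \<in> Obj (SR RR)"
  then obtain n \<sigma> where "X = (n, \<sigma>)" "is_simplex RR n \<sigma>" by (cases X) simp
  then show "\<exists>c\<in>Obj C. \<exists>e. iso (SR RR) e \<and> Dom (SR RR) e = FObj E c \<and> Cod (SR RR) e = X"
   using E_ess_surjective[of n \<sigma>] by (metis E_simps(1))
 qed
 ultimately have e: "equivalence C (SR RR) E" by (simp add: equivalence_iff E_functor)
 have p: "comp_fct C (SP RR) E = \<pi>"
  by (rule fct_eqI[OF comp_fct_functor[OF E_functor SP_functor] pi_functor]) (simp_all add: comp_fct_def compose_def)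
 show ?thesis unfolding equivalence_over_def cartesian_fct_def
  using fib E_functor p e equivalence_preserves_cartesian[OF e SP_functor pi_functor p] by simp
qed

end

theorem theorem2p12:
  fixes C :: "('o, 'a) cat" and \<pi> :: "('o, 'a, nat, delta_arr) fct"
  assumes "segal_2_category C \<pi>"
  shows "(\<exists>R :: ('o, 'o list, 'o list \<times> 'a \<times> 'o list) two_cat.
            strict_2_category R \<and>
            (\<exists>E. equivalence_over Delta C \<pi> (simp_repl R) (simp_repl_proj R) E)) \<and>
         (\<forall>(R :: ('p, 'm, 't) two_cat) (R' :: ('q, 'n, 'u) two_cat).
            strict_2_category R \<and>
            (\<exists>E. equivalence_over Delta C \<pi> (simp_repl R) (simp_repl_proj R) E) \<and>
            strict_2_category R' \<and>
            (\<exists>E'. equivalence_over Delta C \<pi> (simp_repl R') (simp_repl_proj R') E') \<longrightarrow>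
            (\<exists>\<gamma>. strong_equivalence R R' \<gamma>))"
proof (intro conjI allI impI)
  interpret segal C \<pi> by (rule segal.intro) (rule assms)
  show "\<exists>R :: ('o, 'o list, 'o list \<times> 'a \<times> 'o list) two_cat. strict_2_category R \<and>
      (\<exists>E. equivalence_over Delta C \<pi> (simp_repl R) (simp_repl_proj R) E)"
    using RR_strict E_equivalence_over by blast
qed (use replacement_unique in blast)

end
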